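(* Let $N\ge1$, $\beta\in\mathbb C$ with $\beta^4=(-1)^N$, and $\nu\in\{\pm1\}$. Let $Z=Z(Q)$ be the centre of $Q=Q(N,\beta)$, with its projective $SL(2,\mathbb Z)$-action in which the generators $\mathbf S=\begin{pmatrix}0&-1\\1&0\end{pmatrix}$ and $\mathbf T=\begin{pmatrix}1&1\\0&1\end{pmatrix}$ act by the linear maps $\mathscr S_Z$ and $\mathscr T_Z$. Then, with respect to the decomposition $Z=Z_P\oplus Z_\Lambda$, $$\mathscr S_Z=\mathscr S_{Z_P}\oplus\mathscr S_{Z_\Lambda},\qquad \mathscr T_Z=\mathscr T_{Z_P}\oplus\mathscr T_{Z_\Lambda},$$ where: (i) in the basis $\phi_{P_0^+},\phi_{X_1^+},\phi_{X_1^-}$ of $Z_P$, $$\mathscr S_{Z_P}=\nu\begin{pmatrix}0&2^{-N}&-2^{-N}\\2^{N-1}&1/2&1/2\\-2^{N-1}&1/2&1/2\end{pmatrix},\qquad \mathscr T_{Z_P}=\begin{pmatrix}1&0&0\\0&\beta^{-1}&0\\0&0&-\beta^{-1}\end{pmatrix};$$ (ii) $\mathscr S_{Z_\Lambda}=\vartheta\circ\big(\nu\beta^2\,(\sigma^1\otimes\cdots\otimes\sigma^N)|_{U_+}\big)\circ\vartheta^{-1}$ and $\mathscr T_{Z_\Lambda}=\vartheta\circ(t^1\otimes\cdots\otimes t^N)|_{U_+}\circ\vartheta^{-1}$, where $\sigma^j,t^j\colon U_j\to U_j$ have the following matrices in the basis $\{f_j^+f_j^-e_0,\ e_0,\ f_j^-e_0,\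 f_j^+e_0\}$: $$\sigma^j=\begin{pmatrix}0&2&0&0\\-\frac12&0&0&0\\0&0&1&0\\0&0&0&1\end{pmatrix},\qquad t^j=\begin{pmatrix}1&2&0&0\\0&1&0&0\\0&0&1&0\\0&0&0&1\end{pmatrix}.$$ Moreover $\mathscr S_Z^2=\mathrm{id}_Z$, and $\mathscr T_Z$ has Jordan blocks of ranks up to and including $N+1$ (i.e. the largest Jordan block has size $N+1$).
   Context: $Q=Q(N,\beta)$ is the unital associative $\mathbb C$-algebra generated by $K$, $f_i^\pm$ ($1\le i\le N$) with relations $\{f_i^\pm,K\}=0$, $\{f_i^+,f_j^-\}=\delta_{ij}e_1$, $\{f_i^\pm,f_j^\pm\}=0$, $K^4=1$, where $\{x,y\}=xy+yx$, $e_0=\frac12(1+K^2)$, $e_1=\frac12(1-K^2)$. Put $\omega_\pm=(e_0\pm ie_1)K$. It is a factorisable ribbon quasi-Hopf algebra; the data needed here are the algebra anti-automorphism $S$ with $S(K)=K^{(-1)^N}$, $S(f_k^\pm)=f_k^\pm(e_0\pm(-1)^Nie_1)K$, the R-matrix $R=\big(\sum_{n,m\in\{0,1\}}\beta^{nm}\rho_{n,m}\,e_n\otimes e_m\big)\prod_{k=1}^N(1\otimes1-2f_k^-\omega_-\otimes f_k^+)$ with $\rho_{n,m}=\frac12\sum_{p,q=0}^1(-1)^{pq}i^{-pn+qm}K^p\otimes K^q$, the monodromy $M=R_{21}R=\sum M_1\otimes M_2$, and the inverse ribbon element $v^{-1}=(e_0-\beta^{-1}iKe_1)\prod_{k=1}^N(1+2f_k^+f_k^-K^2)$.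 $Q$ has the basis of monomials $(f_1^+)^{n_1^+}(f_1^-)^{n_1^-}\cdots(f_N^+)^{n_N^+}(f_N^-)^{n_N^-}K^m$, $n_j^\pm\in\{0,1\}$, $0\le m\le3$; let $\hat\Lambda_L=(-1)^N\nu\beta^22^{1-N}\big(\prod_{j=1}^Nf_j^+f_j^-\big)^*\in Q^*$ using the dual basis (this is the normalised integral of the universal Hopf algebra $L=Q^*$ of $\mathrm{Rep}\,Q$). Lyubashenko's projective $SL(2,\mathbb Z)$-action for the factorisable finite ribbon category $\mathrm{Rep}\,Q$, expressed on $Z(Q)\cong\mathrm{End}(\mathrm{Id}_{\mathrm{Rep}\,Q})$, is given by $$\mathscr S_Z(z)=\sum_{(M)}\hat\Lambda_L(M_1z)\,S(M_2),\qquad\mathscr T_Z(z)=v^{-1}z.$$ $e_1^\pm=\frac12e_1\big(1\mp iK\prod_{j=1}^N(1-2f_j^+f_j^-)\big)$ are central idempotents. $Z_P=\mathrm{span}\{\phi_{P_0^+},\phi_{X_1^+},\phi_{X_1^-}\}$ with $\phi_{P_0^+}=\nu2^{3N}\beta^2Ke_0\prod_{j=1}^Nf_j^+f_j^-$, $\phi_{X_1^\pm}=\pm\nu2^{N+1}e_1^\pm$ (the central elements associated with the internal characters of the indecomposable projective modules). $Z_\Lambda$ is the span of $e_0$ times products of an even number of the $f_j^\pm$. $U_j=\mathrm{span}\{e_0,f_j^-e_0,f_j^+e_0,f_j^+f_j^-e_0\}$, $U_+\subset U_1\otimes\cdots\otimes U_N$ is the span of tensor monomials with an even total number of $f$'s,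 and $\vartheta\colon U_+\to Z_\Lambda$ is the linear bijection $a_1\otimes\cdots\otimes a_N\mapsto a_1\cdots a_N$. *)

theory Defs
  imports
    "HOL-Library.Cardinality"
    "HOL-Library.Poly_Mapping"
    "Jordan_Normal_Form.Jordan_Normal_Form"
begin

section \<open>Complex vector spaces and complex algebras\<close>

class complex_vec = ab_group_add +
  fixes scaleC :: "complex \<Rightarrow> 'a \<Rightarrow> 'a" (infixr "*\<^sub>C" 75)
  assumes scaleC_add_right: "c *\<^sub>C (x + y) = c *\<^sub>C x + c *\<^sub>C y"
    and scaleC_add_left: "(c + d) *\<^sub>C x = c *\<^sub>C x + d *\<^sub>C x"
    and scaleC_scaleC: "c *\<^sub>C d *\<^sub>C x = (c * d) *\<^sub>C x"
    and scaleC_one: "1 *\<^sub>C x = x"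

class complex_alg = complex_vec + ring + monoid_mult +
  assumes mult_scaleC_left: "(c *\<^sub>C x) * y = c *\<^sub>C (x * y)"
    and mult_scaleC_right: "x * (c *\<^sub>C y) = c *\<^sub>C (x * y)"

global_interpretation cvec: vector_space "scaleC :: complex \<Rightarrow> 'a \<Rightarrow> 'a::complex_vec"
  by unfold_locales
    (simp_all add: scaleC_add_right scaleC_add_left scaleC_scaleC scaleC_one)

abbreviation clinear :: "('a::complex_vec \<Rightarrow> 'b::complex_vec) \<Rightarrow> bool" where
  "clinear \<equiv> Vector_Spaces.linear scaleC scaleC"

definition linear_endo_on :: "'a::complex_vec set \<Rightarrow> ('a \<Rightarrow> 'a) \<Rightarrow> bool" where
  "linear_endo_on V f \<longleftrightarrow> f ` V \<subseteq> V \<and>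
     (\<forall>x\<in>V. \<forall>y\<in>V. f (x + y) = f x + f y) \<and> (\<forall>c. \<forall>x\<in>V. f (c *\<^sub>C x) = c *\<^sub>C f x)"

definition is_direct_sum :: "'a::complex_vec set \<Rightarrow> 'a set \<Rightarrow> 'a set \<Rightarrow> bool" where
  "is_direct_sum V A B \<longleftrightarrow> cvec.subspace A \<and> cvec.subspace B \<and>
     A \<inter> B = {0} \<and> V = {a + b | a b. a \<in> A \<and> b \<in> B}"

definition is_ordered_basis :: "'a::complex_vec list \<Rightarrow> 'a set \<Rightarrow> bool" where
  "is_ordered_basis bs V \<longleftrightarrow>
     distinct bs \<and> cvec.independent (set bs) \<and> cvec.span (set bs) = V"

text \<open>The columns of the matrix are the coordinates of the images of the basis vectors.\<close>

definition has_matrix :: "('a::complex_vec \<Rightarrow> 'a) \<Rightarrow> 'a list \<Rightarrow> complex mat \<Rightarrow> bool" where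
  "has_matrix f bs A \<longleftrightarrow> A \<in> carrier_mat (length bs) (length bs) \<and>
     (\<forall>j < length bs. f (bs ! j) = (\<Sum>i < length bs. A $$ (i, j) *\<^sub>C (bs ! i)))"

text \<open>Some linear map whose restriction to the span of \<open>bs\<close> has matrix \<open>A\<close>. It is used only
  on that span, where it is determined when \<open>bs\<close> is independent.\<close>

definition map_of_matrix :: "'a::complex_vec list \<Rightarrow> complex mat \<Rightarrow> 'a \<Rightarrow> 'a" where
  "map_of_matrix bs A = (SOME f. clinear f \<and> has_matrix f bs A)"

definition has_jordan_form_on ::
  "'a::complex_vec set \<Rightarrow> ('a \<Rightarrow> 'a) \<Rightarrow> (nat \<times> complex) list \<Rightarrow> bool" where
  "has_jordan_form_on V f n_as \<longleftrightarrow>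
     (\<exists>bs A. is_ordered_basis bs V \<and> has_matrix f bs A \<and> jordan_nf A n_as)"

text \<open>\<open>SL(2,\<int>)\<close> is presented by the generators \<open>S\<close>, \<open>T\<close> and the relations \<open>S\<^sup>4 = 1\<close>,
  \<open>(S T)\<^sup>3 = S\<^sup>2\<close>; a projective action satisfies these up to nonzero scalars.\<close>

definition projective_SL2Z_action :: "'a::complex_vec set \<Rightarrow> ('a \<Rightarrow> 'a) \<Rightarrow> ('a \<Rightarrow> 'a) \<Rightarrow> bool" where
  "projective_SL2Z_action V S T \<longleftrightarrow>
     linear_endo_on V S \<and> linear_endo_on V T \<and> bij_betw S V V \<and> bij_betw T V V \<and>
     (\<exists>c. c \<noteq> 0 \<and> (\<forall>z\<in>V. (S ^^ 4) z = c *\<^sub>C z)) \<and>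
     (\<exists>c. c \<noteq> 0 \<and> (\<forall>z\<in>V. ((S \<circ> T) ^^ 3) z = c *\<^sub>C S (S z)))"

definition center :: "'a::times set" where
  "center = {z. \<forall>x. z * x = x * z}"


section \<open>Monoid algebras and quotients by two-sided ideals\<close>

text \<open>For an additively written monoid \<open>'m\<close>, the type \<open>'m \<Rightarrow>\<^sub>0 complex\<close> is its monoid algebra
  over the complex numbers, with unit \<open>single 0 1\<close>.\<close>

definition two_sided_ideal :: "'a::ring set \<Rightarrow> bool" where
  "two_sided_ideal I \<longleftrightarrow> 0 \<in> I \<and> (\<forall>x\<in>I. \<forall>y\<in>I. x + y \<in> I) \<and>
     (\<forall>x\<in>I. \<forall>a. a * x \<in> I \<and> x * a \<in> I)"

definition scalar :: "complex \<Rightarrow> ('m::monoid_add \<Rightarrow>\<^sub>0 complex)" where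
  "scalar c = Poly_Mapping.single 0 c"

definition cong_ideal :: "'a::ring_1 set \<Rightarrow> 'a \<Rightarrow> 'a \<Rightarrow> bool" where
  "cong_ideal R x y \<longleftrightarrow> x - y \<in> two_sided_ideal hull R"

lemma ideal_hull: "two_sided_ideal (two_sided_ideal hull R)"
  by (rule hull_in) (auto simp: two_sided_ideal_def)

lemma ideal_hull_0: "0 \<in> two_sided_ideal hull R"
  and ideal_hull_add: "x \<in> two_sided_ideal hull R \<Longrightarrow> y \<in> two_sided_ideal hull R \<Longrightarrow>
        x + y \<in> two_sided_ideal hull R"
  and ideal_hull_left: "x \<in> two_sided_ideal hull R \<Longrightarrow> a * x \<in> two_sided_ideal hull R"
  and ideal_hull_right: "x \<in> two_sided_ideal hull R \<Longrightarrow> x * a \<in> two_sided_ideal hull R"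
  using ideal_hull[of R] unfolding two_sided_ideal_def by blast+

lemma ideal_hull_uminus:
  fixes R :: "'a::ring_1 set"
  shows "x \<in> two_sided_ideal hull R \<Longrightarrow> - x \<in> two_sided_ideal hull R"
  using ideal_hull_left[of x R "-1"] by simp

lemma cong_ideal_equivp: "equivp (cong_ideal R)"
proof (rule equivpI)
  show "reflp (cong_ideal R)"
    by (simp add: reflp_def cong_ideal_def ideal_hull_0)
  show "symp (cong_ideal R)"
    unfolding symp_def cong_ideal_def using ideal_hull_uminus by (metis minus_diff_eq)
  show "transp (cong_ideal R)"
    unfolding transp_def cong_ideal_def using ideal_hull_add
    by (metis diff_add_cancel add_diff_eq)
qed

lemma cong_ideal_add:
  "cong_ideal R x x' \<Longrightarrow> cong_ideal R y y' \<Longrightarrow> cong_ideal R (x + y) (x' + y')"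
  unfolding cong_ideal_def using ideal_hull_add by (metis add_diff_add)

lemma cong_ideal_uminus: "cong_ideal R x x' \<Longrightarrow> cong_ideal R (- x) (- x')"
  unfolding cong_ideal_def using ideal_hull_uminus[of "x - x'"] by simp

lemma cong_ideal_diff:
  "cong_ideal R x x' \<Longrightarrow> cong_ideal R y y' \<Longrightarrow> cong_ideal R (x - y) (x' - y')"
  using cong_ideal_add[of R x x' "- y" "- y'"] cong_ideal_uminus[of R y y'] by simp

lemma cong_ideal_mult:
  assumes "cong_ideal R x x'" "cong_ideal R y y'"
  shows "cong_ideal R (x * y) (x' * y')"
proof -
  have "x * y - x' * y' = (x - x') * y + x' * (y - y')" by (simp add: algebra_simps)
  then show ?thesis
    using assms unfolding cong_ideal_def
    by (simp add: ideal_hull_add ideal_hull_left ideal_hull_right)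
qed

lemma cong_ideal_refl: "cong_ideal R x x"
  by (simp add: cong_ideal_def ideal_hull_0)

lemma scalar_mult_commute: "scalar c * p = p * scalar c"
proof (induction p rule: update_induct)
  case const
  show ?case by simp
next
  case (update p k v)
  have "Poly_Mapping.update k v p = p + Poly_Mapping.single k v"
    using update(1)
    by (intro poly_mapping_eqI) (auto simp: lookup_update lookup_add lookup_single in_keys_iff)
  moreover have "scalar c * Poly_Mapping.single k v = Poly_Mapping.single k v * scalar c"
    by (simp add: scalar_def mult_single mult.commute)
  ultimately show ?case using update(3) by (simp only: distrib_left distrib_right)
qed

lemma scalar_mult_left_commute: "q * (scalar c * p) = scalar c * (q * p)"
proof -
  have "q * (scalar c * p) = (q * scalar c) * p" by (rule mult.assoc[symmetric])
  also have "\<dots> = (scalar c * q) * p" by (simp only: scalar_mult_commute)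
  also have "\<dots> = scalar c * (q * p)" by (rule mult.assoc)
  finally show ?thesis .
qed

lemma scalar_laws:
  "scalar (c + d) = scalar c + scalar d" "scalar (c * d) = scalar c * scalar d" "scalar 1 = 1"
  by (simp_all add: scalar_def single_add mult_single)


section \<open>The algebra \<open>Q\<close>\<close>

text \<open>The generators \<open>f\<^sub>1\<^sup>\<plusminus>, \<dots>, f\<^sub>N\<^sup>\<plusminus>\<close> are indexed by a finite linearly ordered type \<open>'i\<close>, so that
  \<open>N = CARD('i) \<ge> 1\<close>. The order is that of the ordered products over \<open>1, \<dots>, N\<close>.\<close>

datatype free_sign = Pl | Mi
datatype 'i gen = Kgen | Fgen free_sign 'i
datatype 'g free_word = Free_Word "'g list"

fun sgnC :: "free_sign \<Rightarrow> complex" where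
  "sgnC Pl = 1"
| "sgnC Mi = -1"

instantiation free_word :: (type) monoid_add
begin

definition zero_free_word :: "'a free_word" where
  "0 = Free_Word []"

fun plus_free_word :: "'a free_word \<Rightarrow> 'a free_word \<Rightarrow> 'a free_word" where
  "Free_Word u + Free_Word v = Free_Word (u @ v)"

instance
proof
  fix a b c :: "'a free_word"
  show "a + b + c = a + (b + c)" by (cases a; cases b; cases c) simp
  show "0 + a = a" "a + 0 = a" by (cases a; simp add: zero_free_word_def)+
qed

end

type_synonym 'i free_alg = "'i gen free_word \<Rightarrow>\<^sub>0 complex"

definition free_gen :: "'i gen \<Rightarrow> 'i free_alg" where
  "free_gen g = Poly_Mapping.single (Free_Word [g]) 1"

abbreviation anticomm :: "'a::ring \<Rightarrow> 'a \<Rightarrow> 'a" where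
  "anticomm x y \<equiv> x * y + y * x"

definition Q_relators :: "'i free_alg set" where
  "Q_relators = (let K = free_gen Kgen; f = (\<lambda>s i. free_gen (Fgen s i)) in
     {anticomm (f s i) K | s i. True} \<union>
     {anticomm (f Pl i) (f Mi j) - (if i = j then scalar (1/2) * (1 - K ^ 2) else 0) | i j. True} \<union>
     {anticomm (f s i) (f s j) | s i j. True} \<union>
     {K ^ 4 - 1})"

quotient_type 'i Q = "'i free_alg" / "cong_ideal Q_relators"
  by (rule cong_ideal_equivp)

instantiation Q :: (type) complex_alg
begin

lift_definition zero_Q :: "'a Q" is 0 .
lift_definition one_Q :: "'a Q" is 1 .
lift_definition plus_Q :: "'a Q \<Rightarrow> 'a Q \<Rightarrow> 'a Q" is "(+)" by (rule cong_ideal_add)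
lift_definition uminus_Q :: "'a Q \<Rightarrow> 'a Q" is uminus by (rule cong_ideal_uminus)
lift_definition minus_Q :: "'a Q \<Rightarrow> 'a Q \<Rightarrow> 'a Q" is "(-)" by (rule cong_ideal_diff)
lift_definition times_Q :: "'a Q \<Rightarrow> 'a Q \<Rightarrow> 'a Q" is "(*)" by (rule cong_ideal_mult)
lift_definition scaleC_Q :: "complex \<Rightarrow> 'a Q \<Rightarrow> 'a Q" is "\<lambda>c p. scalar c * p"
  by (intro cong_ideal_mult cong_ideal_refl)

instance
proof
  fix a b d :: "'a Q" and x y :: complex
  show "a + b + d = a + (b + d)" "a + b = b + a" "0 + a = a" "- a + a = 0" "a - b = a + - b"
    "a * b * d = a * (b * d)" "1 * a = a" "a * 1 = a"
    "(a + b) * d = a * d + b * d" "a * (b + d) = a * b + a * d"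
    by (transfer, simp add: algebra_simps cong_ideal_refl)+
  show "x *\<^sub>C (a + b) = x *\<^sub>C a + x *\<^sub>C b" "(x + y) *\<^sub>C a = x *\<^sub>C a + y *\<^sub>C a"
    "x *\<^sub>C y *\<^sub>C a = (x * y) *\<^sub>C a" "1 *\<^sub>C a = a" "(x *\<^sub>C a) * b = x *\<^sub>C (a * b)"
    by (transfer, simp add: algebra_simps scalar_laws cong_ideal_refl)+
  show "a * (x *\<^sub>C b) = x *\<^sub>C (a * b)"
    by transfer (simp add: scalar_mult_left_commute cong_ideal_refl)
qed

end

lift_definition qK :: "'i Q" is "free_gen Kgen" .
lift_definition qf :: "free_sign \<Rightarrow> 'i \<Rightarrow> 'i Q" is "\<lambda>s i. free_gen (Fgen s i)" .

definition qe :: "nat \<Rightarrow> 'i Q" where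
  "qe n = (1/2) *\<^sub>C (1 + (-1) ^ n *\<^sub>C qK ^ 2)"

definition omega :: "free_sign \<Rightarrow> 'i Q" where
  "omega s = (qe 0 + (sgnC s * \<i>) *\<^sub>C qe 1) * qK"

definition ordered_prod :: "('i::{finite,linorder} \<Rightarrow> 'a::monoid_mult) \<Rightarrow> 'a" where
  "ordered_prod g = prod_list (map g (sorted_list_of_set UNIV))"

text \<open>The odd case of the value at \<open>qK\<close> is the inverse of \<open>qK\<close>, as \<open>qK ^ 4 = 1\<close>.\<close>

definition antipode :: "'i::{finite,linorder} Q \<Rightarrow> 'i Q" where
  "antipode = (THE S. clinear S \<and> bij S \<and> S 1 = 1 \<and> (\<forall>x y. S (x * y) = S y * S x) \<and>
     S qK = (if even CARD('i) then qK else qK ^ 3) \<and>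
     (\<forall>s k. S (qf s k) = qf s k * (qe 0 + (sgnC s * (-1) ^ CARD('i) * \<i>) *\<^sub>C qe 1) * qK))"


section \<open>Tensor powers\<close>

text \<open>For a complex algebra \<open>'a\<close>, \<open>('i, 'a) tpow\<close> is the algebra given by the tensor product of
  copies of \<open>'a\<close> indexed by \<open>'i\<close> (for finite \<open>'i\<close>): the monoid algebra of the
  multiplicative monoid \<open>'i \<Rightarrow> 'a\<close> modulo multilinearity. The family \<open>a\<close> gives the pure tensor
  of the \<open>a j\<close>. (The ideal generated by the multilinearity relators is also their linear span.)\<close>

datatype ('i, 'a) family = Family "'i \<Rightarrow> 'a"

instantiation family :: (type, monoid_mult) monoid_add
begin

definition zero_family :: "('a, 'b) family" where
  "0 = Family (\<lambda>_. 1)"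

fun plus_family :: "('a, 'b) family \<Rightarrow> ('a, 'b) family \<Rightarrow> ('a, 'b) family" where
  "Family a + Family b = Family (\<lambda>j. a j * b j)"

instance
proof
  fix a b c :: "('a, 'b) family"
  show "a + b + c = a + (b + c)" by (cases a; cases b; cases c) (simp add: mult.assoc)
  show "0 + a = a" "a + 0 = a" by (cases a; simp add: zero_family_def)+
qed

end

definition free_family :: "('i \<Rightarrow> 'a::monoid_mult) \<Rightarrow> (('i, 'a) family \<Rightarrow>\<^sub>0 complex)" where
  "free_family a = Poly_Mapping.single (Family a) 1"

definition multilinearity_relators :: "(('i, 'a::complex_alg) family \<Rightarrow>\<^sub>0 complex) set" where
  "multilinearity_relators =
     {free_family (a(j := x + y)) - free_family (a(j := x)) - free_family (a(j := y))
        | a j x y. True} \<union>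
     {free_family (a(j := c *\<^sub>C x)) - scalar c * free_family (a(j := x)) | a j c x. True}"

quotient_type (overloaded) ('i, 'a) tpow =
    "('i, 'a::complex_alg) family \<Rightarrow>\<^sub>0 complex" / "cong_ideal multilinearity_relators"
  by (rule cong_ideal_equivp)

instantiation tpow :: (type, complex_alg) complex_alg
begin

lift_definition zero_tpow :: "('a, 'b) tpow" is 0 .
lift_definition one_tpow :: "('a, 'b) tpow" is 1 .
lift_definition plus_tpow :: "('a, 'b) tpow \<Rightarrow> ('a, 'b) tpow \<Rightarrow> ('a, 'b) tpow" is "(+)"
  by (rule cong_ideal_add)
lift_definition uminus_tpow :: "('a, 'b) tpow \<Rightarrow> ('a, 'b) tpow" is uminus
  by (rule cong_ideal_uminus)
lift_definition minus_tpow :: "('a, 'b) tpow \<Rightarrow> ('a, 'b) tpow \<Rightarrow> ('a, 'b) tpow" is "(-)"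
  by (rule cong_ideal_diff)
lift_definition times_tpow :: "('a, 'b) tpow \<Rightarrow> ('a, 'b) tpow \<Rightarrow> ('a, 'b) tpow" is "(*)"
  by (rule cong_ideal_mult)
lift_definition scaleC_tpow :: "complex \<Rightarrow> ('a, 'b) tpow \<Rightarrow> ('a, 'b) tpow"
  is "\<lambda>c p. scalar c * p"
  by (intro cong_ideal_mult cong_ideal_refl)

instance
proof
  fix a b d :: "('a, 'b) tpow" and x y :: complex
  show "a + b + d = a + (b + d)" "a + b = b + a" "0 + a = a" "- a + a = 0" "a - b = a + - b"
    "a * b * d = a * (b * d)" "1 * a = a" "a * 1 = a"
    "(a + b) * d = a * d + b * d" "a * (b + d) = a * b + a * d"
    by (transfer, simp add: algebra_simps cong_ideal_refl)+
  show "x *\<^sub>C (a + b) = x *\<^sub>C a + x *\<^sub>C b" "(x + y) *\<^sub>C a = x *\<^sub>C a + y *\<^sub>C a"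
    "x *\<^sub>C y *\<^sub>C a = (x * y) *\<^sub>C a" "1 *\<^sub>C a = a" "(x *\<^sub>C a) * b = x *\<^sub>C (a * b)"
    by (transfer, simp add: algebra_simps scalar_laws cong_ideal_refl)+
  show "a * (x *\<^sub>C b) = x *\<^sub>C (a * b)"
    by transfer (simp add: scalar_mult_left_commute cong_ideal_refl)
qed

end

lift_definition pure_tensor :: "('i \<Rightarrow> 'a::complex_alg) \<Rightarrow> ('i, 'a) tpow" is free_family .

text \<open>The linear map induced by a multilinear map \<open>B\<close>.\<close>

definition tensor_lift ::
  "(('i \<Rightarrow> 'a::complex_alg) \<Rightarrow> 'b::complex_vec) \<Rightarrow> ('i, 'a) tpow \<Rightarrow> 'b" where
  "tensor_lift B = (THE L. clinear L \<and> (\<forall>a. L (pure_tensor a) = B a))"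

definition tensor_map ::
  "('i \<Rightarrow> 'a \<Rightarrow> 'a) \<Rightarrow> ('i, 'a::complex_alg) tpow \<Rightarrow> ('i, 'a) tpow" where
  "tensor_map g = tensor_lift (\<lambda>a. pure_tensor (\<lambda>j. g j (a j)))"

text \<open>The tensor square has index type \<^typ>\<open>bool\<close>, where \<^const>\<open>False\<close> is the left and
  \<^const>\<open>True\<close> the right factor.\<close>

definition tens :: "'a \<Rightarrow> 'a \<Rightarrow> (bool, 'a::complex_alg) tpow" (infixr "\<otimes>\<^sub>C" 72) where
  "x \<otimes>\<^sub>C y = pure_tensor (\<lambda>right. if right then y else x)"

definition tensor_flip :: "(bool, 'a::complex_alg) tpow \<Rightarrow> (bool, 'a) tpow" where
  "tensor_flip = tensor_lift (\<lambda>a. a True \<otimes>\<^sub>C a False)"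


section \<open>Quasi-Hopf data\<close>

definition rho :: "nat \<Rightarrow> nat \<Rightarrow> (bool, 'i Q) tpow" where
  "rho n m = (1/2) *\<^sub>C (\<Sum>p\<in>{0,1}. \<Sum>q\<in>{0,1}.
     ((-1) ^ (p * q) * \<i> powi (- int (p * n) + int (q * m))) *\<^sub>C (qK ^ p \<otimes>\<^sub>C qK ^ q))"

definition R_matrix :: "complex \<Rightarrow> (bool, 'i::{finite,linorder} Q) tpow" where
  "R_matrix \<beta> =
     (\<Sum>n\<in>{0,1}. \<Sum>m\<in>{0,1}. \<beta> ^ (n * m) *\<^sub>C (rho n m * (qe n \<otimes>\<^sub>C qe m))) *
     ordered_prod (\<lambda>k. 1 \<otimes>\<^sub>C 1 - 2 *\<^sub>C ((qf Mi k * omega Mi) \<otimes>\<^sub>C qf Pl k))"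

definition monodromy :: "complex \<Rightarrow> (bool, 'i::{finite,linorder} Q) tpow" where
  "monodromy \<beta> = tensor_flip (R_matrix \<beta>) * R_matrix \<beta>"

definition ribbon_inverse :: "complex \<Rightarrow> 'i::{finite,linorder} Q" where
  "ribbon_inverse \<beta> = (qe 0 - (inverse \<beta> * \<i>) *\<^sub>C (qK * qe 1)) *
     ordered_prod (\<lambda>k. 1 + 2 *\<^sub>C (qf Pl k * qf Mi k * qK ^ 2))"

definition monomial_basis :: "'i::{finite,linorder} Q set" where
  "monomial_basis = {ordered_prod (\<lambda>j. qf Pl j ^ p j * qf Mi j ^ m j) * qK ^ k | p m k.
     (\<forall>j. p j \<in> {0,1} \<and> m j \<in> {0,1}) \<and> k \<le> 3}"

text \<open>\<open>cvec.representation monomial_basis x b\<close> is the value at \<open>x\<close> of the element of the dual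
  basis belonging to the monomial \<open>b\<close>.\<close>

definition Lambda_hat :: "complex \<Rightarrow> complex \<Rightarrow> 'i::{finite,linorder} Q \<Rightarrow> complex" where
  "Lambda_hat \<nu> \<beta> x = (-1) ^ CARD('i) * \<nu> * \<beta> ^ 2 * 2 powi (1 - int CARD('i)) *
     cvec.representation monomial_basis x (ordered_prod (\<lambda>j. qf Pl j * qf Mi j))"

definition S_Z :: "complex \<Rightarrow> complex \<Rightarrow> 'i::{finite,linorder} Q \<Rightarrow> 'i Q" where
  "S_Z \<nu> \<beta> z =
     tensor_lift (\<lambda>a. Lambda_hat \<nu> \<beta> (a False * z) *\<^sub>C antipode (a True)) (monodromy \<beta>)"

definition T_Z :: "complex \<Rightarrow> 'i::{finite,linorder} Q \<Rightarrow> 'i Q" where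
  "T_Z \<beta> z = ribbon_inverse \<beta> * z"


section \<open>The two summands of the centre\<close>

definition e1_pm :: "free_sign \<Rightarrow> 'i::{finite,linorder} Q" where
  "e1_pm s = (1/2) *\<^sub>C (qe 1 *
     (1 - (sgnC s * \<i>) *\<^sub>C (qK * ordered_prod (\<lambda>j. 1 - 2 *\<^sub>C (qf Pl j * qf Mi j)))))"

definition phi_P0 :: "complex \<Rightarrow> complex \<Rightarrow> 'i::{finite,linorder} Q" where
  "phi_P0 \<nu> \<beta> = (\<nu> * 2 ^ (3 * CARD('i)) * \<beta> ^ 2) *\<^sub>C
     (qK * qe 0 * ordered_prod (\<lambda>j. qf Pl j * qf Mi j))"

definition phi_X1 :: "free_sign \<Rightarrow> complex \<Rightarrow> 'i::{finite,linorder} Q" where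
  "phi_X1 s \<nu> = (sgnC s * \<nu> * 2 ^ (CARD('i) + 1)) *\<^sub>C e1_pm s"

definition Z_P_basis :: "complex \<Rightarrow> complex \<Rightarrow> 'i::{finite,linorder} Q list" where
  "Z_P_basis \<nu> \<beta> = [phi_P0 \<nu> \<beta>, phi_X1 Pl \<nu>, phi_X1 Mi \<nu>]"

definition Z_P :: "complex \<Rightarrow> complex \<Rightarrow> 'i::{finite,linorder} Q set" where
  "Z_P \<nu> \<beta> = cvec.span (set (Z_P_basis \<nu> \<beta>))"

definition Z_Lambda :: "'i Q set" where
  "Z_Lambda = cvec.span {qe 0 * prod_list (map (\<lambda>(s, j). qf s j) w) | w. even (length w)}"

definition U_basis :: "'i \<Rightarrow> 'i Q list" where
  "U_basis j = [qf Pl j * qf Mi j * qe 0, qe 0, qf Mi j * qe 0, qf Pl j * qe 0]"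

definition U_space :: "'i \<Rightarrow> 'i Q set" where
  "U_space j = cvec.span {qe 0, qf Mi j * qe 0, qf Pl j * qe 0, qf Pl j * qf Mi j * qe 0}"

text \<open>The tensor product of the subspaces \<open>U_space j\<close> of \<open>Q\<close> is regarded as the subspace of the
  tensor power of \<open>Q\<close> spanned by the pure tensors of families \<open>a\<close> with \<open>a j \<in> U_space j\<close>.\<close>

definition U_plus :: "('i::{finite,linorder}, 'i Q) tpow set" where
  "U_plus = cvec.span {pure_tensor (\<lambda>j. qf Pl j ^ p j * qf Mi j ^ m j * qe 0) | p m.
     (\<forall>j. p j \<in> {0,1} \<and> m j \<in> {0,1}) \<and> even (\<Sum>j\<in>UNIV. p j + m j)}"

definition theta :: "('i::{finite,linorder}, 'i Q) tpow \<Rightarrow> 'i Q" where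
  "theta = tensor_lift ordered_prod"

definition mat_S_P :: "nat \<Rightarrow> complex \<Rightarrow> complex mat" where
  "mat_S_P N \<nu> = \<nu> \<cdot>\<^sub>m mat_of_rows_list 3
     [[0,               1 / 2 ^ N, - 1 / 2 ^ N],
      [2 ^ (N - 1),     1/2,       1/2],
      [- (2 ^ (N - 1)), 1/2,       1/2]]"

definition mat_T_P :: "complex \<Rightarrow> complex mat" where
  "mat_T_P \<beta> = mat_of_rows_list 3
     [[1, 0,         0],
      [0, inverse \<beta>, 0],
      [0, 0,         - inverse \<beta>]]"

definition mat_sigma :: "complex mat" where
  "mat_sigma = mat_of_rows_list 4
     [[0,    2, 0, 0],
      [-1/2, 0, 0, 0],
      [0,    0, 1, 0],
      [0,    0, 0, 1]]"

definition mat_t :: "complex mat" where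
  "mat_t = mat_of_rows_list 4
     [[1, 2, 0, 0],
      [0, 1, 0, 0],
      [0, 0, 1, 0],
      [0, 0, 0, 1]]"

definition sigma_map :: "'i \<Rightarrow> 'i Q \<Rightarrow> 'i Q" where
  "sigma_map j = map_of_matrix (U_basis j) mat_sigma"

definition t_map :: "'i \<Rightarrow> 'i Q \<Rightarrow> 'i Q" where
  "t_map j = map_of_matrix (U_basis j) mat_t"

end

(*
  Fock representations of Q show that the monomials are a basis and give formulas for the
  coefficient functionals, so that the monodromy matrix, which on each block e_n (x) e_m is a power
  of K in each leg times a product of N commuting local factors, determines S_Z by a calculation
  at a single site. On e_0 this yields the tensor product of the sigma^j, and multiplication by the
  inverse ribbon element the tensor product of the t^j.

  The centre splits along e_0 and e_1. A central element of the block e_1 commutes with the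
  involutions 1 - 2 f_j^+ f_j^- and f_j^+ + f_j^-, which leaves e_1 and
  K e_1 prod_j (1 - 2 f_j^+ f_j^-). In the block e_0 it is a + b K with a even and b annihilated by
  all generators, hence b is a multiple of the top product. The relations between S_Z and T_Z can
  thus be checked on Z_P with 3 x 3 matrices and on Z_Lambda at a single site.

  On Z_Lambda, T_Z is multiplication by the product of the 1 + y_j with y_j = 2 f_j^+ f_j^- e_0
  commuting and of square zero. With x = prod_j (1 + y_j) - 1 one has x^N = N! prod_j y_j and
  x^(N+1) = 0, whereas T_Z is diagonalisable on Z_P. So the kernels of (T_Z - c)^k are stationary
  from k = N + 1 on for every c, and not before for c = 1.
*)
theory Submission
  imports Defs "Jordan_Normal_Form.Jordan_Normal_Form_Existence"
    "Jordan_Normal_Form.Jordan_Normal_Form_Uniqueness"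
begin

section \<open>Linear maps and linear extensions\<close>

text \<open>Generators at different sites anticommute, so neither a monomial nor a local factor of
  the R-matrix is literally a tensor factor. The remedy is to attach \<open>qK ^ odd_deg c\<close>
  to a local monomial: the twisted monomials commute with the plain ones at other sites, and the
  products split site by site. The normalisation of the integral splits as well: half of it is
  \<nu>\<beta>^2 (-1/2)^N, the half coming from the projection to a block, so each site receives a
  factor -1/2. Together with the weight 4 of a doubly occupied site this is the origin of the
  entries -1/2 and 2 of \<open>mat_sigma\<close>. On the other summand the working basis is
  \<open>Ktop\<close>, \<open>qe 1\<close>, \<open>Gam\<close>, where \<open>Gam\<close> squares to
  \<open>- qe 1\<close> and has the two idempotents \<open>e1_pm\<close> as eigenvectors. There
  \<open>S_Z\<close> exchanges the lines of \<open>Ktop\<close> and \<open>qe 1\<close> and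
  multiplies \<open>Gam\<close> by \<nu>, while \<open>T_Z\<close> fixes \<open>Ktop\<close> and
  exchanges the lines of \<open>qe 1\<close> and \<open>Gam\<close>. The condition \<beta>^4 =
  (-1)^N enters where a sign (-1)^N collected from the sites has to cancel.\<close>

global_interpretation cpair: vector_space_pair
  "scaleC :: complex \<Rightarrow> 'a \<Rightarrow> 'a::complex_vec" "scaleC :: complex \<Rightarrow> 'b \<Rightarrow> 'b::complex_vec"
  by unfold_locales

lemma clinearI:
  assumes "\<And>x y. f (x + y) = f x + f y" "\<And>c x. f (c *\<^sub>C x) = c *\<^sub>C f x"
  shows "clinear f"
  using assms by unfold_locales

lemma clinear_add: "clinear f \<Longrightarrow> f (x + y) = f x + f y"
  and clinear_scaleC: "clinear f \<Longrightarrow> f (c *\<^sub>C x) = c *\<^sub>C f x"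
  and clinear_diff: "clinear f \<Longrightarrow> f (x - y) = f x - f y"
  and clinear_uminus: "clinear f \<Longrightarrow> f (- x) = - f x"
  and clinear_zero: "clinear f \<Longrightarrow> f 0 = 0"
  and clinear_sum: "clinear f \<Longrightarrow> f (sum g A) = (\<Sum>a\<in>A. f (g a))"
  by (simp_all add: cpair.linear_add cpair.linear_scale cpair.linear_diff cpair.linear_neg
      cpair.linear_0 cpair.linear_sum)

lemma clinear_compose: "clinear f \<Longrightarrow> clinear g \<Longrightarrow> clinear (\<lambda>x. g (f x))"
  by (intro clinearI) (simp_all add: clinear_add clinear_scaleC)

lemma clinear_mult_left: "clinear (\<lambda>x::'a::complex_alg. a * x)"
  and clinear_mult_right: "clinear (\<lambda>x::'a::complex_alg. x * a)"
  by (intro clinearI; simp add: algebra_simps mult_scaleC_left mult_scaleC_right)+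

lemma clinear_eq_on_span:
  assumes "clinear f" "clinear g" "x \<in> cvec.span B" "\<And>b. b \<in> B \<Longrightarrow> f b = g b"
  shows "f x = g x"
  using cpair.linear_eq_on[OF assms(1-3)] assms(4) by blast

lemma clinear_in_subspace:
  assumes "clinear f" "cvec.subspace W" "x \<in> cvec.span B" "\<And>b. b \<in> B \<Longrightarrow> f b \<in> W"
  shows "f x \<in> W"
  using assms(3)
  by (induction rule: cvec.span_induct_alt)
    (auto simp: clinear_zero[OF assms(1)] clinear_add[OF assms(1)] clinear_scaleC[OF assms(1)]
      intro!: cvec.subspace_0[OF assms(2)] cvec.subspace_add[OF assms(2)]
        cvec.subspace_scale[OF assms(2)] assms(4))

definition lin_ext :: "('m \<Rightarrow> 'b::complex_vec) \<Rightarrow> ('m \<Rightarrow>\<^sub>0 complex) \<Rightarrow> 'b" where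
  "lin_ext B p = (\<Sum>k\<in>Poly_Mapping.keys p. Poly_Mapping.lookup p k *\<^sub>C B k)"

lemma lin_ext_single: "lin_ext B (Poly_Mapping.single k c) = c *\<^sub>C B k"
  by (simp add: lin_ext_def)

lemma lin_ext_zero: "lin_ext B 0 = 0"
  by (simp add: lin_ext_def)

lemma lin_ext_add: "lin_ext B (p + q) = lin_ext B p + lin_ext B q"
  unfolding lin_ext_def
  by (rule setsum_keys_plus_distrib) (simp_all add: scaleC_add_left)

lemma lin_ext_diff: "lin_ext B (p - q) = lin_ext B p - lin_ext B q"
  using lin_ext_add[of B "p - q" q] by simp

lemma single_sum_induct [case_names single add]:
  assumes "\<And>k c. P (Poly_Mapping.single k c)" "\<And>p q. P p \<Longrightarrow> P q \<Longrightarrow> P (p + q)"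
  shows "P p"
proof (induction p rule: update_induct)
  case const
  show ?case using assms(1)[of undefined 0] by simp
next
  case (update p k c)
  have "Poly_Mapping.update k c p = p + Poly_Mapping.single k c"
    using update(1)
    by (intro poly_mapping_eqI) (auto simp: lookup_update lookup_add lookup_single in_keys_iff)
  then show ?case using assms(2)[OF update(3) assms(1)] by simp
qed

lemma lin_ext_scalar:
  fixes p :: "'m::monoid_add \<Rightarrow>\<^sub>0 complex"
  shows "lin_ext B (scalar c * p) = c *\<^sub>C lin_ext B p"
  by (induction p rule: single_sum_induct)
    (simp_all add: scalar_def mult_single lin_ext_single lin_ext_add distrib_left
      scaleC_add_right scaleC_scaleC)

lemma lin_ext_mult:
  fixes B :: "'m::monoid_add \<Rightarrow> 'b::complex_alg"
  assumes "\<And>k l. B (k + l) = B k * B l"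
  shows "lin_ext B (p * q) = lin_ext B p * lin_ext B q"
proof (induction p rule: single_sum_induct)
  case (single k c)
  show ?case
    by (induction q rule: single_sum_induct)
      (simp_all add: mult_single lin_ext_single assms lin_ext_add distrib_left
        mult_scaleC_left mult_scaleC_right scaleC_scaleC)
qed (simp add: lin_ext_add distrib_right)

text \<open>For a multiplicative extension the kernel is itself a two-sided ideal, so relators that
  are killed drag the whole ideal they generate along.\<close>

lemma lin_ext_hull_zero:
  fixes B :: "'m::monoid_add \<Rightarrow> 'b::complex_alg"
  assumes "\<And>k l. B (k + l) = B k * B l" "\<And>r. r \<in> R \<Longrightarrow> lin_ext B r = 0"
    "p \<in> two_sided_ideal hull R"
  shows "lin_ext B p = 0"
proof -
  have "two_sided_ideal {p. lin_ext B p = 0}"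
    by (auto simp: two_sided_ideal_def lin_ext_zero lin_ext_add lin_ext_mult[OF assms(1)])
  then have "two_sided_ideal hull R \<subseteq> {p. lin_ext B p = 0}"
    using assms(2) by (intro hull_minimal) auto
  then show ?thesis using assms(3) by auto
qed

section \<open>Universal property of \<open>Q\<close>\<close>

primrec qgen :: "'i gen \<Rightarrow> 'i Q" where
  "qgen Kgen = qK"
| "qgen (Fgen s i) = qf s i"

lemma abs_Q_eq_iff: "abs_Q p = abs_Q q \<longleftrightarrow> p - q \<in> two_sided_ideal hull Q_relators"
  by (simp add: Q.abs_eq_iff cong_ideal_def)

lemma abs_Q_relator: "r \<in> Q_relators \<Longrightarrow> abs_Q r = 0"
  by (simp add: zero_Q.abs_eq abs_Q_eq_iff hull_inc)

lemma abs_Q_word: "abs_Q (Poly_Mapping.single (Free_Word w) 1) = prod_list (map qgen w)"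
proof (induction w)
  case Nil
  have "Poly_Mapping.single (Free_Word []) 1 = (1 :: 'a free_alg)"
    by (simp flip: zero_free_word_def)
  then show ?case by (simp add: one_Q.abs_eq)
next
  case (Cons g w)
  have "Poly_Mapping.single (Free_Word (g # w)) 1 =
      free_gen g * Poly_Mapping.single (Free_Word w) (1::complex)"
    by (simp add: free_gen_def mult_single)
  moreover have "abs_Q (free_gen g) = qgen g"
    by (cases g) (simp_all add: qK.abs_eq qf.abs_eq)
  ultimately show ?case using Cons by (simp flip: times_Q.abs_eq)
qed

lemma abs_Q_single:
  "abs_Q (Poly_Mapping.single (Free_Word w) c) = c *\<^sub>C prod_list (map qgen w)"
proof -
  have "Poly_Mapping.single (Free_Word w) c = scalar c * Poly_Mapping.single (Free_Word w) 1"
    by (simp add: scalar_def mult_single)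
  then show ?thesis by (simp add: abs_Q_word flip: scaleC_Q.abs_eq)
qed

lemma Q_eq_span_words: "cvec.span (range (\<lambda>w. prod_list (map qgen w))) = (UNIV :: 'i Q set)"
proof -
  have "abs_Q p \<in> cvec.span (range (\<lambda>w. prod_list (map qgen w)))" for p :: "'i free_alg"
  proof (induction p rule: single_sum_induct)
    case (single k c)
    show ?case by (cases k) (simp add: abs_Q_single cvec.span_scale cvec.span_base)
  next
    case (add p q)
    then show ?case by (simp add: cvec.span_add flip: plus_Q.abs_eq)
  qed
  then have "x \<in> cvec.span (range (\<lambda>w. prod_list (map qgen w)))" for x :: "'i Q"
    by (induction x rule: Q.abs_induct)
  then show ?thesis by blast
qed

lemma
  fixes i j :: 'i
  shows qf_qK: "qf s i * qK = - (qK * qf s i)"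
  and qf_anticomm: "qf s i * qf s j = - (qf s j * qf s i)"
  and qf_Pl_Mi: "qf Pl i * qf Mi j = (if i = j then qe 1 else 0) - qf Mi j * qf Pl i"
  and qK_pow_4: "(qK :: 'i Q) ^ 4 = 1"
proof -
  let ?K = "free_gen Kgen :: 'i free_alg" and ?f = "\<lambda>s i. free_gen (Fgen s i) :: 'i free_alg"
  have pow: "abs_Q (p ^ n) = abs_Q p ^ n" for p :: "'i free_alg" and n
    by (induction n) (simp_all add: one_Q.abs_eq flip: times_Q.abs_eq)
  have abs: "abs_Q ?K = qK" "\<And>s i. abs_Q (?f s i) = qf s i"
    by (simp_all add: qK.abs_eq qf.abs_eq)
  note ops = plus_Q.abs_eq[symmetric] minus_Q.abs_eq[symmetric] times_Q.abs_eq[symmetric]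
    one_Q.abs_eq[symmetric] scaleC_Q.abs_eq[symmetric] zero_Q.abs_eq[symmetric] pow abs
  have scal: "abs_Q (scalar c) = c *\<^sub>C (1 :: 'i Q)" for c
    using scaleC_Q.abs_eq[of c "1 :: 'i free_alg"] by (simp flip: one_Q.abs_eq)
  have "abs_Q (anticomm (?f s i) ?K) = 0"
    by (intro abs_Q_relator) (auto simp: Q_relators_def Let_def)
  then show "qf s i * qK = - (qK * qf s i)" by (simp add: ops eq_neg_iff_add_eq_0)
  have "abs_Q (anticomm (?f s i) (?f s j)) = 0"
    by (rule abs_Q_relator) (unfold Q_relators_def Let_def, blast)
  then show "qf s i * qf s j = - (qf s j * qf s i)" by (simp add: ops eq_neg_iff_add_eq_0)
  have "abs_Q (?K ^ 4 - 1) = 0"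
    by (intro abs_Q_relator) (auto simp: Q_relators_def Let_def)
  then show "(qK :: 'i Q) ^ 4 = 1" by (simp add: ops)
  have "abs_Q (anticomm (?f Pl i) (?f Mi j) -
      (if i = j then scalar (1/2) * (1 - ?K ^ 2) else 0)) = 0"
    by (intro abs_Q_relator) (auto simp: Q_relators_def Let_def)
  then show "qf Pl i * qf Mi j = (if i = j then qe 1 else 0) - qf Mi j * qf Pl i"
    by (cases "i = j")
      (simp_all add: ops scal mult_scaleC_left qe_def eq_diff_eq eq_neg_iff_add_eq_0)
qed

text \<open>The four hypotheses are the images of the relators. They make the extension of
  \<open>g\<close> to words vanish on the ideal, so that evaluation on representatives is well
  defined. Both the Fock representations and the antipode come from here.\<close>

theorem Q_hom_exists:
  fixes g :: "'i gen \<Rightarrow> 'b::complex_alg"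
  assumes "\<And>s i. anticomm (g (Fgen s i)) (g Kgen) = 0"
    and "\<And>i j. anticomm (g (Fgen Pl i)) (g (Fgen Mi j)) =
      (if i = j then (1/2) *\<^sub>C (1 - g Kgen ^ 2) else 0)"
    and "\<And>s i j. anticomm (g (Fgen s i)) (g (Fgen s j)) = 0"
    and "g Kgen ^ 4 = 1"
  obtains h :: "'i Q \<Rightarrow> 'b" where "clinear h" "h 1 = 1" "\<And>x y. h (x * y) = h x * h y"
    "h qK = g Kgen" "\<And>s i. h (qf s i) = g (Fgen s i)"
proof -
  define B where "B k = (case k of Free_Word w \<Rightarrow> prod_list (map g w))" for k
  have B_add: "B (k + l) = B k * B l" for k l
    by (cases k; cases l) (simp add: B_def)
  have B_0: "B 0 = 1" by (simp add: B_def zero_free_word_def)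
  let ?L = "lin_ext B"
  have gen: "?L (free_gen x) = g x" for x
    by (simp add: free_gen_def lin_ext_single B_def)
  have one: "?L 1 = 1" by (simp add: lin_ext_single B_0 flip: single_one)
  note mult = lin_ext_mult[OF B_add]
  have pow: "?L (p ^ n) = ?L p ^ n" for p n
    by (induction n) (simp_all add: one mult)
  have scl: "?L (scalar c) = c *\<^sub>C 1" for c
    using lin_ext_scalar[of B c 1] by (simp add: one)
  have rel: "?L r = 0" if "r \<in> Q_relators" for r
    using that
    by (auto simp: Q_relators_def Let_def lin_ext_add lin_ext_diff mult gen pow one scl assms
        mult_scaleC_left lin_ext_zero)
  define h where "h x = ?L (rep_Q x)" for x
  have h_abs: "h (abs_Q p) = ?L p" for p
  proof -
    have "abs_Q (rep_Q (abs_Q p)) = abs_Q p" by (rule Quotient_abs_rep[OF Quotient_Q])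
    then have "?L (rep_Q (abs_Q p) - p) = 0"
      by (intro lin_ext_hull_zero[OF B_add rel]) (auto simp: abs_Q_eq_iff)
    then show ?thesis by (simp add: h_def lin_ext_diff)
  qed
  show thesis
  proof
    show "clinear h"
    proof (rule clinearI)
      show "h (x + y) = h x + h y" for x y
        by (induction x rule: Q.abs_induct; induction y rule: Q.abs_induct)
          (simp add: plus_Q.abs_eq h_abs lin_ext_add)
      show "h (c *\<^sub>C x) = c *\<^sub>C h x" for c x
        by (induction x rule: Q.abs_induct) (simp add: scaleC_Q.abs_eq h_abs lin_ext_scalar)
    qed
    show "h 1 = 1" by (simp add: one_Q.abs_eq h_abs one)
    show "h (x * y) = h x * h y" for x y
      by (induction x rule: Q.abs_induct; induction y rule: Q.abs_induct)
        (simp add: times_Q.abs_eq h_abs mult)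
    show "h qK = g Kgen" "\<And>s i. h (qf s i) = g (Fgen s i)"
      by (simp_all add: qK.abs_eq qf.abs_eq h_abs gen)
  qed
qed

section \<open>Universal property of the tensor powers\<close>

definition multilin :: "(('i \<Rightarrow> 'a::complex_vec) \<Rightarrow> 'b::complex_vec) \<Rightarrow> bool" where
  "multilin B \<longleftrightarrow> (\<forall>a j x y. B (a(j := x + y)) = B (a(j := x)) + B (a(j := y))) \<and>
     (\<forall>a j c x. B (a(j := c *\<^sub>C x)) = c *\<^sub>C B (a(j := x)))"

lemma abs_tpow_eq_iff:
  "abs_tpow p = abs_tpow q \<longleftrightarrow> p - q \<in> two_sided_ideal hull multilinearity_relators"
  by (simp add: tpow.abs_eq_iff cong_ideal_def)

lemma pure_tensor_mult: "pure_tensor a * pure_tensor b = pure_tensor (\<lambda>j. a j * b j)"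
  by (simp add: pure_tensor.abs_eq times_tpow.abs_eq free_family_def mult_single)

lemma pure_tensor_one: "pure_tensor (\<lambda>_. 1) = 1"
  by (simp add: pure_tensor.abs_eq one_tpow.abs_eq free_family_def flip: zero_family_def)

lemma multilin_pure_tensor: "multilin (pure_tensor :: ('i \<Rightarrow> 'a::complex_alg) \<Rightarrow> _)"
proof -
  have "abs_tpow r = 0" if "r \<in> multilinearity_relators" for r :: "('i, 'a) family \<Rightarrow>\<^sub>0 complex"
    using that by (simp add: zero_tpow.abs_eq abs_tpow_eq_iff hull_inc)
  then have
    "abs_tpow (free_family (a(j := x + y)) - free_family (a(j := x)) - free_family (a(j := y))) = 0"
    "abs_tpow (free_family (a(j := c *\<^sub>C x)) - scalar c * free_family (a(j := x))) = 0"
    for a :: "'i \<Rightarrow> 'a" and j x y c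
    unfolding multilinearity_relators_def by blast+
  then show ?thesis
    unfolding multilin_def
    by (auto simp: pure_tensor.abs_eq diff_eq_eq simp flip: minus_tpow.abs_eq scaleC_tpow.abs_eq)
qed

lemma tpow_eq_span: "cvec.span (range pure_tensor) = (UNIV :: ('i, 'a::complex_alg) tpow set)"
proof -
  have "abs_tpow p \<in> cvec.span (range pure_tensor)" for p :: "('i, 'a) family \<Rightarrow>\<^sub>0 complex"
  proof (induction p rule: single_sum_induct)
    case (single k c)
    obtain a where k: "k = Family a" by (cases k)
    have "Poly_Mapping.single k c = scalar c * free_family a"
      by (simp add: scalar_def free_family_def mult_single k)
    then have "abs_tpow (Poly_Mapping.single k c) = c *\<^sub>C pure_tensor a"
      by (simp add: pure_tensor.abs_eq scaleC_tpow.abs_eq)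
    then show ?case by (simp add: cvec.span_scale cvec.span_base)
  next
    case (add p q)
    then show ?case by (simp add: cvec.span_add flip: plus_tpow.abs_eq)
  qed
  then have "x \<in> cvec.span (range pure_tensor)" for x :: "('i, 'a) tpow"
    by (induction x rule: tpow.abs_induct)
  then show ?thesis by blast
qed

lemma tpow_linear_eqI:
  assumes "clinear f" "clinear g" "\<And>a. f (pure_tensor a) = g (pure_tensor a)"
  shows "f t = g t"
  by (rule clinear_eq_on_span[OF assms(1,2), of _ "range pure_tensor"])
    (auto simp: tpow_eq_span assms(3))

text \<open>A multilinear \<open>B\<close> need not be multiplicative, so the kernel of its linear
  extension need not be an ideal. Used instead is the largest two-sided ideal inside that kernel:
  the \<open>p\<close> with \<open>?L (u * p * v) = 0\<close> for all \<open>u\<close> and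
  \<open>v\<close>.\<close>

theorem tensor_lift_ex1:
  fixes B :: "('i \<Rightarrow> 'a::complex_alg) \<Rightarrow> 'b::complex_vec"
  assumes "multilin B"
  shows "\<exists>!L. clinear L \<and> (\<forall>a. L (pure_tensor a) = B a)"
proof (rule ex_ex1I)
  define C where "C k = (case k of Family a \<Rightarrow> B a)" for k
  let ?L = "lin_ext C"
  have *: "(\<lambda>i. u i * (a(j := x)) i * v i) = (\<lambda>i. u i * a i * v i)(j := u j * x * v j)"
    for u a v :: "'i \<Rightarrow> 'a" and j x by auto
  have "two_sided_ideal {p. \<forall>u v. ?L (u * p * v) = 0}"
    unfolding two_sided_ideal_def
    by (auto simp: lin_ext_zero distrib_left distrib_right lin_ext_add mult.assoc)
      (metis mult.assoc)
  moreover have "\<forall>u v. ?L (u * r * v) = 0" if r: "r \<in> multilinearity_relators" for r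
  proof -
    \<comment> \<open>Multiplication by families on either side acts slot by slot and linearly, so
      it turns a multilinearity relator into one for other arguments.\<close>
    have "?L (Poly_Mapping.single u 1 * r * Poly_Mapping.single v 1) = 0" for u v
    proof -
      obtain u' v' where uv: "u = Family u'" "v = Family v'" by (cases u; cases v)
      have ff: "Poly_Mapping.single u 1 * free_family a * Poly_Mapping.single v 1 =
          free_family (\<lambda>i. u' i * a i * v' i)" for a
        by (simp add: uv free_family_def mult_single)
      have sc: "Poly_Mapping.single u 1 * (scalar c * p) * Poly_Mapping.single v 1 =
          scalar c * (Poly_Mapping.single u 1 * p * Poly_Mapping.single v 1)" for c p
        by (metis mult.assoc scalar_mult_left_commute)
      have L: "?L (free_family a) = B a" for a
        by (simp add: free_family_def lin_ext_single C_def)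
      from r show ?thesis
        unfolding multilinearity_relators_def
        using assms
        by (auto simp: right_diff_distrib left_diff_distrib ff sc lin_ext_diff lin_ext_scalar L *
            multilin_def distrib_left distrib_right mult_scaleC_left mult_scaleC_right
            simp del: fun_upd_apply)
    qed
    then have s: "?L (Poly_Mapping.single u c * r * Poly_Mapping.single v d) = 0" for u v c d
    proof -
      have "Poly_Mapping.single u c * r * Poly_Mapping.single v d =
        scalar c * (scalar d * (Poly_Mapping.single u 1 * r * Poly_Mapping.single v 1))"
      proof -
        have "Poly_Mapping.single u c = scalar c * Poly_Mapping.single u 1"
          "Poly_Mapping.single v d = scalar d * Poly_Mapping.single v 1"
          by (simp_all add: scalar_def mult_single)
        then show ?thesis
          using scalar_mult_left_commute[of "Poly_Mapping.single u 1 * r" d "Poly_Mapping.single v 1"]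
          by (simp only: mult.assoc)
      qed
      then show ?thesis
        by (simp add: lin_ext_scalar
            \<open>\<And>v u. ?L (Poly_Mapping.single u 1 * r * Poly_Mapping.single v 1) = 0\<close>)
    qed
    show ?thesis
    proof (intro allI)
      fix u v
      show "?L (u * r * v) = 0"
      proof (induction u rule: single_sum_induct)
        case (single k c)
        show ?case
          by (induction v rule: single_sum_induct) (simp_all add: s distrib_left lin_ext_add)
      qed (simp add: distrib_right lin_ext_add)
    qed
  qed
  ultimately have "two_sided_ideal hull multilinearity_relators \<subseteq>
      {p. \<forall>u v. ?L (u * p * v) = 0}"
    by (intro hull_minimal) auto
  then have ker: "?L p = 0" if "p \<in> two_sided_ideal hull multilinearity_relators" for p
  proof -
    from that \<open>_ \<subseteq> {p. \<forall>u v. ?L (u * p * v) = 0}\<close> have "?L (1 * p * 1) = 0" by blast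
    then show ?thesis by simp
  qed
  define h where "h x = ?L (rep_tpow x)" for x
  have h_abs: "h (abs_tpow p) = ?L p" for p
  proof -
    have "abs_tpow (rep_tpow (abs_tpow p)) = abs_tpow p"
      by (rule Quotient_abs_rep[OF Quotient_tpow])
    then have "?L (rep_tpow (abs_tpow p) - p) = 0"
      by (intro ker) (auto simp: abs_tpow_eq_iff)
    then show ?thesis by (simp add: h_def lin_ext_diff)
  qed
  have "clinear h"
  proof (rule clinearI)
    show "h (x + y) = h x + h y" for x y
      by (induction x rule: tpow.abs_induct; induction y rule: tpow.abs_induct)
        (simp add: plus_tpow.abs_eq h_abs lin_ext_add)
    show "h (c *\<^sub>C x) = c *\<^sub>C h x" for c x
      by (induction x rule: tpow.abs_induct) (simp add: scaleC_tpow.abs_eq h_abs lin_ext_scalar)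
  qed
  moreover have "h (pure_tensor a) = B a" for a
    by (simp add: pure_tensor.abs_eq h_abs free_family_def lin_ext_single C_def)
  ultimately show "\<exists>L. clinear L \<and> (\<forall>a. L (pure_tensor a) = B a)" by blast
next
  fix L L' :: "('i, 'a) tpow \<Rightarrow> 'b"
  assume "clinear L \<and> (\<forall>a. L (pure_tensor a) = B a)" "clinear L' \<and> (\<forall>a. L' (pure_tensor a) = B a)"
  then have "L t = L' t" for t by (intro tpow_linear_eqI[of L L' t]) simp_all
  then show "L = L'" ..
qed

lemma clinear_tensor_lift: "multilin B \<Longrightarrow> clinear (tensor_lift B)"
  and tensor_lift_pure: "multilin B \<Longrightarrow> tensor_lift B (pure_tensor a) = B a"
  using theI'[OF tensor_lift_ex1[of B]] unfolding tensor_lift_def by blast+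

lemma tens_mult: "(x \<otimes>\<^sub>C y) * (x' \<otimes>\<^sub>C y') = (x * x') \<otimes>\<^sub>C (y * y')"
  unfolding tens_def pure_tensor_mult by (intro arg_cong[where f = pure_tensor]) auto

lemma tens_one: "1 \<otimes>\<^sub>C 1 = 1"
  by (simp add: tens_def pure_tensor_one)

lemma pure_tensor_bool: "pure_tensor a = a False \<otimes>\<^sub>C a True"
  unfolding tens_def by (intro arg_cong[where f = pure_tensor]) auto

lemma tens_upd:
  "x \<otimes>\<^sub>C y = pure_tensor ((\<lambda>_. y)(False := x))" "x \<otimes>\<^sub>C y = pure_tensor ((\<lambda>_. x)(True := y))"
  unfolding tens_def by (intro arg_cong[where f = pure_tensor], auto)+

lemma tens_add_left: "(x + x') \<otimes>\<^sub>C y = x \<otimes>\<^sub>C y + x' \<otimes>\<^sub>C y"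
  and tens_add_right: "x \<otimes>\<^sub>C (y + y') = x \<otimes>\<^sub>C y + x \<otimes>\<^sub>C y'"
  and tens_scaleC_left: "(c *\<^sub>C x) \<otimes>\<^sub>C y = c *\<^sub>C (x \<otimes>\<^sub>C y)"
  and tens_scaleC_right: "x \<otimes>\<^sub>C (c *\<^sub>C y) = c *\<^sub>C (x \<otimes>\<^sub>C y)"
proof -
  note m = multilin_pure_tensor[unfolded multilin_def, THEN conjunct1, rule_format]
    multilin_pure_tensor[unfolded multilin_def, THEN conjunct2, rule_format]
  show "(x + x') \<otimes>\<^sub>C y = x \<otimes>\<^sub>C y + x' \<otimes>\<^sub>C y" "(c *\<^sub>C x) \<otimes>\<^sub>C y = c *\<^sub>C (x \<otimes>\<^sub>C y)"
    unfolding tens_upd(1) by (rule m)+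
  show "x \<otimes>\<^sub>C (y + y') = x \<otimes>\<^sub>C y + x \<otimes>\<^sub>C y'" "x \<otimes>\<^sub>C (c *\<^sub>C y) = c *\<^sub>C (x \<otimes>\<^sub>C y)"
    unfolding tens_upd(2) by (rule m)+
qed

lemma clinear_tens_left: "clinear (\<lambda>x. x \<otimes>\<^sub>C y)"
  and clinear_tens_right: "clinear (\<lambda>y. x \<otimes>\<^sub>C y)"
  by (intro clinearI; simp add: tens_add_left tens_add_right tens_scaleC_left tens_scaleC_right)+

lemmas tens_uminus_left = clinear_uminus[OF clinear_tens_left]
  and tens_uminus_right = clinear_uminus[OF clinear_tens_right]

lemma tensor_square_linear_eqI:
  assumes "clinear f" "clinear g" "\<And>x y. f (x \<otimes>\<^sub>C y) = g (x \<otimes>\<^sub>C y)"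
  shows "f t = g t"
  by (rule tpow_linear_eqI[OF assms(1,2)]) (simp add: pure_tensor_bool assms(3))

lemma multilin_boolI:
  assumes "\<And>y. clinear (\<lambda>x. G x y)" "\<And>x. clinear (G x)"
  shows "multilin (\<lambda>a. G (a False) (a True))"
proof -
  have "G (a False) (a True) = (\<lambda>x. G x (a True)) (a False)" for a by simp
  show ?thesis
    unfolding multilin_def
  proof (intro conjI allI)
    fix a :: "bool \<Rightarrow> 'a" and j x y c
    show "G ((a(j := x + y)) False) ((a(j := x + y)) True) =
        G ((a(j := x)) False) ((a(j := x)) True) + G ((a(j := y)) False) ((a(j := y)) True)"
      by (cases j) (simp_all add: clinear_add[OF assms(1)] clinear_add[OF assms(2)])
    show "G ((a(j := c *\<^sub>C x)) False) ((a(j := c *\<^sub>C x)) True) =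
        c *\<^sub>C G ((a(j := x)) False) ((a(j := x)) True)"
      by (cases j) (simp_all add: clinear_scaleC[OF assms(1)] clinear_scaleC[OF assms(2)])
  qed
qed

lemma multilin_flip: "multilin (\<lambda>a. a True \<otimes>\<^sub>C a False)"
  using multilin_boolI[of "\<lambda>x y. y \<otimes>\<^sub>C x", OF clinear_tens_right clinear_tens_left] by simp

lemma clinear_tensor_flip: "clinear tensor_flip"
  unfolding tensor_flip_def by (rule clinear_tensor_lift[OF multilin_flip])

lemma tensor_flip_tens: "tensor_flip (x \<otimes>\<^sub>C y) = y \<otimes>\<^sub>C x"
  unfolding tensor_flip_def tens_def[of x y]
  by (subst tensor_lift_pure[OF multilin_flip]) simp

lemma tensor_flip_mult: "tensor_flip (s * t) = tensor_flip s * tensor_flip t"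
proof (rule tensor_square_linear_eqI[where f = "\<lambda>s. tensor_flip (s * t)"])
  fix x y
  show "tensor_flip ((x \<otimes>\<^sub>C y) * t) = tensor_flip (x \<otimes>\<^sub>C y) * tensor_flip t"
    by (rule tensor_square_linear_eqI[where f = "\<lambda>t. tensor_flip ((x \<otimes>\<^sub>C y) * t)"])
      (simp_all add: tens_mult tensor_flip_tens
        clinear_compose[OF clinear_mult_left clinear_tensor_flip]
        clinear_compose[OF clinear_tensor_flip clinear_mult_left])
qed (simp_all add: clinear_compose[OF clinear_mult_right clinear_tensor_flip]
        clinear_compose[OF clinear_tensor_flip clinear_mult_right])

section \<open>Fock representations\<close>

text \<open>\<open>Q_hom_exists\<close> needs a target type of class \<open>complex_alg\<close>;
  linear operators on functions form one.\<close>

typedef 'b endo = "{f :: ('b \<Rightarrow> complex) \<Rightarrow> 'b \<Rightarrow> complex.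
    (\<forall>u v. f (\<lambda>x. u x + v x) = (\<lambda>x. f u x + f v x)) \<and> (\<forall>c u. f (\<lambda>x. c * u x) = (\<lambda>x. c * f u x))}"
  morphisms app_endo Abs_endo
  by (rule exI[of _ "\<lambda>u. u"]) simp

setup_lifting type_definition_endo

instantiation endo :: (type) complex_alg
begin

lift_definition zero_endo :: "'a endo" is "\<lambda>_ _. 0" by simp
lift_definition one_endo :: "'a endo" is "\<lambda>u. u" by simp
lift_definition plus_endo :: "'a endo \<Rightarrow> 'a endo \<Rightarrow> 'a endo" is "\<lambda>f g u x. f u x + g u x"
  by (simp add: algebra_simps)
lift_definition uminus_endo :: "'a endo \<Rightarrow> 'a endo" is "\<lambda>f u x. - f u x" by simp
lift_definition minus_endo :: "'a endo \<Rightarrow> 'a endo \<Rightarrow> 'a endo" is "\<lambda>f g u x. f u x - g u x"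
  by (simp add: algebra_simps)
lift_definition times_endo :: "'a endo \<Rightarrow> 'a endo \<Rightarrow> 'a endo" is "\<lambda>f g u. f (g u)" by simp
lift_definition scaleC_endo :: "complex \<Rightarrow> 'a endo \<Rightarrow> 'a endo" is "\<lambda>c f u x. c * f u x"
  by (simp add: algebra_simps)

instance
  by standard (transfer; auto simp: fun_eq_iff algebra_simps)+

end

lemma endo_eqI: "(\<And>v d. app_endo f v d = app_endo g v d) \<Longrightarrow> f = g"
  by (metis app_endo_inject ext)

text \<open>The algebra acts on functions on \<open>'i \<Rightarrow> bool \<times> bool\<close>, where the two bits at \<open>j\<close> record which of
  \<open>qf Pl j\<close> and \<open>qf Mi j\<close> occur in a monomial: \<open>qf Pl j\<close> creates its bit, \<open>qf Mi j\<close> creates its own bit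
  and, with the coefficient \<open>(1 - \<zeta>\<^sup>2) / 2\<close>, annihilates that of \<open>qf Pl j\<close>, and \<open>qK\<close> is \<open>\<zeta>\<close> times the
  parity, for a fourth root of unity \<open>\<zeta>\<close>. The Jordan-Wigner sign \<open>jw\<close> makes operators at different
  sites anticommute.\<close>

definition sg :: "bool \<times> bool \<Rightarrow> complex" where
  "sg x = (if fst x = snd x then 1 else -1)"

definition jw :: "'i::{finite,linorder} \<Rightarrow> ('i \<Rightarrow> bool \<times> bool) \<Rightarrow> complex" where
  "jw j d = (\<Prod>i\<in>{..<j}. sg (d i))"

definition total_sg :: "('i::finite \<Rightarrow> bool \<times> bool) \<Rightarrow> complex" where
  "total_sg d = (\<Prod>i\<in>UNIV. sg (d i))"

lemma sg_sq: "sg x * sg x = 1"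
  by (simp add: sg_def)

lemma prod_sg_upd:
  "finite A \<Longrightarrow> (\<Prod>i\<in>A. sg ((d(j := x)) i)) =
     (if j \<in> A then sg x * sg (d j) * (\<Prod>i\<in>A. sg (d i)) else (\<Prod>i\<in>A. sg (d i)))"
proof (cases "j \<in> A")
  case True
  assume "finite A"
  have "(\<Prod>i\<in>A - {j}. sg ((d(j := x)) i)) = (\<Prod>i\<in>A - {j}. sg (d i))"
    by (intro prod.cong) auto
  with \<open>finite A\<close> True show ?thesis
    by (simp add: prod.remove[of A j] sg_sq mult.assoc mult.left_commute)
next
  case False
  then show ?thesis by (auto intro!: prod.cong)
qed

lemma jw_upd: "jw j (d(i := x)) = (if i < j then sg x * sg (d i) * jw j d else jw j d)"
  unfolding jw_def by (subst prod_sg_upd) auto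

lemma total_sg_upd: "total_sg (d(i := x)) = sg x * sg (d i) * total_sg d"
  unfolding total_sg_def by (subst prod_sg_upd) auto

lemma jw_sq: "jw j d * jw j d = 1"
  by (simp add: jw_def sg_sq flip: prod.distrib)

lemma total_sg_sq: "total_sg d * total_sg d = 1"
  by (simp add: total_sg_def sg_sq flip: prod.distrib)

text \<open>A local matrix at site \<open>j\<close>, dressed with the sign string of all smaller
  sites. Operators act on coefficient functions, hence the row index is the bit pair found in
  \<open>d\<close> and the column index is summed over.\<close>

lift_definition jw_op :: "'i::{finite,linorder} \<Rightarrow> (bool \<times> bool \<Rightarrow> bool \<times> bool \<Rightarrow> complex) \<Rightarrow>
    ('i \<Rightarrow> bool \<times> bool) endo"
  is "\<lambda>j A v d. jw j d * (\<Sum>x\<in>UNIV. A (d j) x * v (d(j := x)))"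
  by (auto simp: fun_eq_iff algebra_simps sum.distrib sum_distrib_left)

lift_definition parity_op :: "complex \<Rightarrow> ('i::finite \<Rightarrow> bool \<times> bool) endo"
  is "\<lambda>\<zeta> v d. \<zeta> * total_sg d * v d"
  by (auto simp: fun_eq_iff algebra_simps)

section \<open>Anticommutation of the dressed local operators\<close>

definition odd_mat :: "(bool \<times> bool \<Rightarrow> bool \<times> bool \<Rightarrow> complex) \<Rightarrow> bool" where
  "odd_mat A \<longleftrightarrow> (\<forall>y x. A y x \<noteq> 0 \<longrightarrow> sg x * sg y = -1)"

lemma odd_matD: "odd_mat A \<Longrightarrow> sg x * sg y * (A y x * c) = - (A y x * c)"
  unfolding odd_mat_def by (cases "A y x = 0") (simp, metis mult_minus1)

lemma jw_op_parity:
  assumes "odd_mat A"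
  shows "anticomm (jw_op j A) (parity_op \<zeta>) = 0"
proof (rule endo_eqI)
  fix v d
  have "A (d j) x * (\<zeta> * total_sg (d(j := x)) * c) = - (A (d j) x * (\<zeta> * total_sg d * c))" for x c
    unfolding total_sg_upd using odd_matD[OF assms, of x "d j" "\<zeta> * total_sg d * c"]
    by (simp only: mult_ac)
  then have "jw j d * (\<Sum>x\<in>UNIV. A (d j) x * (\<zeta> * total_sg (d(j := x)) * v (d(j := x)))) =
      jw j d * (\<Sum>x\<in>UNIV. - (A (d j) x * (\<zeta> * total_sg d * v (d(j := x)))))"
    by (simp only:)
  then show "app_endo (anticomm (jw_op j A) (parity_op \<zeta>)) v d = app_endo 0 v d"
    by (simp add: plus_endo.rep_eq times_endo.rep_eq zero_endo.rep_eq jw_op.rep_eq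
        parity_op.rep_eq sum_negf sum_distrib_left algebra_simps)
qed

text \<open>Only the string of the larger site passes over the smaller one. An odd matrix at the
  smaller site flips that string, and this is the sole difference between the two orders.\<close>

lemma jw_op_anticomm_neq:
  assumes "odd_mat A" "odd_mat B" "i \<noteq> j"
  shows "anticomm (jw_op i A) (jw_op j B) = 0"
proof -
  have *: "app_endo (jw_op i A * jw_op j B) v d = (if i < j then -1 else 1) *
      (jw i d * jw j d * (\<Sum>x\<in>UNIV. \<Sum>y\<in>UNIV. A (d i) x * B (d j) y * v (d(i := x, j := y))))"
    if "odd_mat A" "i \<noteq> j" for i j :: 'a and A B v d
  proof -
    have "A (d i) x * (jw j (d(i := x)) * c) = (if i < j then -1 else 1) * (A (d i) x * (jw j d * c))"
      for x c
      unfolding jw_upd using odd_matD[OF that(1), of x "d i" "jw j d * c"]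
      by (cases "i < j") (simp_all only: if_True if_False mult_minus1 mult_minus_right mult_1 mult_ac)
    then have "jw i d * (\<Sum>x\<in>UNIV. A (d i) x * (jw j (d(i := x)) *
        (\<Sum>y\<in>UNIV. B (d j) y * v (d(i := x, j := y))))) =
      jw i d * (\<Sum>x\<in>UNIV. (if i < j then -1 else 1) * (A (d i) x * (jw j d *
        (\<Sum>y\<in>UNIV. B (d j) y * v (d(i := x, j := y))))))"
      by (simp only:)
    then show ?thesis
      using that(2)
      by (simp add: times_endo.rep_eq jw_op.rep_eq sum_distrib_left algebra_simps)
  qed
  show ?thesis
  proof (rule endo_eqI)
    fix v d
    have "(\<Sum>x\<in>UNIV. \<Sum>y\<in>UNIV. A (d i) x * B (d j) y * v (d(i := x, j := y))) =
        (\<Sum>y\<in>UNIV. \<Sum>x\<in>UNIV. B (d j) y * A (d i) x * v (d(j := y, i := x)))"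
      using assms(3) by (subst sum.swap) (simp add: fun_upd_twist mult.commute)
    then show "app_endo (anticomm (jw_op i A) (jw_op j B)) v d = app_endo 0 v d"
      using assms *[of A i j B v d] *[of B j i A v d]
      by (auto simp: plus_endo.rep_eq zero_endo.rep_eq mult.commute not_less)
  qed
qed

lemma app_jw_op_same:
  "app_endo (jw_op i A * jw_op i B) v d =
     (\<Sum>y\<in>UNIV. (\<Sum>x\<in>UNIV. A (d i) x * B x y) * v (d(i := y)))"
proof -
  have "app_endo (jw_op i A * jw_op i B) v d =
      (jw i d * jw i d) * (\<Sum>x\<in>UNIV. \<Sum>y\<in>UNIV. A (d i) x * B x y * v (d(i := y)))"
    by (simp add: times_endo.rep_eq jw_op.rep_eq jw_upd sum_distrib_left algebra_simps)
  also have "\<dots> = (\<Sum>y\<in>UNIV. (\<Sum>x\<in>UNIV. A (d i) x * B x y) * v (d(i := y)))"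
    unfolding jw_sq by (subst sum.swap) (simp add: sum_distrib_right)
  finally show ?thesis .
qed

text \<open>At a single site the two strings cancel, so the anticommutator is that of the local
  matrices.\<close>

lemma jw_op_anticomm_same:
  assumes "\<And>x z. (\<Sum>y\<in>UNIV. A x y * B y z) + (\<Sum>y\<in>UNIV. B x y * A y z) =
    (if x = z then c else 0)"
  shows "anticomm (jw_op i A) (jw_op i B) = c *\<^sub>C 1"
proof (rule endo_eqI)
  fix v d
  have "(\<Sum>y\<in>UNIV. (\<Sum>x\<in>UNIV. A (d i) x * B x y) * v (d(i := y))) +
      (\<Sum>y\<in>UNIV. (\<Sum>x\<in>UNIV. B (d i) x * A x y) * v (d(i := y))) =
      (\<Sum>y\<in>UNIV. ((\<Sum>x\<in>UNIV. A (d i) x * B x y) + (\<Sum>x\<in>UNIV. B (d i) x * A x y)) * v (d(i := y)))"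
    by (simp only: sum.distrib distrib_right)
  also have "\<dots> = (\<Sum>y\<in>UNIV. if y = d i then c * v d else 0)"
    unfolding assms by (intro sum.cong) auto
  also have "\<dots> = c * v d" by (subst sum.delta) simp_all
  finally show "app_endo (anticomm (jw_op i A) (jw_op i B)) v d = app_endo (c *\<^sub>C 1) v d"
    by (simp add: plus_endo.rep_eq app_jw_op_same scaleC_endo.rep_eq one_endo.rep_eq)
qed

definition mat_Pl :: "bool \<times> bool \<Rightarrow> bool \<times> bool \<Rightarrow> complex" where
  "mat_Pl y x = of_bool (fst y \<and> \<not> fst x \<and> snd y = snd x)"

text \<open>The sign in the first summand is that of moving f^- past an occupied f^+ at the same
  site; the second summand is the contraction in f^- f^+ = e_1 - f^+ f^-.\<close>

definition mat_Mi :: "complex \<Rightarrow> bool \<times> bool \<Rightarrow> bool \<times> bool \<Rightarrow> complex" where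
  "mat_Mi c y x = of_bool (snd y \<and> \<not> snd x \<and> fst y = fst x) * (if fst y then -1 else 1) +
     c * of_bool (\<not> fst y \<and> fst x \<and> snd y = snd x)"

lemma sum_UNIV_bool_pair:
  "(\<Sum>x\<in>UNIV. g x) = g (False, False) + g (True, False) + g (False, True) + g (True, True)"
  for g :: "bool \<times> bool \<Rightarrow> 'a::comm_monoid_add"
proof -
  have "(\<Sum>x\<in>UNIV. g x) = (\<Sum>x\<in>{(False, False), (True, False), (False, True), (True, True)}. g x)"
    by (rule sum.cong) auto
  then show ?thesis by (simp add: add.assoc)
qed

lemma odd_mat_Pl: "odd_mat mat_Pl" and odd_mat_Mi: "odd_mat (mat_Mi c)"
  by (auto simp: odd_mat_def mat_Pl_def mat_Mi_def sg_def split: if_splits)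

lemma mat_anticomm:
  "(\<Sum>y\<in>UNIV. mat_Pl x y * mat_Mi c y z) + (\<Sum>y\<in>UNIV. mat_Mi c x y * mat_Pl y z) =
    (if x = z then c else 0)"
  "(\<Sum>y\<in>UNIV. mat_Pl x y * mat_Pl y z) + (\<Sum>y\<in>UNIV. mat_Pl x y * mat_Pl y z) =
    (if x = z then 0 else 0)"
  "(\<Sum>y\<in>UNIV. mat_Mi c x y * mat_Mi c y z) + (\<Sum>y\<in>UNIV. mat_Mi c x y * mat_Mi c y z) =
    (if x = z then 0 else 0)"
  by (cases x; cases z; auto simp: sum_UNIV_bool_pair mat_Pl_def mat_Mi_def)+

lemma parity_op_sq: "parity_op \<zeta> ^ 2 = (\<zeta> ^ 2) *\<^sub>C 1"
proof (rule endo_eqI)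
  fix v d
  have "\<zeta> * total_sg d * (\<zeta> * total_sg d * v d) = \<zeta>\<^sup>2 * ((total_sg d * total_sg d) * v d)"
    by (simp add: power2_eq_square)
  then show "app_endo (parity_op \<zeta> ^ 2) v d = app_endo ((\<zeta> ^ 2) *\<^sub>C 1) v d"
    by (simp add: total_sg_sq power2_eq_square times_endo.rep_eq parity_op.rep_eq
        scaleC_endo.rep_eq one_endo.rep_eq)
qed

definition is_fock_hom :: "complex \<Rightarrow> ('i::{finite,linorder} Q \<Rightarrow> ('i \<Rightarrow> bool \<times> bool) endo) \<Rightarrow> bool"
  where "is_fock_hom \<zeta> h \<longleftrightarrow> clinear h \<and> h 1 = 1 \<and> (\<forall>x y. h (x * y) = h x * h y) \<and>
    h qK = parity_op \<zeta> \<and> (\<forall>i. h (qf Pl i) = jw_op i mat_Pl) \<and>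
    (\<forall>i. h (qf Mi i) = jw_op i (mat_Mi ((1 - \<zeta>\<^sup>2) / 2)))"

definition fock_hom :: "complex \<Rightarrow> 'i::{finite,linorder} Q \<Rightarrow> ('i \<Rightarrow> bool \<times> bool) endo" where
  "fock_hom \<zeta> = (SOME h. is_fock_hom \<zeta> h)"

text \<open>The square of \<open>parity_op \<zeta>\<close> is the scalar \<zeta>^2, so
  \<open>qe 1\<close> acts as (1 - \<zeta>^2)/2. This is why that number is the contraction constant
  in \<open>mat_Mi\<close>.\<close>

lemma is_fock_hom_fock_hom:
  assumes "\<zeta> ^ 4 = 1"
  shows "is_fock_hom \<zeta> (fock_hom \<zeta> :: 'i::{finite,linorder} Q \<Rightarrow> _)"
proof -
  let ?A = "\<lambda>s. case s of Pl \<Rightarrow> mat_Pl | Mi \<Rightarrow> mat_Mi ((1 - \<zeta>\<^sup>2) / 2)"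
  define g :: "'i gen \<Rightarrow> ('i \<Rightarrow> bool \<times> bool) endo" where
    "g x = (case x of Kgen \<Rightarrow> parity_op \<zeta> | Fgen s i \<Rightarrow> jw_op i (?A s))" for x
  have odd: "odd_mat (?A s)" for s by (cases s) (simp_all add: odd_mat_Pl odd_mat_Mi)
  have r1: "anticomm (g (Fgen s i)) (g Kgen) = 0" for s i
    by (simp add: g_def jw_op_parity odd)
  have r2: "anticomm (g (Fgen Pl i)) (g (Fgen Mi j)) =
      (if i = j then (1/2) *\<^sub>C (1 - g Kgen ^ 2) else 0)" for i j
  proof -
    have "(1/2) *\<^sub>C (1 - g Kgen ^ 2) = ((1 - \<zeta>\<^sup>2) / 2) *\<^sub>C 1"
      by (simp add: g_def parity_op_sq cvec.scale_right_diff_distrib scaleC_scaleC diff_divide_distrib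
          cvec.scale_left_diff_distrib)
    then show ?thesis
      by (auto simp: g_def jw_op_anticomm_neq odd_mat_Pl odd_mat_Mi
          intro!: jw_op_anticomm_same mat_anticomm)
  qed
  have r3: "anticomm (g (Fgen s i)) (g (Fgen s j)) = 0" for s i j
    proof (cases "i = j")
      case True
      have "anticomm (jw_op j (?A s)) (jw_op j (?A s)) = 0 *\<^sub>C 1"
        by (cases s; simp only: free_sign.case; intro jw_op_anticomm_same mat_anticomm)
      then show ?thesis by (simp add: g_def True)
    qed (simp add: g_def jw_op_anticomm_neq odd)
  have r4: "g Kgen ^ 4 = 1"
  proof -
    have "g Kgen ^ 4 = (g Kgen ^ 2) ^ 2" by (simp flip: power_mult)
    also have "g Kgen ^ 2 = (\<zeta> ^ 2) *\<^sub>C 1" by (simp add: g_def parity_op_sq)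
    also have "((\<zeta> ^ 2) *\<^sub>C 1 :: ('i \<Rightarrow> bool \<times> bool) endo) ^ 2 = (\<zeta> ^ 4) *\<^sub>C 1"
      by (simp add: power2_eq_square mult_scaleC_left mult_scaleC_right
          scaleC_scaleC power4_eq_xxxx mult.assoc)
    finally show ?thesis using assms by simp
  qed
  obtain h :: "'i Q \<Rightarrow> _" where h: "clinear h" "h 1 = 1" "\<And>x y. h (x * y) = h x * h y"
    "h qK = g Kgen" "\<And>s i. h (qf s i) = g (Fgen s i)"
    using r1 r2 r3 r4 by (rule Q_hom_exists[of g]) blast
  then have "is_fock_hom \<zeta> h" by (simp add: is_fock_hom_def g_def)
  then show ?thesis unfolding fock_hom_def by (rule someI[of "is_fock_hom \<zeta>"])
qed

lemma
  fixes x y :: "'i::{finite,linorder} Q"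
  assumes "\<zeta> ^ 4 = 1"
  shows clinear_fock_hom: "clinear (fock_hom \<zeta> :: 'i Q \<Rightarrow> _)"
    and fock_hom_one: "fock_hom \<zeta> (1 :: 'i Q) = 1"
    and fock_hom_mult: "fock_hom \<zeta> (x * y) = fock_hom \<zeta> x * fock_hom \<zeta> y"
    and fock_hom_qK: "fock_hom \<zeta> (qK :: 'i Q) = parity_op \<zeta>"
    and fock_hom_Pl: "fock_hom \<zeta> (qf Pl (i :: 'i)) = jw_op i mat_Pl"
    and fock_hom_Mi: "fock_hom \<zeta> (qf Mi (i :: 'i)) = jw_op i (mat_Mi ((1 - \<zeta>\<^sup>2) / 2))"
  using is_fock_hom_fock_hom[OF assms, where 'i = 'i] by (simp_all add: is_fock_hom_def)

lemmas fock_hom_simps = fock_hom_one fock_hom_mult fock_hom_qK fock_hom_Pl fock_hom_Mi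

section \<open>Monomials acting on the empty state\<close>

definition loc :: "'i \<Rightarrow> bool \<times> bool \<Rightarrow> 'i Q" where
  "loc j x = qf Pl j ^ of_bool (fst x) * qf Mi j ^ of_bool (snd x)"

lemma loc_simps:
  "loc j (False, False) = 1" "loc j (True, False) = qf Pl j" "loc j (False, True) = qf Mi j"
  "loc j (True, True) = qf Pl j * qf Mi j"
  by (simp_all add: loc_def)

definition mon :: "('i::{finite,linorder} \<Rightarrow> bool \<times> bool) \<Rightarrow> nat \<Rightarrow> 'i Q" where
  "mon d k = ordered_prod (\<lambda>j. loc j (d j)) * qK ^ k"

definition ket :: "'b \<Rightarrow> 'b \<Rightarrow> complex" where
  "ket D d = of_bool (d = D)"

lemma app_jw_op_ket:
  "app_endo (jw_op j A) (ket D) = (\<lambda>d. jw j D * A (d j) (D j) * of_bool (d = D(j := d j)))"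
proof
  fix d
  have "(\<Sum>x\<in>UNIV. A (d j) x * ket D (d(j := x))) =
      (\<Sum>x\<in>UNIV. if x = D j then A (d j) (D j) * of_bool (d = D(j := d j)) else 0)"
  proof (rule sum.cong)
    fix x
    have "d(j := x) = D \<longleftrightarrow> x = D j \<and> d = D(j := d j)" by (auto simp: fun_eq_iff)
    then show "A (d j) x * ket D (d(j := x)) =
        (if x = D j then A (d j) (D j) * of_bool (d = D(j := d j)) else 0)"
      by (auto simp: ket_def)
  qed simp
  also have "\<dots> = A (d j) (D j) * of_bool (d = D(j := d j))" by (subst sum.delta) simp_all
  finally have s: "(\<Sum>x\<in>UNIV. A (d j) x * ket D (d(j := x))) =
    A (d j) (D j) * of_bool (d = D(j := d j))" .
  have "jw j d = jw j D" if "d = D(j := d j)"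
    by (subst that, subst jw_upd) simp
  then show "app_endo (jw_op j A) (ket D) d = jw j D * A (d j) (D j) * of_bool (d = D(j := d j))"
    unfolding jw_op.rep_eq s by auto
qed

lemma app_fock_loc:
  assumes "\<zeta> ^ 4 = 1" "D j = (False, False)" "jw j D = 1"
  shows "app_endo (fock_hom \<zeta> (loc j x)) (ket D) = ket (D(j := x))"
proof -
  have Mi: "app_endo (jw_op j (mat_Mi c)) (ket D) = ket (D(j := (False, True)))" for c
    unfolding app_jw_op_ket using assms(2,3)
    by (auto simp: fun_eq_iff ket_def mat_Mi_def prod_eq_iff)
  have Pl: "app_endo (jw_op j mat_Pl) (ket (D(j := (False, b)))) = ket (D(j := (True, b)))" for b
    unfolding app_jw_op_ket using assms(3)
    by (auto simp: fun_eq_iff ket_def mat_Pl_def prod_eq_iff jw_upd)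
  have D: "D(j := (False, False)) = D" using assms(2) by auto
  obtain a b where "x = (a, b)" by (cases x)
  then show ?thesis
    using Mi Pl[of False] Pl[of True] D
    by (cases a; cases b)
      (simp_all add: loc_simps one_endo.rep_eq times_endo.rep_eq fock_hom_simps[OF assms(1)])
qed

text \<open>The rightmost factor acts first, so the sites are filled from the largest down. Whenever
  a site is filled all smaller ones are still empty, and no string produces a sign.\<close>

lemma app_fock_prod:
  assumes "\<zeta> ^ 4 = 1"
  shows "sorted xs \<Longrightarrow> distinct xs \<Longrightarrow>
    app_endo (fock_hom \<zeta> (prod_list (map (\<lambda>j. loc j (d j)) xs))) (ket (\<lambda>_. (False, False))) =
      ket (\<lambda>j. if j \<in> set xs then d j else (False, False))"
proof (induction xs)
  case Nil
  show ?case by (simp add: fock_hom_simps[OF assms] one_endo.rep_eq)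
next
  case (Cons j xs)
  let ?D = "\<lambda>i. if i \<in> set xs then d i else (False, False)"
  have "jw j ?D = 1"
    unfolding jw_def using Cons.prems by (intro prod.neutral) (auto simp: sg_def)
  moreover have "?D j = (False, False)" using Cons.prems by auto
  moreover have "?D(j := d j) = (\<lambda>i. if i \<in> set (j # xs) then d i else (False, False))" by auto
  ultimately show ?case
    using Cons app_fock_loc[OF assms, of ?D j "d j"]
    by (simp add: fock_hom_simps[OF assms] times_endo.rep_eq)
qed

lemma app_fock_mon:
  assumes "\<zeta> ^ 4 = 1"
  shows "app_endo (fock_hom \<zeta> (mon d k)) (ket (\<lambda>_. (False, False))) D = \<zeta> ^ k * ket d D"
proof -
  let ?v = "ket (\<lambda>_::'a. (False, False))"
  note h = fock_hom_simps[OF assms]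
  have K: "app_endo (parity_op \<zeta>) ?v = (\<lambda>d. \<zeta> * ?v d)"
    by (auto simp: fun_eq_iff parity_op.rep_eq ket_def total_sg_def sg_def)
  have scl: "app_endo f (\<lambda>d. c * u d) = (\<lambda>d. c * app_endo f u d)" for f :: "('a \<Rightarrow> bool \<times> bool) endo" and c u
    using app_endo[of f] by simp
  have Kp: "app_endo (fock_hom \<zeta> (qK ^ k)) ?v = (\<lambda>d. \<zeta> ^ k * ?v d)"
    by (induction k)
      (simp_all add: h one_endo.rep_eq times_endo.rep_eq K scl mult.assoc mult.left_commute)
  have "app_endo (fock_hom \<zeta> (ordered_prod (\<lambda>j. loc j (d j)))) ?v = ket d"
    unfolding ordered_prod_def by (subst app_fock_prod[OF assms]) simp_all
  then show ?thesis by (simp add: h mon_def times_endo.rep_eq Kp scl)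
qed

text \<open>The average over the fourth roots of unity separates the powers of \<open>qK\<close>.\<close>

definition coord :: "('i::{finite,linorder} \<Rightarrow> bool \<times> bool) \<Rightarrow> nat \<Rightarrow> 'i Q \<Rightarrow> complex" where
  "coord d k x = (1/4) * (\<Sum>\<zeta>\<in>{1, \<i>, -1, -\<i>}. inverse (\<zeta> ^ k) *
     app_endo (fock_hom \<zeta> x) (ket (\<lambda>_. (False, False))) d)"

lemma fourth_roots: "\<zeta> \<in> {1, \<i>, -1, -\<i>} \<Longrightarrow> \<zeta> ^ 4 = 1"
  by (auto simp: power4_eq_xxxx)

lemma coord_add: "coord d k (x + y) = coord d k x + coord d k y"
  and coord_scaleC: "coord d k (c *\<^sub>C x) = c * coord d k x"
proof -
  note h = clinear_fock_hom[OF fourth_roots]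
  show "coord d k (x + y) = coord d k x + coord d k y"
    unfolding coord_def distrib_left[symmetric] sum.distrib[symmetric]
    by (intro arg_cong[where f = "(*) (1/4)"] sum.cong refl)
      (simp only: clinear_add[OF h] plus_endo.rep_eq distrib_left)
  show "coord d k (c *\<^sub>C x) = c * coord d k x"
    unfolding coord_def mult.left_commute[of c] sum_distrib_left
    by (intro sum.cong refl)
      (simp only: clinear_scaleC[OF h] scaleC_endo.rep_eq mult.left_commute[of c])
qed

text \<open>On the empty state the monomial contributes \<zeta>^k', and the mean of \<zeta>^(k'-k)
  over the four roots vanishes unless k = k', both exponents being below 4.\<close>

lemma coord_mon:
  assumes "k < 4" "k' < 4"
  shows "coord d k (mon d' k') = of_bool (d = d' \<and> k = k')"
proof -
  have "coord d k (mon d' k') =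
      (1/4) * (\<Sum>\<zeta>\<in>{1, \<i>, -1, -\<i>}. inverse (\<zeta> ^ k) * \<zeta> ^ k') * of_bool (d = d')"
    unfolding coord_def using fourth_roots
    by (simp add: app_fock_mon sum_distrib_right ket_def algebra_simps)
  moreover have "(\<Sum>\<zeta>\<in>{1, \<i>, -1, -\<i>}. inverse (\<zeta> ^ k) * \<zeta> ^ k') = (if k = k' then 4 else 0)"
  proof -
    have "1 \<noteq> \<i>" "(1::complex) \<noteq> -1" "1 \<noteq> -\<i>" "\<i> \<noteq> -1" "\<i> \<noteq> -\<i>" "-1 \<noteq> -\<i>"
      by (simp_all add: complex_eq_iff)
    then have "(\<Sum>\<zeta>\<in>{1, \<i>, -1, -\<i>}. inverse (\<zeta> ^ k) * \<zeta> ^ k') =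
      1 + inverse (\<i> ^ k) * \<i> ^ k' + inverse ((-1) ^ k) * (-1) ^ k' + inverse ((-\<i>) ^ k) * (-\<i>) ^ k'"
      by (simp add: add.assoc)
    moreover have "k \<in> {0, 1, 2, 3}" "k' \<in> {0, 1, 2, 3}" using assms by auto
    ultimately show ?thesis by (auto simp: power3_eq_cube)
  qed
  ultimately show ?thesis by (cases "k = k'"; cases "d = d'") simp_all
qed

section \<open>Ordered products\<close>

lemma set_sorted_UNIV: "set (sorted_list_of_set (UNIV :: 'i::{finite,linorder} set)) = UNIV"
  and distinct_sorted_UNIV: "distinct (sorted_list_of_set (UNIV :: 'i set))"
  by simp_all

lemma prod_list_commute:
  assumes "\<And>j. j \<in> set xs \<Longrightarrow> x * g j = g j * x"
  shows "x * prod_list (map g xs) = prod_list (map g xs) * (x :: 'a::monoid_mult)"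
  using assms
proof (induction xs)
  case (Cons j xs)
  have "x * (g j * prod_list (map g xs)) = g j * (x * prod_list (map g xs))"
    using Cons.prems[of j] by (simp flip: mult.assoc)
  then show ?case using Cons by (simp add: mult.assoc)
qed simp

lemma prod_list_mult_distrib:
  assumes "distinct xs"
    "\<And>i j. i \<in> set xs \<Longrightarrow> j \<in> set xs \<Longrightarrow> i \<noteq> j \<Longrightarrow> b i * a j = a j * (b i :: 'a::monoid_mult)"
  shows "prod_list (map a xs) * prod_list (map b xs) = prod_list (map (\<lambda>j. a j * b j) xs)"
  using assms
proof (induction xs)
  case (Cons j xs)
  have "b j * prod_list (map a xs) = prod_list (map a xs) * b j"
    using Cons.prems by (intro prod_list_commute) auto
  then have "a j * prod_list (map a xs) * (b j * prod_list (map b xs)) =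
      a j * b j * (prod_list (map a xs) * prod_list (map b xs))"
    by (metis mult.assoc)
  then show ?case using Cons by (simp add: mult.assoc)
qed simp

lemma ordered_prod_mult_distrib:
  assumes "\<And>i j. i \<noteq> j \<Longrightarrow> b i * a j = a j * (b i :: 'a::monoid_mult)"
  shows "ordered_prod a * ordered_prod b = ordered_prod (\<lambda>j. a j * b j)"
  unfolding ordered_prod_def using assms by (intro prod_list_mult_distrib) auto

lemma ordered_prod_commute:
  assumes "\<And>j. x * g j = g j * x"
  shows "x * ordered_prod g = ordered_prod g * (x :: 'a::monoid_mult)"
  unfolding ordered_prod_def using assms by (intro prod_list_commute)

lemma prod_list_intertwine:
  assumes "\<And>j. a j * t = t * (b j :: 'a::monoid_mult)"
  shows "prod_list (map a xs) * t = t * prod_list (map b xs)"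
proof (induction xs)
  case (Cons j xs)
  then have "a j * prod_list (map a xs) * t = a j * t * prod_list (map b xs)"
    by (simp add: mult.assoc)
  then show ?case by (simp add: assms mult.assoc)
qed simp

lemma ordered_prod_intertwine:
  assumes "\<And>j. a j * t = t * (b j :: 'a::monoid_mult)"
  shows "ordered_prod a * t = t * ordered_prod b"
  unfolding ordered_prod_def by (rule prod_list_intertwine[OF assms])

text \<open>A central \<open>e\<close> can be carried to each factor in turn. Identities that hold
  only in one block may therefore be applied inside an ordered product.\<close>

lemma prod_list_cong_idem:
  fixes e :: "'a::monoid_mult"
  assumes "\<And>x. e * x = x * e" "\<And>j. j \<in> set xs \<Longrightarrow> a j * e = b j * e"
  shows "prod_list (map a xs) * e = prod_list (map b xs) * e"
  using assms(2)
proof (induction xs)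
  case (Cons j xs)
  have "a j * prod_list (map a xs) * e = a j * (prod_list (map b xs) * e)"
    using Cons by (simp add: mult.assoc)
  also have "\<dots> = (a j * e) * prod_list (map b xs)"
    using assms(1)[of "prod_list (map b xs)"] by (simp add: mult.assoc)
  also have "\<dots> = b j * prod_list (map b xs) * e"
    using assms(1)[of "prod_list (map b xs)"] Cons.prems[of j] by (simp add: mult.assoc)
  finally show ?case by simp
qed simp

lemma ordered_prod_cong_idem:
  fixes e :: "'a::monoid_mult"
  assumes "\<And>x. e * x = x * e" "\<And>j. a j * e = b j * e"
  shows "ordered_prod a * e = ordered_prod b * e"
  unfolding ordered_prod_def using assms by (intro prod_list_cong_idem) auto

lemma prod_list_mult_idem:
  fixes e :: "'a::monoid_mult"
  assumes "\<And>x. e * x = x * e" "e * e = e"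
  shows "prod_list (map (\<lambda>j. a j * e) xs) * e = prod_list (map a xs) * e"
  by (rule prod_list_cong_idem[OF assms(1)]) (simp add: assms(2) mult.assoc)

lemma ordered_prod_mult_idem:
  fixes e :: "'a::monoid_mult" and a :: "'i::{finite,linorder} \<Rightarrow> 'a"
  assumes "\<And>x. e * x = x * e" "e * e = e"
  shows "ordered_prod (\<lambda>j. a j * e) = ordered_prod a * e"
proof -
  \<comment> \<open>At least one factor carries \<open>e\<close> and can absorb the trailing one;
    for an empty product the claim would read 1 = e.\<close>
  have "sorted_list_of_set (UNIV :: 'i set) \<noteq> []" by simp
  then obtain j xs where xs: "sorted_list_of_set (UNIV :: 'i set) = j # xs"
    by (cases "sorted_list_of_set (UNIV :: 'i set)") auto
  have "a j * e * prod_list (map (\<lambda>j. a j * e) xs) = a j * (prod_list (map (\<lambda>j. a j * e) xs) * e)"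
    by (simp add: assms(1) mult.assoc)
  also have "\<dots> = a j * prod_list (map a xs) * e"
    by (simp add: prod_list_mult_idem[OF assms] mult.assoc)
  finally show ?thesis by (simp add: ordered_prod_def xs)
qed

lemma ordered_prod_scaleC:
  fixes a :: "'i::{finite,linorder} \<Rightarrow> 'a::complex_alg"
  shows "ordered_prod (\<lambda>j. c j *\<^sub>C a j) = (\<Prod>j\<in>UNIV. c j) *\<^sub>C ordered_prod a"
proof -
  have "distinct xs \<Longrightarrow> prod_list (map (\<lambda>j. c j *\<^sub>C a j) xs) =
      (\<Prod>j\<in>set xs. c j) *\<^sub>C prod_list (map a xs)" for xs
    by (induction xs) (simp_all add: mult_scaleC_left mult_scaleC_right scaleC_scaleC)
  from this[OF distinct_sorted_UNIV] show ?thesis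
    by (simp add: ordered_prod_def)
qed

lemma ordered_prod_one: "ordered_prod (\<lambda>_::'b::{finite,linorder}. 1 :: 'a::monoid_mult) = 1"
proof -
  have "prod_list (map (\<lambda>_. 1) xs) = (1 :: 'a)" for xs :: "'b list"
    by (induction xs) simp_all
  then show ?thesis by (simp only: ordered_prod_def)
qed

lemma sum_fun_upd_UNIV:
  assumes "finite A" "j \<notin> A"
  shows "(\<Sum>f\<in>PiE (insert j A) (\<lambda>_. UNIV). G f) =
    (\<Sum>c\<in>(UNIV::'c::finite set). \<Sum>f\<in>PiE A (\<lambda>_. UNIV). G (f(j := c)))"
proof -
  have "(\<Sum>f\<in>PiE (insert j A) (\<lambda>_. UNIV). G f) =
      (\<Sum>(c, f)\<in>UNIV \<times> PiE A (\<lambda>_. UNIV). G (f(j := c)))"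
    unfolding PiE_insert_eq
    using sum.reindex[OF inj_combinator[OF assms(2), of "\<lambda>_. UNIV :: 'c set"], of G]
    by (simp add: comp_def case_prod_unfold)
  then show ?thesis by (simp add: sum.cartesian_product)
qed

lemma ordered_prod_sum:
  fixes g :: "'i::{finite,linorder} \<Rightarrow> 'c::finite \<Rightarrow> 'a::complex_alg"
  shows "ordered_prod (\<lambda>j. \<Sum>c\<in>UNIV. g j c) = (\<Sum>f\<in>UNIV. ordered_prod (\<lambda>j. g j (f j)))"
proof -
  have "distinct xs \<Longrightarrow> prod_list (map (\<lambda>j. \<Sum>c\<in>UNIV. g j c) xs) =
      (\<Sum>f\<in>PiE (set xs) (\<lambda>_. UNIV). prod_list (map (\<lambda>j. g j (f j)) xs))" for xs
  proof (induction xs)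
    case (Cons j xs)
    have "prod_list (map (\<lambda>j. \<Sum>c\<in>UNIV. g j c) (j # xs)) =
        (\<Sum>c\<in>UNIV. \<Sum>f\<in>PiE (set xs) (\<lambda>_. UNIV). g j c * prod_list (map (\<lambda>j. g j (f j)) xs))"
      using Cons by (simp add: sum_distrib_left sum_distrib_right sum.swap[of _ UNIV])
    also have "\<dots> = (\<Sum>c\<in>UNIV. \<Sum>f\<in>PiE (set xs) (\<lambda>_. UNIV).
        prod_list (map (\<lambda>i. g i ((f(j := c)) i)) (j # xs)))"
      using Cons.prems by (intro sum.cong refl) (auto intro!: arg_cong[where f = "\<lambda>ys. _ * prod_list ys"])
    also have "\<dots> = (\<Sum>f\<in>PiE (set (j # xs)) (\<lambda>_. UNIV). prod_list (map (\<lambda>j. g j (f j)) (j # xs)))"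
      using Cons.prems by (subst list.set(2), subst sum_fun_upd_UNIV) auto
    finally show ?case .
  qed simp
  from this[OF distinct_sorted_UNIV] show ?thesis
    by (simp add: ordered_prod_def PiE_UNIV_domain)
qed

lemma multilin_ordered_prod:
  "multilin (ordered_prod :: ('i::{finite,linorder} \<Rightarrow> 'a::complex_alg) \<Rightarrow> 'a)"
proof -
  have "\<exists>l r. \<forall>x. ordered_prod (a(j := x)) = l * x * r" for a :: "'i \<Rightarrow> 'a" and j
  proof -
    have "j \<in> set (sorted_list_of_set UNIV)" by simp
    then obtain ys zs where s: "sorted_list_of_set (UNIV :: 'i set) = ys @ j # zs"
      by (meson split_list)
    with distinct_sorted_UNIV[where 'i = 'i] have "j \<notin> set ys" "j \<notin> set zs" by auto
    then have m: "map (a(j := x)) ys = map a ys" "map (a(j := x)) zs = map a zs" for x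
      by auto
    have "ordered_prod (a(j := x)) = prod_list (map a ys) * x * prod_list (map a zs)" for x
      by (simp add: ordered_prod_def s m mult.assoc del: map_fun_upd)
    then show ?thesis by blast
  qed
  note lr = this
  show ?thesis
    unfolding multilin_def
  proof (intro conjI allI)
    fix a :: "'i \<Rightarrow> 'a" and j x y c
    obtain l r where "\<And>x. ordered_prod (a(j := x)) = l * x * r" using lr by metis
    then show "ordered_prod (a(j := x + y)) = ordered_prod (a(j := x)) + ordered_prod (a(j := y))"
      "ordered_prod (a(j := c *\<^sub>C x)) = c *\<^sub>C ordered_prod (a(j := x))"
      by (simp_all add: distrib_left distrib_right mult_scaleC_left mult_scaleC_right)
  qed
qed

section \<open>The central idempotents\<close>

lemma qK_qf: "qK * qf s i = - (qf s i * qK)"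
  by (simp only: qf_qK minus_minus)

lemma qK_qf_left: "qK * (qf s i * x) = - (qf s i * (qK * x))"
  by (simp only: mult.assoc[symmetric] qK_qf mult_minus_left)

lemma qK_sq_qgen: "qK ^ 2 * qgen g = qgen g * qK ^ 2"
  by (cases g) (simp_all add: power2_eq_square mult.assoc qK_qf qK_qf_left)

lemma central_if_commutes_qgen:
  assumes "\<And>g. z * qgen g = qgen g * z"
  shows "z * x = x * (z :: 'i Q)"
proof (rule clinear_eq_on_span[OF clinear_mult_left clinear_mult_right])
  show "x \<in> cvec.span (range (\<lambda>w. prod_list (map qgen w)))" by (simp add: Q_eq_span_words)
  show "z * b = b * z" if "b \<in> range (\<lambda>w. prod_list (map qgen w))" for b
    using that assms by (auto intro: prod_list_commute)
qed

lemma qK_sq_central: "qK ^ 2 * x = x * qK ^ 2"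
  by (rule central_if_commutes_qgen[OF qK_sq_qgen])

lemma qe_central: "qe n * x = x * qe n"
  by (simp add: qe_def distrib_left distrib_right mult_scaleC_left mult_scaleC_right qK_sq_central)

lemma qK_pow4_simps: "(qK :: 'i Q) ^ 2 * qK ^ 2 = 1" "qK * (qK * (qK * qK)) = (1 :: 'i Q)"
  using qK_pow_4[where 'i = 'i] by (simp_all add: power4_eq_xxxx power2_eq_square mult.assoc)

lemma scaleC_half_double: "(1/2) *\<^sub>C (x + x) = x"
  by (simp add: scaleC_add_right flip: scaleC_add_left)

lemma qe_sum: "qe 0 + qe (Suc 0) = 1"
  by (simp add: qe_def scaleC_half_double flip: scaleC_add_right)

lemma qe_mult:
  "qe 0 * qe 0 = (qe 0 :: 'a Q)" "qe (Suc 0) * qe (Suc 0) = (qe (Suc 0) :: 'a Q)"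
  "qe 0 * qe (Suc 0) = (0 :: 'a Q)" "qe (Suc 0) * qe 0 = (0 :: 'a Q)"
proof -
  have q: "(1/4::complex) *\<^sub>C x + (1/4) *\<^sub>C x = (1/2) *\<^sub>C x"
    "(1/4::complex) *\<^sub>C x + ((1/4) *\<^sub>C x + y) = (1/2) *\<^sub>C x + y" for x y :: "'a Q"
    by (simp_all flip: scaleC_add_left add.assoc)
  show "qe 0 * qe 0 = (qe 0 :: 'a Q)" "qe (Suc 0) * qe (Suc 0) = (qe (Suc 0) :: 'a Q)"
    "qe 0 * qe (Suc 0) = (0 :: 'a Q)" "qe (Suc 0) * qe 0 = (0 :: 'a Q)"
    by (simp_all add: qe_def algebra_simps mult_scaleC_left mult_scaleC_right scaleC_scaleC
        qK_pow4_simps qK_pow_4 scaleC_add_right cvec.scale_right_diff_distrib q)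
qed

lemma qe_mult_left: "qe 0 * (qe 0 * x) = qe 0 * x" "qe (Suc 0) * (qe (Suc 0) * x) = qe (Suc 0) * x"
  "qe 0 * (qe (Suc 0) * x) = 0" "qe (Suc 0) * (qe 0 * x) = 0"
  by (simp_all add: qe_mult flip: mult.assoc)

lemma qK_qK_qe: "qK * (qK * qe 0) = qe 0" "qK * (qK * qe (Suc 0)) = - qe (Suc 0)"
  by (simp_all add: qe_def algebra_simps mult_scaleC_left mult_scaleC_right power2_eq_square
      qK_pow4_simps cvec.scale_right_diff_distrib scaleC_add_right cvec.scale_minus_right)

lemma qK_sq_qe: "qK ^ 2 * qe 0 = qe 0" "qK ^ 2 * qe (Suc 0) = - qe (Suc 0)"
  by (simp_all add: power2_eq_square mult.assoc qK_qK_qe)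

lemma qf_Mi_Pl: "qf Mi i * qf Pl j = (if i = j then qe (Suc 0) else 0) - qf Pl j * qf Mi i"
  by (simp add: qf_Pl_Mi)

lemma qf_sq: "qf s i * qf s i = 0"
proof -
  have "qf s i * qf s i + qf s i * qf s i = 0"
    using qf_anticomm[of s i i] by (simp only: eq_neg_iff_add_eq_0)
  then have "2 *\<^sub>C (qf s i * qf s i) = 0"
    using scaleC_add_left[of 1 1 "qf s i * qf s i"] by (simp add: scaleC_one)
  then show ?thesis by (simp add: cvec.scale_eq_0_iff)
qed

lemma qf_anticomm_neq:
  assumes "i \<noteq> j"
  shows "qf s i * qf t j = - (qf t j * qf s i)"
proof (cases "s = t")
  case True
  then show ?thesis using qf_anticomm[of s i j] by simp
next
  case False
  then show ?thesis using assms qf_Pl_Mi[of i j] qf_Mi_Pl[of i j] by (cases s; cases t) simp_all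
qed

lemma qf_qf_neq_left:
  assumes "i \<noteq> j"
  shows "qf s i * (qf t j * x) = - (qf t j * (qf s i * x))"
  using arg_cong[where f = "\<lambda>y. y * x", OF qf_anticomm_neq[OF assms, of s t]]
  by (simp add: mult.assoc)

section \<open>The monomial basis\<close>

lemma sg_cases: "sg x = 1 \<or> sg x = -1"
  by (simp add: sg_def)

lemma qf_loc_neq: "i \<noteq> j \<Longrightarrow> qf s j * loc i x = sg x *\<^sub>C (loc i x * qf s j)"
  by (cases x; cases "fst x"; cases "snd x")
    (auto simp: loc_simps sg_def mult.assoc qf_qf_neq_left[of j i] qf_anticomm_neq[of j i]
      scaleC_one cvec.scale_minus_left)

lemma qK_loc: "qK * loc i x = sg x *\<^sub>C (loc i x * qK)"
  by (cases x; cases "fst x"; cases "snd x")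
    (auto simp: loc_simps sg_def mult.assoc qK_qf qK_qf_left scaleC_one cvec.scale_minus_left)

lemma mult_prod_list_loc:
  assumes "\<And>i. i \<in> set xs \<Longrightarrow> t * loc i (d i) = sg (d i) *\<^sub>C (loc i (d i) * t)"
  shows "t * prod_list (map (\<lambda>i. loc i (d i)) xs) =
    prod_list (map (\<lambda>i. sg (d i)) xs) *\<^sub>C (prod_list (map (\<lambda>i. loc i (d i)) xs) * t)"
  using assms
proof (induction xs)
  case (Cons i xs)
  have "t * prod_list (map (\<lambda>i. loc i (d i)) (i # xs)) =
      (t * loc i (d i)) * prod_list (map (\<lambda>i. loc i (d i)) xs)"
    by (simp add: mult.assoc)
  then show ?case
    using Cons by (simp add: mult_scaleC_left mult_scaleC_right mult.assoc scaleC_scaleC)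
qed (simp add: scaleC_one)

lemma prod_list_sg: "prod_list (map (\<lambda>i. sg (d i)) xs) \<in> {1, -1}"
proof (induction xs)
  case (Cons i xs)
  then show ?case using sg_cases[of "d i"] by auto
qed simp

text \<open>The scalar is the product of the signs of the sites before \<open>j\<close>. Its value
  is left open, as later arguments ask only for membership in a span or for vanishing.\<close>

lemma qf_ordered_prod_loc:
  obtains c where "c \<in> {1, -1}"
    "qf s j * ordered_prod (\<lambda>i. loc i (d i)) =
       c *\<^sub>C ordered_prod ((\<lambda>i. loc i (d i))(j := qf s j * loc j (d j)))"
proof -
  have "j \<in> set (sorted_list_of_set UNIV)" by simp
  then obtain ys zs where s: "sorted_list_of_set (UNIV :: 'a set) = ys @ j # zs"
    by (meson split_list)
  with distinct_sorted_UNIV[where 'i = 'a] have j: "j \<notin> set ys" "j \<notin> set zs" by auto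
  let ?a = "\<lambda>i. loc i (d i)" and ?a' = "(\<lambda>i. loc i (d i))(j := qf s j * loc j (d j))"
  have m: "map ?a' ys = map ?a ys" "map ?a' zs = map ?a zs" using j by auto
  have "qf s j * prod_list (map ?a ys) =
      prod_list (map (\<lambda>i. sg (d i)) ys) *\<^sub>C (prod_list (map ?a ys) * qf s j)"
    using j by (intro mult_prod_list_loc qf_loc_neq) auto
  then have "qf s j * ordered_prod ?a = prod_list (map (\<lambda>i. sg (d i)) ys) *\<^sub>C ordered_prod ?a'"
    unfolding ordered_prod_def s
    by (simp add: m mult_scaleC_left del: map_fun_upd flip: mult.assoc)
  with prod_list_sg show thesis by (rule that)
qed

lemma ordered_prod_loc_upd:
  "ordered_prod ((\<lambda>i. loc i (d i))(j := loc j x)) = ordered_prod (\<lambda>i. loc i ((d(j := x)) i))"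
  by (intro arg_cong[where f = ordered_prod]) auto

lemma qf_Pl_loc: "qf Pl j * loc j x = (if fst x then 0 else loc j (True, snd x))"
  by (cases x; cases "fst x"; cases "snd x")
    (auto simp: loc_simps qf_sq simp flip: mult.assoc)

lemma qf_Mi_loc: "qf Mi j * loc j x =
    (if fst x then qe (Suc 0) * loc j (False, snd x) else 0) -
    (if snd x then 0 else (if fst x then 1 else -1) *\<^sub>C loc j (fst x, True))"
proof -
  have "qf Mi j * (qf Pl j * y) = qe (Suc 0) * y - qf Pl j * (qf Mi j * y)" for y
    using arg_cong[where f = "\<lambda>z. z * y", OF qf_Mi_Pl[of j j]]
    by (simp add: mult.assoc left_diff_distrib)
  then show ?thesis
    by (cases x; cases "fst x"; cases "snd x")
      (auto simp: loc_simps qf_sq qf_Mi_Pl scaleC_one cvec.scale_minus_left)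
qed

lemma qK_power_mod4: "(qK :: 'i Q) ^ k = qK ^ (k mod 4)"
proof -
  have "(qK :: 'i Q) ^ k = qK ^ (4 * (k div 4) + k mod 4)" by simp
  also have "\<dots> = qK ^ (k mod 4)" by (simp only: power_add power_mult qK_pow_4 power_one mult_1)
  finally show ?thesis .
qed

lemma mon_mod4: "mon d k = mon d (k mod 4)"
  unfolding mon_def by (subst qK_power_mod4) simp

lemma mon_mult_qK: "mon d k * qK ^ n = mon d (k + n)"
  by (simp add: mon_def power_add mult.assoc)

lemma monomial_basis_eq: "monomial_basis = {mon d k | d k. k < 4}"
proof -
  let ?C = "\<lambda>p m :: 'a \<Rightarrow> nat. \<forall>j. p j \<in> {0,1} \<and> m j \<in> {0,1}"
  let ?M = "\<lambda>p m. ordered_prod (\<lambda>j. qf Pl j ^ p j * qf Mi j ^ m j) :: 'a Q"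
  let ?L = "\<lambda>d. ordered_prod (\<lambda>j. loc j (d j)) :: 'a Q"
  have 1: "?M p m = ?L (\<lambda>j. (p j = 1, m j = 1))" if "?C p m" for p m
  proof -
    have "qf Pl j ^ p j * qf Mi j ^ m j = loc j (p j = 1, m j = 1)" for j
      using that[rule_format, of j] by (auto simp: loc_def)
    then show ?thesis by simp
  qed
  have 2: "?L d = ?M (\<lambda>j. of_bool (fst (d j))) (\<lambda>j. of_bool (snd (d j)))"
    "?C (\<lambda>j. of_bool (fst (d j))) (\<lambda>j. of_bool (snd (d j)))" for d
    by (simp_all add: loc_def)
  show ?thesis
  proof (intro equalityI subsetI)
    fix x :: "'a Q" assume "x \<in> monomial_basis"
    then obtain p m k where x: "x = ?M p m * qK ^ k" "?C p m" "k \<le> 3"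
      unfolding monomial_basis_def by blast
    have "x = mon (\<lambda>j. (p j = 1, m j = 1)) k" "k < 4"
      using x by (simp_all only: mon_def 1[OF x(2)])
    then show "x \<in> {mon d k | d k. k < 4}" by blast
  next
    fix x :: "'a Q" assume "x \<in> {mon d k | d k. k < 4}"
    then obtain d k where x: "x = ?L d * qK ^ k" "k \<le> 3" unfolding mon_def by fastforce
    then show "x \<in> monomial_basis"
      unfolding monomial_basis_def x(1) 2(1)
      by (intro CollectI exI conjI) (rule refl, rule 2(2), rule x(2))
  qed
qed

lemma mon_in_span: "mon d k \<in> cvec.span monomial_basis"
proof -
  have "k mod 4 < 4" by simp
  then have "mon d (k mod 4) \<in> monomial_basis" unfolding monomial_basis_eq by blast
  then show ?thesis by (subst mon_mod4) (rule cvec.span_base)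
qed

text \<open>The span contains 1 and is stable under left multiplication by the generators, hence
  contains every word.\<close>

lemma span_monomial_basis: "cvec.span monomial_basis = (UNIV :: 'i::{finite,linorder} Q set)"
proof -
  let ?S = "cvec.span monomial_basis :: 'i Q set"
  have K_in: "x * qK ^ n \<in> ?S" if "x \<in> ?S" for x n
  proof (rule clinear_in_subspace[OF clinear_mult_right _ that])
    fix b :: "'i Q" assume "b \<in> monomial_basis"
    then obtain d k where "b = mon d k" unfolding monomial_basis_eq by blast
    then show "b * qK ^ n \<in> ?S" by (simp add: mon_mult_qK mon_in_span)
  qed auto
  have e_in: "qe n * x \<in> ?S" if "x \<in> ?S" for x n
    unfolding qe_central using that
    by (simp add: qe_def distrib_left mult_scaleC_right K_in cvec.span_add cvec.span_scale)
  have op: "ordered_prod (\<lambda>i. loc i (d i)) \<in> ?S" for d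
    using mon_in_span[of d 0] by (simp add: mon_def)
  note ml = multilin_ordered_prod[unfolded multilin_def]
  have upd_in: "ordered_prod ((\<lambda>i. loc i (d i))(j := loc j x)) \<in> ?S" for d j x
    by (simp only: ordered_prod_loc_upd op)
  \<comment> \<open>Contracting f^- with f^+ at site \<open>j\<close> leaves \<open>qe 1\<close> in
    the middle of the product. Being central it moves to the outside, where it is a combination of
    powers of \<open>qK\<close>.\<close>
  have upd_e: "ordered_prod ((\<lambda>i. loc i (d i))(j := qe (Suc 0) * loc j x)) \<in> ?S" for d :: "'i \<Rightarrow> _" and j x
  proof -
    have q: "qe (Suc 0) * y = (1/2) *\<^sub>C y + (-1/2) *\<^sub>C (qK ^ 2 * y)" for y :: "'i Q"
      by (simp add: qe_def distrib_right mult_scaleC_left scaleC_add_right left_diff_distrib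
          cvec.scale_right_diff_distrib cvec.scale_minus_left)
    have "j \<in> set (sorted_list_of_set UNIV)" by simp
    then obtain ys zs where s: "sorted_list_of_set (UNIV :: 'i set) = ys @ j # zs"
      by (meson split_list)
    with distinct_sorted_UNIV[where 'i = 'i] have "j \<notin> set ys" "j \<notin> set zs" by auto
    then have m: "map ((\<lambda>i. loc i (d i))(j := y)) ys = map (\<lambda>i. loc i (d i)) ys"
      "map ((\<lambda>i. loc i (d i))(j := y)) zs = map (\<lambda>i. loc i (d i)) zs" for y
      by auto
    have "ordered_prod ((\<lambda>i. loc i (d i))(j := qe (Suc 0) * y)) =
        qe (Suc 0) * ordered_prod ((\<lambda>i. loc i (d i))(j := y))" for y
      unfolding ordered_prod_def s
      using arg_cong[where f = "\<lambda>z. z * (y * prod_list (map (\<lambda>i. loc i (d i)) zs))",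
          OF qe_central[of "Suc 0" "prod_list (map (\<lambda>i. loc i (d i)) ys)"]]
      by (simp add: m mult.assoc del: map_fun_upd)
    then show ?thesis using e_in[OF upd_in] by simp
  qed
  have f_op: "qf s j * ordered_prod (\<lambda>i. loc i (d i)) \<in> ?S" for s j d
  proof -
    obtain c where c: "qf s j * ordered_prod (\<lambda>i. loc i (d i)) =
       c *\<^sub>C ordered_prod ((\<lambda>i. loc i (d i))(j := qf s j * loc j (d j)))"
      using qf_ordered_prod_loc by blast
    let ?P = "\<lambda>y. ordered_prod ((\<lambda>i. loc i (d i))(j := y))"
    have lin: "clinear ?P" by (rule clinearI) (use ml in blast)+
    have "?P (qf s j * loc j (d j)) \<in> ?S"
    proof (cases s)
      case Pl
      then show ?thesis
        using upd_in clinear_zero[OF lin] by (auto simp: qf_Pl_loc cvec.span_zero simp del: fun_upd_apply)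
    next
      case Mi
      then show ?thesis
        using upd_in upd_e
        by (auto simp: qf_Mi_loc clinear_zero[OF lin] clinear_diff[OF lin] clinear_scaleC[OF lin]
            clinear_uminus[OF lin]
            intro!: cvec.span_diff cvec.span_scale cvec.span_neg cvec.span_zero
            simp del: fun_upd_apply)
    qed
    then show ?thesis by (simp add: c cvec.span_scale)
  qed
  have gen_in: "qgen g * x \<in> ?S" if "x \<in> ?S" for g x
  proof (rule clinear_in_subspace[OF clinear_mult_left _ that])
    fix b :: "'i Q" assume "b \<in> monomial_basis"
    then obtain d k where b: "b = mon d k" by (auto simp: monomial_basis_eq)
    show "qgen g * b \<in> ?S"
    proof (cases g)
      case Kgen
      have "qK * ordered_prod (\<lambda>i. loc i (d i)) \<in> ?S"
        unfolding ordered_prod_def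
        by (subst mult_prod_list_loc[OF qK_loc])
          (use K_in[OF op, of d 1] in \<open>auto simp: ordered_prod_def intro!: cvec.span_scale\<close>)
      then show ?thesis
        using K_in[of "qK * ordered_prod (\<lambda>i. loc i (d i))" k] by (simp add: Kgen b mon_def mult.assoc)
    next
      case (Fgen s j)
      then show ?thesis
        using K_in[OF f_op, of s j d k] by (simp add: b mon_def mult.assoc)
    qed
  qed auto
  have "prod_list (map qgen w) \<in> ?S" for w
  proof (induction w)
    case Nil
    show ?case using op[of "\<lambda>_. (False, False)"] by (simp add: loc_simps ordered_prod_one)
  qed (simp add: gen_in)
  then have "cvec.span (range (\<lambda>w. prod_list (map qgen w))) \<subseteq> ?S"
    by (intro cvec.span_minimal) auto
  then show ?thesis by (auto simp: Q_eq_span_words)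
qed

lemma independent_if_dual:
  assumes "\<And>b x y. b \<in> B \<Longrightarrow> l b (x + y) = (l b x + l b y :: complex)"
    and "\<And>b c x. b \<in> B \<Longrightarrow> l b (c *\<^sub>C x) = c * l b x"
    and "\<And>b b'. b \<in> B \<Longrightarrow> b' \<in> B \<Longrightarrow> l b b' = of_bool (b = b')"
  shows "cvec.independent B"
proof
  assume "cvec.dependent B"
  then obtain t u v where t: "finite t" "t \<subseteq> B" "v \<in> t" "u v \<noteq> 0" "(\<Sum>v\<in>t. u v *\<^sub>C v) = 0"
    unfolding cvec.dependent_explicit by blast
  have v: "v \<in> B" using t by auto
  have l0: "l v 0 = 0" using assms(2)[OF v, of 0 0] by simp
  have "l v (\<Sum>v\<in>t'. u v *\<^sub>C v) = (\<Sum>b\<in>t'. u b * of_bool (v = b))" if "finite t'" "t' \<subseteq> B" for t'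
    using that by (induction t') (simp_all add: l0 assms v)
  from this[OF t(1,2)] t l0 show False by (simp add: of_bool_def sum.delta' if_distrib cong: if_cong)
qed

lemma coord_zero: "coord d k 0 = 0"
  using coord_scaleC[of d k 0 0] by simp

lemma coord_sum: "coord d k (sum g A) = (\<Sum>a\<in>A. coord d k (g a))"
  by (induction A rule: infinite_finite_induct) (simp_all add: coord_zero coord_add)

text \<open>The functionals \<open>coord d k\<close> are dual to the monomials. This makes the
  monomials independent and identifies the dual basis vector in \<open>Lambda_hat\<close> with a
  functional that can be computed in the Fock representations.\<close>

lemma coord_top_representation:
  "cvec.representation monomial_basis x (ordered_prod (\<lambda>j. qf Pl j * qf Mi j)) =
    coord (\<lambda>_. (True, True)) 0 (x :: 'i::{finite,linorder} Q)"
proof -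
  have ind: "cvec.independent (monomial_basis :: 'i Q set)"
  proof (rule independent_if_dual[where l = "\<lambda>b. coord (fst (SOME (d, k). b = mon d k \<and> k < 4))
        (snd (SOME (d, k). b = mon d k \<and> k < 4))"])
    fix b b' :: "'i Q" assume "b \<in> monomial_basis" "b' \<in> monomial_basis"
    then obtain d k d' k' where b: "b = mon d k" "k < 4" "b' = mon d' k'" "k' < 4"
      by (auto simp: monomial_basis_eq)
    obtain D j where Dj: "(SOME (d, k). b = mon d k \<and> k < 4) = (D, j)" by fastforce
    have "case (D, j) of (d, k) \<Rightarrow> b = mon d k \<and> k < 4"
      unfolding Dj[symmetric] by (rule someI[of _ "(d, k)"]) (simp add: b)
    then have D: "b = mon D j" "j < 4" by auto
    have "b = b' \<longleftrightarrow> D = d' \<and> j = k'"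
    proof
      assume "b = b'"
      then have "coord D j (mon d' k') = 1" using D b(3) coord_mon[of j j D D] by simp
      then show "D = d' \<and> j = k'" using coord_mon[OF D(2) b(4), of D d'] by auto
    qed (simp add: D b)
    then show "coord (fst (SOME (d, k). b = mon d k \<and> k < 4))
        (snd (SOME (d, k). b = mon d k \<and> k < 4)) b' = of_bool (b = b')"
      by (simp add: Dj b(3) coord_mon[OF D(2) b(4)])
  qed (simp_all add: coord_add coord_scaleC)
  have top: "ordered_prod (\<lambda>j. qf Pl j * qf Mi j) = mon (\<lambda>_::'i. (True, True)) 0"
    by (simp add: mon_def loc_simps)
  let ?r = "cvec.representation monomial_basis x"
  let ?B = "{b. ?r b \<noteq> 0}"
  have fin: "finite ?B" by (rule cvec.finite_representation)
  have sub: "?B \<subseteq> monomial_basis" using cvec.representation_ne_zero by auto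
  have "x = (\<Sum>b\<in>?B. ?r b *\<^sub>C b)"
    using cvec.sum_nonzero_representation_eq[OF ind, of x] by (simp add: span_monomial_basis)
  also have "coord (\<lambda>_. (True, True)) 0 \<dots> = (\<Sum>b\<in>?B. ?r b * coord (\<lambda>_. (True, True)) 0 b)"
    by (simp only: coord_sum coord_scaleC)
  also have "\<dots> = (\<Sum>b\<in>?B. if b = mon (\<lambda>_. (True, True)) 0 then ?r b else 0)"
  proof (rule sum.cong)
    fix b assume "b \<in> ?B"
    with sub obtain d k where b: "b = mon d k" "k < 4" by (auto simp: monomial_basis_eq)
    have c: "coord (\<lambda>_. (True, True)) 0 b = of_bool ((\<lambda>_. (True, True)) = d \<and> 0 = k)"
      using coord_mon[of 0 k "\<lambda>_. (True, True)" d] b by simp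
    moreover have "b = mon (\<lambda>_. (True, True)) 0 \<Longrightarrow> coord (\<lambda>_. (True, True)) 0 b = 1"
      using coord_mon[of 0 0 "\<lambda>_. (True, True)" "\<lambda>_. (True, True)"] by simp
    ultimately show "?r b * coord (\<lambda>_. (True, True)) 0 b =
        (if b = mon (\<lambda>_. (True, True)) 0 then ?r b else 0)"
      using b by (auto simp: of_bool_def split: if_splits)
  qed simp
  also have "\<dots> = ?r (mon (\<lambda>_. (True, True)) 0)"
    using fin by (simp add: sum.delta)
  finally show ?thesis by (simp add: top)
qed

definition top_coef :: "'i::{finite,linorder} Q \<Rightarrow> complex" where
  "top_coef = coord (\<lambda>_. (True, True)) 0"

text \<open>Collecting the powers of \<open>qK\<close> at the right end costs a sign. It is 1 if
  every site is doubly occupied, since f^+ f^- commutes with \<open>qK\<close>; for all other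
  monomials the top coefficient vanishes and the sign does not matter.\<close>

lemma qK_pow_ordered_prod_loc:
  obtains c where "c \<in> {1, -1}"
    "ordered_prod (\<lambda>j. loc j (x j) * qK ^ n j) = c *\<^sub>C (ordered_prod (\<lambda>j. loc j (x j)) * qK ^ (\<Sum>j\<in>UNIV. n j))"
    "(\<forall>j. x j = (True, True)) \<longrightarrow> c = 1"
proof -
  have K: "\<exists>c. c \<in> {1, -1} \<and> ((\<forall>j. x j = (True, True)) \<longrightarrow> c = 1) \<and>
      qK ^ m * prod_list (map (\<lambda>j. loc j (x j)) xs) = c *\<^sub>C (prod_list (map (\<lambda>j. loc j (x j)) xs) * qK ^ m)"
    for m xs
  proof (induction m)
    case 0
    show ?case by (intro exI[of _ 1]) (simp add: scaleC_one)
  next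
    case (Suc m)
    let ?P = "prod_list (map (\<lambda>j. loc j (x j)) xs)" and ?s = "prod_list (map (\<lambda>i. sg (x i)) xs)"
    from Suc obtain c where c: "c \<in> {1, -1}" "(\<forall>j. x j = (True, True)) \<longrightarrow> c = 1"
      "qK ^ m * ?P = c *\<^sub>C (?P * qK ^ m)" by blast
    have "qK * ?P = ?s *\<^sub>C (?P * qK)" by (rule mult_prod_list_loc[OF qK_loc])
    then have "qK ^ Suc m * ?P = (c * ?s) *\<^sub>C (?P * qK ^ Suc m)"
      using c(3) by (simp add: mult.assoc mult_scaleC_right mult_scaleC_left scaleC_scaleC)
        (simp add: mult_scaleC_left scaleC_scaleC flip: mult.assoc)
    moreover have "?s = 1" if "\<forall>j. x j = (True, True)"
      using that by (induction xs) (simp_all add: sg_def)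
    ultimately show ?case using c prod_list_sg[of x xs] by (intro exI[of _ "c * ?s"]) auto
  qed
  have "distinct xs \<Longrightarrow> \<exists>c. c \<in> {1, -1} \<and> ((\<forall>j. x j = (True, True)) \<longrightarrow> c = 1) \<and>
      prod_list (map (\<lambda>j. loc j (x j) * qK ^ n j) xs) =
        c *\<^sub>C (prod_list (map (\<lambda>j. loc j (x j)) xs) * qK ^ (\<Sum>j\<in>set xs. n j))" for xs
  proof (induction xs)
    case Nil
    show ?case by (intro exI[of _ 1]) (simp add: scaleC_one)
  next
    case (Cons j xs)
    let ?P = "prod_list (map (\<lambda>j. loc j (x j)) xs)" and ?n = "\<Sum>j\<in>set xs. n j"
    obtain c where c: "c \<in> {1, -1}" "(\<forall>j. x j = (True, True)) \<longrightarrow> c = 1"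
      "prod_list (map (\<lambda>j. loc j (x j) * qK ^ n j) xs) = c *\<^sub>C (?P * qK ^ ?n)"
      using Cons by auto
    obtain c' where c': "c' \<in> {1, -1}" "(\<forall>j. x j = (True, True)) \<longrightarrow> c' = 1"
      "qK ^ n j * ?P = c' *\<^sub>C (?P * qK ^ n j)" using K by blast
    have "loc j (x j) * qK ^ n j * (c *\<^sub>C (?P * qK ^ ?n)) =
        c *\<^sub>C (loc j (x j) * ((qK ^ n j * ?P) * qK ^ ?n))"
      by (simp add: mult_scaleC_right mult.assoc)
    also have "\<dots> = (c * c') *\<^sub>C (loc j (x j) * ?P * qK ^ (n j + ?n))"
      by (simp add: c'(3) mult_scaleC_right mult_scaleC_left scaleC_scaleC power_add mult.assoc)
    finally show ?case
      using c c' Cons.prems by (intro exI[of _ "c * c'"]) auto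
  qed
  from this[OF distinct_sorted_UNIV] show thesis
    using that unfolding ordered_prod_def set_sorted_UNIV by blast
qed

lemma coord_prod_loc:
  "top_coef (ordered_prod (\<lambda>j. loc j (x j) * qK ^ n j) * qK ^ m) =
     of_bool ((\<forall>j. x j = (True, True)) \<and> 4 dvd (m + (\<Sum>j\<in>UNIV. n j)))"
proof -
  obtain c where c: "c \<in> {1, -1}" "ordered_prod (\<lambda>j. loc j (x j) * qK ^ n j) =
      c *\<^sub>C (ordered_prod (\<lambda>j. loc j (x j)) * qK ^ (\<Sum>j\<in>UNIV. n j))"
    "(\<forall>j. x j = (True, True)) \<longrightarrow> c = 1"
    by (rule qK_pow_ordered_prod_loc)
  let ?k = "m + (\<Sum>j\<in>UNIV. n j)"
  have "ordered_prod (\<lambda>j. loc j (x j) * qK ^ n j) * qK ^ m = c *\<^sub>C mon x ?k"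
    by (simp add: c(2) mon_def mult_scaleC_left power_add mult.assoc power_commutes
        add.commute[of m] flip: power_add)
  moreover have "coord (\<lambda>_. (True, True)) 0 (mon x ?k) =
      of_bool ((\<lambda>_. (True, True)) = x \<and> 0 = ?k mod 4)"
    by (subst mon_mod4, subst coord_mon) auto
  ultimately have "top_coef (ordered_prod (\<lambda>j. loc j (x j) * qK ^ n j) * qK ^ m) =
      c * of_bool ((\<lambda>_. (True, True)) = x \<and> 0 = ?k mod 4)"
    by (simp add: top_coef_def coord_scaleC)
  also have "\<dots> = of_bool ((\<forall>j. x j = (True, True)) \<and> 4 dvd ?k)"
    using c(3) by (auto simp: fun_eq_iff dvd_eq_mod_eq_0 of_bool_def)
  finally show ?thesis .
qed

lemma top_coef_prod_local:
  "top_coef (ordered_prod (\<lambda>j. (\<Sum>x\<in>UNIV. u j x *\<^sub>C loc j x) * qK ^ n j) * qK ^ m) =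
     (\<Prod>j\<in>UNIV. u j (True, True)) * of_bool (4 dvd (m + (\<Sum>j\<in>UNIV. n j)))"
proof -
  have "ordered_prod (\<lambda>j. (\<Sum>x\<in>UNIV. u j x *\<^sub>C loc j x) * qK ^ n j) * qK ^ m =
      (\<Sum>x\<in>UNIV. (\<Prod>j\<in>UNIV. u j (x j)) *\<^sub>C (ordered_prod (\<lambda>j. loc j (x j) * qK ^ n j) * qK ^ m))"
    by (simp add: sum_distrib_right mult_scaleC_left ordered_prod_sum ordered_prod_scaleC)
  then have "top_coef (ordered_prod (\<lambda>j. (\<Sum>x\<in>UNIV. u j x *\<^sub>C loc j x) * qK ^ n j) * qK ^ m) =
      (\<Sum>x\<in>UNIV. (\<Prod>j\<in>UNIV. u j (x j)) * top_coef (ordered_prod (\<lambda>j. loc j (x j) * qK ^ n j) * qK ^ m))"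
    by (simp add: top_coef_def coord_sum coord_scaleC)
  also have "\<dots> = (\<Sum>x\<in>UNIV. if x = (\<lambda>_::'a. (True, True)) then
      (\<Prod>j\<in>UNIV. u j (True, True)) * of_bool (4 dvd (m + (\<Sum>j\<in>UNIV. n j))) else 0)"
    by (rule sum.cong[OF refl]) (auto simp: coord_prod_loc fun_eq_iff of_bool_def)
  finally show ?thesis by (simp add: sum.delta)
qed

section \<open>The antipode\<close>

text \<open>The antipode reverses products, so it is obtained from \<open>Q_hom_exists\<close> as a
  homomorphism into the opposite algebra.\<close>

typedef 'a opp = "UNIV :: 'a set" morphisms of_opp to_opp by simp

setup_lifting type_definition_opp

instantiation opp :: (complex_alg) complex_alg
begin

lift_definition zero_opp :: "'a opp" is 0 .
lift_definition one_opp :: "'a opp" is 1 .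
lift_definition plus_opp :: "'a opp \<Rightarrow> 'a opp \<Rightarrow> 'a opp" is "(+)" .
lift_definition uminus_opp :: "'a opp \<Rightarrow> 'a opp" is uminus .
lift_definition minus_opp :: "'a opp \<Rightarrow> 'a opp \<Rightarrow> 'a opp" is "(-)" .
lift_definition times_opp :: "'a opp \<Rightarrow> 'a opp \<Rightarrow> 'a opp" is "\<lambda>x y. y * x" .
lift_definition scaleC_opp :: "complex \<Rightarrow> 'a opp \<Rightarrow> 'a opp" is scaleC .

instance
  by standard (transfer; simp add: algebra_simps scaleC_add_right scaleC_add_left scaleC_scaleC
      scaleC_one mult_scaleC_left mult_scaleC_right)+

end

definition e_comb :: "complex \<Rightarrow> 'i Q" where
  "e_comb c = qe 0 + c *\<^sub>C qe (Suc 0)"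

lemma e_comb_central: "e_comb c * x = x * e_comb c"
  by (simp add: e_comb_def distrib_left distrib_right mult_scaleC_left mult_scaleC_right qe_central)

lemma e_comb_mult: "e_comb c * e_comb d = e_comb (c * d)"
  by (simp add: e_comb_def distrib_left distrib_right mult_scaleC_left mult_scaleC_right qe_mult
      scaleC_scaleC mult.commute)

lemma e_comb_one: "e_comb 1 = 1"
  by (simp add: e_comb_def qe_sum scaleC_one)

lemma qK_sq_e_comb: "qK ^ 2 = e_comb (-1)"
proof -
  have "qK ^ 2 = qK ^ 2 * (qe 0 + qe (Suc 0) :: 'a Q)" by (simp add: qe_sum)
  then show ?thesis
    by (simp only: distrib_left qK_sq_qe e_comb_def cvec.scale_minus_left scaleC_one)
qed

lemma qK_power_odd_qf: "odd m \<Longrightarrow> qK ^ m * qf s i = - (qf s i * qK ^ m)"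
proof -
  assume "odd m"
  have "qK ^ m * qf s i = (-1) ^ m *\<^sub>C (qf s i * qK ^ m)" for m
    by (induction m)
      (simp_all add: scaleC_one mult.assoc mult_scaleC_right mult_scaleC_left qK_qf_left
        cvec.scale_minus_left)
  then show ?thesis using \<open>odd m\<close> by (simp add: scaleC_one cvec.scale_minus_left)
qed

text \<open>Moving \<open>qK\<close> past the second generator costs the outer sign; the inner one
  comes from \<open>qK ^ 2 = e_comb (-1)\<close>.\<close>

lemma twisted_qf_mult:
  "(qf s i * e_comb c * qK) * (qf t j * e_comb d * qK) = - (qf s i * qf t j * e_comb (- (c * d)))"
proof -
  have "qK * (qf t j * (e_comb d * qK)) = - (qf t j * (e_comb d * qK ^ 2))"
    by (simp add: qK_qf_left power2_eq_square e_comb_central mult.assoc)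
  moreover have "e_comb c * (qf t j * y) = qf t j * (e_comb c * y)" for y
    by (simp add: e_comb_central mult.assoc)
  ultimately have "(qf s i * e_comb c * qK) * (qf t j * e_comb d * qK) =
      - (qf s i * qf t j * (e_comb c * e_comb d * qK ^ 2))"
    by (simp add: mult.assoc)
  then show ?thesis by (simp add: qK_sq_e_comb e_comb_mult)
qed

section \<open>Existence, uniqueness and values of the antipode\<close>

definition is_antipode :: "('i::{finite,linorder} Q \<Rightarrow> 'i Q) \<Rightarrow> bool" where
  "is_antipode S \<longleftrightarrow> clinear S \<and> bij S \<and> S 1 = 1 \<and> (\<forall>x y. S (x * y) = S y * S x) \<and>
     S qK = (if even CARD('i) then qK else qK ^ 3) \<and>
     (\<forall>s k. S (qf s k) = qf s k * (qe 0 + (sgnC s * (-1) ^ CARD('i) * \<i>) *\<^sub>C qe 1) * qK)"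

lemma linear_eqI_words:
  assumes "clinear f" "clinear g" "\<And>w. f (prod_list (map qgen w)) = g (prod_list (map qgen w))"
  shows "f x = g x"
  by (rule clinear_eq_on_span[OF assms(1,2), of _ "range (\<lambda>w. prod_list (map qgen w))"])
    (auto simp: Q_eq_span_words assms(3))

text \<open>The relators hold for the images of the generators in the opposite algebra. Bijectivity
  follows from S^4 = id: S^2 fixes \<open>qK\<close> and multiplies each f by a central involution
  that S fixes. Uniqueness is clear on words.\<close>

lemma antipode_ex1: "\<exists>!S. is_antipode (S :: 'i::{finite,linorder} Q \<Rightarrow> 'i Q)"
proof (rule ex_ex1I)
  let ?N = "CARD('i)"
  \<comment> \<open>Since \<open>qK ^ 4 = 1\<close>, the exponent 3 stands for -1; in both cases
    \<open>m\<close> is odd, which is all that the relations with the f's use.\<close>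
  define m :: nat where "m = (if even ?N then 1 else 3)"
  define c where "c s = sgnC s * (-1) ^ ?N * \<i>" for s
  have m: "odd m" "qK ^ m = (if even ?N then qK else qK ^ 3)" by (simp_all add: m_def)
  have c_sq: "c s * c s = -1" "c Pl * c Mi = 1" "c Mi * c Pl = 1" for s
    by (cases s; cases "even ?N"; simp add: c_def)+
  have K4: "(qK ^ m) ^ 4 = (1 :: 'i Q)"
    by (metis mult.commute power_mult power_one qK_pow_4)
  have K2: "(qK ^ m) ^ 2 = (qK ^ 2 :: 'i Q)"
  proof -
    have "(qK ^ 3) ^ 2 = (qK ^ 4 * qK ^ 2 :: 'i Q)" by (simp flip: power_mult power_add)
    then show ?thesis by (simp add: m_def qK_pow_4)
  qed
  define g :: "'i gen \<Rightarrow> 'i Q opp" where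
    "g x = (case x of Kgen \<Rightarrow> to_opp (qK ^ m) | Fgen s k \<Rightarrow> to_opp (qf s k * e_comb (c s) * qK))" for x
  have of_g: "of_opp (g Kgen) = qK ^ m" "of_opp (g (Fgen s k)) = qf s k * e_comb (c s) * qK" for s k
    by (simp_all add: g_def to_opp_inverse)
  have of_opp_pow: "of_opp (x ^ n) = of_opp x ^ n" for x :: "'i Q opp" and n
    by (induction n) (simp_all add: one_opp.rep_eq times_opp.rep_eq power_commutes)
  have opp_eqI: "x = y" if "of_opp x = of_opp y" for x y :: "'i Q opp"
    using that by (simp add: of_opp_inject)
  note ops = plus_opp.rep_eq times_opp.rep_eq zero_opp.rep_eq one_opp.rep_eq minus_opp.rep_eq
    scaleC_opp.rep_eq of_opp_pow of_g
  have "anticomm (g (Fgen s i)) (g Kgen) = 0" for s i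
  proof (rule opp_eqI)
    have "qK ^ m * (qf s i * e_comb (c s) * qK) = (qK ^ m * qf s i) * e_comb (c s) * qK"
      by (simp only: mult.assoc)
    also have "\<dots> = - (qf s i * (qK ^ m * e_comb (c s)) * qK)"
      by (simp add: qK_power_odd_qf[OF m(1)] mult.assoc)
    also have "\<dots> = - (qf s i * e_comb (c s) * qK * qK ^ m)"
    proof -
      have "qK ^ m * (qK * y) = qK * (qK ^ m * y)" for y :: "'i Q"
        by (simp only: mult.assoc[symmetric] power_commutes)
      then show ?thesis by (simp add: e_comb_central mult.assoc)
    qed
    finally have "qK ^ m * (qf s i * e_comb (c s) * qK) = - (qf s i * e_comb (c s) * qK * qK ^ m)" .
    then show "of_opp (anticomm (g (Fgen s i)) (g Kgen)) = of_opp 0" by (simp add: ops)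
  qed
  moreover have "anticomm (g (Fgen Pl i)) (g (Fgen Mi j)) =
      (if i = j then (1/2) *\<^sub>C (1 - g Kgen ^ 2) else 0)" for i j
  proof (rule opp_eqI)
    have "anticomm (qf Mi j * e_comb (c Mi) * qK) (qf Pl i * e_comb (c Pl) * qK) =
        - ((qf Mi j * qf Pl i + qf Pl i * qf Mi j) * e_comb (-1))"
      by (simp add: twisted_qf_mult c_sq distrib_right)
    also have "\<dots> = (if i = j then qe (Suc 0) else 0)"
      by (simp add: qf_Pl_Mi e_comb_def distrib_left right_diff_distrib mult_scaleC_right qe_mult
          cvec.scale_minus_left scaleC_one)
    also have "\<dots> = of_opp (if i = j then (1/2) *\<^sub>C (1 - g Kgen ^ 2) else 0)"
      by (simp add: ops K2 qe_def cvec.scale_minus_left scaleC_one)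
    finally show "of_opp (anticomm (g (Fgen Pl i)) (g (Fgen Mi j))) =
        of_opp (if i = j then (1/2) *\<^sub>C (1 - g Kgen ^ 2) else 0)" by (simp add: ops)
  qed
  moreover have "anticomm (g (Fgen s i)) (g (Fgen s j)) = 0" for s i j
  proof (rule opp_eqI)
    have "anticomm (qf s j * e_comb (c s) * qK) (qf s i * e_comb (c s) * qK) =
        - ((qf s j * qf s i + qf s i * qf s j) * e_comb 1)"
      by (simp add: twisted_qf_mult c_sq distrib_right)
    then show "of_opp (anticomm (g (Fgen s i)) (g (Fgen s j))) = of_opp 0"
      using qf_anticomm[of s i j] by (simp add: ops)
  qed
  moreover have "g Kgen ^ 4 = 1" by (rule opp_eqI) (simp add: ops K4)
  ultimately obtain h :: "'i Q \<Rightarrow> 'i Q opp" where h: "clinear h" "h 1 = 1"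
    "\<And>x y. h (x * y) = h x * h y" "h qK = g Kgen" "\<And>s i. h (qf s i) = g (Fgen s i)"
    by (rule Q_hom_exists[of g]) blast
  define S where "S x = of_opp (h x)" for x
  have lin: "clinear S"
    by (rule clinearI) (simp_all add: S_def clinear_add[OF h(1)] clinear_scaleC[OF h(1)] ops)
  have one: "S 1 = 1" by (simp add: S_def h ops)
  have mult: "S (x * y) = S y * S x" for x y by (simp add: S_def h ops)
  have K: "S qK = qK ^ m" and f: "S (qf s k) = qf s k * e_comb (c s) * qK" for s k
    by (simp_all add: S_def h ops)
  have pow: "S (x ^ n) = S x ^ n" for x n
    by (induction n) (simp_all add: one mult power_commutes)
  have e: "S (qe n) = qe n" for n
    by (simp add: qe_def clinear_add[OF lin] clinear_scaleC[OF lin] one pow K K2)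
  have ec: "S (e_comb a) = e_comb a" for a
    by (simp add: e_comb_def clinear_add[OF lin] clinear_scaleC[OF lin] e)
  have SSK: "S (S qK) = qK"
  proof -
    have "S (S qK) = qK ^ (m * m)" by (simp add: pow K power_mult)
    also have "(m * m) mod 4 = 1" by (simp add: m_def)
    then have "qK ^ (m * m) = (qK :: 'i Q)" by (subst qK_power_mod4) simp
    finally show ?thesis .
  qed
  \<comment> \<open>For even N the power is \<open>qK ^ 2\<close>, which is -1 on the block of
    \<open>qe 1\<close>; for odd N it is \<open>qK ^ 4 = 1\<close>.\<close>
  obtain d where d: "d * d = 1" "qK ^ (m + 1) = (e_comb d :: 'i Q)"
  proof (cases "even ?N")
    case True
    then show thesis
      using that[of "-1"] qK_sq_e_comb[where 'a = 'i] by (simp add: m_def power2_eq_square)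
  next
    case False
    then show thesis using that[of 1] qK_pow_4[where 'i = 'i] by (simp add: m_def e_comb_one)
  qed
  define u :: "'i Q" where "u = - e_comb (- d)"
  have u: "S u = u" "u * u = 1"
    using d(1) by (simp_all add: u_def clinear_uminus[OF lin] ec e_comb_mult e_comb_one)
  have SSf: "S (S (qf s k)) = qf s k * u" for s k
  proof -
    have "e_comb (c s) * (qf s k * (e_comb (c s) * qK)) = (e_comb (c s) * qf s k) * (e_comb (c s) * qK)"
      by (simp only: mult.assoc)
    also have "e_comb (c s) * qf s k = qf s k * e_comb (c s)" by (rule e_comb_central)
    also have "qf s k * e_comb (c s) * (e_comb (c s) * qK) = qf s k * ((e_comb (c s) * e_comb (c s)) * qK)"
      by (simp only: mult.assoc)
    finally have "e_comb (c s) * (qf s k * (e_comb (c s) * qK)) = qf s k * (e_comb (-1) * qK)"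
      by (simp only: e_comb_mult c_sq)
    then have "S (S (qf s k)) = (qK ^ m * qf s k) * (e_comb (-1) * qK)"
      by (simp add: f mult ec K mult.assoc)
    also have "\<dots> = - (qf s k * (e_comb (-1) * qK ^ (m + 1)))"
    proof -
      have "qK ^ m * (e_comb (-1) * qK) = e_comb (-1) * (qK ^ m * qK :: 'i Q)"
        by (simp only: mult.assoc e_comb_central)
      then show ?thesis
        by (simp add: qK_power_odd_qf[OF m(1)] mult.assoc power_commutes)
    qed
    finally show ?thesis by (simp only: u_def d(2) e_comb_mult mult_minus_right mult_minus1)
  qed
  have S4: "S (S (S (S x))) = x" for x
  proof (rule linear_eqI_words[of "\<lambda>x. S (S (S (S x)))"])
    show "clinear (\<lambda>x. S (S (S (S x))))"
      by (intro clinear_compose[OF _ lin] lin)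
    show "clinear (\<lambda>x :: 'i Q. x)" by (rule clinearI) simp_all
    have gen: "S (S (S (S (qgen g)))) = qgen g" for g
      by (cases g) (simp_all add: SSK SSf mult u mult.assoc)
    show "S (S (S (S (prod_list (map qgen w))))) = prod_list (map qgen w)" for w
      by (induction w) (simp_all add: one mult gen)
  qed
  have "bij S"
  proof (rule bijI)
    show "inj S" by (rule injI) (metis S4)
    show "surj S" by (rule surjI[of _ "\<lambda>x. S (S (S x))"]) (rule S4)
  qed
  then have "is_antipode S"
    using lin one mult K f unfolding is_antipode_def m(2) by (simp add: e_comb_def c_def)
  then show "\<exists>S :: 'i Q \<Rightarrow> 'i Q. is_antipode S" by (rule exI[of is_antipode])
next
  fix S S' :: "'i Q \<Rightarrow> 'i Q"
  assume S: "is_antipode S" "is_antipode S'"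
  have gen: "S (qgen g) = S' (qgen g)" for g
    using S by (cases g) (simp_all add: is_antipode_def)
  have "S (prod_list (map qgen w)) = S' (prod_list (map qgen w))" for w
    by (induction w) (use S gen in \<open>simp_all add: is_antipode_def\<close>)
  then have "S x = S' x" for x
    using S by (intro linear_eqI_words[of S S' x]) (simp_all add: is_antipode_def)
  then show "S = S'" by (rule ext)
qed

lemma is_antipode_antipode: "is_antipode (antipode :: 'i::{finite,linorder} Q \<Rightarrow> 'i Q)"
proof -
  have "antipode = (THE S :: 'i Q \<Rightarrow> 'i Q. is_antipode S)"
    by (simp add: antipode_def is_antipode_def[abs_def])
  then show ?thesis using theI'[OF antipode_ex1[where 'i = 'i]] by simp
qed

lemma clinear_antipode: "clinear antipode"
  and antipode_one: "antipode 1 = 1"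
  and antipode_mult: "antipode (x * y) = antipode y * antipode x"
  using is_antipode_antipode by (auto simp: is_antipode_def)

lemma antipode_qK: "antipode (qK :: 'i::{finite,linorder} Q) = (if even CARD('i) then qK else qK ^ 3)"
  and antipode_qf: "antipode (qf s (k::'i)) = qf s k * e_comb (sgnC s * (-1) ^ CARD('i) * \<i>) * qK"
  using is_antipode_antipode[where 'i = 'i] by (auto simp: is_antipode_def e_comb_def)

lemma antipode_power: "antipode (x ^ n) = antipode x ^ n"
  by (induction n) (simp_all add: antipode_one antipode_mult power_commutes)

lemma antipode_qe: "antipode (qe n) = qe n"
proof -
  have "(qK ^ 3) ^ 2 = (qK ^ 4 * qK ^ 2 :: 'a Q)" by (simp flip: power_mult power_add)
  then have "antipode (qK ^ 2) = (qK ^ 2 :: 'a Q)"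
    by (simp add: antipode_power antipode_qK qK_pow_4)
  then show ?thesis
    by (simp add: qe_def clinear_add[OF clinear_antipode] clinear_scaleC[OF clinear_antipode] antipode_one)
qed

lemma antipode_qK_qe: "antipode (qK :: 'i::{finite,linorder} Q) * qe 0 = qK * qe 0"
  "antipode (qK :: 'i Q) * qe (Suc 0) = (-1) ^ CARD('i) *\<^sub>C (qK * qe (Suc 0))"
  by (auto simp: antipode_qK power3_eq_cube mult.assoc qK_qK_qe scaleC_one cvec.scale_minus_left)

lemma e_comb_qe: "e_comb c * qe 0 = qe 0" "e_comb c * qe (Suc 0) = c *\<^sub>C qe (Suc 0)"
  by (simp_all add: e_comb_def distrib_right mult_scaleC_left qe_mult)

lemma antipode_qf_qe:
  "antipode (qf s k) * qe 0 = qf s k * qK * qe 0"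
  "antipode (qf s (k :: 'i::{finite,linorder})) * qe (Suc 0) =
     (sgnC s * (-1) ^ CARD('i) * \<i>) *\<^sub>C (qf s k * qK * qe (Suc 0))"
proof -
  have "antipode (qf s k) * qe n = qf s k * qK * (e_comb (sgnC s * (-1) ^ CARD('i) * \<i>) * qe n)" for n
    by (simp only: antipode_qf mult.assoc e_comb_central)
  then show "antipode (qf s k) * qe 0 = qf s k * qK * qe 0"
    "antipode (qf s k) * qe (Suc 0) =
     (sgnC s * (-1) ^ CARD('i) * \<i>) *\<^sub>C (qf s k * qK * qe (Suc 0))"
    by (simp_all add: e_comb_qe mult_scaleC_right)
qed

section \<open>Words in the block of \<open>qe 0\<close>\<close>

definition fword :: "(free_sign \<times> 'i) list \<Rightarrow> 'i Q" where
  "fword w = prod_list (map (\<lambda>(s, j). qf s j) w)"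

lemma fword_simps: "fword [] = 1" "fword ((s, j) # w) = qf s j * fword w"
  by (simp_all add: fword_def)

text \<open>The only contraction term is \<open>qe 1\<close>, which dies here: in this block the f's
  generate a Grassmann algebra.\<close>

lemma qf_anticomm_qe0: "qf s i * (qf t j * qe 0) = - (qf t j * (qf s i * qe 0))"
proof -
  have "(qf s i * qf t j) * qe 0 = - (qf t j * qf s i) * qe 0"
    using qf_anticomm[of s i j] qf_Pl_Mi[of i j] qf_Mi_Pl[of i j]
    by (cases s; cases t) (auto simp: left_diff_distrib qe_mult)
  then show ?thesis by (simp add: mult.assoc)
qed

lemma qf_pair_fword_qe0:
  "qf s i * (qf t j * (fword w * qe 0)) = fword w * (qf s i * (qf t j * qe 0))"
proof (induction w)
  case (Cons x w)
  obtain u k where x: "x = (u, k)" by (cases x)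
  have "qf s i * (qf t j * (qf u k * (qe 0 * y))) = qf u k * (qf s i * (qf t j * (qe 0 * y)))" for y
  proof -
    have "qf s i * (qf t j * (qf u k * qe 0)) = - (qf s i * (qf u k * (qf t j * qe 0)))"
      by (subst qf_anticomm_qe0[of t]) simp
    also have "qf s i * (qf u k * (qf t j * qe 0)) = (qf s i * (qf u k * qe 0)) * qf t j"
      by (simp only: qe_central mult.assoc)
    also have "\<dots> = - (qf u k * (qf s i * (qf t j * qe 0)))"
      by (subst qf_anticomm_qe0[of s]) (simp add: mult.assoc qe_central)
    finally have "qf s i * (qf t j * (qf u k * qe 0)) = qf u k * (qf s i * (qf t j * qe 0))" by simp
    from arg_cong[where f = "\<lambda>z. z * y", OF this] show ?thesis by (simp add: mult.assoc)
  qed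
  from this[of "fword w"] show ?case
    using Cons by (simp add: x fword_simps mult.assoc qe_central)
qed (simp add: fword_simps)

text \<open>The antipode reverses a pair of generators and puts a \<open>qK\<close> behind each.
  Moving one \<open>qK\<close> out costs a sign, which cancels the sign of restoring the order.
  Pairs commute with all words, so the word may be consumed two letters at a time.\<close>

lemma antipode_fword_qe0:
  "even (length w) \<Longrightarrow> antipode (fword w) * qe 0 = fword w * qe 0"
proof (induction w rule: induct_list012)
  case (3 x y w)
  obtain s i t j where xy: "x = (s, i)" "y = (t, j)" by (cases x; cases y)
  have "antipode (qf t j) * (antipode (qf s i) * qe 0) = antipode (qf t j) * qe 0 * (qf s i * qK)"
    by (simp only: antipode_qf_qe(1)[of s i]) (simp only: mult.assoc qe_central)
  also have "\<dots> = qf t j * (qK * (qf s i * (qK * qe 0)))"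
    by (simp only: antipode_qf_qe) (simp only: mult.assoc qe_central)
  also have "\<dots> = qf s i * (qf t j * qe 0)"
    by (simp add: qK_qf_left qK_qK_qe) (simp add: qf_anticomm_qe0[of t])
  finally have st: "antipode (qf t j) * (antipode (qf s i) * qe 0) = qf s i * (qf t j * qe 0)" .
  have "antipode (fword (x # y # w)) * qe 0 =
      antipode (fword w) * (antipode (qf t j) * (antipode (qf s i) * qe 0))"
    by (simp add: xy fword_simps antipode_mult mult.assoc)
  also have "\<dots> = (antipode (fword w) * qe 0) * (qf s i * qf t j)"
    by (simp add: st mult.assoc qe_central)
  also have "\<dots> = fword w * (qf s i * (qf t j * qe 0))"
    using 3 by (simp add: mult.assoc qe_central)
  also have "\<dots> = fword (x # y # w) * qe 0"
    by (simp add: qf_pair_fword_qe0[symmetric] xy fword_simps mult.assoc)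
  finally show ?case .
qed (simp_all add: fword_simps antipode_one)

lemmas lin_simps = distrib_left distrib_right left_diff_distrib right_diff_distrib
  mult_scaleC_left mult_scaleC_right scaleC_scaleC scaleC_add_right cvec.scale_right_diff_distrib
  cvec.scale_minus_left cvec.scale_minus_right scaleC_one

section \<open>The monodromy matrix\<close>

lemma tens_ordered_prod:
  "ordered_prod (\<lambda>j. a j \<otimes>\<^sub>C b j) = ordered_prod a \<otimes>\<^sub>C ordered_prod b"
proof -
  have "prod_list (map (\<lambda>j. a j \<otimes>\<^sub>C b j) xs) = prod_list (map a xs) \<otimes>\<^sub>C prod_list (map b xs)" for xs
    by (induction xs) (simp_all add: tens_one tens_mult)
  then show ?thesis by (simp add: ordered_prod_def)
qed

lemma tensor_flip_one: "tensor_flip 1 = 1"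
  by (metis tens_one tensor_flip_tens)

lemma tensor_flip_ordered_prod: "tensor_flip (ordered_prod g) = ordered_prod (\<lambda>j. tensor_flip (g j))"
proof -
  have "tensor_flip (prod_list (map g xs)) = prod_list (map (\<lambda>j. tensor_flip (g j)) xs)" for xs
    by (induction xs) (simp_all add: tensor_flip_one tensor_flip_mult)
  then show ?thesis by (simp add: ordered_prod_def)
qed

lemma tens_central:
  assumes "\<And>x. e * x = x * e" "\<And>x. e' * x = x * e'"
  shows "(e \<otimes>\<^sub>C e') * t = t * (e \<otimes>\<^sub>C e')"
  by (rule tensor_square_linear_eqI[OF clinear_mult_left clinear_mult_right])
    (simp add: tens_mult assms)

text \<open>Coordinates in the commutative algebra spanned by E, XE, YE and XYE, where X and Y
  square to scalars on E. For X = K\<otimes>1 and Y = 1\<otimes>K this turns identities between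
  Cartan parts into identities between scalars.\<close>

definition val4 :: "'a::complex_alg \<Rightarrow> 'a \<Rightarrow> 'a \<Rightarrow> complex \<Rightarrow> complex \<Rightarrow> complex \<Rightarrow> complex \<Rightarrow> 'a" where
  "val4 E X Y a b c d = a *\<^sub>C E + b *\<^sub>C (X * E) + c *\<^sub>C (Y * E) + d *\<^sub>C (X * (Y * E))"

context
  fixes E X Y :: "'a::complex_alg" and s t :: complex
  assumes E: "\<And>x. E * x = x * E" "E * E = E" and XY: "Y * X = X * Y"
    and sq: "X * (X * E) = s *\<^sub>C E" "Y * (Y * E) = t *\<^sub>C E"
begin

lemma val4_rules: "Y * (X * z) = X * (Y * z)" "X * (X * (Y * E)) = s *\<^sub>C (Y * E)"
  "E * X = X * E" "E * Y = Y * E" "E * (X * z) = X * (E * z)" "E * (Y * z) = Y * (E * z)"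
proof -
  show 1: "Y * (X * z) = X * (Y * z)" for z by (simp add: XY flip: mult.assoc)
  have "X * (X * (Y * E)) = Y * (X * (X * E))" by (simp add: 1)
  then show "X * (X * (Y * E)) = s *\<^sub>C (Y * E)" by (simp add: sq mult_scaleC_right)
  show "E * X = X * E" "E * Y = Y * E" by (rule E)+
  show "E * (X * z) = X * (E * z)" "E * (Y * z) = Y * (E * z)"
    by (simp_all add: E(1) mult.assoc)
qed

lemma val4_mult:
  "val4 E X Y a b c d * val4 E X Y a' b' c' d' =
    val4 E X Y (a * a' + s * b * b' + t * c * c' + s * t * d * d')
      (a * b' + b * a' + t * c * d' + t * d * c')
      (a * c' + c * a' + s * b * d' + s * d * b')
      (a * d' + d * a' + b * c' + c * b')"
  unfolding val4_def
  by (simp add: distrib_left distrib_right mult_scaleC_left mult_scaleC_right scaleC_scaleC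
      scaleC_add_left scaleC_add_right mult.assoc E(2) XY sq val4_rules)
    (simp add: ac_simps)

text \<open>The four equations in \<open>eqs\<close> compare, in this order, the coefficients of FE,
  FXE, FYE and FXYE; the signs arise from moving F to the left past X and Y.\<close>

lemma val4_intertwine:
  assumes F: "X * F = - (F * X)" "Y * F = - (F * Y)"
    and eqs: "r * t * c = - p * s * b" "r * t * d = p * a" "r * a = p * s * d" "r * b = - p * c"
  shows "(1 + r *\<^sub>C (F * Y)) * val4 E X Y a b c d = val4 E X Y a b c d * (1 + p *\<^sub>C (F * X))"
proof -
  have F': "X * (F * z) = - (F * (X * z))" "Y * (F * z) = - (F * (Y * z))" for z
    using arg_cong[where f = "\<lambda>y. y * z", OF F(1)] arg_cong[where f = "\<lambda>y. y * z", OF F(2)]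
    by (simp_all add: mult.assoc)
  have E': "E * (F * z) = F * (E * z)" for z by (simp add: E(1) mult.assoc)
  have "r *\<^sub>C (F * Y * val4 E X Y a b c d) =
      F * ((r * t * c) *\<^sub>C E + (r * t * d) *\<^sub>C (X * E) + (r * a) *\<^sub>C (Y * E) + (r * b) *\<^sub>C (X * (Y * E)))"
    unfolding val4_def
    by (simp add: distrib_left mult_scaleC_right scaleC_scaleC scaleC_add_right mult.assoc sq
        val4_rules ac_simps)
  also have "\<dots> = p *\<^sub>C (val4 E X Y a b c d * (F * X))"
    unfolding val4_def eqs
    by (simp add: lin_simps mult.assoc sq val4_rules F' E' XY ac_simps)
  finally show ?thesis
    by (simp add: distrib_left distrib_right mult_scaleC_left mult_scaleC_right)
qed

end

section \<open>The Cartan part of the R-matrix on the four blocks\<close>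

definition sector :: "nat \<Rightarrow> nat \<Rightarrow> (bool, 'i Q) tpow" where
  "sector n m = qe n \<otimes>\<^sub>C qe m"

lemma sector_central: "sector n m * t = t * sector n m"
  unfolding sector_def by (rule tens_central) (rule qe_central)+

lemma sector_sum:
  "sector 0 0 + sector 0 (Suc 0) + sector (Suc 0) 0 + sector (Suc 0) (Suc 0) = (1 :: (bool, 'i Q) tpow)"
proof -
  have "sector 0 0 + sector 0 (Suc 0) + sector (Suc 0) 0 + sector (Suc 0) (Suc 0) =
      (qe 0 + qe (Suc 0)) \<otimes>\<^sub>C (qe 0 + qe (Suc 0) :: 'i Q)"
    by (simp add: sector_def tens_add_left tens_add_right add.assoc)
  then show ?thesis by (simp add: qe_sum tens_one)
qed

lemma tens_zero: "0 \<otimes>\<^sub>C y = 0" "x \<otimes>\<^sub>C 0 = 0"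
  by (rule clinear_zero[OF clinear_tens_left], rule clinear_zero[OF clinear_tens_right])

lemma sector_mult:
  assumes "n \<in> {0, 1}" "m \<in> {0, 1}" "n' \<in> {0, 1}" "m' \<in> {0, 1}"
  shows "sector n m * sector n' m' = (if n = n' \<and> m = m' then sector n m else 0)"
  using assms by (auto simp: sector_def tens_mult qe_mult tens_zero)

lemma rho_eq:
  "rho n m = (1/2) *\<^sub>C (1 \<otimes>\<^sub>C 1) + (\<i> powi (- int n) / 2) *\<^sub>C (qK \<otimes>\<^sub>C 1) +
     (\<i> powi int m / 2) *\<^sub>C (1 \<otimes>\<^sub>C qK) + (- (\<i> powi (- int n + int m)) / 2) *\<^sub>C (qK \<otimes>\<^sub>C qK)"
  by (simp add: rho_def lin_simps ac_simps)

abbreviation sval :: "nat \<Rightarrow> nat \<Rightarrow> complex \<Rightarrow> complex \<Rightarrow> complex \<Rightarrow> complex \<Rightarrow> (bool, 'i Q) tpow" where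
  "sval n m \<equiv> val4 (sector n m) (qK \<otimes>\<^sub>C 1) (1 \<otimes>\<^sub>C qK)"

lemma rho_sector:
  "rho n m * sector n' m' = sval n' m' (1/2) (\<i> powi (- int n) / 2) (\<i> powi int m / 2)
     (- (\<i> powi (- int n + int m)) / 2)"
  unfolding rho_eq val4_def
  by (simp add: lin_simps tens_one tens_mult flip: mult.assoc)

lemma flip_rho_sector:
  "tensor_flip (rho m n) * sector n' m' = sval n' m' (1/2) (\<i> powi int n / 2)
     (\<i> powi (- int m) / 2) (- (\<i> powi (- int m + int n)) / 2)"
  unfolding rho_eq val4_def
  by (simp add: clinear_add[OF clinear_tensor_flip] clinear_scaleC[OF clinear_tensor_flip]
      clinear_diff[OF clinear_tensor_flip] tensor_flip_one
      tensor_flip_tens lin_simps tens_one tens_mult flip: mult.assoc)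

definition sgn_sector :: "nat \<Rightarrow> complex" where
  "sgn_sector n = (if n = 0 then 1 else -1)"

lemma sector_sq:
  assumes "n \<in> {0, 1}" "m \<in> {0, 1}"
  shows "(qK \<otimes>\<^sub>C 1) * ((qK \<otimes>\<^sub>C 1) * sector n m) = sgn_sector n *\<^sub>C sector n m"
    "(1 \<otimes>\<^sub>C qK) * ((1 \<otimes>\<^sub>C qK) * sector n m) = sgn_sector m *\<^sub>C sector n m"
    "sector n m * sector n m = sector n m"
  using assms
  by (auto simp: sector_def tens_mult qK_qK_qe qe_mult tens_uminus_left tens_uminus_right
      sgn_sector_def scaleC_one cvec.scale_minus_left)

lemma tens_qK_commute:
  "(1 \<otimes>\<^sub>C qK) * (qK \<otimes>\<^sub>C 1) = (qK \<otimes>\<^sub>C 1) * (1 \<otimes>\<^sub>C qK :: (bool, 'i Q) tpow)"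
  by (simp add: tens_mult)

text \<open>The scalars that the powers of \<open>qK\<close> in the factors of the flipped R-matrix (\<open>local_a\<close>) and of
  the R-matrix (\<open>local_b\<close>) contribute on the block of \<open>sector n m\<close>, after the Cartan part of the
  R-matrix has been moved to the left of both products.\<close>

definition local_a :: "nat \<Rightarrow> nat \<Rightarrow> complex" where
  "local_a n m = (if n = 0 then (if m = 0 then 2 else -2) else (if m = 0 then - 2 * \<i> else 2 * \<i>))"

definition local_b :: "nat \<Rightarrow> complex" where
  "local_b n = (if n = 0 then -2 else 2 * \<i>)"

lemma powi_minus_1: "\<i> powi (-1) = -\<i>"
  by (simp add: power_int_minus)

text \<open>Each Cartan factor has four terms, but on a block their product collapses to a single
  one. It is the source of the powers of \<open>qK\<close> in the two legs of the monodromy.\<close>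

lemma flip_rho_rho:
  assumes "n \<in> {0, 1}" "m \<in> {0, 1}"
  shows "tensor_flip (rho m n) * (rho n m * (sector n m :: (bool, 'i Q) tpow)) =
    (-1) ^ (n * m) *\<^sub>C ((qK ^ m \<otimes>\<^sub>C qK ^ n) * sector n m)"
proof -
  let ?E = "sector n m :: (bool, 'i Q) tpow"
  have "tensor_flip (rho m n) * (rho n m * ?E) = tensor_flip (rho m n) * (rho n m * (?E * ?E))"
    by (simp only: sector_sq(3)[OF assms])
  also have "\<dots> = (tensor_flip (rho m n) * ?E) * (rho n m * ?E)"
    using sector_central[of n m "rho n m * ?E"] by (simp only: mult.assoc)
  also have "\<dots> = (-1) ^ (n * m) *\<^sub>C ((qK ^ m \<otimes>\<^sub>C qK ^ n) * ?E)"
    unfolding rho_sector flip_rho_sector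
      val4_mult[OF sector_central sector_sq(3)[OF assms] tens_qK_commute sector_sq(1,2)[OF assms]]
    using assms
    by (auto simp: val4_def sgn_sector_def powi_minus_1 tens_one tens_mult scaleC_one
        cvec.scale_minus_left simp flip: mult.assoc)
  finally show ?thesis .
qed

text \<open>Passing the Cartan part trades the \<open>qK\<close> in the second leg for one in the
  first. Afterwards the factors of both halves of the monodromy carry \<open>qK\<close> in the first
  leg and can be multiplied site by site.\<close>

lemma local_intertwine:
  assumes "n \<in> {0, 1}" "m \<in> {0, 1}"
  shows "(1 + local_b m *\<^sub>C (qf Pl k \<otimes>\<^sub>C (qf Mi k * qK))) * (rho n m * sector n m) =
    (rho n m * sector n m) * (1 + local_a n m *\<^sub>C ((qf Pl k * qK) \<otimes>\<^sub>C qf Mi k))"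
proof -
  let ?F = "qf Pl k \<otimes>\<^sub>C qf Mi k" and ?X = "qK \<otimes>\<^sub>C 1" and ?Y = "1 \<otimes>\<^sub>C qK"
  have F: "qf Pl k \<otimes>\<^sub>C (qf Mi k * qK) = ?F * ?Y" "(qf Pl k * qK) \<otimes>\<^sub>C qf Mi k = ?F * ?X"
    by (simp_all add: tens_mult)
  have "?X * ?F = - (?F * ?X)" "?Y * ?F = - (?F * ?Y)"
    by (simp_all add: tens_mult qK_qf tens_uminus_left tens_uminus_right)
  then show ?thesis
    unfolding F rho_sector using assms
    by (intro val4_intertwine[OF sector_central sector_sq(3)[OF assms] tens_qK_commute sector_sq(1,2)[OF assms]])
      (auto simp: local_a_def local_b_def sgn_sector_def powi_minus_1)
qed

section \<open>Local factors of the monodromy\<close>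

definition R_local :: "'i \<Rightarrow> (bool, 'i Q) tpow" where
  "R_local k = 1 \<otimes>\<^sub>C 1 - 2 *\<^sub>C ((qf Mi k * omega Mi) \<otimes>\<^sub>C qf Pl k)"

text \<open>On each block \<open>omega Mi\<close> is a multiple of \<open>qK\<close>, and the scalar
  is written so that the coefficient -2 in the R-matrix turns it into
  \<open>local_b\<close>.\<close>

lemma omega_Mi_qe: "n \<in> {0, 1} \<Longrightarrow> omega Mi * (qe n :: 'a Q) = (- local_b n / 2) *\<^sub>C (qK * qe n)"
proof -
  have "omega Mi = e_comb (-\<i>) * (qK :: 'a Q)" by (simp add: omega_def e_comb_def)
  then have "omega Mi * qe n = qK * (e_comb (-\<i>) * (qe n :: 'a Q))"
    by (simp only: e_comb_central mult.assoc)
  then show "n \<in> {0, 1} \<Longrightarrow> omega Mi * (qe n :: 'a Q) = (- local_b n / 2) *\<^sub>C (qK * qe n)"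
    by (auto simp: e_comb_qe local_b_def lin_simps)
qed

lemma R_local_sector:
  assumes "n \<in> {0, 1}"
  shows "R_local k * sector n m = (1 + local_b n *\<^sub>C ((qf Mi k * qK) \<otimes>\<^sub>C qf Pl k)) * sector n m"
  by (simp add: R_local_def sector_def lin_simps tens_one tens_mult mult.assoc omega_Mi_qe[OF assms]
      tens_scaleC_left tens_uminus_left)

lemma flip_R_local_sector:
  assumes "m \<in> {0, 1}"
  shows "tensor_flip (R_local k) * sector n m =
    (1 + local_b m *\<^sub>C (qf Pl k \<otimes>\<^sub>C (qf Mi k * qK))) * sector n m"
  by (simp add: R_local_def sector_def lin_simps tens_mult mult.assoc omega_Mi_qe[OF assms]
      tens_scaleC_right tens_uminus_right clinear_diff[OF clinear_tensor_flip]
      clinear_scaleC[OF clinear_tensor_flip] tensor_flip_tens tensor_flip_one tens_one)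

lemma R_matrix_sector:
  assumes "n \<in> {0, 1}" "m \<in> {0, 1}"
  shows "R_matrix \<beta> * sector n m = \<beta> ^ (n * m) *\<^sub>C (rho n m * sector n m * ordered_prod R_local)"
proof -
  let ?P = "ordered_prod R_local"
  let ?T = "\<Sum>n\<in>{0,1}. \<Sum>m\<in>{0,1}. \<beta> ^ (n * m) *\<^sub>C (rho n m * sector n m)"
  have "R_matrix \<beta> * sector n m = ?T * sector n m * ?P"
    by (simp only: R_matrix_def R_local_def[abs_def] sector_def[symmetric] mult.assoc sector_central)
  also have "?T * sector n m = \<beta> ^ (n * m) *\<^sub>C (rho n m * sector n m)"
    using assms
    by (auto simp: distrib_right mult_scaleC_left mult.assoc sector_mult)
  finally show ?thesis by (simp add: mult_scaleC_left)
qed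

lemma flip_sector: "tensor_flip (sector n m) = sector m n"
  by (simp add: sector_def tensor_flip_tens)

lemma flip_R_matrix_sector:
  assumes "n \<in> {0, 1}" "m \<in> {0, 1}"
  shows "tensor_flip (R_matrix \<beta>) * sector n m = \<beta> ^ (n * m) *\<^sub>C (tensor_flip (rho m n) *
    sector n m * ordered_prod (\<lambda>k. tensor_flip (R_local k)))"
  using arg_cong[where f = tensor_flip, OF R_matrix_sector[OF assms(2,1), of \<beta>]]
  by (simp add: tensor_flip_mult flip_sector clinear_scaleC[OF clinear_tensor_flip]
      tensor_flip_ordered_prod mult.commute)

definition M_local :: "nat \<Rightarrow> nat \<Rightarrow> 'i \<Rightarrow> (bool, 'i Q) tpow" where
  "M_local n m k = (1 + local_a n m *\<^sub>C ((qf Pl k * qK) \<otimes>\<^sub>C qf Mi k)) *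
     (1 + local_b n *\<^sub>C ((qf Mi k * qK) \<otimes>\<^sub>C qf Pl k))"

text \<open>Doubling the central idempotent gives each half of the monodromy its own copy. The power
  of \<beta>^2 comes from the two prefactors, the sign from \<open>flip_rho_rho\<close>.\<close>

lemma monodromy_sector_local:
  assumes "n \<in> {0, 1}" "m \<in> {0, 1}"
  shows "monodromy \<beta> * (sector n m :: (bool, 'a::{finite,linorder} Q) tpow) =
    (\<beta> ^ 2) ^ (n * m) *\<^sub>C (-1) ^ (n * m) *\<^sub>C
    ((qK ^ m \<otimes>\<^sub>C qK ^ n) * ordered_prod (M_local n m) * sector n m)"
proof -
  let ?E = "sector n m :: (bool, 'a Q) tpow" and ?\<rho> = "rho n m :: (bool, 'a Q) tpow"
    and ?\<rho>' = "tensor_flip (rho m n) :: (bool, 'a Q) tpow"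
  let ?A = "\<lambda>k :: 'a. 1 + local_b m *\<^sub>C (qf Pl k \<otimes>\<^sub>C (qf Mi k * qK))"
  let ?A' = "\<lambda>k :: 'a. 1 + local_a n m *\<^sub>C ((qf Pl k * qK) \<otimes>\<^sub>C qf Mi k)"
  let ?B = "\<lambda>k :: 'a. 1 + local_b n *\<^sub>C ((qf Mi k * qK) \<otimes>\<^sub>C qf Pl k)"
  let ?P = "ordered_prod (R_local :: 'a \<Rightarrow> _)"
    and ?P' = "ordered_prod (\<lambda>k :: 'a. tensor_flip (R_local k))"
  have E_left: "?E * (t * x) = t * (?E * x)" for t x
    using arg_cong[where f = "\<lambda>y. y * x", OF sector_central[of n m t]] by (simp only: mult.assoc)
  \<comment> \<open>Exchanging the two sites produces one sign in each leg, and these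
    cancel.\<close>
  have comm: "?B i * ?A' j = ?A' j * ?B i" if ij: "i \<noteq> j" for i j :: 'a
  proof -
    have "(qf Mi i * qK) \<otimes>\<^sub>C qf Pl i * (qf Pl j * qK) \<otimes>\<^sub>C qf Mi j =
        (qf Pl j * qK) \<otimes>\<^sub>C qf Mi j * (qf Mi i * qK) \<otimes>\<^sub>C qf Pl i"
      using qf_anticomm_neq[OF ij, of Pl Mi] qf_qf_neq_left[OF ij, of Mi Pl]
      by (simp add: tens_mult mult.assoc qK_qf_left tens_uminus_left tens_uminus_right)
    then show ?thesis
      by (simp add: lin_simps ac_simps)
  qed
  have "monodromy \<beta> * ?E = tensor_flip (R_matrix \<beta>) * (R_matrix \<beta> * (?E * ?E))"
    by (simp only: monodromy_def mult.assoc sector_sq(3)[OF assms])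
  also have "\<dots> = (tensor_flip (R_matrix \<beta>) * ?E) * (R_matrix \<beta> * ?E)"
    using sector_central[of n m "R_matrix \<beta> * ?E"] by (simp only: mult.assoc)
  also have "\<dots> = (\<beta> ^ (n * m) * \<beta> ^ (n * m)) *\<^sub>C (?\<rho>' * ((?P' * ?E) * (?\<rho> * (?P * ?E))))"
    unfolding R_matrix_sector[OF assms] flip_R_matrix_sector[OF assms]
    by (simp only: mult_scaleC_left mult_scaleC_right scaleC_scaleC mult.assoc
        sector_central[of n m ?P] E_left[of ?P'])
  also have "?P' * ?E = ordered_prod ?A * ?E"
    by (rule ordered_prod_cong_idem[OF sector_central flip_R_local_sector[OF assms(2)]])
  also have "?P * ?E = ordered_prod ?B * ?E"
    by (rule ordered_prod_cong_idem[OF sector_central R_local_sector[OF assms(1)]])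
  also have "?\<rho>' * ((ordered_prod ?A * ?E) * (?\<rho> * (ordered_prod ?B * ?E))) =
      ?\<rho>' * ((ordered_prod ?A * (?\<rho> * ?E)) * (ordered_prod ?B * ?E))"
    by (simp only: mult.assoc E_left[of ?\<rho>])
  also have "ordered_prod ?A * (?\<rho> * ?E) = (?\<rho> * ?E) * ordered_prod ?A'"
    by (rule ordered_prod_intertwine[OF local_intertwine[OF assms]])
  also have "?\<rho>' * ((?\<rho> * ?E) * ordered_prod ?A' * (ordered_prod ?B * ?E)) =
      (?\<rho>' * (?\<rho> * ?E)) * (ordered_prod ?A' * ordered_prod ?B) * ?E"
    by (simp only: mult.assoc)
  also have "ordered_prod ?A' * ordered_prod ?B = ordered_prod (M_local n m)"
    unfolding M_local_def[abs_def] by (rule ordered_prod_mult_distrib) (rule comm)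
  also have "?\<rho>' * (?\<rho> * ?E) = (-1) ^ (n * m) *\<^sub>C ((qK ^ m \<otimes>\<^sub>C qK ^ n) * ?E)"
    by (rule flip_rho_rho[OF assms])
  finally have "monodromy \<beta> * ?E = (\<beta> ^ (n * m) * \<beta> ^ (n * m)) *\<^sub>C
      ((-1) ^ (n * m) *\<^sub>C ((qK ^ m \<otimes>\<^sub>C qK ^ n) * ?E) * ordered_prod (M_local n m) * ?E)" .
  also have "\<dots> = (\<beta> ^ 2) ^ (n * m) *\<^sub>C (-1) ^ (n * m) *\<^sub>C
      ((qK ^ m \<otimes>\<^sub>C qK ^ n) * (ordered_prod (M_local n m) * (?E * ?E)))"
    by (simp only: mult_scaleC_left mult.assoc E_left[of "ordered_prod (M_local n m)"]
        power2_eq_square power_mult_distrib)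
  finally show ?thesis by (simp only: sector_sq(3)[OF assms] mult.assoc)
qed

section \<open>Expansion of the monodromy into monomials\<close>

definition rloc :: "'i \<Rightarrow> bool \<times> bool \<Rightarrow> 'i Q" where
  "rloc j c = qf Mi j ^ of_bool (fst c) * qf Pl j ^ of_bool (snd c)"

definition odd_deg :: "bool \<times> bool \<Rightarrow> nat" where
  "odd_deg c = of_bool (fst c \<noteq> snd c)"

text \<open>The bits of \<open>c\<close> say which of the two nontrivial terms of
  \<open>M_local\<close> are chosen. If both are, the two scalars multiply and f^+ K f^- K = - f^+
  f^- K^2; with the sign of K^2 on the block this gives 4 or -4, and no \<open>qK\<close> is left
  over.\<close>

definition weight :: "nat \<Rightarrow> nat \<Rightarrow> bool \<times> bool \<Rightarrow> complex" where
  "weight n m c = (if fst c then (if snd c then (-1) ^ m * 4 else local_a n m)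
     else (if snd c then local_b n else 1))"

lemma M_local_sector:
  assumes "n \<in> {0, 1}" "m \<in> {0, 1}"
  shows "M_local n m k * sector n m =
    (\<Sum>c\<in>UNIV. weight n m c *\<^sub>C ((loc k c * qK ^ odd_deg c) \<otimes>\<^sub>C rloc k c)) * sector n m"
  using assms
  by (auto simp: sum_UNIV_bool_pair loc_simps rloc_def odd_deg_def weight_def M_local_def
      local_a_def local_b_def sector_def tens_mult lin_simps mult.assoc qK_qf_left qK_qK_qe
      tens_uminus_left tens_uminus_right tens_one ac_simps)

theorem monodromy_sector:
  assumes "n \<in> {0, 1}" "m \<in> {0, 1}"
  shows "monodromy \<beta> * (sector n m :: (bool, 'i::{finite,linorder} Q) tpow) =
    (- (\<beta> ^ 2)) ^ (n * m) *\<^sub>C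
    (\<Sum>c\<in>UNIV. (\<Prod>j\<in>UNIV. weight n m (c j)) *\<^sub>C
      ((qK ^ m * ordered_prod (\<lambda>j. loc j (c j) * qK ^ odd_deg (c j)) * qe n) \<otimes>\<^sub>C
       (qK ^ n * ordered_prod (\<lambda>j. rloc j (c j)) * qe m)))"
proof -
  let ?g = "\<lambda>j c. weight n m c *\<^sub>C ((loc j c * qK ^ odd_deg c) \<otimes>\<^sub>C rloc j c)"
  have "ordered_prod (M_local n m) * (sector n m :: (bool, 'i Q) tpow) =
      ordered_prod (\<lambda>j. \<Sum>c\<in>UNIV. ?g j c) * sector n m"
    by (rule ordered_prod_cong_idem[OF sector_central M_local_sector[OF assms]])
  also have "ordered_prod (\<lambda>j. \<Sum>c\<in>UNIV. ?g j c) = (\<Sum>c\<in>UNIV. (\<Prod>j\<in>UNIV. weight n m (c j)) *\<^sub>C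
      (ordered_prod (\<lambda>j. loc j (c j) * qK ^ odd_deg (c j)) \<otimes>\<^sub>C ordered_prod (\<lambda>j. rloc j (c j))))"
    by (simp add: ordered_prod_sum ordered_prod_scaleC tens_ordered_prod)
  finally have P0: "ordered_prod (M_local n m) * sector n m =
      (\<Sum>c\<in>UNIV. (\<Prod>j\<in>UNIV. weight n m (c j)) *\<^sub>C
      (ordered_prod (\<lambda>j. loc j (c j) * qK ^ odd_deg (c j)) \<otimes>\<^sub>C ordered_prod (\<lambda>j. rloc j (c j)))) *
      (sector n m :: (bool, 'i Q) tpow)" .
  have P: "(qK ^ m \<otimes>\<^sub>C qK ^ n) * (ordered_prod (M_local n m) * (sector n m :: (bool, 'i Q) tpow)) =
    (\<Sum>c\<in>UNIV. (\<Prod>j\<in>UNIV. weight n m (c j)) *\<^sub>C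
      ((qK ^ m * ordered_prod (\<lambda>j. loc j (c j) * qK ^ odd_deg (c j)) * qe n) \<otimes>\<^sub>C
       (qK ^ n * ordered_prod (\<lambda>j. rloc j (c j)) * qe m)))"
    unfolding P0
    by (simp add: sum_distrib_left sum_distrib_right mult_scaleC_left mult_scaleC_right sector_def
        tens_mult mult.assoc)
  have "(\<beta> ^ 2) ^ (n * m) * (-1) ^ (n * m) = (- (\<beta> ^ 2)) ^ (n * m)"
    by (metis mult_minus1_right power_mult_distrib)
  then show ?thesis
    unfolding monodromy_sector_local[OF assms]
    by (simp only: P mult.assoc scaleC_scaleC)
qed

section \<open>The S-transformation on the two blocks of \<open>Q\<close>\<close>

definition lam :: "nat \<Rightarrow> complex \<Rightarrow> complex \<Rightarrow> complex" where
  "lam N \<nu> \<beta> = (-1) ^ N * \<nu> * \<beta> ^ 2 * 2 powi (1 - int N)"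

lemma Lambda_hat_eq: "Lambda_hat \<nu> \<beta> (x :: 'i::{finite,linorder} Q) = lam CARD('i) \<nu> \<beta> * top_coef x"
  by (simp add: Lambda_hat_def lam_def coord_top_representation top_coef_def)

lemma top_coef_add: "top_coef (x + y) = top_coef x + top_coef y"
  and top_coef_scaleC: "top_coef (c *\<^sub>C x) = c * top_coef x"
  and top_coef_zero: "top_coef 0 = 0"
  by (simp_all add: top_coef_def coord_add coord_scaleC coord_zero)

definition S_comp :: "complex \<Rightarrow> complex \<Rightarrow> 'i::{finite,linorder} Q \<Rightarrow> (bool, 'i Q) tpow \<Rightarrow> 'i Q" where
  "S_comp \<nu> \<beta> z = tensor_lift (\<lambda>a. Lambda_hat \<nu> \<beta> (a False * z) *\<^sub>C antipode (a True))"

lemma multilin_S_comp: "multilin (\<lambda>a. Lambda_hat \<nu> \<beta> (a False * z) *\<^sub>C antipode (a True))"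
  by (rule multilin_boolI[of "\<lambda>x y. Lambda_hat \<nu> \<beta> (x * z) *\<^sub>C antipode y"]; rule clinearI)
    (simp_all add: Lambda_hat_eq lin_simps top_coef_add top_coef_scaleC scaleC_add_left
      clinear_add[OF clinear_antipode] clinear_scaleC[OF clinear_antipode] ac_simps)

lemma clinear_S_comp: "clinear (S_comp \<nu> \<beta> z)"
  unfolding S_comp_def by (rule clinear_tensor_lift[OF multilin_S_comp])

lemma S_comp_tens: "S_comp \<nu> \<beta> z (x \<otimes>\<^sub>C y) = Lambda_hat \<nu> \<beta> (x * z) *\<^sub>C antipode y"
  unfolding S_comp_def tens_def by (subst tensor_lift_pure[OF multilin_S_comp]) simp

lemma S_Z_eq: "S_Z \<nu> \<beta> z = S_comp \<nu> \<beta> z (monodromy \<beta>)"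
  by (simp add: S_Z_def S_comp_def)

text \<open>The argument sits inside the multilinear map that is lifted, so linearity in it is
  checked on pure tensors.\<close>

lemma clinear_S_Z: "clinear (S_Z \<nu> \<beta> :: 'i::{finite,linorder} Q \<Rightarrow> 'i Q)"
proof -
  have "S_comp \<nu> \<beta> (z + z') t = S_comp \<nu> \<beta> z t + S_comp \<nu> \<beta> z' t" for z z' :: "'i Q" and t
  proof (rule tensor_square_linear_eqI[OF clinear_S_comp, of "\<lambda>t. S_comp \<nu> \<beta> z t + S_comp \<nu> \<beta> z' t"])
    show "clinear (\<lambda>t. S_comp \<nu> \<beta> z t + S_comp \<nu> \<beta> z' t)"
      by (rule clinearI) (simp_all add: clinear_add[OF clinear_S_comp]
          clinear_scaleC[OF clinear_S_comp] scaleC_add_right)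
  qed (simp add: S_comp_tens Lambda_hat_eq lin_simps top_coef_add scaleC_add_left)
  moreover have "S_comp \<nu> \<beta> (c *\<^sub>C z) t = c *\<^sub>C S_comp \<nu> \<beta> z t" for c and z :: "'i Q" and t
  proof (rule tensor_square_linear_eqI[OF clinear_S_comp, of "\<lambda>t. c *\<^sub>C S_comp \<nu> \<beta> z t"])
    show "clinear (\<lambda>t. c *\<^sub>C S_comp \<nu> \<beta> z t)"
      by (rule clinearI) (simp_all add: clinear_add[OF clinear_S_comp]
          clinear_scaleC[OF clinear_S_comp] lin_simps mult.commute)
  qed (simp add: S_comp_tens Lambda_hat_eq lin_simps top_coef_scaleC ac_simps)
  ultimately show ?thesis unfolding S_Z_eq[abs_def] by (intro clinearI)
qed

lemma S_comp_sector_zero: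
  assumes "n \<in> {0, 1}" "n' \<in> {0, 1}" "n \<noteq> n'" "z * qe n = z"
  shows "S_comp \<nu> \<beta> z (t * sector n' m) = 0"
proof (rule tensor_square_linear_eqI[of "\<lambda>t. S_comp \<nu> \<beta> z (t * sector n' m)" "\<lambda>_. 0"])
  show "clinear (\<lambda>t. S_comp \<nu> \<beta> z (t * sector n' m))"
    by (rule clinear_compose[OF clinear_mult_right clinear_S_comp])
  show "clinear (\<lambda>t :: (bool, 'a Q) tpow. 0 :: 'a Q)" by (rule clinearI) simp_all
  have "z * (qe n * qe n') = 0" using assms(1-3) by (auto simp: qe_mult)
  then have "z * qe n' = 0" by (metis assms(4) mult.assoc)
  then have "qe n' * z = 0" by (simp add: qe_central)
  then show "S_comp \<nu> \<beta> z (x \<otimes>\<^sub>C y * sector n' m) = 0" for x y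
    by (simp add: sector_def tens_mult S_comp_tens mult.assoc Lambda_hat_eq top_coef_zero)
qed

lemma S_comp_monodromy_sector:
  assumes "n \<in> {0, 1}" "m \<in> {0, 1}" "z * qe n = z"
  shows "S_comp \<nu> \<beta> z (monodromy \<beta> * (sector n m :: (bool, 'i::{finite,linorder} Q) tpow)) =
    (- (\<beta> ^ 2)) ^ (n * m) *\<^sub>C (\<Sum>c\<in>UNIV. (\<Prod>j\<in>UNIV. weight n m (c j)) *\<^sub>C
      (lam CARD('i) \<nu> \<beta> * top_coef (ordered_prod (\<lambda>j. loc j (c j) * qK ^ odd_deg (c j)) * z * qK ^ m)) *\<^sub>C
       antipode (qK ^ n * ordered_prod (\<lambda>j. rloc j (c j)) * qe m))"
proof -
  \<comment> \<open>The top monomials commute with \<open>qK\<close>, and for all others both sides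
    vanish. The \<open>qK ^ m\<close> of the first leg may thus be moved behind
    \<open>z\<close>.\<close>
  have K: "top_coef (qK * y) = top_coef (y * qK)" for y :: "'i Q"
  proof -
    have "y \<in> cvec.span monomial_basis" by (simp add: span_monomial_basis)
    then show ?thesis
    proof (induction rule: cvec.span_induct_alt)
      case (step c x y)
      obtain d k where x: "x = mon d k" using step(1) unfolding monomial_basis_eq by blast
      have 1: "qK * mon d k = prod_list (map (\<lambda>i. sg (d i)) (sorted_list_of_set UNIV)) *\<^sub>C mon d (Suc k)"
        unfolding mon_def ordered_prod_def
        by (subst mult.assoc[symmetric], subst mult_prod_list_loc[OF qK_loc])
          (simp_all add: mult_scaleC_left mult.assoc)
      have 2: "mon d k * qK = mon d (Suc k)"
        using mon_mult_qK[of d k 1] by simp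
      have 3: "top_coef (mon d (Suc k)) = of_bool ((\<lambda>_. (True, True)) = d \<and> 0 = Suc k mod 4)"
        unfolding top_coef_def by (subst mon_mod4, subst coord_mon) auto
      have 4: "prod_list (map (\<lambda>i. sg (True, True)) xs) = 1" for xs :: "'i list"
        by (induction xs) (simp_all add: sg_def)
      have "top_coef (qK * x) = top_coef (x * qK)"
        unfolding x 1 2 top_coef_scaleC 3 using 4 by auto
      then show ?case
        using step(2) by (simp add: lin_simps top_coef_add top_coef_scaleC)
    qed simp
  qed
  have Km: "top_coef (qK ^ m * y) = top_coef (y * qK ^ m)" for y :: "'i Q"
    using assms(2) K by auto
  have "qe n * z = z" using assms(3) by (simp add: qe_central)
  then show ?thesis
    unfolding monodromy_sector[OF assms(1,2)]
    by (simp add: clinear_scaleC[OF clinear_S_comp] clinear_sum[OF clinear_S_comp] S_comp_tens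
        Lambda_hat_eq mult.assoc Km)
qed

lemma S_Z_block:
  assumes "n \<in> {0, 1}" "z * qe n = z"
  shows "S_Z \<nu> \<beta> z = S_comp \<nu> \<beta> z (monodromy \<beta> * sector n 0) + S_comp \<nu> \<beta> z (monodromy \<beta> * sector n 1)"
proof -
  have "monodromy \<beta> = monodromy \<beta> * sector 0 0 + monodromy \<beta> * sector 0 (Suc 0) +
      monodromy \<beta> * sector (Suc 0) 0 + monodromy \<beta> * (sector (Suc 0) (Suc 0) :: (bool, 'a Q) tpow)"
    by (simp only: sector_sum mult_1_right flip: distrib_left)
  then have "S_Z \<nu> \<beta> z = S_comp \<nu> \<beta> z (monodromy \<beta> * sector 0 0) +
      S_comp \<nu> \<beta> z (monodromy \<beta> * sector 0 (Suc 0)) +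
      S_comp \<nu> \<beta> z (monodromy \<beta> * sector (Suc 0) 0) +
      S_comp \<nu> \<beta> z (monodromy \<beta> * sector (Suc 0) (Suc 0))"
    by (metis S_Z_eq clinear_add[OF clinear_S_comp])
  then show ?thesis
    using assms(1) S_comp_sector_zero[OF _ _ _ assms(2), of 0] S_comp_sector_zero[OF _ _ _ assms(2), of 1]
    by auto
qed

section \<open>Complementary monomials and the top coefficient\<close>

definition compl :: "bool \<times> bool \<Rightarrow> bool \<times> bool" where
  "compl x = (\<not> fst x, \<not> snd x)"

text \<open>For f^+ followed by f^- the twisting \<open>qK\<close> gives the sign -1; in the
  opposite order it cancels the sign of restoring the order.\<close>

definition merge_sg :: "bool \<times> bool \<Rightarrow> bool \<times> bool \<Rightarrow> complex" where
  "merge_sg c d = (if (fst c \<and> fst d) \<or> (snd c \<and> snd d) then 0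
     else if c = (True, False) \<and> d = (False, True) then -1 else 1)"

text \<open>The sign of passing an odd monomial at another site is undone by the sign of passing the
  \<open>qK\<close> attached to it.\<close>

lemma loc_twisted_commute:
  assumes "i \<noteq> j"
  shows "loc i x * (loc j y * qK ^ odd_deg y) = (loc j y * qK ^ odd_deg y) * loc i x"
proof -
  have ji: "j \<noteq> i" using assms by simp
  obtain a b c d where "x = (a, b)" "y = (c, d)" by (cases x; cases y)
  then show ?thesis
    by (cases a; cases b; cases c; cases d)
      (simp_all add: loc_simps odd_deg_def mult.assoc qf_qf_neq_left[OF ji] qf_anticomm_neq[OF ji]
        qK_qf qK_qf_left)
qed

lemma qf_qf_qe0: "qf Mi j * (qf Pl j * qe 0) = - (qf Pl j * (qf Mi j * qe 0))"
  by (rule qf_anticomm_qe0)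

lemma qf_sq_left: "qf s j * (qf s j * x) = 0"
  by (simp add: qf_sq flip: mult.assoc)

lemma qf_Mi_Pl_left: "qf Mi j * (qf Pl j * x) = x * qe (Suc 0) - qf Pl j * (qf Mi j * x)"
  using arg_cong[where f = "\<lambda>y. y * x", OF qf_Mi_Pl[of j j]]
  by (simp add: mult.assoc left_diff_distrib qe_central)

lemma merge_loc_qe0:
  "(loc j c * qK ^ odd_deg c) * loc j d * qe 0 =
     (merge_sg c d *\<^sub>C (loc j (fst c \<or> fst d, snd c \<or> snd d) * qK ^ odd_deg c)) * qe 0"
proof -
  obtain a b a' b' where "c = (a, b)" "d = (a', b')" by (cases c; cases d)
  then show ?thesis
    by (cases a; cases b; cases a'; cases b')
      (simp_all add: loc_simps odd_deg_def merge_sg_def lin_simps mult.assoc qK_qf_left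
        qf_Mi_Pl_left qf_sq_left qe_mult)
qed

lemma top_coef_half_qe:
  "top_coef (x * qe 0) = (top_coef x + top_coef (x * qK ^ 2)) / 2"
  "top_coef (x * qe (Suc 0)) = (top_coef x - top_coef (x * qK ^ 2)) / 2"
  by (simp_all add: qe_def lin_simps top_coef_add top_coef_scaleC
      top_coef_scaleC[of "-1", simplified cvec.scale_minus_left scaleC_one]
      diff_conv_add_uminus del: add_uminus_conv_diff)

text \<open>Projection to the block of \<open>qe 0\<close> averages over the exponents k and k + 2
  of \<open>qK\<close>, so only the parity of the exponent remains visible.\<close>

lemma four_dvd_parity:
  fixes n :: nat
  shows "of_bool (4 dvd n) + of_bool (4 dvd (n + 2)) = (of_bool (even n) :: complex)"
proof -
  have "4 dvd n + 2 \<longleftrightarrow> even n \<and> \<not> 4 dvd n" by presburger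
  moreover have "4 dvd n \<Longrightarrow> even n" by presburger
  ultimately show ?thesis by auto
qed

text \<open>The integral sees only doubly occupied sites, so in the sum over \<open>c\<close> that
  describes the monodromy exactly one index can contribute, the site-wise complement of
  \<open>d\<close>.\<close>

lemma top_coef_merge:
  fixes c d :: "'i::{finite,linorder} \<Rightarrow> bool \<times> bool"
  shows "top_coef (ordered_prod (\<lambda>j. loc j (c j) * qK ^ odd_deg (c j)) *
      (ordered_prod (\<lambda>j. loc j (d j)) * qe 0 * qK ^ a) * qK ^ m) =
    (if c = (\<lambda>j. compl (d j)) then (\<Prod>j\<in>UNIV. merge_sg (c j) (d j)) *
       of_bool (even (a + m + (\<Sum>j\<in>UNIV. odd_deg (d j)))) / 2 else 0)"
proof -
  let ?L = "\<lambda>j. loc j (c j) * qK ^ odd_deg (c j)"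
  let ?x = "\<lambda>j. (fst (c j) \<or> fst (d j), snd (c j) \<or> snd (d j))"
  let ?X = "\<lambda>j. loc j (?x j) * qK ^ odd_deg (c j)"
  let ?s = "\<Prod>j\<in>UNIV. merge_sg (c j) (d j)" and ?n = "a + m" and ?o = "\<Sum>j\<in>UNIV. odd_deg (c j)"
  have "ordered_prod ?L * (ordered_prod (\<lambda>j. loc j (d j)) * qe 0 * qK ^ a) * qK ^ m =
      (ordered_prod ?L * ordered_prod (\<lambda>j. loc j (d j))) * qe 0 * qK ^ ?n"
    by (simp only: mult.assoc power_add)
  also have "ordered_prod ?L * ordered_prod (\<lambda>j. loc j (d j)) = ordered_prod (\<lambda>j. ?L j * loc j (d j))"
    by (rule ordered_prod_mult_distrib) (rule loc_twisted_commute)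
  also have "\<dots> * qe 0 = ordered_prod (\<lambda>j. merge_sg (c j) (d j) *\<^sub>C ?X j) * qe 0"
    by (rule ordered_prod_cong_idem[OF qe_central merge_loc_qe0])
  also have "\<dots> * qK ^ ?n = ?s *\<^sub>C (ordered_prod ?X * qK ^ ?n * qe 0)"
    by (simp add: ordered_prod_scaleC mult_scaleC_left mult.assoc qe_central)
  finally have X: "ordered_prod ?L * (ordered_prod (\<lambda>j. loc j (d j)) * qe 0 * qK ^ a) * qK ^ m =
      ?s *\<^sub>C (ordered_prod ?X * qK ^ ?n * qe 0)" .
  have *: "top_coef (ordered_prod ?L * (ordered_prod (\<lambda>j. loc j (d j)) * qe 0 * qK ^ a) * qK ^ m) =
      ?s * ((top_coef (ordered_prod ?X * qK ^ ?n) + top_coef (ordered_prod ?X * qK ^ (?n + 2))) / 2)"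
    unfolding X top_coef_scaleC top_coef_half_qe by (simp only: power_add mult.assoc)
  have t: "top_coef (ordered_prod ?X * qK ^ k) = of_bool ((\<forall>j. ?x j = (True, True)) \<and> 4 dvd (k + ?o))" for k
    by (rule coord_prod_loc)
  have "of_bool ((\<forall>j. ?x j = (True, True)) \<and> 4 dvd (?n + ?o)) +
      of_bool ((\<forall>j. ?x j = (True, True)) \<and> 4 dvd (?n + 2 + ?o)) =
      (of_bool ((\<forall>j. ?x j = (True, True)) \<and> even (?n + ?o)) :: complex)"
    using four_dvd_parity[of "?n + ?o"]
    by (cases "\<forall>j. ?x j = (True, True)") (simp_all only: simp_thms of_bool_eq add_0_left ac_simps)
  then have **: "top_coef (ordered_prod ?L * (ordered_prod (\<lambda>j. loc j (d j)) * qe 0 * qK ^ a) * qK ^ m) =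
      ?s * of_bool ((\<forall>j. ?x j = (True, True)) \<and> even (?n + ?o)) / 2"
    unfolding * t by simp
  show ?thesis
  proof (cases "c = (\<lambda>j. compl (d j))")
    case True
    then have x: "\<forall>j. ?x j = (True, True)" by (auto simp: compl_def)
    have o: "(\<Sum>j\<in>UNIV. odd_deg (compl (d j))) = (\<Sum>j\<in>UNIV. odd_deg (d j))"
      by (intro sum.cong refl) (auto simp: odd_deg_def compl_def)
    show ?thesis unfolding ** using x o by (simp add: True)
  next
    case False
    \<comment> \<open>If the union of \<open>c\<close> and \<open>d\<close> is full but
      \<open>c\<close> is not the complement, some generator occurs in both, and its square is
      zero.\<close>
    have "?s = 0" if "\<forall>j. ?x j = (True, True)"
    proof -
      from False obtain j where "c j \<noteq> compl (d j)" by auto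
      with that have "merge_sg (c j) (d j) = 0"
        by (auto simp: merge_sg_def compl_def prod_eq_iff)
      then show ?thesis by (auto intro: prod_zero)
    qed
    then show ?thesis unfolding ** using False by auto
  qed
qed

definition sigma_loc :: "'i \<Rightarrow> bool \<times> bool \<Rightarrow> 'i Q" where
  "sigma_loc j d = (- (1/2) * weight 0 0 (compl d) * merge_sg (compl d) d) *\<^sub>C rloc j (compl d) * qe 0"

lemma fword_append: "fword (u @ v) = fword u * fword v"
  by (simp add: fword_def)

lemma ordered_prod_fword:
  obtains w where "ordered_prod (\<lambda>j. fword (W j)) = fword w" "length w = (\<Sum>j\<in>UNIV. length (W j))"
proof -
  have "distinct xs \<Longrightarrow> prod_list (map (\<lambda>j. fword (W j)) xs) = fword (concat (map W xs)) \<and>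
      length (concat (map W xs)) = (\<Sum>j\<in>set xs. length (W j))" for xs
    by (induction xs) (simp_all add: fword_append fword_simps)
  from this[OF distinct_sorted_UNIV] that show thesis
    unfolding ordered_prod_def set_sorted_UNIV by blast
qed

definition loc_word :: "'i \<Rightarrow> bool \<times> bool \<Rightarrow> (free_sign \<times> 'i) list" where
  "loc_word j c = (if fst c then [(Pl, j)] else []) @ (if snd c then [(Mi, j)] else [])"

definition rloc_word :: "'i \<Rightarrow> bool \<times> bool \<Rightarrow> (free_sign \<times> 'i) list" where
  "rloc_word j c = (if fst c then [(Mi, j)] else []) @ (if snd c then [(Pl, j)] else [])"

lemma loc_word: "loc j c = fword (loc_word j c)" "even (length (loc_word j c)) \<longleftrightarrow> even (odd_deg c)"
  and rloc_word: "rloc j c = fword (rloc_word j c)" "even (length (rloc_word j c)) \<longleftrightarrow> even (odd_deg c)"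
  by (auto simp: loc_word_def rloc_word_def loc_def rloc_def fword_simps odd_deg_def)

lemma even_sum_cong:
  "(\<And>j. j \<in> A \<Longrightarrow> even (f j :: nat) \<longleftrightarrow> even (g j :: nat)) \<Longrightarrow> even (sum f A) \<longleftrightarrow> even (sum g A)"
  by (induction A rule: infinite_finite_induct) simp_all

lemma ordered_prod_loc_fword:
  obtains w where "ordered_prod (\<lambda>j. loc j (c j)) = fword w"
    "even (length w) \<longleftrightarrow> even (\<Sum>j\<in>UNIV. odd_deg (c j))"
proof -
  obtain w where w: "ordered_prod (\<lambda>j. fword (loc_word j (c j))) = fword w"
    "length w = (\<Sum>j\<in>UNIV. length (loc_word j (c j)))" by (rule ordered_prod_fword)
  show thesis
    by (rule that[of w]) (simp_all only: w loc_word(1) even_sum_cong[of UNIV, OF loc_word(2)])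
qed

lemma ordered_prod_rloc_fword:
  obtains w where "ordered_prod (\<lambda>j. rloc j (c j)) = fword w"
    "even (length w) \<longleftrightarrow> even (\<Sum>j\<in>UNIV. odd_deg (c j))"
proof -
  obtain w where w: "ordered_prod (\<lambda>j. fword (rloc_word j (c j))) = fword w"
    "length w = (\<Sum>j\<in>UNIV. length (rloc_word j (c j)))" by (rule ordered_prod_fword)
  show thesis
    by (rule that[of w]) (simp_all only: w rloc_word(1) even_sum_cong[of UNIV, OF rloc_word(2)])
qed

lemma odd_deg_compl: "odd_deg (compl x) = odd_deg x"
  by (auto simp: odd_deg_def compl_def)

text \<open>The half is the weight of the projection to a block in the top coefficient. Apart from
  \<nu>\<beta>^2 the rest is an N-th power and can be shared out among the sites.\<close>

lemma half_lam: "lam N \<nu> \<beta> / 2 = \<nu> * \<beta> ^ 2 * (- (1/2)) ^ N"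
proof -
  have "(- (1/2)) ^ N = ((-1) ^ N / 2 ^ N :: complex)"
    using power_divide[of "-1 :: complex" 2 N] by simp
  moreover have "(2 :: complex) powi (1 - int N) = 2 / 2 ^ N"
    by (simp add: power_int_diff)
  ultimately show ?thesis by (simp add: lam_def)
qed

lemma antipode_qe0_comm: "antipode (x * qe n) = antipode x * qe n"
  by (simp add: antipode_mult antipode_qe qe_central)

text \<open>Only the complementary index survives in the block (0,0). The block (0,1) drops out
  because its extra \<open>qK\<close> makes the parity odd, and the antipode acts trivially because
  the resulting word has even length.\<close>

theorem S_Z_Lambda_monomial:
  fixes d :: "'i::{finite,linorder} \<Rightarrow> bool \<times> bool"
  assumes "even (\<Sum>j\<in>UNIV. odd_deg (d j))"
  shows "S_Z \<nu> \<beta> (ordered_prod (\<lambda>j. loc j (d j)) * qe 0) =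
    (\<nu> * \<beta> ^ 2) *\<^sub>C ordered_prod (\<lambda>j. sigma_loc j (d j))"
proof -
  let ?z = "ordered_prod (\<lambda>j. loc j (d j)) * qe 0"
  let ?c = "\<lambda>j. compl (d j)"
  let ?w = "\<Prod>j\<in>UNIV. weight 0 0 (?c j)" and ?s = "\<Prod>j\<in>UNIV. merge_sg (?c j) (d j)"
  let ?R = "ordered_prod (\<lambda>j. rloc j (?c j))"
  note t = top_coef_merge[of _ d 0, unfolded power_0 mult_1_right]
  have z: "?z * qe 0 = ?z" by (simp add: mult.assoc qe_mult)
  have "S_comp \<nu> \<beta> ?z (monodromy \<beta> * sector 0 0) =
      (\<Sum>c\<in>UNIV. if c = ?c then (?w * (lam CARD('i) \<nu> \<beta> * (?s / 2))) *\<^sub>C antipode (?R * qe 0) else 0)"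
  proof -
    have "(\<Prod>j\<in>UNIV. weight 0 0 (c j)) *\<^sub>C (lam CARD('i) \<nu> \<beta> *
        top_coef (ordered_prod (\<lambda>j. loc j (c j) * qK ^ odd_deg (c j)) * ?z * qK ^ 0)) *\<^sub>C
        antipode (qK ^ 0 * ordered_prod (\<lambda>j. rloc j (c j)) * qe 0) =
      (if c = ?c then (?w * (lam CARD('i) \<nu> \<beta> * (?s / 2))) *\<^sub>C antipode (?R * qe 0) else 0)" for c
      using t[of c 0] assms by (cases "c = ?c") (simp_all add: scaleC_scaleC)
    then show ?thesis
      by (subst S_comp_monodromy_sector[OF _ _ z]) (simp_all add: scaleC_one)
  qed
  also have "\<dots> = (?w * (lam CARD('i) \<nu> \<beta> * (?s / 2))) *\<^sub>C antipode (?R * qe 0)"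
    by (simp add: sum.delta)
  also have "antipode (?R * qe 0) = ?R * qe 0"
  proof -
    obtain w where w: "?R = fword w" "even (length w) \<longleftrightarrow> even (\<Sum>j\<in>UNIV. odd_deg (?c j))"
      by (rule ordered_prod_rloc_fword)
    then have "even (length w)" using assms by (simp add: odd_deg_compl)
    then show ?thesis by (simp add: w(1) antipode_qe0_comm antipode_fword_qe0)
  qed
  also have "?w * (lam CARD('i) \<nu> \<beta> * (?s / 2)) =
      (\<nu> * \<beta> ^ 2) * (\<Prod>j\<in>UNIV. - (1/2) * weight 0 0 (?c j) * merge_sg (?c j) (d j))"
  proof -
    have "?w * (lam CARD('i) \<nu> \<beta> * (?s / 2)) = (lam CARD('i) \<nu> \<beta> / 2) * (?w * ?s)" by simp
    then show ?thesis by (simp only: half_lam prod.distrib prod_constant mult.assoc mult.left_commute)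
  qed
  also have "(\<nu> * \<beta> ^ 2 * (\<Prod>j\<in>UNIV. - (1/2) * weight 0 0 (?c j) * merge_sg (?c j) (d j))) *\<^sub>C (?R * qe 0) =
      (\<nu> * \<beta> ^ 2) *\<^sub>C (ordered_prod (\<lambda>j. (- (1/2) * weight 0 0 (?c j) * merge_sg (?c j) (d j)) *\<^sub>C rloc j (?c j)) * qe 0)"
    by (simp only: ordered_prod_scaleC mult_scaleC_left scaleC_scaleC)
  also have "\<dots> = (\<nu> * \<beta> ^ 2) *\<^sub>C ordered_prod (\<lambda>j. sigma_loc j (d j))"
    unfolding sigma_loc_def by (subst ordered_prod_mult_idem[OF qe_central qe_mult(1)]) (rule refl)
  finally have 0: "S_comp \<nu> \<beta> ?z (monodromy \<beta> * sector 0 0) =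
    (\<nu> * \<beta> ^ 2) *\<^sub>C ordered_prod (\<lambda>j. sigma_loc j (d j))" .
  have t1: "top_coef (ordered_prod (\<lambda>j. loc j (c j) * qK ^ odd_deg (c j)) * ?z * qK ^ 1) = 0" for c
    using t[of c 1] assms by (simp del: power_one_right)
  have 1: "S_comp \<nu> \<beta> ?z (monodromy \<beta> * sector 0 1) = 0"
    unfolding S_comp_monodromy_sector[OF insertI1 insertI2[OF insertI1] z] t1 by simp
  show ?thesis using S_Z_block[OF _ z, of \<nu> \<beta>] 0 1 by simp
qed

section \<open>Images of \<open>Ktop\<close>, \<open>qe 1\<close> and \<open>Gam\<close> under
  S\<close>

definition top_el :: "'i::{finite,linorder} Q" where
  "top_el = ordered_prod (\<lambda>j. qf Pl j * qf Mi j)"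

definition hfac :: "'i \<Rightarrow> 'i Q" where
  "hfac j = 1 - 2 *\<^sub>C (qf Pl j * qf Mi j)"

text \<open>The element that separates the two idempotents of the block: \<open>e1_pm s\<close> is
  half of \<open>qe 1 - (sgnC s * \<i>) *\<^sub>C Gam\<close>, and \<open>Gam\<close> acts on it as
  \<open>sgnC s * \<i>\<close>.\<close>

definition Gam :: "'i::{finite,linorder} Q" where
  "Gam = qK * ordered_prod hfac * qe 1"

lemma top_el_eq: "top_el = ordered_prod (\<lambda>j. loc j (True, True))"
  by (simp add: top_el_def loc_simps)

text \<open>The top product leaves only the empty index. The \<open>qK\<close> in the argument
  reverses the parity condition, so this time the block (0,1) survives and (0,0) vanishes.\<close>

lemma S_Z_qK_top:
  "S_Z \<nu> \<beta> (top_el * qe 0 * qK) = (lam CARD('i) \<nu> \<beta> / 2) *\<^sub>C (qe 1 :: 'i::{finite,linorder} Q)"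
proof -
  let ?z = "top_el * qe 0 * qK :: 'i Q" and ?c = "\<lambda>_ :: 'i. (False, False)"
  have z: "?z * qe 0 = ?z"
    by (simp add: mult.assoc) (simp add: qe_mult_left flip: qe_central)
  have t: "top_coef (ordered_prod (\<lambda>j. loc j (c j) * qK ^ odd_deg (c j)) * ?z * qK ^ m) =
      (if c = ?c then of_bool (odd m) / 2 else 0)" for c m
    using top_coef_merge[of c "\<lambda>_. (True, True)" 1 m]
    by (simp add: top_el_eq compl_def odd_deg_def merge_sg_def)
  have "S_comp \<nu> \<beta> ?z (monodromy \<beta> * sector 0 0) = 0"
    unfolding S_comp_monodromy_sector[OF insertI1 insertI1 z] t by (simp cong: if_cong)
  moreover have "S_comp \<nu> \<beta> ?z (monodromy \<beta> * sector 0 1) =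
      (\<Sum>c\<in>UNIV. if c = ?c then (lam CARD('i) \<nu> \<beta> / 2) *\<^sub>C qe 1 else 0)"
  proof -
    have "(\<Prod>j\<in>UNIV. weight 0 1 (c j)) *\<^sub>C (lam CARD('i) \<nu> \<beta> *
        (if c = ?c then of_bool (odd (1::nat)) / 2 else 0)) *\<^sub>C
        antipode (qK ^ 0 * ordered_prod (\<lambda>j. rloc j (c j)) * qe 1) =
        (if c = ?c then (lam CARD('i) \<nu> \<beta> / 2) *\<^sub>C qe 1 else 0)" for c
      by (simp add: weight_def rloc_def ordered_prod_one antipode_qe scaleC_one)
    then show ?thesis
      unfolding S_comp_monodromy_sector[OF insertI1 insertI2[OF insertI1] z] t
      by (simp add: scaleC_one)
  qed
  ultimately show ?thesis using S_Z_block[OF insertI1 z, of \<nu> \<beta>] by (simp add: sum.delta)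
qed

lemma top_coef_L:
  "top_coef (ordered_prod (\<lambda>j. loc j (c j) * qK ^ odd_deg (c j)) * qK ^ k) =
     of_bool (c = (\<lambda>_. (True, True)) \<and> 4 dvd k)"
proof -
  have "(\<forall>j. c j = (True, True)) \<longleftrightarrow> c = (\<lambda>_. (True, True))" by auto
  then show ?thesis
    unfolding coord_prod_loc by (auto simp: odd_deg_def)
qed

lemma qf_Mi_Pl_qe0: "qf Mi j * qf Pl j * qe 0 = (- 1) *\<^sub>C (qf Pl j * qf Mi j) * qe 0"
  by (simp add: qf_Mi_Pl left_diff_distrib qe_mult cvec.scale_minus_left scaleC_one)

lemma fword_top: obtains w :: "(free_sign \<times> 'i::{finite,linorder}) list"
  where "top_el = fword w" "even (length w)"
proof -
  obtain w :: "(free_sign \<times> 'i) list" where "ordered_prod (\<lambda>j. loc j (True, True)) = fword w"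
    "even (length w) \<longleftrightarrow> even (\<Sum>j\<in>(UNIV :: 'i set). odd_deg (True, True))"
    by (rule ordered_prod_loc_fword)
  then show thesis using that[of w] by (simp add: top_el_eq odd_deg_def)
qed

lemma four_dvd_Suc: "4 dvd Suc (Suc (Suc (Suc n))) \<longleftrightarrow> 4 dvd n"
  "\<not> 4 dvd Suc (Suc (Suc 0))" "\<not> 4 dvd Suc (Suc 0)"
  by presburger+

text \<open>With no generators in the argument every site of \<open>c\<close> must be doubly
  occupied. The block (1,1) contributes an odd power of \<open>qK\<close>, which never reaches the
  top coefficient.\<close>

lemma S_Z_qe1:
  "S_Z \<nu> \<beta> (qe 1) = (\<nu> * \<beta> ^ 2 * 2 ^ CARD('i)) *\<^sub>C (top_el * qe 0 * qK :: 'i::{finite,linorder} Q)"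
proof -
  let ?z = "qe 1 :: 'i Q" and ?c = "\<lambda>_ :: 'i. (True, True)"
  let ?r = "(\<nu> * \<beta> ^ 2 * 2 ^ CARD('i)) *\<^sub>C (top_el * qe 0 * qK :: 'i Q)"
  have z: "?z * qe 1 = ?z" by (simp add: qe_mult)
  have t: "top_coef (ordered_prod (\<lambda>j. loc j (c j) * qK ^ odd_deg (c j)) * ?z * qK ^ m) =
      (if c = ?c then (of_bool (4 dvd m) - of_bool (4 dvd (m + 2))) / 2 else 0)" for c m
  proof -
    have X: "ordered_prod (\<lambda>j. loc j (c j) * qK ^ odd_deg (c j)) * ?z * qK ^ m =
        ordered_prod (\<lambda>j. loc j (c j) * qK ^ odd_deg (c j)) * qK ^ m * qe (Suc 0)"
      by (simp add: mult.assoc qe_central)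
    show ?thesis
      unfolding X top_coef_half_qe
      unfolding mult.assoc[of _ "qK ^ m"] power_add[symmetric] top_coef_L
      by simp
  qed
  have R: "antipode (qK * ordered_prod (\<lambda>j :: 'i. rloc j (True, True)) * qe 0) =
      (-1) ^ CARD('i) *\<^sub>C (top_el * qe 0 * qK)"
  proof -
    have "ordered_prod (\<lambda>j :: 'i. rloc j (True, True)) * qe 0 =
        ordered_prod (\<lambda>j. (-1) *\<^sub>C (qf Pl j * qf Mi j)) * qe 0"
      by (rule ordered_prod_cong_idem[OF qe_central])
        (simp only: rloc_def fst_conv snd_conv of_bool_eq power_one_right qf_Mi_Pl_qe0)
    also have "\<dots> = (-1) ^ CARD('i) *\<^sub>C (top_el * qe 0)"
      by (simp only: ordered_prod_scaleC prod_constant mult_scaleC_left top_el_def)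
    finally have 1: "ordered_prod (\<lambda>j :: 'i. rloc j (True, True)) * qe 0 = (-1) ^ CARD('i) *\<^sub>C (top_el * qe 0)" .
    have 2: "antipode (top_el * qe 0) = (top_el * qe 0 :: 'i Q)"
    proof -
      obtain w :: "(free_sign \<times> 'i) list" where w: "top_el = fword w" "even (length w)" by (rule fword_top)
      show ?thesis unfolding w(1) antipode_qe0_comm by (rule antipode_fword_qe0[OF w(2)])
    qed
    have "antipode (qK * ordered_prod (\<lambda>j :: 'i. rloc j (True, True)) * qe 0) =
        antipode (ordered_prod (\<lambda>j :: 'i. rloc j (True, True)) * qe 0) * antipode qK"
      by (simp only: antipode_mult mult.assoc)
    also have "\<dots> = (-1) ^ CARD('i) *\<^sub>C (top_el * qe 0 * antipode qK)"
      by (simp only: 1 2 clinear_scaleC[OF clinear_antipode] mult_scaleC_left)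
    also have "top_el * qe 0 * antipode qK = top_el * (antipode qK * qe 0 :: 'i Q)"
      by (simp only: qe_central mult.assoc)
    also have "\<dots> = top_el * qe 0 * qK" by (simp only: antipode_qK_qe(1) qe_central mult.assoc)
    finally show ?thesis .
  qed
  have "S_comp \<nu> \<beta> ?z (monodromy \<beta> * sector 1 1) = 0"
  proof -
    have "(of_bool (4 dvd (1::nat)) - of_bool (4 dvd (1 + 2 :: nat))) / 2 = (0 :: complex)"
      by (simp add: four_dvd_Suc)
    then show ?thesis
      unfolding S_comp_monodromy_sector[OF insertI2[OF insertI1] insertI2[OF insertI1] z] t
      by (simp cong: if_cong)
  qed
  moreover have "S_comp \<nu> \<beta> ?z (monodromy \<beta> * sector 1 0) = (\<Sum>c\<in>UNIV. if c = ?c then ?r else 0)"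
  proof -
    \<comment> \<open>Here 4^N are the weights of the occupied sites, and (-1)^N is the sign of
      rewriting f^- f^+ as - f^+ f^- in the block of \<open>qe 0\<close>.\<close>
    have "lam CARD('i) \<nu> \<beta> / 2 * (-1) ^ CARD('i) * 4 ^ CARD('i) = \<nu> * \<beta> ^ 2 * 2 ^ CARD('i)"
      unfolding half_lam mult.assoc by (simp flip: power_mult_distrib)
    then have k: "4 ^ CARD('i) * lam CARD('i) \<nu> \<beta> * (1 / 2) * (-1) ^ CARD('i) = \<nu> * \<beta> ^ 2 * 2 ^ CARD('i)"
      by (simp add: ac_simps)
    have e: "(of_bool (4 dvd (0::nat)) - of_bool (4 dvd (0 + 2 :: nat))) / 2 = (1/2 :: complex)"
      by (simp add: four_dvd_Suc)
    have W: "(\<Prod>j\<in>(UNIV :: 'i set). weight 1 0 (True, True)) = 4 ^ CARD('i)"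
      by (simp add: weight_def)
    have "(\<Prod>j\<in>UNIV. weight 1 0 (c j)) *\<^sub>C (lam CARD('i) \<nu> \<beta> *
        (if c = ?c then (of_bool (4 dvd (0::nat)) - of_bool (4 dvd (0 + 2 :: nat))) / 2 else 0)) *\<^sub>C
        antipode (qK ^ 1 * ordered_prod (\<lambda>j. rloc j (c j)) * qe 0) =
        (if c = ?c then ?r else 0)" for c
    proof (cases "c = ?c")
      case True
      show ?thesis
        by (simp only: True if_True simp_thms e W R power_one_right scaleC_scaleC
            mult.assoc[symmetric] k)
    qed simp
    then show ?thesis
      unfolding S_comp_monodromy_sector[OF insertI2[OF insertI1] insertI1 z] t
      by (simp add: scaleC_one)
  qed
  ultimately show ?thesis
    using S_Z_block[OF insertI2[OF insertI1] z, of \<nu> \<beta>] by (simp add: sum.delta)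
qed

lemma hfac_commute_loc: "i \<noteq> j \<Longrightarrow> hfac i * (loc j x * qK ^ n) = (loc j x * qK ^ n) * hfac i"
proof -
  assume "i \<noteq> j"
  then have ji: "j \<noteq> i" by simp
  have 1: "qf Pl i * (qf Mi i * loc j x) = loc j x * (qf Pl i * qf Mi i)"
    by (cases x; cases "fst x"; cases "snd x")
      (simp_all add: loc_simps mult.assoc qf_qf_neq_left[OF ji] qf_anticomm_neq[OF ji])
  have 2: "qf Pl i * (qf Mi i * qK) = qK * (qf Pl i * qf Mi i)"
    by (simp add: qK_qf qK_qf_left mult.assoc)
  have 3: "qf Pl i * (qf Mi i * qK ^ n) = qK ^ n * (qf Pl i * qf Mi i)"
  proof (induction n)
    case (Suc n)
    have "qf Pl i * (qf Mi i * qK ^ Suc n) = qf Pl i * (qf Mi i * qK) * qK ^ n"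
      by (simp add: mult.assoc)
    also have "\<dots> = qK * (qf Pl i * (qf Mi i * qK ^ n))" by (simp only: 2 mult.assoc)
    finally show ?case by (simp add: Suc mult.assoc)
  qed simp
  have "qf Pl i * (qf Mi i * (loc j x * qK ^ n)) = loc j x * (qf Pl i * (qf Mi i * qK ^ n))"
    using arg_cong[where f = "\<lambda>y. y * qK ^ n", OF 1] by (simp add: mult.assoc)
  then show ?thesis by (simp add: hfac_def lin_simps mult.assoc 3)
qed

lemma hfac_commute_qK: "hfac j * qK = qK * hfac j"
  by (simp add: hfac_def lin_simps mult.assoc qK_qf qK_qf_left)

lemma hfac_commute: "hfac i * hfac j = hfac j * hfac i"
proof (cases "i = j")
  case False
  from hfac_commute_loc[OF this, of "(True, True)" 0]
  have "hfac i * (qf Pl j * qf Mi j) = qf Pl j * qf Mi j * hfac i" by (simp add: loc_simps)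
  then show ?thesis unfolding hfac_def[of j] by (simp add: lin_simps)
qed simp

lemma ordered_prod_hfac_qK: "ordered_prod hfac * qK = qK * ordered_prod hfac"
  by (rule ordered_prod_commute[symmetric]) (simp add: hfac_commute_qK)

text \<open>Local coordinates of the monomial \<open>c\<close> times \<open>hfac j\<close> in the
  block of \<open>qe 1\<close>: each nonempty monomial is reproduced up to sign, and the unit
  becomes 1 - 2 f^+ f^-.\<close>

definition hcoef :: "bool \<times> bool \<Rightarrow> bool \<times> bool \<Rightarrow> complex" where
  "hcoef c x = (if c = (False, False) then (if x = (False, False) then 1 else if x = (True, True) then -2 else 0)
     else if x = c then (if c = (True, False) then 1 else -1) else 0)"

lemma loc_hfac_qe1:
  "loc j c * qK ^ odd_deg c * hfac j * qe 1 =
     (\<Sum>x\<in>UNIV. hcoef c x *\<^sub>C loc j x) * qK ^ odd_deg c * qe 1"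
proof -
  have 2: "x - 2 *\<^sub>C x = - x" for x :: "'a Q"
    using scaleC_add_left[of 1 1 x] by (simp add: scaleC_one)
  obtain a b where "c = (a, b)" by (cases c)
  then show ?thesis
    by (cases a; cases b)
      (simp_all add: sum_UNIV_bool_pair hcoef_def hfac_def loc_simps odd_deg_def lin_simps mult.assoc
        qK_qf_left qf_Mi_Pl_left qf_sq_left qe_mult 2)
qed

text \<open>In this block the antipode sends f^+ f^- to f^- f^+ = 1 - f^+ f^-, which negates 1 - 2
  f^+ f^-.\<close>

lemma antipode_hfac_qe1:
  "antipode (hfac (k :: 'i::{finite,linorder})) * qe 1 = (-1) *\<^sub>C hfac k * qe 1"
proof -
  let ?c = "\<lambda>s. sgnC s * (-1) ^ CARD('i) * \<i>"
  have c: "?c Pl * ?c Mi = 1" by (cases "even CARD('i)") simp_all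
  have "antipode (qf Pl k * qf Mi k) * qe 1 = antipode (qf Mi k) * (antipode (qf Pl k) * qe (Suc 0))"
    by (simp add: antipode_mult mult.assoc)
  also have "\<dots> = ?c Pl *\<^sub>C ((antipode (qf Mi k) * qe (Suc 0)) * (qf Pl k * qK))"
    by (simp only: antipode_qf_qe(2)[of Pl]) (simp only: mult_scaleC_right mult.assoc qe_central)
  also have "\<dots> = (?c Pl * ?c Mi) *\<^sub>C (qf Mi k * (qK * (qf Pl k * (qK * qe (Suc 0)))))"
    by (simp only: antipode_qf_qe(2)[of Mi])
      (simp only: mult_scaleC_left scaleC_scaleC mult.assoc qe_central)
  also have "\<dots> = qf Mi k * (qf Pl k * qe (Suc 0))"
    unfolding c by (simp add: scaleC_one qK_qf_left qK_qK_qe)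
  also have "\<dots> = qe (Suc 0) - qf Pl k * (qf Mi k * qe (Suc 0))"
    by (simp add: qf_Mi_Pl_left qe_mult)
  finally have "antipode (qf Pl k * qf Mi k) * qe 1 = qe (Suc 0) - qf Pl k * (qf Mi k * qe (Suc 0))" .
  moreover have "2 *\<^sub>C qe (Suc 0) = qe (Suc 0) + (qe (Suc 0) :: 'i Q)"
    using scaleC_add_left[of 1 1 "qe (Suc 0) :: 'i Q"] by (simp add: scaleC_one)
  ultimately show ?thesis
    by (simp add: hfac_def clinear_diff[OF clinear_antipode] clinear_scaleC[OF clinear_antipode]
        antipode_one lin_simps mult.assoc)
qed

text \<open>The sign (-1)^N from the N involutions cancels the one from \<open>qK\<close> in
  \<open>antipode_qK_qe\<close>.\<close>

lemma antipode_Gam: "antipode (Gam :: 'i::{finite,linorder} Q) = Gam"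
proof -
  let ?e = "qe 1 :: 'i Q"
  have "antipode (prod_list (map hfac xs)) * ?e = (-1) ^ length xs *\<^sub>C (prod_list (map hfac xs) * ?e)" for xs
  proof (induction xs)
    case (Cons k xs)
    let ?P = "prod_list (map hfac xs)"
    have "antipode (prod_list (map hfac (k # xs))) * ?e = antipode ?P * (antipode (hfac k) * ?e)"
      by (simp add: antipode_mult mult.assoc)
    also have "\<dots> = (-1) *\<^sub>C (antipode ?P * ?e * hfac k)"
      by (simp only: antipode_hfac_qe1 mult_scaleC_left mult_scaleC_right mult.assoc qe_central)
    also have "\<dots> = (-1) *\<^sub>C ((-1) ^ length xs *\<^sub>C (?P * ?e) * hfac k)" by (simp only: Cons)
    also have "\<dots> = (-1) ^ length (k # xs) *\<^sub>C (?P * hfac k * ?e)"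
      by (simp add: lin_simps mult.assoc qe_central)
    also have "?P * hfac k = hfac k * ?P"
      by (rule prod_list_commute[symmetric]) (rule hfac_commute)
    finally show ?case by simp
  qed (simp add: antipode_one scaleC_one)
  from this[of "sorted_list_of_set UNIV"]
  have h: "antipode (ordered_prod hfac) * ?e = (-1) ^ CARD('i) *\<^sub>C (ordered_prod hfac * ?e)"
    by (simp add: ordered_prod_def)
  have "antipode Gam = antipode (ordered_prod hfac) * (antipode qK * ?e)"
    by (simp add: Gam_def antipode_mult antipode_qe qe_central mult.assoc)
  also have "\<dots> = (-1) ^ CARD('i) *\<^sub>C (antipode (ordered_prod hfac) * ?e * qK)"
    by (simp add: antipode_qK_qe lin_simps mult.assoc) (simp add: qe_central mult.assoc)
  also have "\<dots> = ((-1) ^ CARD('i) * (-1) ^ CARD('i)) *\<^sub>C (ordered_prod hfac * ?e * qK)"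
    by (simp only: h mult_scaleC_left scaleC_scaleC)
  also have "ordered_prod hfac * ?e * qK = Gam"
    unfolding Gam_def ordered_prod_hfac_qK[symmetric] by (simp add: mult.assoc qe_central)
  finally show ?thesis by (simp add: scaleC_one flip: power_mult_distrib)
qed

text \<open>Here many indices contribute, since every site may be empty or doubly occupied. The sum
  is therefore reassembled into an ordered product of one-site sums. Only the block (1,1) has an
  even total power of \<open>qK\<close>; its factor \<beta>^2 meets the \<beta>^2 of the integral,
  and \<beta>^4 cancels the sign (-1)^N.\<close>

lemma S_Z_Gam:
  assumes "\<beta> ^ 4 = (-1) ^ CARD('i::{finite,linorder})"
  shows "S_Z \<nu> \<beta> (Gam :: 'i Q) = \<nu> *\<^sub>C Gam"
proof -
  let ?z = "Gam :: 'i Q"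
  let ?L = "\<lambda>c. ordered_prod (\<lambda>j :: 'i. loc j (c j) * qK ^ odd_deg (c j))"
  let ?u = "\<lambda>c :: 'i \<Rightarrow> _. \<Prod>j\<in>UNIV. hcoef (c j) (True, True)"
  have z: "?z * qe 1 = ?z" by (simp add: Gam_def mult.assoc qe_mult)
  \<comment> \<open>A site of odd degree has no top coefficient, so whenever the product
    \<open>?u c\<close> is nonzero the twists contribute no power of \<open>qK\<close>.\<close>
  have u: "?u c * of_bool (4 dvd (k + (\<Sum>j\<in>UNIV. odd_deg (c j)))) = ?u c * of_bool (4 dvd k)" for c k
  proof (cases "\<exists>j. odd_deg (c j) \<noteq> 0")
    case True
    then obtain j where "odd_deg (c j) \<noteq> 0" ..
    then have "hcoef (c j) (True, True) = 0" by (cases "c j") (auto simp: odd_deg_def hcoef_def)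
    then have "?u c = 0" by (intro prod_zero) auto
    then show ?thesis by simp
  qed simp
  have t: "top_coef (?L c * ?z * qK ^ m) = ?u c * ((of_bool (4 dvd (m + 1)) - of_bool (4 dvd (m + 1 + 2))) / 2)"
    for c m
  proof -
    let ?H = "\<lambda>j. (\<Sum>x\<in>UNIV. hcoef (c j) x *\<^sub>C loc j x) * qK ^ odd_deg (c j)"
    have G: "?z = ordered_prod hfac * (qe 1 * qK)"
      unfolding Gam_def ordered_prod_hfac_qK[symmetric] by (simp add: mult.assoc qe_central)
    have "?L c * ?z * qK ^ m = (?L c * ordered_prod hfac) * qe 1 * (qK * qK ^ m)"
      unfolding G by (simp only: mult.assoc)
    also have "?L c * ordered_prod hfac = ordered_prod (\<lambda>j. loc j (c j) * qK ^ odd_deg (c j) * hfac j)"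
      by (rule ordered_prod_mult_distrib) (rule hfac_commute_loc)
    also have "\<dots> * qe 1 = ordered_prod ?H * qe 1"
      by (rule ordered_prod_cong_idem[OF qe_central loc_hfac_qe1])
    also have "\<dots> * (qK * qK ^ m) = ordered_prod ?H * qK ^ (m + 1) * qe (Suc 0)"
      by (simp add: mult.assoc qe_central)
    finally have X: "?L c * ?z * qK ^ m = ordered_prod ?H * qK ^ (m + 1) * qe (Suc 0)" .
    show ?thesis
      unfolding X top_coef_half_qe
      unfolding mult.assoc[of _ "qK ^ (m + 1)"] power_add[symmetric]
        top_coef_prod_local u by (simp only: right_diff_distrib times_divide_eq_right)
  qed
  let ?v = "\<lambda>c. weight 1 1 c * hcoef c (True, True)"
  let ?A = "\<lambda>y. antipode (qK * y * qe 1) :: 'i Q"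
  have linA: "clinear ?A"
    by (rule clinearI) (simp_all add: lin_simps clinear_add[OF clinear_antipode]
        clinear_scaleC[OF clinear_antipode])
  have 0: "S_comp \<nu> \<beta> ?z (monodromy \<beta> * sector 1 0) = 0"
    unfolding S_comp_monodromy_sector[OF insertI2[OF insertI1] insertI1 z] t
    by (simp add: four_dvd_Suc)
  have "S_comp \<nu> \<beta> ?z (monodromy \<beta> * sector 1 1) = (- (\<beta> ^ 2)) *\<^sub>C
      (\<Sum>c\<in>UNIV. (- (lam CARD('i) \<nu> \<beta> / 2)) *\<^sub>C ?A ((\<Prod>j\<in>UNIV. ?v (c j)) *\<^sub>C ordered_prod (\<lambda>j. rloc j (c j))))"
    unfolding S_comp_monodromy_sector[OF insertI2[OF insertI1] insertI2[OF insertI1] z] t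
    by (simp add: clinear_scaleC[OF clinear_antipode] prod.distrib lin_simps mult.assoc ac_simps
        four_dvd_Suc)
  also have "\<dots> = (- (\<beta> ^ 2)) *\<^sub>C (- (lam CARD('i) \<nu> \<beta> / 2)) *\<^sub>C
      ?A (\<Sum>c\<in>UNIV. ordered_prod (\<lambda>j. ?v (c j) *\<^sub>C rloc j (c j)))"
    by (simp only: clinear_sum[OF linA] cvec.scale_sum_right ordered_prod_scaleC)
  also have "\<dots> = (\<beta> ^ 2 * (lam CARD('i) \<nu> \<beta> / 2)) *\<^sub>C
      ?A (\<Sum>c\<in>UNIV. ordered_prod (\<lambda>j. ?v (c j) *\<^sub>C rloc j (c j)))"
    by (simp only: scaleC_scaleC mult_minus_left mult_minus_right minus_minus)
  also have "(\<Sum>c\<in>UNIV. ordered_prod (\<lambda>j. ?v (c j) *\<^sub>C rloc j (c j))) =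
      ordered_prod (\<lambda>j :: 'i. \<Sum>c\<in>UNIV. ?v c *\<^sub>C rloc j c)"
    by (rule ordered_prod_sum[symmetric])
  also have "?A (ordered_prod (\<lambda>j :: 'i. \<Sum>c\<in>UNIV. ?v c *\<^sub>C rloc j c)) = 2 ^ CARD('i) *\<^sub>C antipode Gam"
  proof -
    \<comment> \<open>The empty site gives -2 and the full one 4 f^- f^+ = 4 - 4 f^+ f^- in this
      block.\<close>
    have "(\<Sum>c\<in>UNIV. ?v c *\<^sub>C rloc j c) * qe 1 = (2 *\<^sub>C hfac j) * qe 1" for j :: 'i
    proof -
      have "4 *\<^sub>C x = 2 *\<^sub>C x + 2 *\<^sub>C x" for x :: "'i Q" by (simp flip: scaleC_add_left)
      then show ?thesis
        by (simp add: sum_UNIV_bool_pair hcoef_def weight_def rloc_def hfac_def lin_simps mult.assoc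
            qf_Mi_Pl_left qe_mult)
    qed
    then have "ordered_prod (\<lambda>j :: 'i. \<Sum>c\<in>UNIV. ?v c *\<^sub>C rloc j c) * qe 1 =
        ordered_prod (\<lambda>j. 2 *\<^sub>C hfac j) * qe 1"
      by (rule ordered_prod_cong_idem[OF qe_central])
    then show ?thesis
      by (simp add: mult.assoc ordered_prod_scaleC lin_simps clinear_scaleC[OF clinear_antipode] Gam_def)
  qed
  also have "(\<beta> ^ 2 * (lam CARD('i) \<nu> \<beta> / 2)) *\<^sub>C 2 ^ CARD('i) *\<^sub>C antipode Gam = \<nu> *\<^sub>C (Gam :: 'i Q)"
  proof -
    have "\<beta> ^ 2 * (lam CARD('i) \<nu> \<beta> / 2) * 2 ^ CARD('i) = \<nu> * (\<beta> ^ 2 * \<beta> ^ 2) * ((- (1/2)) ^ CARD('i) * 2 ^ CARD('i))"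
      unfolding half_lam by (simp add: ac_simps)
    also have "\<dots> = \<nu> * ((-1) ^ CARD('i) * (-1) ^ CARD('i))"
      using assms by (simp flip: power_add power_mult_distrib)
    also have "\<dots> = \<nu>" by (simp flip: power_mult_distrib)
    finally show ?thesis by (simp add: scaleC_scaleC antipode_Gam)
  qed
  finally show ?thesis
    using S_Z_block[OF insertI2[OF insertI1] z, of \<nu> \<beta>] 0 by simp
qed

section \<open>The summand \<open>Z_Lambda\<close> and its tensor description\<close>

definition L0 :: "('i::{finite,linorder} \<Rightarrow> bool \<times> bool) \<Rightarrow> 'i Q" where
  "L0 d = ordered_prod (\<lambda>j. loc j (d j)) * qe 0"

definition even_deg :: "('i::finite \<Rightarrow> bool \<times> bool) \<Rightarrow> bool" where
  "even_deg d \<longleftrightarrow> even (\<Sum>j\<in>UNIV. odd_deg (d j))"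

fun bit_set :: "free_sign \<Rightarrow> bool \<times> bool \<Rightarrow> bool" where
  "bit_set Pl x = fst x"
| "bit_set Mi x = snd x"

fun add_bit :: "free_sign \<Rightarrow> bool \<times> bool \<Rightarrow> bool \<times> bool" where
  "add_bit Pl x = (True, snd x)"
| "add_bit Mi x = (fst x, True)"

lemma qf_loc_qe0:
  obtains c where "c = 0 \<longleftrightarrow> bit_set s x" "qf s j * loc j x * qe 0 = (c *\<^sub>C loc j (add_bit s x)) * qe 0"
proof -
  have "qf s j * loc j x * qe 0 = ((if bit_set s x then 0 else if s = Mi \<and> fst x then -1 else 1) *\<^sub>C
      loc j (add_bit s x)) * qe 0"
  proof -
    obtain a b where x: "x = (a, b)" by (cases x)
    show ?thesis unfolding x
      by (cases s; cases a; cases b)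
        (simp_all add: loc_simps lin_simps mult.assoc qf_sq_left qf_Mi_Pl_left qe_mult)
  qed
  then show thesis by (rule that[rotated]) auto
qed

text \<open>In the block of \<open>qe 0\<close> a generator acts as exterior multiplication. Only
  the vanishing of the scalar is recorded, not its sign.\<close>

lemma qf_L0:
  fixes d :: "'i::{finite,linorder} \<Rightarrow> bool \<times> bool"
  obtains c where "c = 0 \<longleftrightarrow> bit_set s (d j)" "qf s j * L0 d = c *\<^sub>C L0 (d(j := add_bit s (d j)))"
proof -
  obtain c where c: "c \<in> {1, -1}" "qf s j * ordered_prod (\<lambda>i. loc i (d i)) =
       c *\<^sub>C ordered_prod ((\<lambda>i. loc i (d i))(j := qf s j * loc j (d j)))"
    by (rule qf_ordered_prod_loc)
  obtain k where k: "k = 0 \<longleftrightarrow> bit_set s (d j)"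
    "qf s j * loc j (d j) * qe 0 = (k *\<^sub>C loc j (add_bit s (d j))) * qe 0" by (rule qf_loc_qe0)
  let ?a = "\<lambda>i. loc i (d i)"
  have "ordered_prod (?a(j := qf s j * loc j (d j))) * qe 0 =
      ordered_prod (?a(j := k *\<^sub>C loc j (add_bit s (d j)))) * qe 0"
    by (rule ordered_prod_cong_idem[OF qe_central]) (auto simp: k(2))
  also have "ordered_prod (?a(j := k *\<^sub>C loc j (add_bit s (d j)))) =
      k *\<^sub>C ordered_prod (?a(j := loc j (add_bit s (d j))))"
    using multilin_ordered_prod unfolding multilin_def by blast
  also have "?a(j := loc j (add_bit s (d j))) = (\<lambda>i. loc i ((d(j := add_bit s (d j))) i))" by auto
  finally have X: "ordered_prod (?a(j := qf s j * loc j (d j))) * qe 0 =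
      k *\<^sub>C L0 (d(j := add_bit s (d j)))"
    by (simp only: L0_def mult_scaleC_left)
  have "qf s j * L0 d = c *\<^sub>C (ordered_prod (?a(j := qf s j * loc j (d j))) * qe 0)"
    using arg_cong[where f = "\<lambda>y. y * qe 0", OF c(2)]
    by (simp only: L0_def mult.assoc mult_scaleC_left)
  then have "qf s j * L0 d = (c * k) *\<^sub>C L0 (d(j := add_bit s (d j)))"
    by (simp only: X scaleC_scaleC)
  moreover have "c * k = 0 \<longleftrightarrow> bit_set s (d j)" using c(1) k(1) by auto
  ultimately show thesis by (rule that[rotated])
qed

lemma sum_odd_deg_add_bit:
  fixes d :: "'i::finite \<Rightarrow> bool \<times> bool"
  assumes "\<not> bit_set s (d j)"
  shows "even_deg (d(j := add_bit s (d j))) \<longleftrightarrow> \<not> even_deg d"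
proof -
  have 1: "(\<Sum>i\<in>UNIV. odd_deg (e i)) = odd_deg (e j) + (\<Sum>i\<in>UNIV - {j}. odd_deg (e i))" for e :: "'i \<Rightarrow> _"
    by (simp add: sum.remove)
  have "(\<Sum>i\<in>UNIV - {j}. odd_deg ((d(j := add_bit s (d j))) i)) = (\<Sum>i\<in>UNIV - {j}. odd_deg (d i))"
    by (intro sum.cong) auto
  moreover have "even (odd_deg (add_bit s (d j))) \<longleftrightarrow> odd (odd_deg (d j))"
    using assms by (cases s; cases "d j") (auto simp: odd_deg_def)
  ultimately show ?thesis unfolding even_deg_def 1[of d] 1[of "d(j := _)"] by auto
qed

lemma fword_in_span:
  "fword w * qe 0 \<in> cvec.span {L0 d | d :: 'i::{finite,linorder} \<Rightarrow> _. even_deg d \<longleftrightarrow> even (length w)}"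
proof (induction w)
  case Nil
  have 1: "fword [] * qe 0 = L0 (\<lambda>_::'i. (False, False))" and 2: "even_deg (\<lambda>_::'i. (False, False))"
    by (simp_all add: L0_def loc_simps ordered_prod_one even_deg_def odd_deg_def fword_simps)
  show ?case unfolding 1 by (rule cvec.span_base) (use 2 in auto)
next
  case (Cons x w)
  obtain s j where x: "x = (s, j)" by (cases x)
  have "qf s j * (fword w * qe 0) \<in>
      cvec.span {L0 d | d :: 'i \<Rightarrow> _. even_deg d \<longleftrightarrow> even (length (x # w))}"
  proof (rule clinear_in_subspace[OF clinear_mult_left _ Cons.IH])
    fix b :: "'i Q" assume "b \<in> {L0 d | d. even_deg d \<longleftrightarrow> even (length w)}"
    then obtain d where d: "b = L0 d" "even_deg d \<longleftrightarrow> even (length w)" by blast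
    obtain c where c: "c = 0 \<longleftrightarrow> bit_set s (d j)"
      "qf s j * L0 d = c *\<^sub>C L0 (d(j := add_bit s (d j)))" by (rule qf_L0)
    show "qf s j * b \<in> cvec.span {L0 d | d. even_deg d \<longleftrightarrow> even (length (x # w))}"
    proof (cases "bit_set s (d j)")
      case True
      then show ?thesis using c by (simp add: d(1) cvec.span_zero)
    next
      case False
      then have "L0 (d(j := add_bit s (d j))) \<in> {L0 d | d. even_deg d \<longleftrightarrow> even (length (x # w))}"
        using sum_odd_deg_add_bit[of s d j] d(2) by auto
      then show ?thesis unfolding d(1) c(2) by (intro cvec.span_scale cvec.span_base)
    qed
  qed simp
  then show ?case by (simp add: x fword_simps mult.assoc)
qed

lemma Z_Lambda_eq: "Z_Lambda = cvec.span {L0 d | d :: 'i::{finite,linorder} \<Rightarrow> _. even_deg d}"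
proof (rule equalityI)
  show "Z_Lambda \<subseteq> cvec.span {L0 d | d :: 'i \<Rightarrow> _. even_deg d}"
    unfolding Z_Lambda_def
  proof (rule cvec.span_minimal)
    show "{qe 0 * prod_list (map (\<lambda>(s, j). qf s j) w) | w. even (length w)} \<subseteq>
        cvec.span {L0 d | d :: 'i \<Rightarrow> _. even_deg d}"
    proof (clarify)
      fix w :: "(free_sign \<times> 'i) list" assume "even (length w)"
      then show "qe 0 * prod_list (map (\<lambda>(s, j). qf s j) w) \<in> cvec.span {L0 d | d. even_deg d}"
        using fword_in_span[of w] by (simp add: fword_def qe_central)
    qed
  qed simp
  show "cvec.span {L0 d | d :: 'i \<Rightarrow> _. even_deg d} \<subseteq> Z_Lambda"
    unfolding Z_Lambda_def
  proof (rule cvec.span_mono, clarify)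
    fix d :: "'i \<Rightarrow> bool \<times> bool" assume d: "even_deg d"
    obtain w where w: "ordered_prod (\<lambda>j. loc j (d j)) = fword w"
      "even (length w) \<longleftrightarrow> even (\<Sum>j\<in>UNIV. odd_deg (d j))" by (rule ordered_prod_loc_fword)
    then show "\<exists>w. L0 d = qe 0 * prod_list (map (\<lambda>(s, j). qf s j) w) \<and> even (length w)"
      using d by (intro exI[of _ w]) (simp add: L0_def fword_def qe_central even_deg_def)
  qed
qed

lemma L0_eq_mon: "L0 d = (1/2) *\<^sub>C (mon d 0 + mon d 2)"
  by (simp add: L0_def mon_def qe_def lin_simps)

lemma coord_L0: "coord d 0 (L0 d') = of_bool (d = d') / 2" "coord d 1 (L0 d') = 0"
  by (simp_all add: L0_eq_mon coord_scaleC coord_add coord_mon)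

lemma L0_inj: "L0 d = L0 d' \<Longrightarrow> d = d'"
  using coord_L0(1)[of d d] coord_L0(1)[of d d'] by (auto split: if_splits)

lemma independent_L0: "cvec.independent (L0 ` D)"
proof (rule independent_if_dual[where l = "\<lambda>b x. 2 * coord (inv_into UNIV L0 b) 0 x"])
  have inj: "inj (L0 :: ('a \<Rightarrow> _) \<Rightarrow> _)" by (rule injI) (rule L0_inj)
  show "2 * coord (inv_into UNIV L0 b) 0 b' = of_bool (b = b')" if "b \<in> L0 ` D" "b' \<in> L0 ` D" for b b'
    using that by (auto simp: inv_f_f[OF inj] coord_L0 inj_eq[OF inj])
qed (simp_all add: coord_add coord_scaleC)

lemma clinear_theta: "clinear theta"
  and theta_pure: "theta (pure_tensor a) = ordered_prod a"
  unfolding theta_def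
  by (rule clinear_tensor_lift[OF multilin_ordered_prod], rule tensor_lift_pure[OF multilin_ordered_prod])

definition pt :: "('i::{finite,linorder} \<Rightarrow> bool \<times> bool) \<Rightarrow> ('i, 'i Q) tpow" where
  "pt d = pure_tensor (\<lambda>j. loc j (d j) * qe 0)"

lemma theta_pt: "theta (pt d) = L0 d"
  by (simp add: pt_def theta_pure L0_def ordered_prod_mult_idem[OF qe_central qe_mult(1)])

lemma U_plus_eq: "U_plus = cvec.span (pt ` {d :: 'i::{finite,linorder} \<Rightarrow> _. even_deg d})"
proof -
  let ?C = "\<lambda>p m :: 'i \<Rightarrow> nat. \<forall>j. p j \<in> {0,1} \<and> m j \<in> {0,1}"
  let ?U = "\<lambda>p m. pure_tensor (\<lambda>j. qf Pl j ^ p j * qf Mi j ^ m j * qe 0) :: ('i, 'i Q) tpow"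
  let ?d = "\<lambda>p m j. (p j = (1::nat), m j = (1::nat))"
  have 1: "?U p m = pt (?d p m)" "even (\<Sum>j\<in>UNIV. p j + m j) \<longleftrightarrow> even_deg (?d p m)" if "?C p m" for p m
  proof -
    have "qf Pl j ^ p j * qf Mi j ^ m j = loc j (?d p m j)" for j
      using that[rule_format, of j] by (auto simp: loc_def)
    then show "?U p m = pt (?d p m)" by (simp add: pt_def)
    show "even (\<Sum>j\<in>UNIV. p j + m j) \<longleftrightarrow> even_deg (?d p m)"
      unfolding even_deg_def
    proof (rule even_sum_cong)
      show "even (p j + m j) \<longleftrightarrow> even (odd_deg (?d p m j))" for j
        using that[rule_format, of j] by (auto simp: odd_deg_def)
    qed
  qed
  have "{?U p m | p m. ?C p m \<and> even (\<Sum>j\<in>UNIV. p j + m j)} = pt ` {d. even_deg d}"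
  proof (intro equalityI subsetI)
    fix x assume "x \<in> {?U p m | p m. ?C p m \<and> even (\<Sum>j\<in>UNIV. p j + m j)}"
    then obtain p m where x: "x = ?U p m" "?C p m" "even (\<Sum>j\<in>UNIV. p j + m j)" by blast
    then show "x \<in> pt ` {d. even_deg d}" using 1[OF x(2)] by (intro image_eqI[of _ _ "?d p m"]) simp_all
  next
    fix x :: "('i, 'i Q) tpow" assume "x \<in> pt ` {d. even_deg d}"
    then obtain d where d: "x = pt d" "even_deg d" by blast
    let ?p = "\<lambda>j. of_bool (fst (d j)) :: nat" and ?m = "\<lambda>j. of_bool (snd (d j)) :: nat"
    have C: "?C ?p ?m" by simp
    have "?d ?p ?m = d" by (auto simp: fun_eq_iff prod_eq_iff)
    then have "x = ?U ?p ?m" "even (\<Sum>j\<in>UNIV. ?p j + ?m j)"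
      using 1[OF C] d by simp_all
    then show "x \<in> {?U p m | p m. ?C p m \<and> even (\<Sum>j\<in>UNIV. p j + m j)}"
      by (intro CollectI exI[of _ ?p] exI[of _ ?m] conjI C)
  qed
  then show ?thesis unfolding U_plus_def by simp
qed

lemma theta_image_pt: "theta ` pt ` D = L0 ` D"
  by (simp add: image_image theta_pt)

text \<open>The images \<open>L0 d\<close> of the spanning tensors are independent. This gives
  injectivity on the span without separate knowledge of a basis of the tensor power.\<close>

lemma bij_theta: "bij_betw theta U_plus (Z_Lambda :: 'i::{finite,linorder} Q set)"
proof -
  let ?D = "{d :: 'i \<Rightarrow> bool \<times> bool. even_deg d}"
  have "inj_on theta (pt ` ?D)"
    by (rule inj_onI) (auto simp: theta_pt dest: L0_inj)
  then have "inj_on theta (cvec.span (pt ` ?D))"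
    using independent_L0[of ?D] clinear_theta
    by (intro cpair.linear_inj_on_span_independent_image) (simp_all add: theta_image_pt)
  moreover have "theta ` cvec.span (pt ` ?D) = cvec.span (L0 ` ?D)"
    using cpair.linear_span_image[OF clinear_theta, of "pt ` ?D"] by (simp add: theta_image_pt)
  moreover have "L0 ` ?D = {L0 d | d. even_deg d}" by auto
  ultimately show ?thesis unfolding bij_betw_def U_plus_eq Z_Lambda_eq by simp
qed

section \<open>Multilinear maps and the one-site maps\<close>

lemma multilin_scaleC:
  fixes B :: "('i::finite \<Rightarrow> 'a::complex_alg) \<Rightarrow> 'b::complex_vec"
  assumes "multilin B"
  shows "B (\<lambda>j. c j *\<^sub>C a j) = (\<Prod>j\<in>UNIV. c j) *\<^sub>C B a"
proof -
  have "B (\<lambda>j. if j \<in> A then c j *\<^sub>C a j else a j) = (\<Prod>j\<in>A. c j) *\<^sub>C B a" for A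
  proof (induction A rule: finite_induct[OF finite])
    case (2 k A)
    let ?f = "\<lambda>j. if j \<in> A then c j *\<^sub>C a j else a j"
    have "(\<lambda>j. if j \<in> insert k A then c j *\<^sub>C a j else a j) = ?f(k := c k *\<^sub>C a k)" by auto
    moreover have "?f(k := a k) = ?f" using 2 by auto
    ultimately show ?case using assms 2 by (simp add: multilin_def scaleC_scaleC)
  qed (simp add: scaleC_one)
  from this[of UNIV] show ?thesis by simp
qed

lemma multilin_in_span:
  fixes B :: "('i::finite \<Rightarrow> 'a::complex_alg) \<Rightarrow> 'b::complex_vec"
  assumes "multilin B" "\<And>j. a j \<in> cvec.span (S j)"
  shows "B a \<in> cvec.span {B l | l. \<forall>j. l j \<in> S j}"
proof -
  have "(\<forall>j\<in>A. a j \<in> cvec.span (S j)) \<Longrightarrow> (\<forall>j\<in>-A. a j \<in> S j) \<Longrightarrow> B a \<in> cvec.span {B l | l. \<forall>j. l j \<in> S j}" for A a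
  proof (induction A arbitrary: a rule: finite_induct[OF finite])
    case 1
    then show ?case by (intro cvec.span_base) auto
  next
    case (2 k A)
    have lin: "clinear (\<lambda>x. B (a(k := x)))"
      by (rule clinearI) (use assms(1) in \<open>auto simp: multilin_def\<close>)
    have "B (a(k := a k)) \<in> cvec.span {B l | l. \<forall>j. l j \<in> S j}"
    proof (rule clinear_in_subspace[OF lin])
      show "a k \<in> cvec.span (S k)" using 2 by auto
      show "B (a(k := b)) \<in> cvec.span {B l | l. \<forall>j. l j \<in> S j}" if "b \<in> S k" for b
        using 2(1,2,4,5) that by (intro 2(3)) auto
    qed simp
    then show ?case by simp
  qed
  from this[of UNIV a] show ?thesis using assms(2) by simp
qed

lemma multilin_tensor_map:
  assumes "\<And>j. clinear (g j)"
  shows "multilin (\<lambda>a. pure_tensor (\<lambda>j. g j (a j)))"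
proof -
  have *: "(\<lambda>i. g i ((a(j := x)) i)) = (\<lambda>i. g i (a i))(j := g j x)" for a j x by auto
  show ?thesis
    unfolding multilin_def *
    by (simp only: clinear_add[OF assms] clinear_scaleC[OF assms]
        multilin_pure_tensor[unfolded multilin_def, THEN conjunct1, rule_format]
        multilin_pure_tensor[unfolded multilin_def, THEN conjunct2, rule_format] simp_thms)
qed

lemma clinear_tensor_map: "(\<And>j. clinear (g j)) \<Longrightarrow> clinear (tensor_map g)"
  unfolding tensor_map_def by (rule clinear_tensor_lift[OF multilin_tensor_map])

lemma tensor_map_pure:
  "(\<And>j. clinear (g j)) \<Longrightarrow> tensor_map g (pure_tensor a) = pure_tensor (\<lambda>j. g j (a j))"
  unfolding tensor_map_def by (rule tensor_lift_pure[OF multilin_tensor_map])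

lemma map_of_matrix:
  assumes "distinct bs" "cvec.independent (set bs)" "A \<in> carrier_mat (length bs) (length bs)"
  shows "clinear (map_of_matrix bs A)" "has_matrix (map_of_matrix bs A) bs A"
proof -
  define v where "v b = (\<Sum>i<length bs. A $$ (i, THE j. j < length bs \<and> bs ! j = b) *\<^sub>C (bs ! i))" for b
  obtain f where f: "clinear f" "\<And>b. b \<in> set bs \<Longrightarrow> f b = v b"
    using cpair.linear_independent_extend[OF assms(2), of v] by blast
  have "has_matrix f bs A"
    unfolding has_matrix_def
  proof (intro conjI allI impI assms(3))
    fix j assume j: "j < length bs"
    have "(THE k. k < length bs \<and> bs ! k = bs ! j) = j"
      using j assms(1) by (intro the_equality) (auto simp: nth_eq_iff_index_eq)
    then show "f (bs ! j) = (\<Sum>i<length bs. A $$ (i, j) *\<^sub>C bs ! i)"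
      using f(2)[of "bs ! j"] j by (simp add: v_def)
  qed
  with f(1) have "clinear f \<and> has_matrix f bs A" ..
  then have "clinear (map_of_matrix bs A) \<and> has_matrix (map_of_matrix bs A) bs A"
    unfolding map_of_matrix_def by (rule someI[of "\<lambda>f. clinear f \<and> has_matrix f bs A"])
  then show "clinear (map_of_matrix bs A)" "has_matrix (map_of_matrix bs A) bs A" by auto
qed

lemma ordered_prod_single: "ordered_prod ((\<lambda>_::'i::{finite,linorder}. 1)(j := y)) = (y :: 'a::monoid_mult)"
proof -
  have ones: "prod_list (map (\<lambda>_. 1) xs) = (1 :: 'a)" for xs :: "'i list"
    by (induction xs) simp_all
  have "j \<in> set (sorted_list_of_set UNIV)" by simp
  then obtain ys zs where s: "sorted_list_of_set (UNIV :: 'i set) = ys @ j # zs"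
    by (meson split_list)
  with distinct_sorted_UNIV[where 'i = 'i] have j: "j \<notin> set ys" "j \<notin> set zs" by auto
  let ?f = "(\<lambda>_::'i. 1)(j := y)"
  have m: "map ?f ys = map (\<lambda>_. 1) ys" "map ?f zs = map (\<lambda>_. 1) zs" using j by auto
  show ?thesis unfolding ordered_prod_def s by (simp add: m ones del: map_fun_upd)
qed

text \<open>Placing a single site among empty ones makes distinctness and independence of
  \<open>U_basis j\<close> a special case of the statements on the \<open>L0 d\<close>.\<close>

lemma loc_qe0_eq_L0: "loc j x * qe 0 = L0 ((\<lambda>_. (False, False))(j := x))"
proof -
  have "(\<lambda>i. loc i (((\<lambda>_. (False, False))(j := x)) i)) = (\<lambda>_. 1)(j := loc j x)"
    by (auto simp: fun_eq_iff loc_simps)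
  then show ?thesis by (simp add: L0_def ordered_prod_single)
qed

lemma loc_qe0_inj: "loc j x * qe 0 = loc j y * qe 0 \<Longrightarrow> x = (y :: bool \<times> bool)"
  for j :: "'i::{finite,linorder}"
proof -
  assume "loc j x * qe 0 = loc j y * qe 0"
  then have "(\<lambda>_. (False, False))(j := x) = (\<lambda>_. (False, False))(j := y)"
    unfolding loc_qe0_eq_L0 by (rule L0_inj)
  then have "((\<lambda>_. (False, False))(j := x)) j = ((\<lambda>_. (False, False))(j := y)) j" by (rule fun_cong)
  then show "x = y" by simp
qed

lemma U_basis_eq: "U_basis j =
    map (\<lambda>x. loc j x * qe 0) [(True, True), (False, False), (False, True), (True, False)]"
  by (simp add: U_basis_def loc_simps)

lemma distinct_U_basis: "distinct (U_basis (j :: 'i::{finite,linorder}))"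
  unfolding U_basis_eq distinct_map by (auto intro!: inj_onI dest: loc_qe0_inj)

lemma independent_U_basis: "cvec.independent (set (U_basis (j :: 'i::{finite,linorder})))"
proof -
  have *: "set (U_basis j) = L0 ` (\<lambda>x. (\<lambda>_. (False, False))(j := x)) `
      {(True, True), (False, False), (False, True), (True, False)}"
    unfolding U_basis_eq loc_qe0_eq_L0 by simp
  show ?thesis unfolding * by (rule independent_L0)
qed

lemma is_ordered_basis_U: "is_ordered_basis (U_basis j) (U_space (j :: 'i::{finite,linorder}))"
proof -
  have "set (U_basis j) = {qe 0, qf Mi j * qe 0, qf Pl j * qe 0, qf Pl j * qf Mi j * qe 0}"
    by (auto simp: U_basis_def)
  then show ?thesis
    using distinct_U_basis[of j] independent_U_basis[of j] by (simp add: is_ordered_basis_def U_space_def)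
qed

lemma length_U_basis: "length (U_basis j) = 4"
  by (simp add: U_basis_def)

lemma sigma_map: "clinear (sigma_map j)" "has_matrix (sigma_map j) (U_basis j) mat_sigma"
  and t_map: "clinear (t_map j)" "has_matrix (t_map j) (U_basis j) mat_t"
  for j :: "'i::{finite,linorder}"
proof -
  have c: "mat_sigma \<in> carrier_mat (length (U_basis j)) (length (U_basis j))"
    "mat_t \<in> carrier_mat (length (U_basis j)) (length (U_basis j))"
    unfolding length_U_basis mat_sigma_def mat_t_def
    by (intro carrier_matI; simp add: mat_of_rows_list_def)+
  note m = map_of_matrix[OF distinct_U_basis independent_U_basis]
  show "clinear (sigma_map j)" "has_matrix (sigma_map j) (U_basis j) mat_sigma"
    unfolding sigma_map_def using m[OF c(1)] by blast+
  show "clinear (t_map j)" "has_matrix (t_map j) (U_basis j) mat_t"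
    unfolding t_map_def using m[OF c(2)] by blast+
qed

lemma has_matrix_U_basis:
  assumes "has_matrix f (U_basis j) A" "k < 4"
  shows "f (U_basis j ! k) = A $$ (0, k) *\<^sub>C (loc j (True, True) * qe 0) +
    A $$ (1, k) *\<^sub>C (loc j (False, False) * qe 0) + A $$ (2, k) *\<^sub>C (loc j (False, True) * qe 0) +
    A $$ (3, k) *\<^sub>C (loc j (True, False) * qe 0)"
proof -
  have "f (U_basis j ! k) = (\<Sum>i<4. A $$ (i, k) *\<^sub>C (U_basis j ! i))"
    using assms unfolding has_matrix_def length_U_basis by blast
  moreover have "{..<4 :: nat} = {0, 1, 2, 3}" by auto
  ultimately show ?thesis by (simp add: U_basis_eq add.assoc)
qed

lemma sigma_map_loc: "sigma_map j (loc j x * qe 0) = sigma_loc j (x :: bool \<times> bool)"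
  for j :: "'i::{finite,linorder}"
proof -
  note h = has_matrix_U_basis[OF sigma_map(2), of _ j]
  have m: "f = -g \<Longrightarrow> 2 *\<^sub>C f = - (2 *\<^sub>C g)" for f g :: "'i Q" by (simp add: cvec.scale_minus_right)
  obtain a b where "x = (a, b)" by (cases x)
  then show ?thesis
    using h[of 0] h[of 1] h[of 2] h[of 3] qf_qf_qe0[of j]
    by (cases a; cases b)
      (simp_all add: U_basis_eq mat_sigma_def mat_of_rows_list_def sigma_loc_def compl_def weight_def
        local_a_def local_b_def merge_sg_def loc_simps rloc_def lin_simps mult.assoc numeral_eq_Suc)
qed

lemma t_map_loc: "t_map j (loc j x * qe 0) = (1 + 2 *\<^sub>C (qf Pl j * qf Mi j)) * (loc j (x :: bool \<times> bool) * qe 0)"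
  for j :: "'i::{finite,linorder}"
proof -
  note h = has_matrix_U_basis[OF t_map(2), of _ j]
  obtain a b where "x = (a, b)" by (cases x)
  then show ?thesis
    using h[of 0] h[of 1] h[of 2] h[of 3]
    by (cases a; cases b)
      (simp_all add: U_basis_eq mat_t_def mat_of_rows_list_def loc_simps lin_simps mult.assoc
        numeral_eq_Suc qf_Mi_Pl_left qf_sq_left qe_mult)
qed

lemma sigma_loc_simps:
  "sigma_loc j (True, True) = (- (1/2)) *\<^sub>C (loc j (False, False) * qe 0)"
  "sigma_loc j (False, False) = 2 *\<^sub>C (loc j (True, True) * qe 0)"
  "sigma_loc j (True, False) = loc j (True, False) * qe 0"
  "sigma_loc j (False, True) = loc j (False, True) * qe 0"
  using qf_qf_qe0[of j]
  by (simp_all add: sigma_loc_def compl_def weight_def local_a_def local_b_def merge_sg_def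
      loc_simps rloc_def lin_simps mult.assoc)

lemma t_loc_simps:
  "(1 + 2 *\<^sub>C (qf Pl j * qf Mi j)) * (loc j (True, True) * qe 0) = loc j (True, True) * qe 0"
  "(1 + 2 *\<^sub>C (qf Pl j * qf Mi j)) * (loc j (False, False) * qe 0) =
     loc j (False, False) * qe 0 + 2 *\<^sub>C (loc j (True, True) * qe 0)"
  "(1 + 2 *\<^sub>C (qf Pl j * qf Mi j)) * (loc j (True, False) * qe 0) = loc j (True, False) * qe 0"
  "(1 + 2 *\<^sub>C (qf Pl j * qf Mi j)) * (loc j (False, True) * qe 0) = loc j (False, True) * qe 0"
  by (simp_all add: loc_simps lin_simps mult.assoc qf_Mi_Pl_left qf_sq_left qe_mult)

text \<open>Evenness is a condition on all sites together. It survives the tensor product of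
  one-site maps because \<open>sigma_map\<close> and \<open>t_map\<close> preserve the parity at
  each single site.\<close>

lemma pure_tensor_in_U_plus:
  fixes d :: "'i::{finite,linorder} \<Rightarrow> bool \<times> bool"
  assumes "even_deg d"
    and "\<And>j. a j \<in> cvec.span {loc j x * qe 0 | x. odd_deg x = odd_deg (d j)}"
  shows "pure_tensor a \<in> U_plus"
proof -
  let ?S = "\<lambda>j. {loc j x * qe 0 | x. odd_deg x = odd_deg (d j)}"
  have "pure_tensor a \<in> cvec.span {pure_tensor l | l. \<forall>j. l j \<in> ?S j}"
    by (rule multilin_in_span[OF multilin_pure_tensor assms(2)])
  also have "\<dots> \<subseteq> U_plus"
    unfolding U_plus_eq
  proof (rule cvec.span_mono, clarify)
    fix l :: "'i \<Rightarrow> 'i Q" assume "\<forall>j. l j \<in> ?S j"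
    then have "\<forall>j. \<exists>x. l j = loc j x * qe 0 \<and> odd_deg x = odd_deg (d j)" by blast
    then obtain e where e: "\<And>j. l j = loc j (e j) * qe 0" "\<And>j. odd_deg (e j) = odd_deg (d j)"
      by metis
    have "pure_tensor l = pt e" unfolding pt_def by (intro arg_cong[where f = pure_tensor] ext e)
    moreover have "even_deg e" using assms(1) by (simp add: even_deg_def e(2))
    ultimately show "pure_tensor l \<in> pt ` {d. even_deg d}" by blast
  qed
  finally show ?thesis .
qed

lemma subspace_U_plus: "cvec.subspace U_plus"
  by (simp add: U_plus_eq)

lemma tensor_map_pt:
  "tensor_map sigma_map (pt d) = pure_tensor (\<lambda>j. sigma_map j (loc j (d j) * qe 0))"
  "tensor_map t_map (pt d) = pure_tensor (\<lambda>j. t_map j (loc j (d j) * qe 0))"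
  unfolding pt_def by (rule tensor_map_pure, rule sigma_map t_map)+

lemma clinear_tensor_sigma: "clinear (tensor_map sigma_map :: ('i::{finite,linorder}, 'i Q) tpow \<Rightarrow> _)"
  and clinear_tensor_t: "clinear (tensor_map t_map :: ('i, 'i Q) tpow \<Rightarrow> _)"
  by (rule clinear_tensor_map, rule sigma_map t_map)+

lemma tensor_map_U_plus:
  "tensor_map sigma_map ` U_plus \<subseteq> (U_plus :: ('i::{finite,linorder}, 'i Q) tpow set)"
  "tensor_map t_map ` U_plus \<subseteq> (U_plus :: ('i, 'i Q) tpow set)"
proof -
  let ?S = "\<lambda>j y. cvec.span {loc j x * qe 0 | x. odd_deg x = odd_deg y}"
  have loc_in: "loc j x * qe 0 \<in> ?S j y" if "odd_deg x = odd_deg y" for j :: 'i and x y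
    using that by (intro cvec.span_base) blast
  have "sigma_map j (loc j y * qe 0) \<in> ?S j y" for j :: 'i and y
  proof -
    obtain a b where "y = (a, b)" by (cases y)
    then show ?thesis unfolding sigma_map_loc
      by (cases a; cases b; simp only: sigma_loc_simps; intro cvec.span_scale loc_in;
          simp add: odd_deg_def)
  qed
  then have s: "tensor_map sigma_map (pt d) \<in> U_plus" if "even_deg d" for d :: "'i \<Rightarrow> _"
    unfolding tensor_map_pt by (intro pure_tensor_in_U_plus[OF that])
  have "t_map j (loc j y * qe 0) \<in> ?S j y" for j :: 'i and y
  proof -
    obtain a b where "y = (a, b)" by (cases y)
    then show ?thesis unfolding t_map_loc
      by (cases a; cases b; simp only: t_loc_simps; intro cvec.span_add cvec.span_scale loc_in;
          simp add: odd_deg_def)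
  qed
  then have t: "tensor_map t_map (pt d) \<in> U_plus" if "even_deg d" for d :: "'i \<Rightarrow> _"
    unfolding tensor_map_pt by (intro pure_tensor_in_U_plus[OF that])
  show "tensor_map sigma_map ` U_plus \<subseteq> (U_plus :: ('i, 'i Q) tpow set)"
  proof (rule image_subsetI)
    fix u :: "('i, 'i Q) tpow" assume "u \<in> U_plus"
    then show "tensor_map sigma_map u \<in> U_plus"
      unfolding U_plus_eq
      by (rule clinear_in_subspace[OF clinear_tensor_sigma cvec.subspace_span])
        (use s in \<open>auto simp: U_plus_eq\<close>)
  qed
  show "tensor_map t_map ` U_plus \<subseteq> (U_plus :: ('i, 'i Q) tpow set)"
  proof (rule image_subsetI)
    fix u :: "('i, 'i Q) tpow" assume "u \<in> U_plus"
    then show "tensor_map t_map u \<in> U_plus"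
      unfolding U_plus_eq
      by (rule clinear_in_subspace[OF clinear_tensor_t cvec.subspace_span])
        (use t in \<open>auto simp: U_plus_eq\<close>)
  qed
qed

section \<open>Transport of both transformations along \<open>theta\<close>\<close>

lemma clinear_scale: "clinear f \<Longrightarrow> clinear (\<lambda>x. c *\<^sub>C f x)"
  by (rule clinearI) (simp_all add: clinear_add clinear_scaleC scaleC_add_right scaleC_scaleC mult.commute)

lemma U_plus_linear_eqI:
  assumes "clinear f" "clinear g" "u \<in> U_plus" "\<And>d. even_deg d \<Longrightarrow> f (pt d) = g (pt d)"
  shows "f u = g u"
  using assms(3) unfolding U_plus_eq
  by (rule clinear_eq_on_span[OF assms(1,2)]) (use assms(4) in auto)

lemma S_Z_theta:
  assumes "u \<in> U_plus"
  shows "S_Z \<nu> \<beta> (theta u) = theta ((\<nu> * \<beta> ^ 2) *\<^sub>C tensor_map sigma_map u)"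
proof (rule U_plus_linear_eqI[of "\<lambda>u. S_Z \<nu> \<beta> (theta u)" "\<lambda>u. theta ((\<nu> * \<beta> ^ 2) *\<^sub>C tensor_map sigma_map u)", OF _ _ assms])
  show "clinear (\<lambda>u. S_Z \<nu> \<beta> (theta u) :: 'a Q)" by (rule clinear_compose[OF clinear_theta clinear_S_Z])
  show "clinear (\<lambda>u. theta ((\<nu> * \<beta> ^ 2) *\<^sub>C tensor_map sigma_map u) :: 'a Q)"
    by (rule clinear_compose[OF clinear_scale[OF clinear_tensor_sigma] clinear_theta])
  show "S_Z \<nu> \<beta> (theta (pt d)) = theta ((\<nu> * \<beta> ^ 2) *\<^sub>C tensor_map sigma_map (pt d))"
    if "even_deg d" for d :: "'a \<Rightarrow> _"
    using S_Z_Lambda_monomial[of d \<nu> \<beta>] that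
    by (simp add: theta_pt clinear_scaleC[OF clinear_theta] tensor_map_pt sigma_map_loc theta_pure
        L0_def even_deg_def)
qed

lemma clinear_T_Z: "clinear (T_Z \<beta>)"
  unfolding T_Z_def[abs_def] by (rule clinear_mult_left)

lemma ribbon_inverse_qe0:
  "ribbon_inverse \<beta> * qe 0 = ordered_prod (\<lambda>k. 1 + 2 *\<^sub>C (qf Pl k * qf Mi k)) * qe 0"
proof -
  have "(1 + 2 *\<^sub>C (qf Pl k * qf Mi k * qK ^ 2)) * qe 0 = (1 + 2 *\<^sub>C (qf Pl k * qf Mi k)) * qe 0" for k :: 'a
    by (simp add: lin_simps mult.assoc qK_sq_qe)
  then have P: "ordered_prod (\<lambda>k :: 'a. 1 + 2 *\<^sub>C (qf Pl k * qf Mi k * qK ^ 2)) * qe 0 =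
      ordered_prod (\<lambda>k. 1 + 2 *\<^sub>C (qf Pl k * qf Mi k)) * qe 0"
    by (rule ordered_prod_cong_idem[OF qe_central])
  let ?P = "ordered_prod (\<lambda>k :: 'a. 1 + 2 *\<^sub>C (qf Pl k * qf Mi k * qK ^ 2))"
  have "ribbon_inverse \<beta> * qe 0 = (qe 0 - (inverse \<beta> * \<i>) *\<^sub>C (qK * qe 1)) * (qe 0 * ?P)"
    by (simp add: ribbon_inverse_def mult.assoc qe_central)
  also have "\<dots> = qe 0 * ?P"
    by (simp add: left_diff_distrib mult_scaleC_left mult.assoc qe_mult_left)
  finally show ?thesis by (simp add: qe_central P)
qed

lemma T_Z_L0: "T_Z \<beta> (L0 d) = ordered_prod (\<lambda>j. (1 + 2 *\<^sub>C (qf Pl j * qf Mi j)) * (loc j (d j) * qe 0))"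
proof -
  let ?A = "\<lambda>j :: 'a. 1 + 2 *\<^sub>C (qf Pl j * qf Mi j)"
  have "T_Z \<beta> (L0 d) = (ribbon_inverse \<beta> * qe 0) * ordered_prod (\<lambda>j. loc j (d j))"
    by (simp add: T_Z_def L0_def mult.assoc qe_central)
  also have "\<dots> = (ordered_prod ?A * ordered_prod (\<lambda>j. loc j (d j))) * qe 0"
    by (simp add: ribbon_inverse_qe0 mult.assoc qe_central)
  also have "ordered_prod ?A * ordered_prod (\<lambda>j. loc j (d j)) = ordered_prod (\<lambda>j. ?A j * loc j (d j))"
  proof (rule ordered_prod_mult_distrib)
    fix i j :: 'a assume "i \<noteq> j"
    then have "hfac j * loc i (d i) = loc i (d i) * hfac j"
      using hfac_commute_loc[of j i "d i" 0] by simp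
    then have "(2 *\<^sub>C (qf Pl j * qf Mi j)) * loc i (d i) = loc i (d i) * (2 *\<^sub>C (qf Pl j * qf Mi j))"
      by (simp add: hfac_def left_diff_distrib right_diff_distrib)
    then show "loc i (d i) * ?A j = ?A j * loc i (d i)"
      by (simp add: distrib_left distrib_right)
  qed
  also have "\<dots> * qe 0 = ordered_prod (\<lambda>j. ?A j * loc j (d j) * qe 0)"
    by (rule ordered_prod_mult_idem[OF qe_central qe_mult(1), symmetric])
  finally show ?thesis by (simp only: mult.assoc)
qed

lemma T_Z_theta:
  assumes "u \<in> U_plus"
  shows "T_Z \<beta> (theta u) = theta (tensor_map t_map u)"
proof (rule U_plus_linear_eqI[of "\<lambda>u. T_Z \<beta> (theta u)" "\<lambda>u. theta (tensor_map t_map u)", OF _ _ assms])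
  show "clinear (\<lambda>u. T_Z \<beta> (theta u) :: 'a Q)" by (rule clinear_compose[OF clinear_theta clinear_T_Z])
  show "clinear (\<lambda>u. theta (tensor_map t_map u) :: 'a Q)"
    by (rule clinear_compose[OF clinear_tensor_t clinear_theta])
  show "T_Z \<beta> (theta (pt d)) = theta (tensor_map t_map (pt d))" for d :: "'a \<Rightarrow> _"
    by (simp add: theta_pt tensor_map_pt t_map_loc theta_pure T_Z_L0)
qed

lemma Z_Lambda_thetaE:
  assumes "z \<in> Z_Lambda"
  obtains u where "u \<in> U_plus" "z = theta u"
  using assms bij_theta unfolding bij_betw_def by blast

lemma theta_in_Z_Lambda: "u \<in> U_plus \<Longrightarrow> theta u \<in> Z_Lambda"
  using bij_theta unfolding bij_betw_def by blast

lemma tensor_maps_in_U_plus: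
  "u \<in> U_plus \<Longrightarrow> tensor_map sigma_map u \<in> U_plus" "u \<in> U_plus \<Longrightarrow> tensor_map t_map u \<in> U_plus"
  using tensor_map_U_plus by blast+

lemma S_Z_Z_Lambda: "z \<in> Z_Lambda \<Longrightarrow> S_Z \<nu> \<beta> z \<in> Z_Lambda"
  and T_Z_Z_Lambda: "z \<in> Z_Lambda \<Longrightarrow> T_Z \<beta> z \<in> Z_Lambda"
  by (erule Z_Lambda_thetaE, simp add: S_Z_theta T_Z_theta theta_in_Z_Lambda tensor_maps_in_U_plus
      cvec.subspace_scale[OF subspace_U_plus])+

section \<open>Modular relations on \<open>Z_Lambda\<close>\<close>

lemma sigma_sigma_loc:
  "sigma_map j (sigma_map j (loc j x * qe 0)) = (- ((-1) ^ odd_deg x)) *\<^sub>C (loc j x * qe 0)"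
  for j :: "'i::{finite,linorder}"
proof -
  obtain a b where "x = (a, b)" by (cases x)
  then show ?thesis
    by (cases a; cases b)
      (simp_all add: sigma_map_loc sigma_loc_simps clinear_scaleC[OF sigma_map(1)] odd_deg_def
        clinear_uminus[OF sigma_map(1)] lin_simps)
qed

text \<open>The square of the one-site map is -1 on even and 1 on odd vectors. As the number of odd
  sites is even, the signs multiply to (-1)^N, which \<beta>^4 cancels.\<close>

lemma S_Z_S_Z_Z_Lambda:
  assumes "\<beta> ^ 4 = (-1) ^ CARD('i::{finite,linorder})" "\<nu> \<in> {1, -1}" "z \<in> (Z_Lambda :: 'i Q set)"
  shows "S_Z \<nu> \<beta> (S_Z \<nu> \<beta> z) = z"
proof -
  obtain u :: "('i, 'i Q) tpow" where u: "u \<in> U_plus" "z = theta u" using assms(3) by (rule Z_Lambda_thetaE)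
  have "tensor_map sigma_map (tensor_map sigma_map u) = ((-1) ^ CARD('i)) *\<^sub>C u"
  proof (rule U_plus_linear_eqI[of "\<lambda>u. tensor_map sigma_map (tensor_map sigma_map u)" "\<lambda>u. ((-1) ^ CARD('i)) *\<^sub>C u", OF _ _ u(1)])
    show "clinear (\<lambda>u :: ('i, 'i Q) tpow. tensor_map sigma_map (tensor_map sigma_map u))"
      by (rule clinear_compose[OF clinear_tensor_sigma clinear_tensor_sigma])
    show "clinear (\<lambda>u :: ('i, 'i Q) tpow. ((-1) ^ CARD('i)) *\<^sub>C u)"
      by (rule clinear_scale) (rule clinearI, simp_all)
    fix d :: "'i \<Rightarrow> bool \<times> bool" assume d: "even_deg d"
    have "tensor_map sigma_map (tensor_map sigma_map (pt d)) =
        pure_tensor (\<lambda>j. (- ((-1) ^ odd_deg (d j))) *\<^sub>C (loc j (d j) * qe 0))"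
      unfolding tensor_map_pt by (subst tensor_map_pure) (simp_all add: sigma_map sigma_sigma_loc)
    also have "\<dots> = (\<Prod>j\<in>UNIV. (-1) * (-1) ^ odd_deg (d j)) *\<^sub>C pt d"
      unfolding pt_def by (subst multilin_scaleC[OF multilin_pure_tensor]) simp
    also have "(\<Prod>j\<in>UNIV. (-1) * (-1) ^ odd_deg (d j)) = ((-1) ^ CARD('i) :: complex)"
      using d unfolding prod.distrib power_sum[symmetric] even_deg_def by simp
    finally show "tensor_map sigma_map (tensor_map sigma_map (pt d)) = ((-1) ^ CARD('i)) *\<^sub>C pt d" .
  qed
  moreover have "(\<nu> * \<beta>\<^sup>2) * ((\<nu> * \<beta>\<^sup>2) * (-1) ^ CARD('i)) = 1"
  proof -
    have "(\<nu> * \<beta>\<^sup>2) * ((\<nu> * \<beta>\<^sup>2) * (-1) ^ CARD('i)) = (\<nu> * \<nu>) * (\<beta> ^ 4 * (-1) ^ CARD('i))"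
      by (simp add: power4_eq_xxxx power2_eq_square ac_simps)
    then show ?thesis using assms(1,2) by (auto simp flip: power_mult_distrib)
  qed
  ultimately show ?thesis
    using u by (simp add: S_Z_theta clinear_scaleC[OF clinear_theta] clinear_scaleC[OF clinear_S_Z]
        tensor_maps_in_U_plus scaleC_scaleC scaleC_one)
qed

text \<open>On odd vectors the map is the identity. On the plane of the even ones it has trace -1
  and determinant 1, hence satisfies g^2 + g + 1 = 0.\<close>

lemma sigma_t_cube_loc:
  fixes j :: "'i::{finite,linorder}"
  defines "g \<equiv> \<lambda>y. sigma_map j (t_map j y)"
  shows "g (g (g (loc j x * qe 0))) = loc j x * qe 0"
proof -
  have g: "g (loc j (True, True) * qe 0) = (- (1/2)) *\<^sub>C (loc j (False, False) * qe 0)"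
    "g (loc j (False, False) * qe 0) = 2 *\<^sub>C (loc j (True, True) * qe 0) - loc j (False, False) * qe 0"
    "g (loc j (True, False) * qe 0) = loc j (True, False) * qe 0"
    "g (loc j (False, True) * qe 0) = loc j (False, True) * qe 0"
    unfolding g_def t_map_loc t_loc_simps
    by (simp_all add: sigma_map_loc sigma_loc_simps clinear_add[OF sigma_map(1)]
        clinear_scaleC[OF sigma_map(1)] lin_simps)
  have lin: "clinear g" unfolding g_def by (rule clinear_compose[OF t_map(1) sigma_map(1)])
  obtain a b where "x = (a, b)" by (cases x)
  then show ?thesis
    by (cases a; cases b)
      (simp_all add: g clinear_diff[OF lin] clinear_uminus[OF lin] clinear_scaleC[OF lin] lin_simps)
qed

lemma ST_cube_Z_Lambda:
  assumes "z \<in> Z_Lambda"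
  shows "((S_Z \<nu> \<beta> \<circ> T_Z \<beta>) ^^ 3) z = ((\<nu> * \<beta> ^ 2) ^ 3) *\<^sub>C z"
proof -
  obtain u :: "('a, 'a Q) tpow" where u: "u \<in> U_plus" "z = theta u" using assms by (rule Z_Lambda_thetaE)
  let ?G = "\<lambda>u :: ('a, 'a Q) tpow. tensor_map sigma_map (tensor_map t_map u)"
  have lin: "clinear ?G" by (rule clinear_compose[OF clinear_tensor_t clinear_tensor_sigma])
  have "?G (?G (?G u)) = u"
  proof (rule U_plus_linear_eqI[of "\<lambda>u. ?G (?G (?G u))" "\<lambda>u. u", OF _ _ u(1)])
    show "clinear (\<lambda>u. ?G (?G (?G u)))"
      by (rule clinear_compose[OF clinear_compose[OF lin lin] lin])
    show "clinear (\<lambda>u :: ('a, 'a Q) tpow. u)" by (rule clinearI) simp_all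
    fix d :: "'a \<Rightarrow> bool \<times> bool"
    have G: "?G (pure_tensor a) = pure_tensor (\<lambda>j. sigma_map j (t_map j (a j)))" for a :: "'a \<Rightarrow> 'a Q"
      by (simp add: tensor_map_pure sigma_map t_map)
    show "?G (?G (?G (pt d))) = pt d"
      unfolding pt_def G by (simp add: sigma_t_cube_loc)
  qed
  moreover have "S_Z \<nu> \<beta> (T_Z \<beta> (c *\<^sub>C theta v)) = (\<nu> * \<beta> ^ 2 * c) *\<^sub>C theta (?G v)" if "v \<in> U_plus" for v c
    using that by (simp add: clinear_scaleC[OF clinear_T_Z] clinear_scaleC[OF clinear_S_Z] T_Z_theta
        S_Z_theta tensor_maps_in_U_plus clinear_scaleC[OF clinear_theta] scaleC_scaleC mult.commute)
  from this[of _ 1] this have "S_Z \<nu> \<beta> (T_Z \<beta> (theta v)) = (\<nu> * \<beta> ^ 2) *\<^sub>C theta (?G v)"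
    "S_Z \<nu> \<beta> (T_Z \<beta> (c *\<^sub>C theta v)) = (\<nu> * \<beta> ^ 2 * c) *\<^sub>C theta (?G v)" if "v \<in> U_plus" for v c
    using that by (simp_all add: scaleC_one)
  ultimately show "((S_Z \<nu> \<beta> \<circ> T_Z \<beta>) ^^ 3) z = ((\<nu> * \<beta> ^ 2) ^ 3) *\<^sub>C z"
    using u by (simp add: numeral_eq_Suc tensor_maps_in_U_plus ac_simps)
qed

section \<open>The summand \<open>Z_P\<close>\<close>

definition Ktop :: "'i::{finite,linorder} Q" where
  "Ktop = top_el * qe 0 * qK"

lemma Ktop_eq: "Ktop = (1/2) *\<^sub>C (mon (\<lambda>_. (True, True)) 1 + mon (\<lambda>_. (True, True)) 3)"
  by (simp add: Ktop_def top_el_eq mon_def qe_def lin_simps mult.assoc numeral_3_eq_3 power2_eq_square)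

lemma qe1_eq: "qe 1 = (1/2) *\<^sub>C (mon (\<lambda>_. (False, False)) 0 - mon (\<lambda>_. (False, False)) 2)"
  by (simp add: mon_def qe_def loc_simps ordered_prod_one lin_simps)

lemma coord_diff: "coord d k (x - y) = coord d k x - coord d k y"
  using coord_add[of d k "x - y" y] by simp

lemma Ktop_qe: "Ktop * qe 0 = Ktop" "Ktop * qe 1 = 0"
  by (simp_all add: Ktop_def mult.assoc) (simp_all add: qe_mult_left qe_mult flip: qe_central)

lemma Gam_qe: "Gam * qe 0 = 0" "Gam * qe 1 = Gam"
  by (simp_all add: Gam_def mult.assoc qe_mult)

text \<open>Each involution contributes -2 at its pair; the overall sign is that of
  \<open>qK ^ 2\<close> in the block of \<open>qe 1\<close>, and the half is the projection.\<close>

lemma top_coef_Gam_qK: "top_coef (Gam * qK :: 'i::{finite,linorder} Q) = - ((-2) ^ CARD('i) / 2)"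
proof -
  have h: "hfac j = (\<Sum>x\<in>UNIV. hcoef (False, False) x *\<^sub>C loc j x) * qK ^ 0" for j :: 'i
    by (simp add: sum_UNIV_bool_pair hcoef_def hfac_def loc_simps lin_simps)
  have t: "top_coef (ordered_prod hfac * qK ^ m :: 'i Q) = (-2) ^ CARD('i) * of_bool (4 dvd m)" for m
    using top_coef_prod_local[of "\<lambda>_. hcoef (False, False)" "\<lambda>_ :: 'i. 0" m]
    unfolding h[symmetric] by (simp add: hcoef_def)
  have "Gam * qK = (- 1) *\<^sub>C (ordered_prod hfac * qK ^ 0 * qe (Suc 0) :: 'i Q)"
    unfolding Gam_def ordered_prod_hfac_qK[symmetric]
    by (simp add: mult.assoc lin_simps) (simp add: qe_central mult.assoc qK_qK_qe)
  then have "top_coef (Gam * qK :: 'i Q) = - top_coef (ordered_prod hfac * qK ^ 0 * qe (Suc 0) :: 'i Q)"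
    using top_coef_scaleC[of "-1" "ordered_prod hfac * qK ^ 0 * qe (Suc 0) :: 'i Q"] by (simp only: mult_minus1)
  also have "top_coef (ordered_prod hfac * qK ^ 0 * qe (Suc 0) :: 'i Q) = (-2) ^ CARD('i) / 2"
    unfolding top_coef_half_qe unfolding mult.assoc[of _ "qK ^ 0"] power_add[symmetric] t
    by (simp add: four_dvd_Suc)
  finally show ?thesis .
qed

text \<open>Multiplication by \<open>qe 0\<close> isolates \<open>Ktop\<close>. To separate the
  other two, multiply by \<open>qK\<close> and take the top coefficient: it vanishes on
  \<open>qe 1\<close>, as there is at least one site, but not on \<open>Gam\<close>.\<close>

lemma Ktop_qe1_Gam_independent:
  assumes "x *\<^sub>C Ktop + y *\<^sub>C qe 1 + z *\<^sub>C Gam = (0 :: 'i::{finite,linorder} Q)"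
  shows "x = 0 \<and> y = 0 \<and> z = 0"
proof -
  have "(x *\<^sub>C Ktop + y *\<^sub>C qe 1 + z *\<^sub>C Gam :: 'i Q) * qe 0 = x *\<^sub>C Ktop"
    by (simp add: lin_simps Ktop_qe Gam_qe qe_mult)
  from this[unfolded assms] have k: "x *\<^sub>C (Ktop :: 'i Q) = 0" by simp
  have "coord (\<lambda>_ :: 'i. (True, True)) 1 (x *\<^sub>C Ktop) = x / 2"
    by (simp only: Ktop_eq coord_scaleC coord_add coord_mon) (simp add: coord_mon)
  then have x: "x = 0" by (simp add: k coord_zero)
  have "top_coef (qe 1 * qK :: 'i Q) = 0"
  proof -
    have "qe 1 * qK = (1/2) *\<^sub>C (mon (\<lambda>_ :: 'i. (False, False)) 1 - mon (\<lambda>_. (False, False)) 3)"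
      unfolding qe1_eq by (simp add: mon_def lin_simps mult.assoc numeral_3_eq_3 power2_eq_square)
    then show ?thesis
      by (simp add: top_coef_def coord_scaleC coord_diff coord_mon fun_eq_iff)
  qed
  moreover have "top_coef ((y *\<^sub>C qe 1 + z *\<^sub>C Gam) * qK :: 'i Q) = 0"
    using assms x by (simp add: top_coef_zero)
  ultimately have z: "z = 0"
    by (simp add: lin_simps top_coef_add top_coef_scaleC top_coef_Gam_qK del: One_nat_def)
  have "coord (\<lambda>_ :: 'i. (False, False)) 0 (y *\<^sub>C qe 1) = y / 2"
    unfolding qe1_eq coord_scaleC coord_diff by (simp add: coord_mon)
  moreover have "y *\<^sub>C qe 1 = (0 :: 'i Q)"
    unfolding assms[symmetric] by (simp add: x z)
  ultimately have "y = 0" by (simp only: coord_zero) simp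
  with x z show ?thesis by simp
qed

lemma independent3:
  assumes "\<And>x y z. x *\<^sub>C a + y *\<^sub>C b + z *\<^sub>C c = 0 \<Longrightarrow> x = 0 \<and> y = 0 \<and> z = 0"
  shows "distinct [a, b, c]" "cvec.independent {a, b, c}"
proof -
  have "a \<noteq> b" using assms[of 1 "-1" 0] by (auto simp: cvec.scale_minus_left)
  moreover have "a \<noteq> c" using assms[of 1 0 "-1"] by (auto simp: cvec.scale_minus_left)
  moreover have "b \<noteq> c" using assms[of 0 1 "-1"] by (auto simp: cvec.scale_minus_left)
  ultimately show d: "distinct [a, b, c]" by simp
  show "cvec.independent {a, b, c}"
    using assms d by (auto simp: cvec.dependent_finite add.assoc)
qed

lemma qK_commute_even_qe0: "top_el * qe 0 * qK = qK * qe 0 * (top_el :: 'i::{finite,linorder} Q)"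
proof -
  have s: "prod_list (map (\<lambda>i. sg (True, True)) xs) = 1" for xs :: "'i list"
    by (induction xs) (simp_all add: sg_def)
  have "qK * top_el = (top_el * qK :: 'i Q)"
    unfolding top_el_eq ordered_prod_def
    by (subst mult_prod_list_loc[OF qK_loc]) (simp add: s scaleC_one)
  then have "qK * (top_el * qe 0) = top_el * (qK * qe 0 :: 'i Q)" by (simp flip: mult.assoc)
  then show ?thesis by (simp add: qe_central mult.assoc)
qed

lemma phi_P0_eq: "phi_P0 \<nu> \<beta> = (\<nu> * 2 ^ (3 * CARD('i)) * \<beta> ^ 2) *\<^sub>C (Ktop :: 'i::{finite,linorder} Q)"
  unfolding phi_P0_def Ktop_def qK_commute_even_qe0 unfolding top_el_def ..

lemma phi_X1_eq:
  "phi_X1 s \<nu> = (sgnC s * \<nu> * 2 ^ CARD('i)) *\<^sub>C (qe 1 - (sgnC s * \<i>) *\<^sub>C (Gam :: 'i::{finite,linorder} Q))"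
proof -
  have "qe 1 * (qK * ordered_prod hfac) = (Gam :: 'i Q)"
    by (simp add: Gam_def qe_central)
  then have "e1_pm s = (1/2) *\<^sub>C (qe 1 - (sgnC s * \<i>) *\<^sub>C (Gam :: 'i Q))"
    unfolding e1_pm_def hfac_def[abs_def, symmetric] by (simp add: right_diff_distrib mult_scaleC_right)
  then show ?thesis by (simp add: phi_X1_def scaleC_scaleC)
qed

text \<open>Change of coordinates: the difference of the last two coordinates belongs to
  \<open>qe 1\<close>, their sum to \<open>Gam\<close>.\<close>

lemma Z_P_basis_lincomb:
  "x *\<^sub>C phi_P0 \<nu> \<beta> + y *\<^sub>C phi_X1 Pl \<nu> + z *\<^sub>C phi_X1 Mi \<nu> =
    (x * (\<nu> * 2 ^ (3 * CARD('i)) * \<beta> ^ 2)) *\<^sub>C Ktop + (\<nu> * 2 ^ CARD('i) * (y - z)) *\<^sub>C qe 1 +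
    (- \<i> * \<nu> * 2 ^ CARD('i) * (y + z)) *\<^sub>C (Gam :: 'i::{finite,linorder} Q)"
proof -
  let ?a = "\<nu> * 2 ^ CARD('i)"
  have X: "w *\<^sub>C phi_X1 s \<nu> = (w * sgnC s * ?a) *\<^sub>C qe 1 + (- \<i> * ?a * w * (sgnC s * sgnC s)) *\<^sub>C (Gam :: 'i Q)" for s w
    by (simp add: phi_X1_eq lin_simps mult.assoc mult.left_commute mult.commute)
  have c: "(p *\<^sub>C e + q *\<^sub>C g) + (r *\<^sub>C e + t *\<^sub>C g) = (p + r) *\<^sub>C e + (q + t) *\<^sub>C g" for p q r t and e g :: "'i Q"
    by (simp add: scaleC_add_left add.assoc add.left_commute)
  have "x *\<^sub>C phi_P0 \<nu> \<beta> + y *\<^sub>C phi_X1 Pl \<nu> + z *\<^sub>C phi_X1 Mi \<nu> =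
    (x * (\<nu> * 2 ^ (3 * CARD('i)) * \<beta> ^ 2)) *\<^sub>C Ktop + ((y * ?a + - z * ?a) *\<^sub>C qe 1 +
    (- \<i> * ?a * y + - \<i> * ?a * z) *\<^sub>C (Gam :: 'i Q))"
    unfolding X add.assoc c[symmetric] by (simp add: phi_P0_eq scaleC_scaleC)
  also have "y * ?a + - z * ?a = ?a * (y - z)" by (simp add: algebra_simps)
  also have "- \<i> * ?a * y + - \<i> * ?a * z = - \<i> * \<nu> * 2 ^ CARD('i) * (y + z)" by (simp add: algebra_simps)
  finally show ?thesis by (simp only: add.assoc)
qed

lemma
  fixes \<nu> \<beta> :: complex
  assumes "\<nu> \<noteq> 0" "\<beta> \<noteq> 0"
  shows is_ordered_basis_Z_P: "is_ordered_basis (Z_P_basis \<nu> \<beta>) (Z_P \<nu> \<beta> :: 'i::{finite,linorder} Q set)"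
    and Z_P_eq: "Z_P \<nu> \<beta> = cvec.span {Ktop, qe 1, Gam :: 'i Q}"
proof -
  have ind: "x = 0 \<and> y = 0 \<and> z = 0"
    if "x *\<^sub>C phi_P0 \<nu> \<beta> + y *\<^sub>C phi_X1 Pl \<nu> + z *\<^sub>C phi_X1 Mi \<nu> = (0 :: 'i Q)" for x y z
  proof -
    note K = Ktop_qe1_Gam_independent[OF that[unfolded Z_P_basis_lincomb]]
    from K have "x * (\<nu> * 2 ^ (3 * CARD('i)) * \<beta> ^ 2) = 0" by blast
    then have "x = 0" using assms by simp
    moreover from K have "\<nu> * 2 ^ CARD('i) * (y - z) = 0" by blast
    then have "y = z" using assms by simp
    moreover from K have "- \<i> * \<nu> * 2 ^ CARD('i) * (y + z) = 0" by blast
    then have "y + z = 0" using assms by simp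
    then have "2 * z = 0" unfolding \<open>y = z\<close> by (simp only: mult_2)
    ultimately show ?thesis by simp
  qed
  have "distinct [phi_P0 \<nu> \<beta>, phi_X1 Pl \<nu>, phi_X1 Mi \<nu> :: 'i Q]"
    "cvec.independent {phi_P0 \<nu> \<beta>, phi_X1 Pl \<nu>, phi_X1 Mi \<nu> :: 'i Q}"
    by (rule independent3, rule ind, assumption)+
  then show "is_ordered_basis (Z_P_basis \<nu> \<beta>) (Z_P \<nu> \<beta> :: 'i Q set)"
    by (simp add: is_ordered_basis_def Z_P_basis_def Z_P_def)
  let ?c = "\<nu> * 2 ^ (3 * CARD('i)) * \<beta> ^ 2" and ?a = "\<nu> * 2 ^ CARD('i)"
  let ?K = "{Ktop, qe 1, Gam :: 'i Q}" and ?B = "{phi_P0 \<nu> \<beta>, phi_X1 Pl \<nu>, phi_X1 Mi \<nu> :: 'i Q}"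
  have in_K: "x *\<^sub>C Ktop + y *\<^sub>C qe 1 + z *\<^sub>C Gam \<in> cvec.span ?K" for x y z
    by (intro cvec.span_add cvec.span_scale cvec.span_base) auto
  have in_B: "x *\<^sub>C phi_P0 \<nu> \<beta> + y *\<^sub>C phi_X1 Pl \<nu> + z *\<^sub>C phi_X1 Mi \<nu> \<in> cvec.span ?B" for x y z
    by (intro cvec.span_add cvec.span_scale cvec.span_base) auto
  note lc = Z_P_basis_lincomb[where 'i = 'i and \<nu> = \<nu> and \<beta> = \<beta>]
  have "?B \<subseteq> cvec.span ?K"
    using in_K lc[of 1 0 0] lc[of 0 1 0] lc[of 0 0 1] by (simp only: cvec.scale_zero_left scaleC_one add_0_left add_0_right insert_subset empty_subsetI simp_thms)
  \<comment> \<open>The three coefficient vectors solve \<open>Z_P_basis_lincomb\<close> for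
    \<open>Ktop\<close>, \<open>qe 1\<close> and \<open>Gam\<close>.\<close>
  moreover have "?K \<subseteq> cvec.span ?B"
    using in_B[of "1 / ?c" 0 0] in_B[of 0 "1 / (2 * ?a)" "- 1 / (2 * ?a)"]
      in_B[of 0 "\<i> / (2 * ?a)" "\<i> / (2 * ?a)"] assms unfolding lc
    by (simp add: scaleC_one field_simps)
  ultimately show "Z_P \<nu> \<beta> = cvec.span ?K"
    unfolding Z_P_def Z_P_basis_def by (simp add: cvec.span_eq)
qed

section \<open>T on the basis \<open>Ktop\<close>, \<open>qe 1\<close>, \<open>Gam\<close>\<close>

lemma hfac_sq_qe1: "hfac j * hfac j * qe 1 = qe 1"
proof -
  have "4 *\<^sub>C x = 2 *\<^sub>C x + 2 *\<^sub>C x" for x :: "'a Q" by (simp flip: scaleC_add_left)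
  then show ?thesis
    by (simp add: hfac_def lin_simps mult.assoc qf_Mi_Pl_left qe_mult qf_sq_left)
qed

lemma hprod_sq_qe1: "ordered_prod hfac * ordered_prod hfac * qe 1 = qe 1"
proof -
  have "hfac j * hfac j * qe 1 = 1 * qe 1" for j :: 'a
    by (simp only: hfac_sq_qe1 mult_1)
  then have "ordered_prod (\<lambda>j :: 'a. hfac j * hfac j) * qe 1 = ordered_prod (\<lambda>_ :: 'a. 1) * qe 1"
    by (rule ordered_prod_cong_idem[OF qe_central])
  moreover have "ordered_prod hfac * ordered_prod hfac = ordered_prod (\<lambda>j :: 'a. hfac j * hfac j)"
    by (rule ordered_prod_mult_distrib) (rule hfac_commute)
  ultimately show ?thesis by (simp add: ordered_prod_one)
qed

text \<open>The involutions square to 1 in this block, and \<open>qK\<close> commutes with their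
  product, so only \<open>qK ^ 2 = -1\<close> is left.\<close>

lemma Gam_sq: "Gam * Gam = - qe 1"
proof -
  let ?H = "ordered_prod (hfac :: 'a \<Rightarrow> _)"
  have "Gam * Gam = qK * ?H * (qe 1 * (qK * ?H)) * qe 1" by (simp only: Gam_def mult.assoc)
  also have "\<dots> = qK * (?H * qK) * ?H * (qe 1 * qe 1)"
    by (simp only: qe_central[of 1 "qK * ?H"] mult.assoc)
  also have "\<dots> = qK * qK * (?H * ?H * qe 1)"
    unfolding ordered_prod_hfac_qK by (simp add: qe_mult mult.assoc)
  also have "\<dots> = - qe 1" unfolding hprod_sq_qe1 by (simp add: mult.assoc qK_qK_qe)
  finally show ?thesis .
qed

text \<open>Since \<open>qK ^ 2\<close> is -1 here, the ribbon factors 1 + 2 f^+ f^- K^2 become the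
  involutions that make up \<open>Gam\<close>.\<close>

lemma T_Z_qe1: "T_Z \<beta> (qe 1) = (- (inverse \<beta> * \<i>)) *\<^sub>C Gam"
proof -
  have "(1 + 2 *\<^sub>C (qf Pl k * qf Mi k * qK ^ 2)) * qe 1 = hfac k * qe 1" for k :: 'a
    by (simp add: lin_simps mult.assoc qK_sq_qe hfac_def)
  then have P: "ordered_prod (\<lambda>k :: 'a. 1 + 2 *\<^sub>C (qf Pl k * qf Mi k * qK ^ 2)) * qe 1 =
      ordered_prod hfac * qe 1"
    by (rule ordered_prod_cong_idem[OF qe_central])
  have "T_Z \<beta> (qe 1) = (qe 0 - (inverse \<beta> * \<i>) *\<^sub>C (qK * qe 1)) * (ordered_prod hfac * qe 1 :: 'a Q)"
    by (simp only: T_Z_def ribbon_inverse_def P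
        mult.assoc[of "qe 0 - (inverse \<beta> * \<i>) *\<^sub>C (qK * qe 1)"])
  also have "\<dots> = qe 0 * (ordered_prod hfac * qe 1) -
      (inverse \<beta> * \<i>) *\<^sub>C (qK * (qe 1 * ordered_prod hfac) * qe 1)"
    by (simp only: left_diff_distrib mult_scaleC_left mult.assoc)
  also have "qe 0 * (ordered_prod hfac * qe 1) = (0 :: 'a Q)"
    unfolding qe_central[of 0 "ordered_prod hfac * qe 1"] by (simp add: mult.assoc qe_mult)
  also have "qK * (qe 1 * ordered_prod hfac) * qe 1 = (Gam :: 'a Q)"
    unfolding qe_central[of 1 "ordered_prod hfac"] by (simp add: Gam_def mult.assoc qe_mult)
  finally show ?thesis by (simp add: cvec.scale_minus_left)
qed

lemma T_Z_Gam: "T_Z \<beta> Gam = (inverse \<beta> * \<i>) *\<^sub>C qe 1"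
proof -
  have "qe 1 * Gam = (Gam :: 'a Q)" by (simp only: qe_central Gam_qe)
  then have "T_Z \<beta> Gam = T_Z \<beta> (qe 1) * (Gam :: 'a Q)" by (simp only: T_Z_def mult.assoc)
  then show ?thesis
    by (simp only: T_Z_qe1 mult_scaleC_left Gam_sq cvec.scale_minus_left cvec.scale_minus_right
        mult_minus_left minus_minus)
qed

lemma Ktop_L0: "Ktop = L0 (\<lambda>_. (True, True)) * qK"
  by (simp add: Ktop_def L0_def top_el_eq)

lemma T_Z_Ktop: "T_Z \<beta> Ktop = Ktop"
proof -
  have "T_Z \<beta> Ktop = T_Z \<beta> (L0 (\<lambda>_. (True, True))) * qK"
    by (simp add: T_Z_def Ktop_L0 mult.assoc)
  also have "T_Z \<beta> (L0 (\<lambda>_. (True, True))) = ordered_prod (\<lambda>j. loc j (True, True) * qe 0)"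
    unfolding T_Z_L0 t_loc_simps ..
  also have "\<dots> = L0 (\<lambda>_. (True, True))"
    by (simp add: L0_def ordered_prod_mult_idem[OF qe_central qe_mult(1)])
  finally show ?thesis by (simp add: Ktop_L0)
qed

lemma S_Z_values:
  "S_Z \<nu> \<beta> Ktop = (lam CARD('i) \<nu> \<beta> / 2) *\<^sub>C (qe 1 :: 'i::{finite,linorder} Q)"
  "S_Z \<nu> \<beta> (qe 1) = (\<nu> * \<beta> ^ 2 * 2 ^ CARD('i)) *\<^sub>C (Ktop :: 'i Q)"
  using S_Z_qK_top[where 'i = 'i] S_Z_qe1[where 'i = 'i] by (simp_all add: Ktop_def)

section \<open>The centre\<close>

lemma center_iff: "z \<in> center \<longleftrightarrow> (\<forall>x. z * x = x * z)"
  by (simp add: center_def)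

lemma subspace_center: "cvec.subspace (center :: 'a::complex_alg set)"
  by (rule cvec.subspaceI)
    (simp_all add: center_iff distrib_left distrib_right mult_scaleC_left mult_scaleC_right)

lemma centerI:
  assumes "z * qK = qK * z" "\<And>s j. z * qf s j = qf s j * z"
  shows "z \<in> center"
proof -
  have "z * qgen g = qgen g * z" for g using assms by (cases g) simp_all
  then show ?thesis using central_if_commutes_qgen[of z] by (simp add: center_iff)
qed

lemma fword_qK: "qK * fword w = (-1) ^ length w *\<^sub>C (fword w * qK)"
proof (induction w)
  case (Cons x w)
  then show ?case by (cases x) (simp add: fword_simps qK_qf_left lin_simps mult.assoc)
qed (simp add: fword_simps scaleC_one)

lemma fword_qf_qe0: "qf s j * (fword w * qe 0) = (-1) ^ length w *\<^sub>C (fword w * (qf s j * qe 0))"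
proof (induction w)
  case (Cons x w)
  obtain t k where x: "x = (t, k)" by (cases x)
  have "qf s j * (qf t k * (fword w * qe 0)) = (qf s j * (qf t k * qe 0)) * fword w"
    by (simp only: qe_central mult.assoc)
  also have "\<dots> = - (qf t k * (qf s j * (fword w * qe 0)))"
    by (subst qf_anticomm_qe0) (simp add: qe_central mult.assoc)
  finally show ?case by (simp add: x fword_simps Cons lin_simps mult.assoc)
qed (simp add: fword_simps scaleC_one)

lemma L0_center: assumes "even_deg d" shows "L0 d \<in> center"
proof -
  obtain w where w: "ordered_prod (\<lambda>j. loc j (d j)) = fword w"
    "even (length w) \<longleftrightarrow> even (\<Sum>j\<in>UNIV. odd_deg (d j))" by (rule ordered_prod_loc_fword)
  then have e: "even (length w)" using assms by (simp add: even_deg_def)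
  show ?thesis
  proof (rule centerI)
    show "L0 d * qK = qK * L0 d"
      using fword_qK[of w] e by (simp add: L0_def w(1) scaleC_one qe_central flip: mult.assoc)
        (simp add: mult.assoc qe_central)
    show "L0 d * qf s j = qf s j * L0 d" for s j
      using fword_qf_qe0[of s j w] e by (simp add: L0_def w(1) scaleC_one mult.assoc qe_central)
  qed
qed

lemma Ktop_qf: "qf s j * Ktop = 0" "Ktop * qf s j = 0"
proof -
  let ?t = "\<lambda>_ :: 'a. (True, True)"
  obtain c where "c = 0 \<longleftrightarrow> bit_set s (?t j)" "qf s j * L0 ?t = c *\<^sub>C L0 (?t(j := add_bit s (?t j)))"
    by (rule qf_L0)
  then have 0: "qf s j * L0 ?t = 0" by (cases s) simp_all
  then show "qf s j * Ktop = 0" by (simp add: Ktop_L0 flip: mult.assoc)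
  have "even_deg ?t" by (simp add: even_deg_def odd_deg_def)
  then have "L0 ?t * qf s j = 0" using L0_center[of ?t] 0 by (simp add: center_iff)
  moreover have "Ktop * qf s j = - (L0 ?t * qf s j * qK)" by (simp add: Ktop_L0 mult.assoc qK_qf)
  ultimately show "Ktop * qf s j = 0" by simp
qed

lemma Ktop_center: "Ktop \<in> center"
proof (rule centerI)
  have "even_deg (\<lambda>_ :: 'a. (True, True))" by (simp add: even_deg_def odd_deg_def)
  then have c: "L0 (\<lambda>_ :: 'a. (True, True)) * qK = qK * L0 (\<lambda>_. (True, True))"
    using L0_center by (auto simp: center_iff)
  show "Ktop * qK = qK * (Ktop :: 'a Q)"
    using arg_cong[where f = "\<lambda>y. y * qK", OF c] by (simp only: Ktop_L0 mult.assoc)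
qed (simp add: Ktop_qf)

section \<open>Signs in ordered products and centrality of \<open>Gam\<close>\<close>

lemma prod_list_sign:
  fixes g e :: "'a::complex_alg"
  assumes "\<And>x. e * x = x * e" "\<And>i. i \<in> set xs \<Longrightarrow> g * y i * e = c i *\<^sub>C (y i * g * e)"
  shows "g * prod_list (map y xs) * e = prod_list (map c xs) *\<^sub>C (prod_list (map y xs) * g * e)"
  using assms(2)
proof (induction xs)
  case (Cons i xs)
  let ?P = "prod_list (map y xs)"
  have "g * prod_list (map y (i # xs)) * e = (g * y i * e) * ?P"
    by (simp add: assms(1) mult.assoc)
  also have "\<dots> = c i *\<^sub>C (y i * (g * ?P * e))"
    using Cons.prems by (simp add: mult_scaleC_left) (simp add: assms(1) mult.assoc)
  also have "g * ?P * e = prod_list (map c xs) *\<^sub>C (?P * g * e)" using Cons by simp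
  finally show ?case by (simp add: mult_scaleC_right scaleC_scaleC mult.assoc)
qed (simp add: scaleC_one)

lemma ordered_prod_sign:
  fixes g e :: "'a::complex_alg" and y :: "'i::{finite,linorder} \<Rightarrow> 'a"
  assumes "\<And>x. e * x = x * e" "\<And>i. g * y i * e = c i *\<^sub>C (y i * g * e)"
  shows "g * ordered_prod y * e = (\<Prod>i\<in>UNIV. c i) *\<^sub>C (ordered_prod y * g * e)"
proof -
  have "prod_list (map c (sorted_list_of_set (UNIV :: 'i set))) = (\<Prod>i\<in>UNIV. c i)"
    using prod.distinct_set_conv_list[OF distinct_sorted_UNIV[where 'i = 'i], of c]
    by (simp only: set_sorted_UNIV)
  then show ?thesis
    using prod_list_sign[of e "sorted_list_of_set UNIV" g y c] assms by (simp add: ordered_prod_def)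
qed

lemma qf_hfac_neq: "i \<noteq> j \<Longrightarrow> qf s j * hfac i = hfac i * qf s j"
  using hfac_commute_loc[of i j "(True, False)" 0] hfac_commute_loc[of i j "(False, True)" 0]
  by (cases s) (simp_all add: loc_simps)

lemma scaleC_double: "2 *\<^sub>C x = x + x"
  using scaleC_add_left[of 1 1 x] by (simp add: scaleC_one)

lemma qf_hfac_qe1: "qf s j * hfac j * qe 1 = (-1) *\<^sub>C (hfac j * qf s j * qe 1)"
  by (cases s) (simp_all add: hfac_def lin_simps mult.assoc qf_Mi_Pl_left qf_Mi_Pl qf_sq_left qf_sq
      qe_mult scaleC_double)

lemma prod_single_sign: "(\<Prod>i\<in>UNIV. if i = j then c else 1) = (c :: complex)" for j :: "'i::finite"
  by (simp add: prod.delta)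

text \<open>A generator anticommutes with the involution at its own site, commutes with all the
  others and anticommutes with \<open>qK\<close>, so the two signs cancel.\<close>

lemma Gam_center: "Gam \<in> (center :: 'i::{finite,linorder} Q set)"
proof (rule centerI)
  let ?H = "ordered_prod (hfac :: 'i \<Rightarrow> _)"
  have K: "Gam = qK * (?H * qe 1)" by (simp add: Gam_def mult.assoc)
  show "Gam * qK = qK * (Gam :: 'i Q)"
  proof -
    have "Gam * qK = qK * (?H * (qe 1 * qK))" by (simp only: K mult.assoc)
    also have "\<dots> = qK * ((?H * qK) * qe 1)" by (simp only: qe_central mult.assoc)
    finally show ?thesis unfolding K ordered_prod_hfac_qK by (simp only: mult.assoc)
  qed
  fix s and j :: 'i
  have "qf s j * ?H * qe 1 = (\<Prod>i\<in>UNIV. if i = j then -1 else 1) *\<^sub>C (?H * qf s j * qe 1)"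
  proof (rule ordered_prod_sign[OF qe_central])
    show "qf s j * hfac i * qe 1 = (if i = j then -1 else 1) *\<^sub>C (hfac i * qf s j * qe 1)" for i
    proof (cases "i = j")
      case True
      then show ?thesis unfolding True qf_hfac_qe1 by simp
    next
      case False
      then show ?thesis unfolding qf_hfac_neq[OF False] by (simp add: scaleC_one)
    qed
  qed
  then have H: "qf s j * ?H * qe 1 = - (?H * qf s j * qe 1)"
    unfolding prod_single_sign by (simp add: cvec.scale_minus_left scaleC_one)
  have "Gam * qf s j = qK * (?H * qf s j * qe 1)" by (simp only: K mult.assoc qe_central)
  also have "\<dots> = - (qK * (qf s j * (?H * qe 1)))" using H by (simp add: mult.assoc)
  also have "\<dots> = qf s j * Gam" by (simp only: qK_qf_left minus_minus K)
  finally show "Gam * qf s j = qf s j * Gam" .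
qed

lemma qe_center: "qe n \<in> center"
  by (simp add: center_iff qe_central)

text \<open>Split the element into a commuting and an anticommuting part. The latter, times
  \<open>g\<close>, equals its own negative and so vanishes, and right multiplication by
  \<open>g\<close> is invertible on the span.\<close>

lemma sign_filter:
  fixes g z :: "'a::complex_alg"
  assumes "z \<in> cvec.span B" "g * z = z * g"
    and "\<And>b. b \<in> B \<Longrightarrow> g * b = b * g \<or> g * b = - (b * g)" "\<And>b. b \<in> B \<Longrightarrow> b * g * g = b"
  shows "z \<in> cvec.span {b \<in> B. g * b = b * g}"
proof -
  let ?P = "{b \<in> B. g * b = b * g}" and ?M = "{b \<in> B. g * b = - (b * g)}"
  have "B = ?P \<union> ?M" using assms(3) by blast
  then have "z \<in> cvec.span (?P \<union> ?M)" using assms(1) by simp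
  then obtain p m where pm: "p \<in> cvec.span ?P" "m \<in> cvec.span ?M" "z = p + m"
    unfolding cvec.span_Un by blast
  have "g * p = p * g"
    by (rule clinear_eq_on_span[OF clinear_mult_left clinear_mult_right pm(1)]) simp
  moreover have lin: "clinear (\<lambda>x. - (x * g))"
    by (rule clinearI) (simp_all add: distrib_right mult_scaleC_left cvec.scale_minus_right)
  have "g * m = - (m * g)"
    by (rule clinear_eq_on_span[OF clinear_mult_left lin pm(2)]) simp
  ultimately have "m * g + m * g = 0" using assms(2) by (simp add: pm(3) distrib_left distrib_right eq_neg_iff_add_eq_0)
  then have "2 *\<^sub>C (m * g) = 0" by (simp only: scaleC_double)
  then have mg: "m * g = 0" by simp
  have "m * g * g = m"
    by (rule clinear_eq_on_span[OF clinear_compose[OF clinear_mult_right clinear_mult_right] _ pm(2), where g = "\<lambda>x. x"])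
      (use assms(4) in \<open>auto intro!: clinearI\<close>)
  then show ?thesis using pm mg by simp
qed

lemma sign_filter_finite:
  fixes z :: "'a::complex_alg"
  assumes "finite G" "z \<in> cvec.span B" "\<And>g. g \<in> G \<Longrightarrow> g * z = z * g"
    and "\<And>b g. b \<in> B \<Longrightarrow> g \<in> G \<Longrightarrow> g * b = b * g \<or> g * b = - (b * g)"
    and "\<And>b g. b \<in> B \<Longrightarrow> g \<in> G \<Longrightarrow> b * g * g = b"
  shows "z \<in> cvec.span {b \<in> B. \<forall>g\<in>G. g * b = b * g}"
  using assms
proof (induction G)
  case (insert g G)
  have "z \<in> cvec.span {b \<in> {b \<in> B. \<forall>g\<in>G. g * b = b * g}. g * b = b * g}"
    by (rule sign_filter) (use insert in auto)
  also have "{b \<in> {b \<in> B. \<forall>g\<in>G. g * b = b * g}. g * b = b * g} = {b \<in> B. \<forall>h\<in>insert g G. h * b = b * h}"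
    by auto
  finally show ?case .
qed simp

text \<open>On the block of \<open>qe 1\<close>, both \<open>hfac j\<close> and \<open>qf Pl j + qf Mi j\<close> are involutions that commute
  or anticommute with every \<open>hmon d k\<close>. An \<open>hmon d k\<close> commuting with all \<open>hfac j\<close> has even local
  factors, and commuting with all \<open>qf Pl j + qf Mi j\<close> forces \<open>d j = (True, True)\<close> either for no \<open>j\<close>
  (and \<open>k = 0\<close>) or for every \<open>j\<close> (and \<open>k = 1\<close>). This leaves only \<open>qe 1\<close> and \<open>Gam\<close>.\<close>

definition hl :: "'i \<Rightarrow> bool \<times> bool \<Rightarrow> 'i Q" where
  "hl j x = (if x = (True, True) then hfac j else loc j x)"

definition hmon :: "('i::{finite,linorder} \<Rightarrow> bool \<times> bool) \<Rightarrow> nat \<Rightarrow> 'i Q" where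
  "hmon d k = ordered_prod (\<lambda>j. hl j (d j)) * qK ^ k * qe 1"

text \<open>Two powers of \<open>qK\<close> suffice since \<open>qK ^ 2\<close> is -1 in this block,
  and f^+ f^- may be replaced by the involution because the unit is among the local factors.\<close>

lemma span_hmon: "x * qe 1 \<in> cvec.span {hmon d k | d k. k < 2}" for x :: "'i::{finite,linorder} Q"
proof -
  let ?S = "cvec.span {hmon d k | d k. k < 2} :: 'i Q set"
  have hm: "hmon d k \<in> ?S" if "k < 2" for d k using that by (intro cvec.span_base) blast
  have K: "hmon d (Suc (Suc k)) = - hmon d k" for d :: "'i \<Rightarrow> _" and k
  proof -
    have "qK ^ Suc (Suc k) * qe 1 = qK ^ k * (qK * (qK * (qe 1 :: 'i Q)))"
      by (simp only: power_Suc2 mult.assoc)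
    also have "\<dots> = - (qK ^ k * qe 1)" by (simp add: qK_qK_qe)
    finally show ?thesis by (simp only: hmon_def mult.assoc mult_minus_right)
  qed
  have hmk: "hmon d k \<in> ?S" for d k
  proof (induction k rule: less_induct)
    case (less k)
    show ?case
    proof (cases "k < 2")
      case False
      then obtain l where l: "k = Suc (Suc l)" by (metis add_2_eq_Suc le_Suc_ex not_less)
      have "hmon d l \<in> ?S" using less l by simp
      then show ?thesis unfolding l K by (rule cvec.span_neg)
    qed (rule hm)
  qed
  have "x \<in> cvec.span monomial_basis" by (simp add: span_monomial_basis)
  then show ?thesis
  proof (rule clinear_in_subspace[OF clinear_mult_right cvec.subspace_span])
    fix b :: "'i Q" assume "b \<in> monomial_basis"
    then obtain d k where b: "b = mon d k" unfolding monomial_basis_eq by blast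
    have "loc j y \<in> cvec.span (range (hl j))" for j :: 'i and y
    proof (cases "y = (True, True)")
      case True
      have "loc j y = (1/2) *\<^sub>C (hl j (False, False) - hl j (True, True))"
        by (simp add: True hl_def hfac_def loc_simps scaleC_scaleC scaleC_one)
      then show ?thesis by (simp add: cvec.span_scale cvec.span_diff cvec.span_base)
    next
      case False
      then have "loc j y = hl j y" by (simp add: hl_def)
      then show ?thesis by (simp add: cvec.span_base)
    qed
    then have "ordered_prod (\<lambda>j. loc j (d j)) \<in> cvec.span {ordered_prod l | l. \<forall>j. l j \<in> range (hl j)}"
      by (rule multilin_in_span[OF multilin_ordered_prod])
    then have "ordered_prod (\<lambda>j. loc j (d j)) * (qK ^ k * qe 1) \<in> ?S"
    proof (rule clinear_in_subspace[OF clinear_mult_right cvec.subspace_span])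
      fix c :: "'i Q" assume "c \<in> {ordered_prod l | l. \<forall>j. l j \<in> range (hl j)}"
      then obtain l where l: "c = ordered_prod l" "\<And>j. l j \<in> range (hl j)" by blast
      then have "\<forall>j. \<exists>y. l j = hl j y" by blast
      then obtain e where "\<And>j. l j = hl j (e j)" by metis
      then have "l = (\<lambda>j. hl j (e j))" by (rule ext)
      then have "c * (qK ^ k * qe 1) = hmon e k" by (simp add: l(1) hmon_def mult.assoc)
      then show "c * (qK ^ k * qe 1) \<in> ?S" by (simp add: hmk)
    qed
    then show "b * qe 1 \<in> ?S" by (simp add: b mon_def mult.assoc)
  qed
qed

lemma center_mult:
  fixes z w :: "'a::semigroup_mult"
  assumes "z \<in> center" "w \<in> center"
  shows "z * w \<in> center"
proof -
  have "z * w * x = x * (z * w)" for x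
  proof -
    have "z * w * x = z * (x * w)" using assms(2) by (simp add: center_def mult.assoc)
    also have "\<dots> = (x * z) * w" using assms(1) by (simp add: center_def flip: mult.assoc)
    finally show ?thesis by (simp add: mult.assoc)
  qed
  then show ?thesis by (simp add: center_def)
qed

lemma commuting_anticommuting_zero:
  fixes b g :: "'a::complex_alg"
  assumes "g * b = b * g" "g * b = - (b * g)" "b * g * g = b"
  shows "b = 0"
proof -
  have "b * g = - (b * g)" by (rule trans[OF assms(1)[symmetric] assms(2)])
  then have "b * g + b * g = 0" by (simp only: eq_neg_iff_add_eq_0)
  then have "2 *\<^sub>C (b * g) = 0" by (simp only: scaleC_double)
  then have "b * g = 0" by simp
  then show ?thesis using assms(3) by simp
qed

section \<open>The centre of the block of \<open>qe 1\<close>\<close>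

lemma hfac_hl_qe1: "hfac j * hl i x * qe 1 = (if i = j then sg x else 1) *\<^sub>C (hl i x * hfac j * qe 1)"
proof (cases "x = (True, True)")
  case True
  then show ?thesis using hfac_commute[of i j] by (simp add: hl_def sg_def scaleC_one)
next
  case x: False
  show ?thesis
  proof (cases "i = j")
    case False
    then have "hfac j * loc i x = loc i x * hfac j" using hfac_commute_loc[of j i x 0] by simp
    then show ?thesis using x False by (simp add: hl_def scaleC_one)
  next
    case True
    obtain a b where ab: "x = (a, b)" by (cases x)
    have "hfac j * qf s j * qe 1 = (-1) *\<^sub>C (qf s j * hfac j * qe 1)" for s
      unfolding qf_hfac_qe1 by (simp add: scaleC_scaleC scaleC_one)
    then show ?thesis using x True by (cases a; cases b) (simp_all add: ab hl_def loc_simps sg_def scaleC_one)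
  qed
qed

lemma hfac_hmon: "hfac j * hmon d k = sg (d j) *\<^sub>C (hmon d k * hfac j)"
proof -
  let ?P = "ordered_prod (\<lambda>i. hl i (d i))"
  have hK: "hfac j * qK ^ k = qK ^ k * hfac j"
    by (rule power_commuting_commutes[OF hfac_commute_qK[symmetric], symmetric])
  have P: "hfac j * ?P * qe 1 = (\<Prod>i\<in>UNIV. if i = j then sg (d i) else 1) *\<^sub>C (?P * hfac j * qe 1)"
    by (rule ordered_prod_sign[OF qe_central hfac_hl_qe1])
  have "(\<Prod>i\<in>UNIV. if i = j then sg (d i) else 1) = (\<Prod>i\<in>UNIV. if i = j then sg (d j) else 1)"
    by (intro prod.cong) auto
  then have s: "(\<Prod>i\<in>UNIV. if i = j then sg (d i) else 1) = sg (d j)" by (simp only: prod_single_sign)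
  have "hfac j * hmon d k = (hfac j * ?P * qe 1) * qK ^ k"
    by (simp only: hmon_def mult.assoc qe_central)
  also have "\<dots> = (sg (d j) *\<^sub>C (?P * hfac j * qe 1)) * qK ^ k" by (simp only: P s)
  also have "\<dots> = sg (d j) *\<^sub>C (?P * (hfac j * qK ^ k) * qe 1)"
    by (simp only: mult_scaleC_left mult.assoc qe_central)
  also have "\<dots> = sg (d j) *\<^sub>C (hmon d k * hfac j)"
    unfolding hK by (simp only: hmon_def mult.assoc qe_central)
  finally show ?thesis .
qed

lemma hmon_hfac_hfac: "hmon d k * hfac j * hfac j = hmon d k"
proof -
  have "hmon d k * hfac j * hfac j = ordered_prod (\<lambda>j. hl j (d j)) * qK ^ k * (hfac j * hfac j * qe 1)"
    by (simp only: hmon_def mult.assoc qe_central)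
  then show ?thesis unfolding hfac_sq_qe1 by (simp only: hmon_def)
qed

definition gam :: "'i \<Rightarrow> 'i Q" where
  "gam j = qf Pl j + qf Mi j"

lemma gam_sq: "gam j * gam j = qe 1"
  by (simp add: gam_def distrib_left distrib_right qf_sq qf_Mi_Pl)

lemma gam_hl_qe1:
  assumes "sg x = 1"
  shows "gam j * hl i x * qe 1 = (if i = j \<and> x = (True, True) then -1 else 1) *\<^sub>C (hl i x * gam j * qe 1)"
proof -
  have x: "x = (True, True) \<or> x = (False, False)" using assms by (cases x) (auto simp: sg_def split: if_splits)
  have eq: "gam j * hfac j * qe 1 = (-1) *\<^sub>C (hfac j * gam j * qe 1)"
    using qf_hfac_qe1[of Pl j] qf_hfac_qe1[of Mi j]
    by (simp add: gam_def distrib_left distrib_right scaleC_add_right)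
  have neq: "i \<noteq> j \<Longrightarrow> gam j * hfac i = hfac i * gam j"
    by (simp add: gam_def distrib_left distrib_right qf_hfac_neq)
  show ?thesis using x eq neq by (auto simp: hl_def loc_simps scaleC_one)
qed

lemma gam_hmon:
  assumes "\<forall>i. sg (d i) = 1" "k < 2"
  shows "gam j * hmon d k = ((if d j = (True, True) then -1 else 1) * (-1) ^ k) *\<^sub>C (hmon d k * gam j)"
proof -
  let ?P = "ordered_prod (\<lambda>i. hl i (d i))"
  have gK: "gam j * qK ^ k = (-1) ^ k *\<^sub>C (qK ^ k * gam j)"
  proof -
    have "k = 0 \<or> k = 1" using assms(2) by auto
    then show ?thesis by (auto simp: gam_def distrib_left distrib_right qf_qK lin_simps)
  qed
  have P: "gam j * ?P * qe 1 = (\<Prod>i\<in>UNIV. if i = j \<and> d i = (True, True) then -1 else 1) *\<^sub>C (?P * gam j * qe 1)"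
    by (rule ordered_prod_sign[OF qe_central gam_hl_qe1]) (use assms in blast)
  have "(\<Prod>i\<in>UNIV. if i = j \<and> d i = (True, True) then -1 else 1) =
      (\<Prod>i\<in>UNIV. if i = j then (if d j = (True, True) then -1 else 1) else (1 :: complex))"
    by (intro prod.cong) auto
  then have s: "(\<Prod>i\<in>UNIV. if i = j \<and> d i = (True, True) then -1 else 1) =
      (if d j = (True, True) then -1 else (1 :: complex))" by (simp only: prod_single_sign)
  have "gam j * hmon d k = (gam j * ?P * qe 1) * qK ^ k"
    by (simp only: hmon_def mult.assoc qe_central)
  also have "\<dots> = ((if d j = (True, True) then -1 else 1) *\<^sub>C (?P * gam j * qe 1)) * qK ^ k"
    by (simp only: P s)
  also have "\<dots> = (if d j = (True, True) then -1 else 1) *\<^sub>C (?P * (gam j * qK ^ k) * qe 1)"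
    by (simp only: mult_scaleC_left mult.assoc qe_central)
  also have "\<dots> = ((if d j = (True, True) then -1 else 1) * (-1) ^ k) *\<^sub>C (hmon d k * gam j)"
    unfolding gK by (simp only: hmon_def mult.assoc qe_central mult_scaleC_left mult_scaleC_right scaleC_scaleC)
  finally show ?thesis .
qed

lemma hmon_gam_gam: "hmon d k * gam j * gam j = hmon d k"
  by (simp add: mult.assoc gam_sq) (simp add: hmon_def mult.assoc qe_mult)

lemma center_qe1:
  assumes "z \<in> center"
  shows "z * qe 1 \<in> cvec.span {qe 1, Gam :: 'i::{finite,linorder} Q}"
proof -
  let ?z = "z * qe 1"
  have zc: "g * ?z = ?z * g" for g
    using center_mult[OF assms qe_center] by (simp add: center_iff)
  let ?B = "{hmon d k :: 'i Q | d k. k < 2}" and ?G = "range (hfac :: 'i \<Rightarrow> _)" and ?G' = "range (gam :: 'i \<Rightarrow> _)"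
  let ?B2 = "{hmon d k :: 'i Q | d k. k < 2 \<and> (\<forall>j. sg (d j) = 1)}"
  have "?z \<in> cvec.span {b \<in> ?B. \<forall>g\<in>?G. g * b = b * g}"
  proof (rule sign_filter_finite[OF _ span_hmon zc])
    fix b g :: "'i Q" assume "b \<in> ?B" "g \<in> ?G"
    then obtain d k j where b: "b = hmon d k" "g = hfac j" by blast
    show "g * b = b * g \<or> g * b = - (b * g)"
      unfolding b hfac_hmon using sg_cases[of "d j"] by (auto simp: scaleC_one cvec.scale_minus_left)
    show "b * g * g = b" unfolding b by (rule hmon_hfac_hfac)
  qed simp
  also have "\<dots> \<subseteq> cvec.span ?B2"
  proof (rule cvec.span_minimal, clarify)
    fix d :: "'i \<Rightarrow> bool \<times> bool" and k :: nat
    assume k: "k < 2" and c: "\<forall>g\<in>?G. g * hmon d k = hmon d k * g"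
    show "hmon d k \<in> cvec.span ?B2"
    proof (cases "\<forall>j. sg (d j) = 1")
      case True
      then show ?thesis using k by (intro cvec.span_base) blast
    next
      case False
      then obtain j where "sg (d j) = -1" using sg_cases by blast
      then have "hmon d k = 0"
        using c hfac_hmon[of j d k]
        by (intro commuting_anticommuting_zero[of "hfac j"])
          (auto simp: hmon_hfac_hfac scaleC_one cvec.scale_minus_left)
      then show ?thesis by (simp add: cvec.span_zero)
    qed
  qed simp
  finally have "?z \<in> cvec.span ?B2" .
  then have "?z \<in> cvec.span {b \<in> ?B2. \<forall>g\<in>?G'. g * b = b * g}"
  proof (rule sign_filter_finite[OF _ _ zc, rotated])
    fix b g :: "'i Q" assume "b \<in> ?B2" "g \<in> ?G'"
    then obtain d k j where b: "b = hmon d k" "k < 2" "\<forall>j. sg (d j) = 1" "g = gam j" by blast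
    show "g * b = b * g \<or> g * b = - (b * g)"
      unfolding b(1,4) gam_hmon[OF b(3,2)] by (cases "even k") (auto simp: scaleC_one cvec.scale_minus_left)
    show "b * g * g = b" unfolding b(1,4) by (rule hmon_gam_gam)
  qed simp
  also have "\<dots> \<subseteq> cvec.span {qe 1, Gam}"
  proof (rule cvec.span_minimal, clarify)
    fix d :: "'i \<Rightarrow> bool \<times> bool" and k :: nat
    assume k: "k < 2" and d: "\<forall>j. sg (d j) = 1" and c: "\<forall>g\<in>?G'. g * hmon d k = hmon d k * g"
    show "hmon d k \<in> cvec.span {qe 1, Gam}"
    proof (cases "hmon d k = 0")
      case False
      have k01: "k = 0 \<or> k = 1" using k by auto
      \<comment> \<open>The sign in \<open>gam_hmon\<close> has one factor -1 for a full site
        \<open>j\<close> and one for k = 1. If just one of them is present, the vector both commutes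
        and anticommutes with \<open>gam j\<close> and would vanish.\<close>
      have "(d j = (True, True)) = (k = 1)" for j
      proof (rule ccontr)
        assume "(d j = (True, True)) \<noteq> (k = 1)"
        then have "gam j * hmon d k = - (hmon d k * gam j)"
          unfolding gam_hmon[OF d k] using k01 by (auto simp: scaleC_one cvec.scale_minus_left)
        with c have "hmon d k = 0"
          by (intro commuting_anticommuting_zero[of "gam j"]) (auto simp: hmon_gam_gam)
        with False show False ..
      qed
      moreover have "d j = (True, True) \<or> d j = (False, False)" for j
        using d[rule_format, of j] by (cases "d j") (auto simp: sg_def split: if_splits)
      ultimately have "(k = 1 \<and> d = (\<lambda>_. (True, True))) \<or> (k = 0 \<and> d = (\<lambda>_. (False, False)))"
        using k01 by (auto simp: fun_eq_iff)
      moreover have "hmon (\<lambda>_. (True, True)) 1 = (Gam :: 'i Q)"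
        by (simp add: hmon_def hl_def Gam_def ordered_prod_hfac_qK)
      moreover have "hmon (\<lambda>_. (False, False)) 0 = (qe 1 :: 'i Q)"
        by (simp add: hmon_def hl_def loc_simps ordered_prod_one)
      ultimately have "hmon d k \<in> {qe 1, Gam}" by auto
      then show ?thesis by (rule cvec.span_base)
    qed (simp add: cvec.span_zero)
  qed simp
  finally show ?thesis .
qed

section \<open>The centre of the block of \<open>qe 0\<close>\<close>

lemma qK_L0: "qK * L0 d = (if even_deg d then 1 else -1) *\<^sub>C (L0 d * qK)"
proof -
  obtain w where w: "ordered_prod (\<lambda>j. loc j (d j)) = fword w"
    "even (length w) \<longleftrightarrow> even (\<Sum>j\<in>UNIV. odd_deg (d j))" by (rule ordered_prod_loc_fword)
  have "qK * L0 d = (-1) ^ length w *\<^sub>C (L0 d * qK)"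
    unfolding L0_def w(1) using arg_cong[where f = "\<lambda>y. y * qe 0", OF fword_qK[of w]]
    by (simp only: mult.assoc mult_scaleC_left qe_central)
  also have "(-1) ^ length w = (if even_deg d then 1 else -1 :: complex)"
    using w(2) by (simp add: even_deg_def)
  finally show ?thesis .
qed

lemma L0_qK_qK: "L0 d * qK * qK = L0 d"
  by (simp add: L0_def mult.assoc) (simp add: qe_central mult.assoc qK_qK_qe)

lemma L0_qK_pow_in: "L0 d * qK ^ n \<in> {L0 d, L0 d * qK}"
proof (induction n)
  case (Suc n)
  have "L0 d * qK ^ Suc n = (L0 d * qK ^ n) * qK" by (simp only: power_Suc2 mult.assoc)
  then show ?case using Suc L0_qK_qK[of d] by auto
qed simp

text \<open>If some bit of \<open>d\<close> is missing, the corresponding generator adds it, and the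
  coefficient of \<open>d\<close> reappears, times a nonzero scalar, at the enlarged index. Adding a
  missing bit is injective, so nothing else lands there and the coefficient must be zero.\<close>

lemma vanishing_span_L0:
  fixes b :: "'i::{finite,linorder} Q"
  assumes "b \<in> cvec.span (range L0)" "\<And>s j. qf s j * b = 0"
  obtains c where "b = c *\<^sub>C L0 (\<lambda>_. (True, True))"
proof -
  let ?t = "\<lambda>_ :: 'i. (True, True)"
  have 0: "coord d 0 b = 0" if d: "d \<noteq> ?t" for d
  proof -
    from d obtain j where "d j \<noteq> (True, True)" by auto
    then obtain s where s: "\<not> bit_set s (d j)"
      by (metis bit_set.simps prod.collapse)
    let ?d = "d(j := add_bit s (d j))"
    obtain c where c: "c \<noteq> 0" "qf s j * L0 d = c *\<^sub>C L0 ?d" using s by (metis qf_L0)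
    have "coord ?d 0 (qf s j * y) = c * coord d 0 y" if "y \<in> cvec.span (range L0)" for y
      using that
    proof (induction rule: cvec.span_induct_alt)
      case (step a x y)
      then obtain e where x: "x = L0 e" by blast
      obtain c' where c': "c' = 0 \<longleftrightarrow> bit_set s (e j)" "qf s j * L0 e = c' *\<^sub>C L0 (e(j := add_bit s (e j)))"
        by (rule qf_L0)
      have x_eq: "coord ?d 0 (qf s j * x) = c * coord d 0 x"
      proof (cases "e = d")
        case True
        then show ?thesis unfolding x True c(2) by (simp add: coord_scaleC coord_L0)
      next
        case False
        have "e(j := add_bit s (e j)) \<noteq> ?d" if "\<not> bit_set s (e j)"
        proof
          assume eq: "e(j := add_bit s (e j)) = ?d"
          have "e i = d i" if "i \<noteq> j" for i using fun_cong[OF eq, of i] that by simp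
          moreover have "e j = d j"
            using fun_cong[OF eq, of j] s \<open>\<not> bit_set s (e j)\<close>
            by (cases s; cases "e j"; cases "d j") auto
          ultimately have "e = d" by (metis ext)
          with False show False ..
        qed
        then show ?thesis
          unfolding x c'(2) using False c'(1) by (auto simp: coord_scaleC coord_L0)
      qed
      show ?case
        unfolding distrib_left mult_scaleC_right coord_add coord_scaleC x_eq step(2)
        by (simp only: mult.left_commute)
    qed (simp add: coord_zero)
    from this[OF assms(1)] c(1) show ?thesis by (simp add: assms(2) coord_zero)
  qed
  have lin: "clinear (\<lambda>y. \<Sum>d\<in>UNIV. (2 * coord d 0 y) *\<^sub>C L0 d :: 'i Q)"
    by (rule clinearI) (simp_all add: coord_add coord_scaleC scaleC_add_left distrib_left sum.distrib
        cvec.scale_sum_right scaleC_scaleC mult.left_commute)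
  have "b = (\<Sum>d\<in>UNIV. (2 * coord d 0 b) *\<^sub>C L0 d)"
  proof (rule clinear_eq_on_span[OF _ lin assms(1), of "\<lambda>y. y"])
    show "clinear (\<lambda>y :: 'i Q. y)" by (rule clinearI) simp_all
    fix y :: "'i Q" assume "y \<in> range L0"
    then obtain e where y: "y = L0 e" by blast
    have "(\<Sum>d\<in>UNIV. (2 * coord d 0 y) *\<^sub>C L0 d) = (\<Sum>d\<in>UNIV. if d = e then L0 e else 0)"
      by (rule sum.cong) (auto simp: y coord_L0 scaleC_one)
    then show "y = (\<Sum>d\<in>UNIV. (2 * coord d 0 y) *\<^sub>C L0 d)" by (simp add: y sum.delta)
  qed
  also have "\<dots> = (\<Sum>d\<in>UNIV. if d = ?t then (2 * coord ?t 0 b) *\<^sub>C L0 ?t else 0)"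
    by (rule sum.cong) (auto simp: 0)
  also have "\<dots> = (2 * coord ?t 0 b) *\<^sub>C L0 ?t" by (simp add: sum.delta)
  finally show thesis by (rule that)
qed

lemma Z_Lambda_center: "Z_Lambda \<subseteq> (center :: 'i::{finite,linorder} Q set)"
  unfolding Z_Lambda_eq by (rule cvec.span_minimal[OF _ subspace_center]) (auto intro: L0_center)

text \<open>Commutation with \<open>qK\<close> leaves a + bK with a and b even, hence central. Then
  bK is central too; but a generator f commutes with b and anticommutes with K, which forces fb =
  0.\<close>

lemma center_qe0:
  assumes "z \<in> (center :: 'i::{finite,linorder} Q set)"
  obtains a c where "a \<in> Z_Lambda" "z * qe 0 = a + c *\<^sub>C Ktop"
proof -
  let ?z = "z * qe 0"
  have zc: "g * ?z = ?z * g" for g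
    using center_mult[OF assms qe_center] by (simp add: center_iff)
  let ?B = "{L0 d | d :: 'i \<Rightarrow> _. True} \<union> {L0 d * qK | d. True}"
  let ?E = "{L0 d | d :: 'i \<Rightarrow> _. even_deg d}" and ?F = "{L0 d * qK | d :: 'i \<Rightarrow> _. even_deg d}"
  have "z \<in> cvec.span monomial_basis" by (simp add: span_monomial_basis)
  then have "?z \<in> cvec.span ?B"
  proof (rule clinear_in_subspace[OF clinear_mult_right cvec.subspace_span])
    fix b :: "'i Q" assume "b \<in> monomial_basis"
    then obtain d k where b: "b = mon d k" unfolding monomial_basis_eq by blast
    have "b * qe 0 = L0 d * qK ^ k" by (simp add: b mon_def L0_def mult.assoc qe_central)
    then show "b * qe 0 \<in> cvec.span ?B" using L0_qK_pow_in[of d k] by (intro cvec.span_base) auto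
  qed
  then have "?z \<in> cvec.span {b \<in> ?B. qK * b = b * qK}"
  proof (rule sign_filter[OF _ zc])
    fix b assume "b \<in> ?B"
    then obtain d where b: "b = L0 d \<or> b = L0 d * qK" by blast
    have "qK * (L0 d * qK) = (qK * L0 d) * qK" by (simp only: mult.assoc)
    then show "qK * b = b * qK \<or> qK * b = - (b * qK)"
      using b by (cases "even_deg d") (auto simp: qK_L0 scaleC_one cvec.scale_minus_left)
    show "b * qK * qK = b" using b by (auto simp: L0_qK_qK)
  qed
  also have "\<dots> \<subseteq> cvec.span (?E \<union> ?F)"
  proof (rule cvec.span_minimal, rule subsetI)
    fix b assume "b \<in> {b \<in> ?B. qK * b = b * qK}"
    then obtain d where b: "b = L0 d \<or> b = L0 d * qK" and c: "qK * b = b * qK" by blast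
    show "b \<in> cvec.span (?E \<union> ?F)"
    proof (cases "even_deg d")
      case True
      then show ?thesis using b by (intro cvec.span_base) blast
    next
      case False
      have "qK * (L0 d * qK) = (qK * L0 d) * qK" by (simp only: mult.assoc)
      then have "qK * b = - (b * qK)" using b False by (auto simp: qK_L0 scaleC_one cvec.scale_minus_left)
      with c have "b = 0" using b by (intro commuting_anticommuting_zero[of qK]) (auto simp: L0_qK_qK)
      then show ?thesis by (simp add: cvec.span_zero)
    qed
  qed simp
  finally obtain a b' where ab: "a \<in> cvec.span ?E" "b' \<in> cvec.span ?F" "?z = a + b'"
    unfolding cvec.span_Un by blast
  have "?F = (\<lambda>x. x * qK) ` ?E" by auto
  then have "b' \<in> (\<lambda>x. x * qK) ` cvec.span ?E"
    using ab(2) cpair.linear_span_image[OF clinear_mult_right, of "qK :: 'i Q" ?E] by simp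
  then obtain b where b: "b \<in> cvec.span ?E" "b' = b * qK" by blast
  have aZ: "a \<in> Z_Lambda" and bZ: "b \<in> Z_Lambda" using ab(1) b(1) by (simp_all add: Z_Lambda_eq)
  have be: "b * qe 0 = b"
  proof (rule clinear_eq_on_span[OF clinear_mult_right _ b(1), of "\<lambda>x. x"])
    show "clinear (\<lambda>y :: 'i Q. y)" by (rule clinearI) simp_all
  qed (auto simp: L0_def mult.assoc qe_mult)
  have "qf s j * b = 0" for s j
  proof -
    have ac: "a * x = x * a" and bc: "b * x = x * b" for x
      using aZ bZ Z_Lambda_center by (auto simp: center_iff)
    have "b * qK = ?z - a" using ab(3) b(2) by simp
    then have "qf s j * (b * qK) = (b * qK) * qf s j"
      using zc[of "qf s j"] ac[of "qf s j"] by (simp add: left_diff_distrib right_diff_distrib)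
    also have "\<dots> = - (qf s j * (b * qK))"
      using bc[of "qf s j"] by (simp add: mult.assoc qK_qf) (simp flip: mult.assoc)
    finally have "qf s j * (b * qK) + qf s j * (b * qK) = 0" by (simp only: eq_neg_iff_add_eq_0)
    then have "2 *\<^sub>C (qf s j * (b * qK)) = 0" by (simp only: scaleC_double)
    then have "qf s j * (b * qK) = 0" by simp
    then have "qf s j * (b * qK) * qK = 0" by simp
    moreover have "b * qK * qK = b"
    proof -
      have "b * qK * qK = b * qe 0 * qK * qK" by (simp only: be)
      also have "\<dots> = b * (qK * (qK * qe 0))" by (simp only: qe_central mult.assoc)
      finally show ?thesis by (simp add: qK_qK_qe be)
    qed
    ultimately show ?thesis by (simp add: mult.assoc)
  qed
  moreover have "b \<in> cvec.span (range L0)" using b(1) cvec.span_mono[of ?E "range L0"] by blast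
  ultimately obtain c where "b = c *\<^sub>C L0 (\<lambda>_. (True, True))" using vanishing_span_L0 by blast
  then have "?z = a + c *\<^sub>C Ktop" using ab(3) b(2) by (simp add: Ktop_L0 mult_scaleC_left)
  with aZ show thesis by (rule that)
qed

lemma Z_Lambda_qe0:
  assumes "z \<in> (Z_Lambda :: 'i::{finite,linorder} Q set)"
  shows "z * qe 0 = z"
proof -
  have id: "clinear (\<lambda>y :: 'i Q. y)" by (rule clinearI) simp_all
  have "z \<in> cvec.span {L0 d | d. even_deg d}" using assms by (simp only: Z_Lambda_eq)
  then show ?thesis
    by (rule clinear_eq_on_span[OF clinear_mult_right id]) (auto simp: L0_def mult.assoc qe_mult)
qed

text \<open>A common element lies in the block of \<open>qe 0\<close> and is therefore a multiple of
  \<open>Ktop\<close>; that element consists of odd powers of \<open>qK\<close>, which do not occur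
  in \<open>Z_Lambda\<close>.\<close>

theorem center_direct_sum:
  "is_direct_sum (center :: 'i::{finite,linorder} Q set) (cvec.span {Ktop, qe 1, Gam}) Z_Lambda"
  unfolding is_direct_sum_def
proof (intro conjI)
  let ?P = "cvec.span {Ktop, qe 1, Gam :: 'i Q}"
  show "cvec.subspace ?P" by simp
  show "cvec.subspace (Z_Lambda :: 'i Q set)" by (simp add: Z_Lambda_eq)
  have P: "\<exists>x y z. p = x *\<^sub>C Ktop + y *\<^sub>C qe 1 + z *\<^sub>C Gam" if "p \<in> ?P" for p
    using that by (auto simp: cvec.span_insert cvec.span_empty algebra_simps)
  show "?P \<inter> Z_Lambda = {0}"
  proof -
    have "p = 0" if p: "p \<in> ?P" "p \<in> Z_Lambda" for p
    proof -
      obtain x y z where "p = x *\<^sub>C Ktop + y *\<^sub>C qe 1 + z *\<^sub>C Gam" using P[OF p(1)] by blast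
      then have "p * qe 0 = x *\<^sub>C Ktop" by (simp add: lin_simps Ktop_qe Gam_qe qe_mult)
      then have px: "p = x *\<^sub>C Ktop" using Z_Lambda_qe0[OF p(2)] by simp
      have "coord (\<lambda>_. (True, True)) 1 q = 0" if "q \<in> Z_Lambda" for q :: "'i Q"
        using that unfolding Z_Lambda_eq
      proof (induction rule: cvec.span_induct_alt)
        case (step c x y)
        then obtain d where "x = L0 d" by blast
        then show ?case using step(2) by (simp add: coord_add coord_scaleC coord_L0 del: One_nat_def)
      qed (rule coord_zero)
      from this[OF p(2)] have "x = 0"
        unfolding px Ktop_eq coord_scaleC coord_add by (simp add: coord_mon)
      then show ?thesis by (simp add: px)
    qed
    moreover have "(0 :: 'i Q) \<in> Z_Lambda" unfolding Z_Lambda_eq by (rule cvec.span_zero)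
    ultimately show ?thesis by (auto simp: cvec.span_zero)
  qed
  show "center = {a + b | a b. a \<in> ?P \<and> b \<in> Z_Lambda}"
  proof (intro equalityI subsetI)
    fix z :: "'i Q" assume z: "z \<in> center"
    obtain a c where a: "a \<in> Z_Lambda" "z * qe 0 = a + c *\<^sub>C Ktop" using center_qe0[OF z] by blast
    have "z = z * qe 0 + z * qe 1" unfolding distrib_left[symmetric] using qe_sum[where 'a = 'i] by simp
    then have "z = (c *\<^sub>C Ktop + z * qe 1) + a" by (simp add: a(2) ac_simps)
    moreover have "c *\<^sub>C Ktop + z * qe 1 \<in> ?P"
    proof (intro cvec.span_add cvec.span_scale)
      show "Ktop \<in> ?P" by (rule cvec.span_base) simp
      show "z * qe 1 \<in> ?P"
        using center_qe1[OF z] cvec.span_mono[of "{qe 1, Gam}" "{Ktop, qe 1, Gam :: 'i Q}"] by blast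
    qed
    ultimately show "z \<in> {a + b | a b. a \<in> ?P \<and> b \<in> Z_Lambda}" using a(1) by blast
  next
    fix z :: "'i Q" assume z: "z \<in> {a + b | a b. a \<in> ?P \<and> b \<in> Z_Lambda}"
    moreover have "?P \<subseteq> center"
      by (rule cvec.span_minimal[OF _ subspace_center]) (simp add: Ktop_center Gam_center qe_center del: One_nat_def)
    ultimately show "z \<in> center"
      using Z_Lambda_center cvec.subspace_add[OF subspace_center] by blast
  qed
qed

section \<open>Sizes of Jordan blocks\<close>

text \<open>A basis of the smaller kernel is an independent set of full cardinality in the larger
  one.\<close>

lemma mat_kernel_eqI:
  fixes A B :: "'a::field mat"
  assumes A: "A \<in> carrier_mat n n" and B: "B \<in> carrier_mat n n"
    and sub: "mat_kernel A \<subseteq> mat_kernel B" and dim: "kernel_dim A = kernel_dim B"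
  shows "mat_kernel A = mat_kernel B"
proof -
  interpret KA: kernel n n A by unfold_locales (rule A)
  interpret KB: kernel n n B by unfold_locales (rule B)
  obtain C where C: "finite C" "KA.basis C" using kernel_basis_exists[OF A] by blast
  obtain D where D: "finite D" "KB.basis D" using kernel_basis_exists[OF B] by blast
  have CA: "C \<subseteq> mat_kernel A" "\<not> KA.lin_dep C" "KA.span C = mat_kernel A"
    using C(2) unfolding KA.Ker.basis_def by auto
  have CB: "C \<subseteq> mat_kernel B" using CA(1) sub by blast
  have "KB.basis C"
  proof (rule KB.Ker.dim_li_is_basis)
    show "KB.Ker.fin_dim" unfolding KB.Ker.fin_dim_def using D unfolding KB.Ker.basis_def by blast
    show "\<not> KB.lin_dep C" using CA(2) KA.lindep_same[OF CA(1)] KB.lindep_same[OF CB] by simp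
    show "KB.dim \<le> card C" using dim KA.Ker.dim_basis[OF C] by simp
  qed (use C CB in auto)
  then have "KB.span C = mat_kernel B" unfolding KB.Ker.basis_def by auto
  then show ?thesis using CA(3) KA.span_same[OF CA(1)] KB.span_same[OF CB] by simp
qed

lemma char_matrix_mult_vec:
  assumes "A \<in> carrier_mat n n" "v \<in> carrier_vec n"
  shows "char_matrix A c *\<^sub>v v = A *\<^sub>v v - c \<cdot>\<^sub>v v"
proof -
  have "char_matrix A c *\<^sub>v v = A *\<^sub>v v + ((- c) \<cdot>\<^sub>m 1\<^sub>m n) *\<^sub>v v"
    unfolding char_matrix_def using assms by (simp add: add_mult_distrib_mat_vec[of _ n n])
  also have "((- c) \<cdot>\<^sub>m 1\<^sub>m n) *\<^sub>v v = (- c) \<cdot>\<^sub>v v"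
    using assms by (intro eq_vecI) (simp_all add: row_smult)
  finally show ?thesis using assms by (intro eq_vecI) auto
qed

lemma is_ordered_basis_expansion:
  assumes "is_ordered_basis bs V" and z: "z \<in> V"
  obtains v where "v \<in> carrier_vec (length bs)" "z = (\<Sum>i<length bs. v $ i *\<^sub>C bs ! i)"
proof -
  have sp: "cvec.span (set bs) = V" and d: "distinct bs"
    using assms(1) by (auto simp: is_ordered_basis_def)
  obtain u where "z = (\<Sum>b\<in>set bs. u b *\<^sub>C b)"
    using z sp cvec.span_finite[of "set bs"] by auto
  also have "\<dots> = (\<Sum>i<length bs. vec (length bs) (\<lambda>i. u (bs ! i)) $ i *\<^sub>C bs ! i)"
    by (simp add: sum.reindex_bij_betw[OF bij_betw_nth[OF d refl refl], symmetric] flip: lessThan_atLeast0)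
  finally show thesis by (rule that[rotated]) simp
qed

lemma ordered_basis_independent:
  assumes "is_ordered_basis bs V" "(\<Sum>i<length bs. v $ i *\<^sub>C bs ! i) = 0" "i < length bs"
  shows "v $ i = 0"
proof -
  have d: "distinct bs" and ind: "cvec.independent (set bs)"
    using assms(1) by (auto simp: is_ordered_basis_def)
  have b: "bij_betw (\<lambda>i. bs ! i) {..<length bs} (set bs)" by (rule bij_betw_nth[OF d refl refl])
  define u where "u b = v $ (the_inv_into {..<length bs} ((!) bs) b)" for b
  have u: "u (bs ! i) = v $ i" if "i < length bs" for i
    using that b by (simp add: u_def the_inv_into_f_f bij_betw_def)
  have "(\<Sum>b\<in>set bs. u b *\<^sub>C b) = (\<Sum>i<length bs. v $ i *\<^sub>C bs ! i)"
    by (subst sum.reindex_bij_betw[OF b, symmetric]) (simp add: u)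
  moreover have "\<forall>u. (\<Sum>b\<in>set bs. u b *\<^sub>C b) = 0 \<longrightarrow> (\<forall>b\<in>set bs. u b = 0)"
    using ind by (auto simp: cvec.dependent_finite)
  ultimately have "u (bs ! i) = 0" using assms(2,3) nth_mem by metis
  then show ?thesis using u assms(3) by simp
qed

locale matrix_representation =
  fixes f :: "'a::complex_vec \<Rightarrow> 'a" and bs V A
  assumes basis: "is_ordered_basis bs V" and matrix: "has_matrix f bs A" and linear_f: "clinear f"
begin

abbreviation "n \<equiv> length bs"

definition combo :: "complex vec \<Rightarrow> 'a" where "combo v = (\<Sum>i<n. v $ i *\<^sub>C bs ! i)"

lemma A_carrier: "A \<in> carrier_mat n n" using matrix by (simp add: has_matrix_def)

lemma combo_image: "combo ` carrier_vec n = V"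
proof -
  have "cvec.subspace V" "\<And>i. i < n \<Longrightarrow> bs ! i \<in> V"
    using basis cvec.span_superset[of "set bs"] by (auto simp: is_ordered_basis_def)
  then have "combo v \<in> V" for v
    unfolding combo_def by (intro cvec.subspace_sum cvec.subspace_scale) auto
  moreover have "\<exists>v\<in>carrier_vec n. z = combo v" if "z \<in> V" for z
    using is_ordered_basis_expansion[OF basis that] unfolding combo_def by metis
  ultimately show ?thesis by blast
qed

lemma combo_zero_iff: "v \<in> carrier_vec n \<Longrightarrow> combo v = 0 \<longleftrightarrow> v = 0\<^sub>v n"
  using ordered_basis_independent[OF basis] by (auto simp: combo_def intro!: eq_vecI)

lemma combo_diff_smult:
  "u \<in> carrier_vec n \<Longrightarrow> v \<in> carrier_vec n \<Longrightarrow> combo (u - c \<cdot>\<^sub>v v) = combo u - c *\<^sub>C combo v"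
  by (simp add: combo_def cvec.scale_left_diff_distrib sum_subtractf cvec.scale_sum_right scaleC_scaleC)

lemma f_combo:
  assumes "v \<in> carrier_vec n"
  shows "f (combo v) = combo (A *\<^sub>v v)"
proof -
  have "f (combo v) = (\<Sum>j<n. v $ j *\<^sub>C (\<Sum>i<n. A $$ (i, j) *\<^sub>C bs ! i))"
    using matrix by (simp add: combo_def clinear_sum[OF linear_f] clinear_scaleC[OF linear_f] has_matrix_def)
  also have "\<dots> = (\<Sum>i<n. \<Sum>j<n. (A $$ (i, j) * v $ j) *\<^sub>C bs ! i)"
    by (simp add: cvec.scale_sum_right scaleC_scaleC mult.commute) (rule sum.swap)
  also have "\<dots> = combo (A *\<^sub>v v)"
    using A_carrier assms
    by (simp add: combo_def scalar_prod_def cvec.scale_sum_left[symmetric] lessThan_atLeast0)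
  finally show ?thesis .
qed

lemma shift_pow_combo:
  assumes "v \<in> carrier_vec n"
  shows "((\<lambda>x. f x - c *\<^sub>C x) ^^ k) (combo v) = combo (char_matrix A c ^\<^sub>m k *\<^sub>v v)"
  using assms
proof (induction k arbitrary: v)
  case (Suc k)
  let ?C = "char_matrix A c" and ?g = "\<lambda>x. f x - c *\<^sub>C x"
  have C: "?C \<in> carrier_mat n n" using A_carrier by simp
  have "?g (combo v) = combo (?C *\<^sub>v v)"
    using Suc.prems A_carrier by (simp add: char_matrix_mult_vec combo_diff_smult f_combo)
  then have "(?g ^^ Suc k) (combo v) = (?g ^^ k) (combo (?C *\<^sub>v v))" by (simp only: funpow_Suc_right o_apply)
  also have "\<dots> = combo (?C ^\<^sub>m k *\<^sub>v (?C *\<^sub>v v))"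
    using Suc.prems mult_mat_vec_carrier[OF C] by (intro Suc.IH) auto
  also have "?C ^\<^sub>m k *\<^sub>v (?C *\<^sub>v v) = ?C ^\<^sub>m Suc k *\<^sub>v v"
    using assoc_mult_mat_vec[OF pow_carrier_mat[OF C] C Suc.prems] by simp
  finally show ?case .
qed (simp add: carrier_matD[OF char_matrix_closed[OF A_carrier]])

text \<open>Statements about iterates of f - c become statements about matrix kernels, whose
  dimensions can be read off the block sizes.\<close>

lemma mat_kernel_shift_pow:
  "mat_kernel (char_matrix A c ^\<^sub>m k) =
    {v \<in> carrier_vec n. ((\<lambda>x. f x - c *\<^sub>C x) ^^ k) (combo v) = 0}"
proof -
  have C: "char_matrix A c ^\<^sub>m k \<in> carrier_mat n n" using A_carrier by auto
  show ?thesis unfolding mat_kernel[OF C]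
    using C by (auto simp: shift_pow_combo combo_zero_iff)
qed

text \<open>The kernel of (A - c)^k has dimension the sum of min(k, n) over the blocks of size n for
  c. Stationarity from m to m + 1 for every c bounds all sizes by m. If no block had size m, the
  kernels for d would already agree for m - 1 and m, against the vector \<open>w\<close>.\<close>

lemma max_jordan_block:
  assumes jnf: "jordan_nf A n_as"
    and bound: "\<And>c z. z \<in> V \<Longrightarrow> ((\<lambda>x. f x - c *\<^sub>C x) ^^ Suc m) z = 0 \<Longrightarrow> ((\<lambda>x. f x - c *\<^sub>C x) ^^ m) z = 0"
    and sharp: "w \<in> V" "((\<lambda>x. f x - d *\<^sub>C x) ^^ m) w = 0" "((\<lambda>x. f x - d *\<^sub>C x) ^^ (m - 1)) w \<noteq> 0"
  shows "Max (fst ` set n_as) = m"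
proof (rule Max_eqI)
  let ?C = "char_matrix A"
  have carr: "?C c ^\<^sub>m k \<in> carrier_mat n n" for c k using A_carrier by auto
  have dim: "kernel_dim (?C c ^\<^sub>m k) = (\<Sum>n\<leftarrow>map fst [(n, e)\<leftarrow>n_as. e = c]. min k n)" for c k
    using dim_gen_eigenspace[OF jnf, of c k] unfolding dim_gen_eigenspace_def .
  \<comment> \<open>Equal sums of pointwise comparable terms: this passes from equal kernel
    dimensions to the single blocks.\<close>
  have sum_eq: "\<forall>x\<in>set xs. g x = h x" if "sum_list (map g xs) = sum_list (map h xs)" "\<And>x. g x \<le> h x"
    for g h :: "nat \<Rightarrow> nat" and xs
    using that(1)
  proof (induction xs)
    case (Cons x xs)
    have "sum_list (map g xs) \<le> sum_list (map h xs)" by (rule sum_list_mono) (rule that(2))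
    with Cons that(2)[of x] show ?case by simp
  qed simp
  show "finite (fst ` set n_as)" by simp
  show "y \<le> m" if "y \<in> fst ` set n_as" for y
  proof -
    obtain c where c: "(y, c) \<in> set n_as" using \<open>y \<in> fst ` set n_as\<close> by (metis imageE prod.collapse)
    have "((\<lambda>x. f x - c *\<^sub>C x) ^^ Suc m) z = 0" if "((\<lambda>x. f x - c *\<^sub>C x) ^^ m) z = 0" for z
      using that clinear_zero[OF linear_f] by simp
    then have "mat_kernel (?C c ^\<^sub>m m) = mat_kernel (?C c ^\<^sub>m Suc m)"
      unfolding mat_kernel_shift_pow using bound combo_image by blast
    then have "kernel_dim (?C c ^\<^sub>m m) = kernel_dim (?C c ^\<^sub>m Suc m)"
      unfolding kernel_dim_def by (simp only: carrier_matD[OF carr])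
    then have "\<forall>n\<in>set (map fst [(n, e)\<leftarrow>n_as. e = c]). min m n = min (Suc m) n"
      unfolding dim by (rule sum_eq) simp
    moreover have "y \<in> set (map fst [(n, e)\<leftarrow>n_as. e = c])" using c by force
    ultimately have "min m y = min (Suc m) y" by blast
    then show ?thesis by simp
  qed
  show "m \<in> fst ` set n_as"
  proof (rule ccontr)
    assume no: "m \<notin> fst ` set n_as"
    have le: "y < m" if "y \<in> fst ` set n_as" for y
      using \<open>\<And>y. y \<in> fst ` set n_as \<Longrightarrow> y \<le> m\<close>[OF that] no that by (cases "y = m") auto
    \<comment> \<open>For m = 0 the subtraction m - 1 gives 0, and the two conditions on
      \<open>w\<close> contradict each other.\<close>
    have "m \<noteq> 0" using sharp by (cases m) auto
    then obtain k where m: "m = Suc k" by (cases m) auto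
    have "kernel_dim (?C d ^\<^sub>m k) = kernel_dim (?C d ^\<^sub>m m)"
      unfolding dim by (intro arg_cong[of _ _ sum_list] map_cong refl) (use le m in force)
    moreover have "mat_kernel (?C d ^\<^sub>m k) \<subseteq> mat_kernel (?C d ^\<^sub>m m)"
      unfolding mat_kernel_shift_pow m using clinear_zero[OF linear_f] by auto
    ultimately have "mat_kernel (?C d ^\<^sub>m k) = mat_kernel (?C d ^\<^sub>m m)"
      using mat_kernel_eqI[OF carr carr] by blast
    moreover obtain v where "v \<in> carrier_vec n" "w = combo v" using sharp(1) combo_image by blast
    ultimately show False using sharp(2,3) unfolding mat_kernel_shift_pow m by auto
  qed
qed

end

text \<open>A finite spanning set is thinned out to a basis, and over the complex numbers the
  characteristic polynomial of the coordinate matrix splits.\<close>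

lemma jordan_form_exists:
  fixes f :: "'a::complex_vec \<Rightarrow> 'a"
  assumes "finite B" "V = cvec.span B" "f ` V \<subseteq> V"
  shows "\<exists>n_as. has_jordan_form_on V f n_as"
proof -
  obtain C where C: "C \<subseteq> B" "cvec.independent C" "B \<subseteq> cvec.span C"
    using cvec.maximal_independent_subset by blast
  have V: "cvec.span C = V"
    using cvec.span_mono[OF C(1)] cvec.span_minimal[OF C(3)] assms(2) by auto
  obtain bs where bs: "set bs = C" "distinct bs"
    using finite_distinct_list[OF finite_subset[OF C(1) assms(1)]] by blast
  then have basis: "is_ordered_basis bs V" using C(2) V by (simp add: is_ordered_basis_def)
  let ?n = "length bs"
  have "\<exists>v. v \<in> carrier_vec ?n \<and> f (bs ! j) = (\<Sum>i<?n. v $ i *\<^sub>C bs ! i)" if "j < ?n" for j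
  proof -
    have "f (bs ! j) \<in> V" using that bs V assms(3) cvec.span_base[of "bs ! j" C] by auto
    then show ?thesis using is_ordered_basis_expansion[OF basis] by metis
  qed
  then obtain v where v: "f (bs ! j) = (\<Sum>i<?n. v j $ i *\<^sub>C bs ! i)" if "j < ?n" for j by metis
  define A where "A = mat ?n ?n (\<lambda>(i, j). v j $ i)"
  have A: "A \<in> carrier_mat ?n ?n" by (simp add: A_def)
  obtain as where "char_poly A = (\<Prod>a\<leftarrow>as. [:- a, 1:])" using char_poly_factorized[OF A] by blast
  then obtain n_as where "jordan_nf A n_as" using jordan_nf_exists[OF A] by blast
  moreover have "has_matrix f bs A" unfolding has_matrix_def using A v by (simp add: A_def)
  ultimately show ?thesis using basis unfolding has_jordan_form_on_def by blast
qed

section \<open>The action on the centre\<close>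

lemma lincomb3_in_span: "x *\<^sub>C a + y *\<^sub>C b + z *\<^sub>C c \<in> cvec.span {a, b, c}"
  by (intro cvec.span_add cvec.span_scale cvec.span_base) auto

lemma span3E:
  assumes "p \<in> cvec.span {a, b, c}"
  obtains x y z where "p = x *\<^sub>C a + y *\<^sub>C b + z *\<^sub>C c"
  using assms by (auto simp: cvec.span_insert cvec.span_empty algebra_simps)

lemma T_Z_lincomb:
  "T_Z \<beta> (x *\<^sub>C Ktop + y *\<^sub>C qe 1 + z *\<^sub>C Gam) =
    x *\<^sub>C Ktop + (z * (inverse \<beta> * \<i>)) *\<^sub>C qe 1 + (- (y * (inverse \<beta> * \<i>))) *\<^sub>C Gam"
  unfolding clinear_add[OF clinear_T_Z] clinear_scaleC[OF clinear_T_Z] T_Z_Ktop T_Z_qe1 T_Z_Gam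
  by (simp add: scaleC_scaleC add.assoc add.commute)

lemma S_Z_lincomb:
  assumes "\<beta> ^ 4 = (-1) ^ CARD('i::{finite,linorder})"
  shows "S_Z \<nu> \<beta> (x *\<^sub>C Ktop + y *\<^sub>C qe 1 + z *\<^sub>C (Gam :: 'i Q)) =
    (y * (\<nu> * \<beta> ^ 2 * 2 ^ CARD('i))) *\<^sub>C Ktop + (x * (lam CARD('i) \<nu> \<beta> / 2)) *\<^sub>C qe 1 + (z * \<nu>) *\<^sub>C Gam"
  unfolding clinear_add[OF clinear_S_Z] clinear_scaleC[OF clinear_S_Z] S_Z_values S_Z_Gam[OF assms]
  by (simp only: scaleC_scaleC add.assoc add.left_commute)

lemma lincomb3_eqI:
  "x = x' \<Longrightarrow> y = y' \<Longrightarrow> z = z' \<Longrightarrow> x *\<^sub>C a + y *\<^sub>C b + z *\<^sub>C c = x' *\<^sub>C a + y' *\<^sub>C b + z' *\<^sub>C c"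
  by simp

text \<open>The last equation says that the two scalars by which \<open>S_Z\<close> exchanges
  \<open>Ktop\<close> and \<open>qe 1\<close> are inverse to each other.\<close>

lemma parameters:
  fixes \<beta> \<nu> :: complex
  assumes "\<beta> ^ 4 = (-1) ^ N" "\<nu> \<in> {1, -1}"
  shows "\<beta> \<noteq> 0" "\<nu> \<noteq> 0" "\<nu> * \<nu> = 1" "\<beta> ^ 8 = 1"
    "\<nu> * \<beta> ^ 2 * 2 ^ N * (lam N \<nu> \<beta> / 2) = 1"
proof -
  show "\<beta> \<noteq> 0" using assms(1) by (metis neg_one_eq_numeral_iff power_eq_0_iff power_0_left zero_neq_neg_one zero_neq_numeral)
  show "\<nu> \<noteq> 0" and n: "\<nu> * \<nu> = 1" using assms(2) by auto
  have "\<beta> ^ 8 = \<beta> ^ 4 * \<beta> ^ 4" by (simp flip: power_add)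
  then show "\<beta> ^ 8 = 1" by (simp add: assms(1) flip: power_mult_distrib)
  have "\<nu> * \<beta> ^ 2 * 2 ^ N * (lam N \<nu> \<beta> / 2) = (\<nu> * \<nu>) * (\<beta> ^ 4 * (2 * (- (1/2))) ^ N)"
    unfolding half_lam power_mult_distrib by (simp add: power4_eq_xxxx power2_eq_square)
  also have "(2 * (- (1/2))) ^ N = ((-1) ^ N :: complex)" by simp
  finally show "\<nu> * \<beta> ^ 2 * 2 ^ N * (lam N \<nu> \<beta> / 2) = 1"
    by (simp add: assms(1) n flip: power_mult_distrib)
qed

lemma has_matrix_Z_P:
  fixes \<beta> \<nu> :: complex
  assumes b: "\<beta> ^ 4 = (-1) ^ CARD('i::{finite,linorder})" and n: "\<nu> \<in> {1, -1}"
  shows "has_matrix (S_Z \<nu> \<beta>) (Z_P_basis \<nu> \<beta> :: 'i Q list) (mat_S_P CARD('i) \<nu>)"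
    and "has_matrix (T_Z \<beta>) (Z_P_basis \<nu> \<beta> :: 'i Q list) (mat_T_P \<beta>)"
proof -
  note p = parameters[OF b n]
  let ?N = "CARD('i)"
  have less3: "j < 3 \<longleftrightarrow> j = 0 \<or> j = 1 \<or> j = 2" for j :: nat by auto
  have set3: "{..<3} = {0, 1, 2 :: nat}" by auto
  have len: "length (Z_P_basis \<nu> \<beta> :: 'i Q list) = 3" by (simp add: Z_P_basis_def)
  have combo: "(\<Sum>i<3. A $$ (i, j) *\<^sub>C (Z_P_basis \<nu> \<beta> ! i)) =
      A $$ (0, j) *\<^sub>C phi_P0 \<nu> \<beta> + A $$ (1, j) *\<^sub>C phi_X1 Pl \<nu> + A $$ (2, j) *\<^sub>C (phi_X1 Mi \<nu> :: 'i Q)"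
    for A j by (simp add: set3 Z_P_basis_def add.assoc)
  have basis: "Z_P_basis \<nu> \<beta> ! j = of_bool (j = 0) *\<^sub>C phi_P0 \<nu> \<beta> + of_bool (j = 1) *\<^sub>C phi_X1 Pl \<nu> +
      of_bool (j = 2) *\<^sub>C (phi_X1 Mi \<nu> :: 'i Q)" if "j < 3" for j
    using that unfolding less3 by (auto simp: Z_P_basis_def scaleC_one)
  have N: "?N = Suc (?N - 1)" by simp
  \<comment> \<open>As N is positive, 2^N is twice this number; the truncated exponent N - 1 of
    \<open>mat_S_P\<close> is thereby removed from the calculation.\<close>
  define E :: complex where "E = 2 ^ (?N - 1)"
  have pw: "2 ^ ?N = 2 * E" unfolding E_def by (subst N) (simp only: power_Suc)
  have E: "E \<noteq> 0" "2 ^ (?N - Suc 0) = E" by (simp_all add: E_def)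
  have bb: "\<beta> ^ 2 * \<beta> ^ 2 = (-1) ^ ?N" using b by (simp add: power4_eq_xxxx power2_eq_square mult.assoc)
  have "3 * ?N = ?N + (?N + ?N)" by simp
  then have q3: "2 ^ (3 * ?N) = 2 ^ ?N * (2 ^ ?N * (2 ^ ?N :: complex))" by (simp only: power_add)
  have nn: "\<nu> * (\<nu> * x) = x" for x using p(3) by (simp flip: mult.assoc)
  have l: "lam ?N \<nu> \<beta> / 2 = \<nu> * \<beta> ^ 2 * (\<beta> ^ 4 / 2 ^ ?N)"
    unfolding half_lam b by (simp add: power_minus[of "1/2"] power_one_over)
  show "has_matrix (S_Z \<nu> \<beta>) (Z_P_basis \<nu> \<beta> :: 'i Q list) (mat_S_P ?N \<nu>)"
    unfolding has_matrix_def len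
  proof (intro conjI allI impI)
    show "mat_S_P ?N \<nu> \<in> carrier_mat 3 3" by (intro carrier_matI) (simp_all add: mat_S_P_def mat_of_rows_list_def)
    fix j :: nat assume j: "j < 3"
    show "S_Z \<nu> \<beta> (Z_P_basis \<nu> \<beta> ! j) = (\<Sum>i<3. mat_S_P ?N \<nu> $$ (i, j) *\<^sub>C (Z_P_basis \<nu> \<beta> ! i :: 'i Q))"
      unfolding combo basis[OF j] unfolding Z_P_basis_lincomb unfolding S_Z_lincomb[OF b]
      unfolding l q3 pw
      by (rule lincomb3_eqI; use j[unfolded less3] in \<open>elim disjE; simp add: mat_S_P_def mat_of_rows_list_def pw E nn p(3,4)\<close>)
  qed
  have ii: "\<i> * \<nu> * x * (inverse \<beta> * \<i>) = - (\<nu> * x * inverse \<beta>)" for x by (simp add: algebra_simps)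
  show "has_matrix (T_Z \<beta>) (Z_P_basis \<nu> \<beta> :: 'i Q list) (mat_T_P \<beta>)"
    unfolding has_matrix_def len
  proof (intro conjI allI impI)
    show "mat_T_P \<beta> \<in> carrier_mat 3 3" by (intro carrier_matI) (simp_all add: mat_T_P_def mat_of_rows_list_def)
    fix j :: nat assume j: "j < 3"
    show "T_Z \<beta> (Z_P_basis \<nu> \<beta> ! j) = (\<Sum>i<3. mat_T_P \<beta> $$ (i, j) *\<^sub>C (Z_P_basis \<nu> \<beta> ! i :: 'i Q))"
      unfolding combo basis[OF j] unfolding Z_P_basis_lincomb unfolding T_Z_lincomb
      by (rule lincomb3_eqI; use j[unfolded less3] in \<open>elim disjE; simp add: mat_T_P_def mat_of_rows_list_def ii\<close>)
  qed
qed

section \<open>Invariance of the centre and the modular relations\<close>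

lemma centerE:
  assumes "z \<in> (center :: 'i::{finite,linorder} Q set)"
  obtains x y u b where "b \<in> Z_Lambda" "z = x *\<^sub>C Ktop + y *\<^sub>C qe 1 + u *\<^sub>C Gam + (b :: 'i Q)"
proof -
  obtain a b where "a \<in> cvec.span {Ktop, qe 1, Gam}" "b \<in> Z_Lambda" "z = a + b"
    using assms center_direct_sum[where 'i = 'i] unfolding is_direct_sum_def by blast
  then show thesis using that by (elim span3E) metis
qed

lemma center_lincombI:
  assumes "b \<in> (Z_Lambda :: 'i::{finite,linorder} Q set)"
  shows "x *\<^sub>C Ktop + y *\<^sub>C qe 1 + u *\<^sub>C Gam + b \<in> center"
  using center_direct_sum[where 'i = 'i] lincomb3_in_span[of x Ktop y "qe 1" u "Gam :: 'i Q"] assms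
  unfolding is_direct_sum_def by blast

lemma S_Z_center:
  assumes "\<beta> ^ 4 = (-1) ^ CARD('i::{finite,linorder})" "z \<in> (center :: 'i Q set)"
  shows "S_Z \<nu> \<beta> z \<in> center"
proof -
  obtain x y u b where b: "b \<in> Z_Lambda" "z = x *\<^sub>C Ktop + y *\<^sub>C qe 1 + u *\<^sub>C Gam + b" using assms(2) by (rule centerE)
  show ?thesis
    unfolding b(2) clinear_add[OF clinear_S_Z, of _ _ _ b] S_Z_lincomb[OF assms(1)]
    by (intro center_lincombI S_Z_Z_Lambda b(1))
qed

lemma T_Z_center:
  assumes "z \<in> (center :: 'i::{finite,linorder} Q set)"
  shows "T_Z \<beta> z \<in> center"
proof -
  obtain x y u b where b: "b \<in> Z_Lambda" "z = x *\<^sub>C Ktop + y *\<^sub>C qe 1 + u *\<^sub>C Gam + b" using assms by (rule centerE)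
  show ?thesis
    unfolding b(2) clinear_add[OF clinear_T_Z, of _ _ b] T_Z_lincomb by (intro center_lincombI T_Z_Z_Lambda b(1))
qed

lemma S_Z_S_Z_center:
  assumes b: "\<beta> ^ 4 = (-1) ^ CARD('i::{finite,linorder})" and n: "\<nu> \<in> {1, -1}" and z: "z \<in> (center :: 'i Q set)"
  shows "S_Z \<nu> \<beta> (S_Z \<nu> \<beta> z) = z"
proof -
  note p = parameters[OF b n]
  obtain x y u c where c: "c \<in> Z_Lambda" "z = x *\<^sub>C Ktop + y *\<^sub>C qe 1 + u *\<^sub>C Gam + c" using z by (rule centerE)
  let ?p = "x *\<^sub>C Ktop + y *\<^sub>C qe 1 + u *\<^sub>C Gam :: 'i Q"
  have "S_Z \<nu> \<beta> (S_Z \<nu> \<beta> ?p) = ?p"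
    unfolding S_Z_lincomb[OF b]
  proof (rule lincomb3_eqI)
    show "x * (lam CARD('i) \<nu> \<beta> / 2) * (\<nu> * \<beta> ^ 2 * 2 ^ CARD('i)) = x"
      "y * (\<nu> * \<beta> ^ 2 * 2 ^ CARD('i)) * (lam CARD('i) \<nu> \<beta> / 2) = y"
      using p(5) by (metis mult.assoc mult.commute mult_1_right)+
    show "u * \<nu> * \<nu> = u" by (simp add: mult.assoc p(3))
  qed
  then show ?thesis
    using S_Z_S_Z_Z_Lambda[OF b n c(1)] by (simp only: c(2) clinear_add[OF clinear_S_Z, of _ _ ?p] clinear_add[OF clinear_S_Z, of _ _ "S_Z \<nu> \<beta> ?p"])
qed

text \<open>On Z_P the composition moves the line of \<open>Ktop\<close> to that of
  \<open>qe 1\<close>, this to that of \<open>Gam\<close>, and the latter back. Its cube is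
  therefore the product of the three scalars, which has to agree with the scalar found on
  \<open>Z_Lambda\<close>.\<close>

lemma ST_cube_center:
  assumes b: "\<beta> ^ 4 = (-1) ^ CARD('i::{finite,linorder})" and n: "\<nu> \<in> {1, -1}" and z: "z \<in> (center :: 'i Q set)"
  shows "((S_Z \<nu> \<beta> \<circ> T_Z \<beta>) ^^ 3) z = ((\<nu> * \<beta> ^ 2) ^ 3) *\<^sub>C z"
proof -
  note p = parameters[OF b n]
  obtain x y u c where c: "c \<in> Z_Lambda" "z = x *\<^sub>C Ktop + y *\<^sub>C qe 1 + u *\<^sub>C Gam + c" using z by (rule centerE)
  let ?p = "x *\<^sub>C Ktop + y *\<^sub>C qe 1 + u *\<^sub>C Gam :: 'i Q" and ?g = "S_Z \<nu> \<beta> \<circ> T_Z \<beta> :: 'i Q \<Rightarrow> _"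
  let ?k = "\<nu> * \<beta> ^ 2 * 2 ^ CARD('i)" and ?l = "lam CARD('i) \<nu> \<beta> / 2" and ?t = "inverse \<beta> * \<i>"
  have g: "?g (x *\<^sub>C Ktop + y *\<^sub>C qe 1 + u *\<^sub>C Gam) =
      (u * ?t * ?k) *\<^sub>C Ktop + (x * ?l) *\<^sub>C qe 1 + (- (y * ?t) * \<nu>) *\<^sub>C Gam" for x y u
    by (simp only: o_apply T_Z_lincomb S_Z_lincomb[OF b])
  \<comment> \<open>Both sides equal \<nu> \<beta>^(-2): the left by \<open>parameters\<close>, the
    right because \<beta>^8 = 1.\<close>
  have s: "?t * ?t * ?k * ?l * (- \<nu>) = (\<nu> * \<beta> ^ 2) ^ 3"
  proof -
    have "(\<nu> * \<beta> ^ 2) ^ 3 = (\<nu> * \<nu>) * \<nu> * (\<beta> ^ 8 * (inverse \<beta> * inverse \<beta>))"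
      using p(1) by (simp add: power3_eq_cube eval_nat_numeral field_simps)
    also have "\<dots> = \<nu> * (inverse \<beta> * inverse \<beta>)" by (simp add: p(3,4))
    also have "\<dots> = (?k * ?l) * \<nu> * (inverse \<beta> * inverse \<beta>)" by (simp only: p(5) mult_1)
    finally show ?thesis by (simp add: algebra_simps)
  qed
  have lin: "clinear ?g"
    using clinear_compose[OF clinear_T_Z clinear_S_Z] by (simp add: comp_def)
  have "?g (?g (?g ?p)) = ((\<nu> * \<beta> ^ 2) ^ 3) *\<^sub>C ?p"
    unfolding g scaleC_add_right scaleC_scaleC s[symmetric]
    by (rule lincomb3_eqI) (simp_all only: ac_simps mult_minus_left mult_minus_right)
  moreover have "?g (?g (?g c)) = ((\<nu> * \<beta> ^ 2) ^ 3) *\<^sub>C c"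
    using ST_cube_Z_Lambda[OF c(1), of \<nu> \<beta>] by (simp add: numeral_3_eq_3)
  moreover have "(?g ^^ 3) w = ?g (?g (?g w))" for w by (simp add: numeral_3_eq_3)
  moreover have "?g (?g (?g (v + w))) = ?g (?g (?g v)) + ?g (?g (?g w))" for v w
    by (simp only: clinear_add[OF lin])
  ultimately show ?thesis unfolding c(2) scaleC_add_right[of _ _ c] by simp
qed

lemma projective_action:
  assumes b: "\<beta> ^ 4 = (-1) ^ CARD('i::{finite,linorder})" and n: "\<nu> \<in> {1, -1}"
  shows "projective_SL2Z_action (center :: 'i Q set) (S_Z \<nu> \<beta>) (T_Z \<beta>)"
proof -
  note p = parameters[OF b n]
  let ?S = "S_Z \<nu> \<beta> :: 'i Q \<Rightarrow> _" and ?T = "T_Z \<beta> :: 'i Q \<Rightarrow> _" and ?c = "(\<nu> * \<beta> ^ 2) ^ 3"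
  note SS = S_Z_S_Z_center[OF b n] and S = S_Z_center[OF b] and T = T_Z_center
  have cube: "?S (?T (?S (?T (?S (?T z))))) = ?c *\<^sub>C z" if "z \<in> center" for z
    using ST_cube_center[OF b n that] by (simp add: numeral_3_eq_3)
  have c: "?c \<noteq> 0" using p by simp
  have scale: "x *\<^sub>C z \<in> center" if "z \<in> center" for x and z :: "'i Q"
    using cvec.subspace_scale[OF subspace_center that] .
  have "linear_endo_on center ?S" "linear_endo_on center ?T"
    using S T by (auto simp: linear_endo_on_def clinear_add[OF clinear_S_Z] clinear_scaleC[OF clinear_S_Z]
        clinear_add[OF clinear_T_Z] clinear_scaleC[OF clinear_T_Z])
  moreover have "bij_betw ?S center center"
    by (rule bij_betw_byWitness[of _ ?S]) (use S SS in auto)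
  moreover have "bij_betw ?T center center"
  \<comment> \<open>The relation STSTST = c, with c a nonzero scalar, makes STSTS / c a left inverse
    of T.\<close>
  proof (rule bij_betw_byWitness[of _ "\<lambda>z. (1 / ?c) *\<^sub>C ?S (?T (?S (?T (?S z))))"])
    show "\<forall>z\<in>center. (1 / ?c) *\<^sub>C ?S (?T (?S (?T (?S (?T z))))) = z"
      using c by (simp add: cube scaleC_scaleC scaleC_one)
    show "\<forall>z\<in>center. ?T ((1 / ?c) *\<^sub>C ?S (?T (?S (?T (?S z))))) = z"
    proof
      fix z :: "'i Q" assume z: "z \<in> center"
      \<comment> \<open>Inserting S^2 = 1 in front exhibits TSTSTS as the conjugate of STSTST by S,
        so the same map is also a right inverse.\<close>
      have "?T (?S (?T (?S (?T (?S z))))) = ?S (?S (?T (?S (?T (?S (?T (?S z)))))))"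
        using z by (simp add: SS S T)
      also have "\<dots> = ?S (?c *\<^sub>C ?S z)" using z by (simp only: cube S)
      also have "\<dots> = ?c *\<^sub>C z" using z by (simp add: clinear_scaleC[OF clinear_S_Z] SS)
      finally show "?T ((1 / ?c) *\<^sub>C ?S (?T (?S (?T (?S z))))) = z"
        using c by (simp add: clinear_scaleC[OF clinear_T_Z] scaleC_scaleC scaleC_one)
    qed
    show "(\<lambda>z. (1 / ?c) *\<^sub>C ?S (?T (?S (?T (?S z))))) ` center \<subseteq> center"
      by (intro image_subsetI scale S T)
  qed (use T in auto)
  moreover have "\<forall>z\<in>center. (?S ^^ 4) z = 1 *\<^sub>C z"
    using SS S by (simp add: eval_nat_numeral scaleC_one)
  moreover have "\<forall>z\<in>center. ((?S \<circ> ?T) ^^ 3) z = ?c *\<^sub>C ?S (?S z)"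
    using ST_cube_center[OF b n] SS by simp
  ultimately show ?thesis
    unfolding projective_SL2Z_action_def using c by (metis zero_neq_one)
qed

section \<open>Powers of a product of commuting unipotent elements\<close>

lemma commuting_binomial_square_zero:
  fixes x w :: "'a::complex_alg"
  assumes "x * w = w * x" "w * w = 0"
  shows "(x + w) ^ Suc m = x ^ Suc m + of_nat (Suc m) *\<^sub>C (x ^ m * w)"
proof (induction m)
  case (Suc m)
  have xm: "x ^ k * w = w * x ^ k" for k
    by (induction k) (simp_all add: mult.assoc assms(1) flip: mult.assoc[of x w])
  have "(x + w) ^ Suc (Suc m) = (x + w) * (x ^ Suc m + of_nat (Suc m) *\<^sub>C (x ^ m * w))"
    by (simp only: power_Suc[of "x + w" "Suc m"] Suc.IH)
  also have "\<dots> = x ^ Suc (Suc m) + of_nat (Suc m) *\<^sub>C (x ^ Suc m * w) + w * x ^ Suc m +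
      of_nat (Suc m) *\<^sub>C (w * (x ^ m * w))"
    by (simp add: distrib_left distrib_right mult_scaleC_right mult.assoc scaleC_add_right)
  also have "w * (x ^ m * w) = 0" unfolding xm by (simp add: assms(2) flip: mult.assoc)
  also have "w * x ^ Suc m = x ^ Suc m * w" by (simp only: xm)
  finally show ?case
    by (simp add: scaleC_add_left scaleC_one of_nat_Suc[of "Suc m"] ac_simps del: power_Suc of_nat_Suc)
qed (simp add: scaleC_one)

text \<open>A further factor changes X into X + w with w = y(1 + X). This w commutes with X and
  squares to zero, so the binomial expansion stops after the linear term. As X^(n+1) = 0, the 1 + X
  in w acts as 1 on X^n, which leaves (n + 1) X^n y.\<close>

lemma prod_one_plus_square_zero:
  fixes y :: "'i \<Rightarrow> 'a::complex_alg"
  assumes comm: "\<And>i j. y i * y j = y j * y i" and sq: "\<And>j. y j * y j = 0"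
  defines "x \<equiv> \<lambda>js. prod_list (map (\<lambda>j. 1 + y j) js) - 1"
  shows "x js ^ Suc (length js) = 0" "x js ^ length js = fact (length js) *\<^sub>C prod_list (map y js)"
proof -
  have "x js ^ Suc (length js) = 0 \<and> x js ^ length js = fact (length js) *\<^sub>C prod_list (map y js)"
  proof (induction js)
    case (Cons j js)
    let ?X = "x js" and ?n = "length js" and ?w = "y j * (1 + x js)"
    have X: "1 + ?X = prod_list (map (\<lambda>j. 1 + y j) js)" by (simp add: x_def)
    have P: "y j * (1 + ?X) = (1 + ?X) * y j"
      unfolding X by (rule prod_list_commute) (simp add: distrib_left distrib_right comm)
    then have yX: "y j * ?X = ?X * y j" by (simp add: distrib_left distrib_right)
    have e: "x (j # js) = ?X + ?w" by (simp add: x_def algebra_simps)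
    have w: "?w * ?w = 0"
    proof -
      have "?w * ?w = y j * ((1 + ?X) * y j) * (1 + ?X)" by (simp only: mult.assoc)
      also have "\<dots> = (y j * y j) * ((1 + ?X) * (1 + ?X))" unfolding P[symmetric] by (simp only: mult.assoc)
      finally show ?thesis by (simp add: sq)
    qed
    have c: "?X * ?w = ?w * ?X"
      by (simp add: distrib_left distrib_right yX mult.assoc flip: mult.assoc[of ?X "y j"])
    have "x (j # js) ^ Suc (Suc ?n) = 0"
      unfolding e commuting_binomial_square_zero[OF c w] unfolding power_Suc[of _ "Suc ?n"] conjunct1[OF Cons.IH]
      by simp
    moreover have "x (j # js) ^ Suc ?n = fact (Suc ?n) *\<^sub>C prod_list (map y (j # js))"
    proof -
      have "?X ^ ?n * ?w = ?X ^ ?n * ((1 + ?X) * y j)" by (simp only: P)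
      also have "\<dots> = (?X ^ ?n + ?X ^ Suc ?n) * y j"
        by (simp add: distrib_left distrib_right power_Suc2 mult.assoc del: power_Suc)
      also have "\<dots> = fact ?n *\<^sub>C (prod_list (map y js) * y j)"
        unfolding conjunct1[OF Cons.IH] conjunct2[OF Cons.IH] by (simp add: mult_scaleC_left)
      also have "prod_list (map y js) * y j = y j * prod_list (map y js)"
        by (rule prod_list_commute[symmetric]) (rule comm)
      finally have "?X ^ ?n * ?w = fact ?n *\<^sub>C (y j * prod_list (map y js))" .
      then show ?thesis
        unfolding e commuting_binomial_square_zero[OF c w] conjunct1[OF Cons.IH] by (simp add: scaleC_scaleC)
    qed
    ultimately show ?case by simp
  qed (simp add: x_def scaleC_one)
  then show "x js ^ Suc (length js) = 0" "x js ^ length js = fact (length js) *\<^sub>C prod_list (map y js)" by auto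
qed

section \<open>The Jordan form of the T-transformation\<close>

definition pair_nil :: "'i \<Rightarrow> 'i Q" where
  "pair_nil j = 2 *\<^sub>C (qf Pl j * qf Mi j) * qe 0"

lemma pair_nil_eq: "pair_nil j = (1 - hfac j) * qe 0"
  by (simp add: pair_nil_def hfac_def)

lemma pair_nil_commute: "pair_nil i * pair_nil j = pair_nil j * (pair_nil i :: 'i::{finite,linorder} Q)"
proof -
  have "(1 - hfac i) * (1 - hfac j) = (1 - hfac j) * (1 - hfac i :: 'i Q)"
    by (simp add: left_diff_distrib right_diff_distrib hfac_commute)
  moreover have "pair_nil i * pair_nil j = (1 - hfac i) * (1 - hfac j) * (qe 0 * qe 0 :: 'i Q)" for i j
    unfolding pair_nil_eq by (simp only: mult.assoc qe_central[of 0 "(1 - hfac j) * qe 0"])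
  ultimately show ?thesis by simp
qed

lemma pair_nil_sq: "pair_nil j * pair_nil j = 0"
  by (simp add: pair_nil_def lin_simps mult.assoc qe_central[of 0 "qf _ _ * _"] qe_mult qf_Mi_Pl_left qf_sq_left)

definition T_nil :: "'i::{finite,linorder} Q" where
  "T_nil = ordered_prod (\<lambda>j. 1 + pair_nil j) - 1"

lemma T_nil_power:
  "T_nil ^ Suc CARD('i) = (0 :: 'i::{finite,linorder} Q)"
  "T_nil ^ CARD('i) = fact CARD('i) *\<^sub>C (ordered_prod pair_nil :: 'i Q)"
  using prod_one_plus_square_zero[of pair_nil "sorted_list_of_set (UNIV :: 'i set)", OF pair_nil_commute pair_nil_sq]
  unfolding T_nil_def ordered_prod_def by (simp_all del: power_Suc)

text \<open>In the block of \<open>qe 0\<close> the \<open>qK ^ 2\<close> of the ribbon factors acts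
  as 1, so T - 1 becomes multiplication by the nilpotent element \<open>T_nil\<close>.\<close>

lemma T_Z_shift: "T_Z \<beta> (qe 0 * z) - 1 *\<^sub>C (qe 0 * z) = qe 0 * (T_nil * z)"
proof -
  have "(1 + pair_nil k) * qe 0 = (1 + 2 *\<^sub>C (qf Pl k * qf Mi k)) * qe 0" for k :: 'a
    by (simp add: pair_nil_def distrib_right mult.assoc qe_mult)
  then have "ordered_prod (\<lambda>k :: 'a. 1 + pair_nil k) * qe 0 = ribbon_inverse \<beta> * qe 0"
    unfolding ribbon_inverse_qe0 by (rule ordered_prod_cong_idem[OF qe_central])
  moreover have "qe 0 * (x * z) = x * qe 0 * z" for x
    by (simp only: qe_central[of 0 "x * z"] qe_central[of 0 z] mult.assoc)
  ultimately have "qe 0 * (ordered_prod (\<lambda>k :: 'a. 1 + pair_nil k) * z) = ribbon_inverse \<beta> * qe 0 * z"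
    by simp
  then have "qe 0 * (ordered_prod (\<lambda>k :: 'a. 1 + pair_nil k) * z) = ribbon_inverse \<beta> * (qe 0 * z)"
    by (simp only: mult.assoc)
  then show ?thesis by (simp add: T_nil_def T_Z_def scaleC_one left_diff_distrib right_diff_distrib)
qed

lemma T_Z_shift_pow: "((\<lambda>x. T_Z \<beta> x - 1 *\<^sub>C x) ^^ k) (qe 0 * z) = qe 0 * (T_nil ^ k * z)"
  by (induction k) (simp_all add: T_Z_shift[simplified] mult.assoc)

lemma T_Z_nilpotent_Z_Lambda:
  assumes "z \<in> (Z_Lambda :: 'i::{finite,linorder} Q set)"
  shows "((\<lambda>x. T_Z \<beta> x - 1 *\<^sub>C x) ^^ Suc CARD('i)) z = 0"
proof -
  have "z = qe 0 * z" unfolding qe_central using Z_Lambda_qe0[OF assms] by simp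
  then show ?thesis using T_Z_shift_pow[of "Suc CARD('i)" \<beta> z] unfolding T_nil_power by simp
qed

lemma T_Z_shift_pow_qe0: "((\<lambda>x. T_Z \<beta> x - 1 *\<^sub>C x) ^^ CARD('i)) (qe 0) \<noteq> (0 :: 'i::{finite,linorder} Q)"
proof -
  have "ordered_prod pair_nil * qe 0 = ordered_prod (\<lambda>j. 2 *\<^sub>C loc j (True, True)) * (qe 0 :: 'i Q)"
    by (rule ordered_prod_cong_idem[OF qe_central]) (simp add: pair_nil_def mult.assoc qe_mult loc_simps mult_scaleC_left)
  also have "\<dots> = 2 ^ CARD('i) *\<^sub>C L0 (\<lambda>_. (True, True))"
    by (simp add: ordered_prod_scaleC L0_def mult_scaleC_left)
  finally have "((\<lambda>x. T_Z \<beta> x - 1 *\<^sub>C x) ^^ CARD('i)) (qe 0 * qe 0) =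
      (fact CARD('i) * 2 ^ CARD('i)) *\<^sub>C (L0 (\<lambda>_. (True, True)) :: 'i Q)"
    unfolding T_Z_shift_pow T_nil_power qe_central[of 0 "_ * _"]
    by (simp add: mult_scaleC_left L0_def mult.assoc qe_mult scaleC_scaleC)
  moreover have "L0 (\<lambda>_. (True, True)) \<noteq> (0 :: 'i Q)"
    using coord_L0(1)[of "\<lambda>_ :: 'i. (True, True)" "\<lambda>_. (True, True)"] by (auto simp: coord_zero)
  ultimately show ?thesis by (simp add: qe_mult)
qed

text \<open>On the plane of \<open>qe 1\<close> and \<open>Gam\<close> the shift has determinant c^2
  + t^2 with t nonzero. Either it is invertible, or c is one of the two distinct eigenvalues and the
  shift has no nilpotent part.\<close>

lemma T_Z_shift_twice_Z_P:
  fixes \<beta> :: complex and p :: "'i::{finite,linorder} Q"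
  defines "g \<equiv> \<lambda>c x. T_Z \<beta> x - c *\<^sub>C x"
  assumes b: "\<beta> \<noteq> 0" and p: "p = x *\<^sub>C Ktop + y *\<^sub>C qe 1 + z *\<^sub>C Gam" and z: "g c (g c p) = 0"
  shows "g c p = 0"
proof -
  define t where "t = inverse \<beta> * \<i>"
  have t: "t \<noteq> 0" using b by (simp add: t_def)
  have g: "g c (x *\<^sub>C Ktop + y *\<^sub>C qe 1 + z *\<^sub>C (Gam :: 'i Q)) =
      ((1 - c) * x) *\<^sub>C Ktop + (z * t - c * y) *\<^sub>C qe 1 + (- (y * t) - c * z) *\<^sub>C Gam" for x y z
    unfolding g_def T_Z_lincomb t_def
    by (simp add: scaleC_add_right scaleC_scaleC cvec.scale_left_diff_distrib scaleC_one algebra_simps)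
  let ?y = "z * t - c * y" and ?z = "- (y * t) - c * z"
  have "(1 - c) * ((1 - c) * x) = 0 \<and> ?z * t - c * ?y = 0 \<and> - (?y * t) - c * ?z = 0"
    using z unfolding p g by (rule Ktop_qe1_Gam_independent)
  then have xx: "(1 - c) * ((1 - c) * x) = 0" and yy: "?z * t - c * ?y = 0" "- (?y * t) - c * ?z = 0" by blast+
  from xx have x: "(1 - c) * x = 0" by simp
  have "u = - v" if "- u - v = 0" for u v :: complex using that by auto
  with yy have e: "?z * t = c * ?y" "?y * t = - (c * ?z)" by (simp_all only: right_minus_eq)
  have "?z = 0 \<and> ?y = 0"
  proof -
    have "(c * c + t * t) * w = 0" if "u * t = c * w" "w * t = - (c * u)" for u w
    proof -
      have "(c * c + t * t) * w = c * (c * w) + t * (w * t)" by (simp add: algebra_simps)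
      then show ?thesis unfolding that(1)[symmetric] that(2) by simp
    qed
    from this[OF e] have "c * c + t * t = 0 \<or> ?y = 0" by simp
    then show ?thesis
    proof
      assume ct: "c * c + t * t = 0"
      \<comment> \<open>This expresses the image coordinate through the vanishing determinant and
        the already known equation; dividing by 2t gives zero.\<close>
      have "2 * t * ?z = ?z * t - c * ?y - (c * c + t * t) * y" by (simp add: algebra_simps)
      then have "?z = 0" using e(1) t ct by simp
      then show ?thesis using e(2) t by simp
    next
      assume "?y = 0"
      then show ?thesis using e(1) t by simp
    qed
  qed
  then show ?thesis unfolding p g using x by simp
qed

text \<open>The two invariant summands are treated separately. On Z_P the kernels are stationary
  from the first power on. On \<open>Z_Lambda\<close> with c = 1 the nilpotency applies; for other c
  the vector w killed by one further step satisfies T w = c w, so nilpotency of T - 1 yields (c -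
  1)^(N+1) w = 0.\<close>

lemma T_Z_shift_stable:
  fixes \<beta> :: complex and z :: "'i::{finite,linorder} Q"
  defines "g \<equiv> \<lambda>c x :: 'i Q. T_Z \<beta> x - c *\<^sub>C x"
  assumes b: "\<beta> \<noteq> 0" and z: "z \<in> center" "(g c ^^ Suc (Suc CARD('i))) z = 0"
  shows "(g c ^^ Suc CARD('i)) z = 0"
proof -
  let ?N = "CARD('i)" and ?P = "cvec.span {Ktop, qe 1, Gam :: 'i Q}"
  obtain p l where zp: "p \<in> ?P" "l \<in> Z_Lambda" "z = p + l"
    using z(1) center_direct_sum[where 'i = 'i] unfolding is_direct_sum_def by blast
  have lin: "clinear (g c)"
    unfolding g_def by (intro clinearI) (simp_all add: clinear_add[OF clinear_T_Z] clinear_scaleC[OF clinear_T_Z]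
      scaleC_add_right cvec.scale_right_diff_distrib scaleC_scaleC mult.commute)
  have pow_add: "(g c ^^ k) (v + w) = (g c ^^ k) v + (g c ^^ k) w" for k v w
    by (induction k) (simp_all add: clinear_add[OF lin])
  have ds: "cvec.subspace ?P" "cvec.subspace (Z_Lambda :: 'i Q set)" "?P \<inter> Z_Lambda = {0}"
    using center_direct_sum[where 'i = 'i] unfolding is_direct_sum_def by blast+
  have "T_Z \<beta> v \<in> ?P" if "v \<in> ?P" for v
    using that by (elim span3E) (simp only: T_Z_lincomb lincomb3_in_span)
  then have gP: "g c v \<in> ?P" if "v \<in> ?P" for v
    using that unfolding g_def by (intro cvec.span_diff cvec.span_scale)
  have P: "(g c ^^ k) v \<in> ?P" if "v \<in> ?P" for k v
    by (induction k) (use that gP in simp_all)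
  have gL: "g c v \<in> Z_Lambda" if "v \<in> Z_Lambda" for v c
    using that T_Z_Z_Lambda unfolding g_def by (intro cvec.subspace_diff cvec.subspace_scale ds(2))
  have L: "(g c ^^ k) v \<in> Z_Lambda" if "v \<in> Z_Lambda" for k v
    by (induction k) (use that gL in simp_all)
  let ?M = "Suc (Suc ?N)"
  have sum: "(g c ^^ ?M) p + (g c ^^ ?M) l = 0" using z(2) unfolding zp(3) pow_add .
  then have "(g c ^^ ?M) p = - (g c ^^ ?M) l" by (simp only: add_eq_0_iff2)
  then have "(g c ^^ ?M) p \<in> ?P \<inter> Z_Lambda"
    using P[OF zp(1), of ?M] cvec.subspace_neg[OF ds(2) L[OF zp(2), of ?M]] by simp
  then have p0: "(g c ^^ ?M) p = 0" using ds(3) by blast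
  then have l0: "(g c ^^ ?M) l = 0" using sum by simp
  obtain x y u where q: "(g c ^^ ?N) p = x *\<^sub>C Ktop + y *\<^sub>C qe 1 + u *\<^sub>C Gam"
    using P[OF zp(1)] by (rule span3E)
  have "g c (g c ((g c ^^ ?N) p)) = 0" using p0 by simp
  then have "g c ((g c ^^ ?N) p) = 0"
    unfolding g_def by (rule T_Z_shift_twice_Z_P[OF b q[unfolded g_def]])
  then have 1: "(g c ^^ Suc ?N) p = 0" by simp
  have 2: "(g c ^^ Suc ?N) l = 0"
  proof (cases "c = 1")
    case True
    then show ?thesis using T_Z_nilpotent_Z_Lambda[OF zp(2)] by (simp add: g_def del: funpow.simps)
  next
    case False
    define w where "w = (g c ^^ Suc ?N) l"
    have w: "w \<in> Z_Lambda" unfolding w_def by (rule L[OF zp(2)])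
    have Tw: "T_Z \<beta> w = c *\<^sub>C w" using l0 by (simp add: w_def g_def)
    have "T_Z \<beta> (a *\<^sub>C w) - 1 *\<^sub>C (a *\<^sub>C w) = ((c - 1) * a) *\<^sub>C w" for a
      by (simp add: scaleC_one clinear_scaleC[OF clinear_T_Z] Tw scaleC_scaleC left_diff_distrib
          right_diff_distrib cvec.scale_left_diff_distrib mult.commute)
    then have "((\<lambda>x. T_Z \<beta> x - 1 *\<^sub>C x) ^^ k) w = (c - 1) ^ k *\<^sub>C w" for k
      by (induction k) (simp_all only: funpow.simps o_apply id_apply power_Suc power_0 scaleC_one)
    then have "(c - 1) ^ Suc ?N *\<^sub>C w = 0" using T_Z_nilpotent_Z_Lambda[OF w] by metis
    then have "w = 0" using False by simp
    then show ?thesis by (simp only: w_def)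
  qed
  show ?thesis unfolding zp(3) pow_add 1 2 by simp
qed

lemma center_eq_span: "center = cvec.span ({Ktop, qe 1, Gam} \<union> L0 ` {d. even_deg d} :: 'i::{finite,linorder} Q set)"
proof -
  have "Z_Lambda = cvec.span (L0 ` {d. even_deg d} :: 'i Q set)" unfolding Z_Lambda_eq by (simp add: image_Collect)
  moreover have "center = {a + b | a b. a \<in> cvec.span {Ktop, qe 1, Gam :: 'i Q} \<and> b \<in> Z_Lambda}"
    using center_direct_sum[where 'i = 'i] unfolding is_direct_sum_def by blast
  ultimately show ?thesis by (simp only: cvec.span_Un)
qed

lemma jordan_form_T_Z:
  assumes b: "\<beta> \<noteq> 0"
  shows "\<exists>n_as. has_jordan_form_on (center :: 'i::{finite,linorder} Q set) (T_Z \<beta>) n_as"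
    and "has_jordan_form_on (center :: 'i Q set) (T_Z \<beta>) n_as \<Longrightarrow> Max (fst ` set n_as) = CARD('i) + 1"
proof -
  show "\<exists>n_as. has_jordan_form_on (center :: 'i Q set) (T_Z \<beta>) n_as"
    by (rule jordan_form_exists[OF _ center_eq_span]) (auto intro: T_Z_center)
  assume "has_jordan_form_on (center :: 'i Q set) (T_Z \<beta>) n_as"
  then obtain bs :: "'i Q list" and A where jf: "is_ordered_basis bs center" "has_matrix (T_Z \<beta>) bs A" "jordan_nf A n_as"
    unfolding has_jordan_form_on_def by blast
  interpret matrix_representation "T_Z \<beta>" bs center A
    by (intro matrix_representation.intro jf clinear_T_Z)
  have "L0 (\<lambda>_ :: 'i. (False, False)) \<in> Z_Lambda"
    unfolding Z_Lambda_eq by (rule cvec.span_base) (auto simp: even_deg_def odd_deg_def)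
  then have e: "(qe 0 :: 'i Q) \<in> Z_Lambda" by (simp add: L0_def loc_simps ordered_prod_one)
  show "Max (fst ` set n_as) = CARD('i) + 1"
    unfolding Suc_eq_plus1[symmetric]
  proof (rule max_jordan_block[OF jf(3)])
    show "((\<lambda>x. T_Z \<beta> x - c *\<^sub>C x) ^^ Suc CARD('i)) z = 0"
      if "z \<in> center" "((\<lambda>x. T_Z \<beta> x - c *\<^sub>C x) ^^ Suc (Suc CARD('i))) z = 0" for c and z :: "'i Q"
      by (rule T_Z_shift_stable[OF b that])
    \<comment> \<open>The longest chain starts at \<open>qe 0\<close>: the N-th power of T - 1 sends
      it to a nonzero multiple of the top product, the next one to zero. The largest block size is
      therefore N + 1, not N.\<close>
    show "qe 0 \<in> center" by (rule qe_center)
    show "((\<lambda>x. T_Z \<beta> x - 1 *\<^sub>C x) ^^ Suc CARD('i)) (qe 0 :: 'i Q) = 0"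
      by (rule T_Z_nilpotent_Z_Lambda[OF e])
    show "((\<lambda>x. T_Z \<beta> x - 1 *\<^sub>C x) ^^ (Suc CARD('i) - 1)) (qe 0 :: 'i Q) \<noteq> 0"
      using T_Z_shift_pow_qe0 by simp
  qed
qed

theorem theorem5p3:
  fixes \<beta> \<nu> :: complex
  assumes "\<beta> ^ 4 = (-1) ^ CARD('n::{finite,linorder})"
    and "\<nu> \<in> {1, -1}"
  shows
    "projective_SL2Z_action (center :: 'n Q set) (S_Z \<nu> \<beta>) (T_Z \<beta>) \<and>
     is_direct_sum (center :: 'n Q set) (Z_P \<nu> \<beta>) Z_Lambda \<and>
     S_Z \<nu> \<beta> ` Z_P \<nu> \<beta> \<subseteq> (Z_P \<nu> \<beta> :: 'n Q set) \<and>
     S_Z \<nu> \<beta> ` Z_Lambda \<subseteq> (Z_Lambda :: 'n Q set) \<and>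
     T_Z \<beta> ` Z_P \<nu> \<beta> \<subseteq> (Z_P \<nu> \<beta> :: 'n Q set) \<and>
     T_Z \<beta> ` Z_Lambda \<subseteq> (Z_Lambda :: 'n Q set) \<and>

     is_ordered_basis (Z_P_basis \<nu> \<beta>) (Z_P \<nu> \<beta> :: 'n Q set) \<and>
     has_matrix (S_Z \<nu> \<beta>) (Z_P_basis \<nu> \<beta> :: 'n Q list) (mat_S_P CARD('n) \<nu>) \<and>
     has_matrix (T_Z \<beta>) (Z_P_basis \<nu> \<beta> :: 'n Q list) (mat_T_P \<beta>) \<and>

     (\<forall>j::'n. is_ordered_basis (U_basis j) (U_space j) \<and>
        has_matrix (sigma_map j) (U_basis j) mat_sigma \<and> has_matrix (t_map j) (U_basis j) mat_t) \<and>
     clinear (theta :: ('n, 'n Q) tpow \<Rightarrow> 'n Q) \<and>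
     bij_betw theta U_plus (Z_Lambda :: 'n Q set) \<and>
     tensor_map sigma_map ` U_plus \<subseteq> (U_plus :: ('n, 'n Q) tpow set) \<and>
     tensor_map t_map ` U_plus \<subseteq> (U_plus :: ('n, 'n Q) tpow set) \<and>
     (\<forall>z\<in>Z_Lambda. S_Z \<nu> \<beta> z =
        theta ((\<nu> * \<beta> ^ 2) *\<^sub>C tensor_map sigma_map (inv_into (U_plus :: ('n, 'n Q) tpow set) theta z))) \<and>
     (\<forall>z\<in>Z_Lambda. T_Z \<beta> z =
        theta (tensor_map t_map (inv_into (U_plus :: ('n, 'n Q) tpow set) theta z))) \<and>

     (\<forall>z\<in>(center :: 'n Q set). S_Z \<nu> \<beta> (S_Z \<nu> \<beta> z) = z) \<and>
     (\<exists>n_as. has_jordan_form_on (center :: 'n Q set) (T_Z \<beta>) n_as) \<and>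
     (\<forall>n_as. has_jordan_form_on (center :: 'n Q set) (T_Z \<beta>) n_as \<longrightarrow> Max (fst ` set n_as) = CARD('n) + 1)"
proof -
  note b = assms(1) and n = assms(2)
  note p = parameters[OF b n]
  have Z_P: "Z_P \<nu> \<beta> = cvec.span {Ktop, qe 1, Gam :: 'n Q}" by (rule Z_P_eq[OF p(2,1)])
  have "S_Z \<nu> \<beta> z \<in> Z_P \<nu> \<beta>" if "z \<in> Z_P \<nu> \<beta>" for z :: "'n Q"
    using that unfolding Z_P by (elim span3E) (simp only: S_Z_lincomb[OF b] lincomb3_in_span)
  moreover have "T_Z \<beta> z \<in> Z_P \<nu> \<beta>" if "z \<in> Z_P \<nu> \<beta>" for z :: "'n Q"
    using that unfolding Z_P by (elim span3E) (simp only: T_Z_lincomb lincomb3_in_span)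
  moreover have "is_direct_sum (center :: 'n Q set) (Z_P \<nu> \<beta>) Z_Lambda"
    unfolding Z_P by (rule center_direct_sum)
  moreover have "theta (inv_into (U_plus :: ('n, 'n Q) tpow set) theta z) = z"
    "inv_into (U_plus :: ('n, 'n Q) tpow set) theta z \<in> U_plus" if "z \<in> Z_Lambda" for z
    using bij_betw_inv_into_right[OF bij_theta that] bij_betw_apply[OF bij_betw_inv_into[OF bij_theta] that] .
  then have "S_Z \<nu> \<beta> z =
      theta ((\<nu> * \<beta> ^ 2) *\<^sub>C tensor_map sigma_map (inv_into (U_plus :: ('n, 'n Q) tpow set) theta z))"
    "T_Z \<beta> z = theta (tensor_map t_map (inv_into (U_plus :: ('n, 'n Q) tpow set) theta z))"
    if "z \<in> Z_Lambda" for z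
    using that S_Z_theta[of "inv_into (U_plus :: ('n, 'n Q) tpow set) theta z" \<nu> \<beta>]
      T_Z_theta[of "inv_into (U_plus :: ('n, 'n Q) tpow set) theta z" \<beta>] by simp_all
  ultimately show ?thesis
    using projective_action[OF b n] is_ordered_basis_Z_P[OF p(2,1), where 'i = 'n] has_matrix_Z_P[OF b n]
      jordan_form_T_Z[OF p(1), where 'i = 'n] S_Z_S_Z_center[OF b n]
    by (intro conjI ballI allI impI image_subsetI)
      (assumption | rule is_ordered_basis_U sigma_map(2) t_map(2) clinear_theta bij_theta tensor_maps_in_U_plus
        S_Z_Z_Lambda T_Z_Z_Lambda)+
qed

end
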